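(* Let $X$ be a spectrally negative Lévy process and $q>0$. The $q$-potential measure of $(U,X)$ is given, for all $(u,x)\in E$ and $v,y>0$ (as an identity of measures in $(v,y)\in(0,\infty)^2$), by \begin{align*} \int_0^\infty e^{-qr}\,\mathbb P_{u,x}(U_r\in dv,X_r\in dy)\,dr&=e^{-q(v-u)}\,\mathbb P_x(X_{v-u}\in dy,\ v-u<\tau_0^-)\,\mathbb I_{\{v>u\}}\,dv\\ &\quad+\big[e^{\Phi(q)x}\Phi'(q)-W^{(q)}(x)\big]\frac yv\,e^{-qv}\,\mathbb P(X_v\in dy)\,dv. \end{align*} In particular, when $u=x=0$, $$\int_0^\infty e^{-qr}\,\mathbb P(U_r\in dv,X_r\in dy)\,dr=\Phi'(q)\frac yv\,e^{-qv}\,\mathbb P(X_v\in dy)\,dv.$$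
   Context: $X$ is a spectrally negative Lévy process (càdlàg, stationary independent increments, no positive jumps, paths not monotone), $X_0=0$ under $\mathbb P$; $\mathbb P_x$ is its law started at $x$. $\psi(\beta)=\log\mathbb E(e^{\beta X_1})$, $\beta\ge0$; $\Phi(q)=\sup\{\beta\ge0:\psi(\beta)=q\}$, $q\ge0$. $W^{(q)}$ is the $q$-scale function: $W^{(q)}(x)=0$ for $x<0$, and on $[0,\infty)$ it is the strictly increasing continuous function with $\int_0^\infty e^{-\beta x}W^{(q)}(x)dx=1/(\psi(\beta)-q)$ for $\beta>\Phi(q)$. $g_t=\sup\{0\le s\le t:X_s\le0\}$ ($\sup\emptyset=0$), $U_t=t-g_t$, $\sigma_0^-=\inf\{t>0:X_t\le0\}$, $\tau_0^-=\inf\{t>0:X_t<0\}$. $E=[(0,\infty)\times(0,\infty)]\cup\{(0,x):x\le0\}$ is the state space of the strong Markov process $(U,X)$. For $(u,x)\in E$, $\mathbb P_{u,x}$ is the law of $(U,X)$ started from $(u,x)$: under it $X$ has law $\mathbb P_x$, $U_s=u+s$ for $s<\sigma_0^-$ and $U_s=s-g_s$ for $s\ge\sigma_0^-$. *)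

theory Defs
  imports "HOL-Probability.Probability"
begin

text \<open>
  Only times \<open>t \<ge> 0\<close> matter; the values of \<open>X t\<close> for \<open>t < 0\<close> are unconstrained and never used.
  Path regularity is required of every path, as on the canonical (Skorokhod) space, so that the
  passage times below are random variables without completing the measure.
\<close>

locale spectrally_negative_levy = prob_space M
  for M :: "'a measure" and X :: "real \<Rightarrow> 'a \<Rightarrow> real" +
  assumes random_variable: "\<And>t. t \<ge> 0 \<Longrightarrow> random_variable borel (X t)"
    and start_zero: "AE \<omega> in M. X 0 \<omega> = 0"
    and right_continuous:
      "\<And>\<omega> t. \<omega> \<in> space M \<Longrightarrow> t \<ge> 0 \<Longrightarrow> continuous (at_right t) (\<lambda>s. X s \<omega>)"
    and left_limits:
      "\<And>\<omega> t. \<omega> \<in> space M \<Longrightarrow> t > 0 \<Longrightarrow> \<exists>l. ((\<lambda>s. X s \<omega>) \<longlongrightarrow> l) (at_left t)"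
    and no_positive_jumps:
      "\<And>\<omega> t l. \<omega> \<in> space M \<Longrightarrow> t > 0 \<Longrightarrow> ((\<lambda>s. X s \<omega>) \<longlongrightarrow> l) (at_left t) \<Longrightarrow> X t \<omega> \<le> l"
    and independent_increments:
      "\<And>(t :: nat \<Rightarrow> real) n. t 0 \<ge> 0 \<Longrightarrow> (\<And>i. i < n \<Longrightarrow> t i \<le> t (Suc i)) \<Longrightarrow>
         indep_vars (\<lambda>_. borel) (\<lambda>i \<omega>. X (t (Suc i)) \<omega> - X (t i) \<omega>) {..<n}"
    and stationary_increments:
      "\<And>s h. s \<ge> 0 \<Longrightarrow> h \<ge> 0 \<Longrightarrow>
         distr M borel (\<lambda>\<omega>. X (s + h) \<omega> - X s \<omega>) = distr M borel (X h)"
    and not_increasing: "\<not> (AE \<omega> in M. monotone_on {0..} (\<le>) (\<le>) (\<lambda>t. X t \<omega>))"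
    and not_decreasing: "\<not> (AE \<omega> in M. monotone_on {0..} (\<le>) (\<ge>) (\<lambda>t. X t \<omega>))"

definition laplace_exponent :: "'a measure \<Rightarrow> (real \<Rightarrow> 'a \<Rightarrow> real) \<Rightarrow> real \<Rightarrow> real" where
  "laplace_exponent M X \<beta> = ln (\<integral>\<omega>. exp (\<beta> * X 1 \<omega>) \<partial>M)"

definition right_inverse :: "'a measure \<Rightarrow> (real \<Rightarrow> 'a \<Rightarrow> real) \<Rightarrow> real \<Rightarrow> real" where
  "right_inverse M X q = Sup {\<beta>. \<beta> \<ge> 0 \<and> laplace_exponent M X \<beta> = q}"

definition is_scale_function ::
    "'a measure \<Rightarrow> (real \<Rightarrow> 'a \<Rightarrow> real) \<Rightarrow> real \<Rightarrow> (real \<Rightarrow> real) \<Rightarrow> bool" where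
  "is_scale_function M X q W \<longleftrightarrow>
     (\<forall>x<0. W x = 0) \<and>
     continuous_on {0..} W \<and> strict_mono_on {0..} W \<and>
     (\<forall>\<beta>>right_inverse M X q.
        ((\<lambda>x. exp (- \<beta> * x) * W x) has_integral 1 / (laplace_exponent M X \<beta> - q)) {0..})"

text \<open>
  The following are functionals of a path \<open>w\<close>; under \<open>\<P>\<^sub>x\<close> the path is \<open>\<lambda>t. x + X t \<omega>\<close>.
  The explicit case below gives \<open>sup {} = 0\<close>, while the extended-real infima give \<open>inf {} = \<infinity>\<close>.
\<close>

definition last_nonpos :: "(real \<Rightarrow> real) \<Rightarrow> real \<Rightarrow> real" where
  "last_nonpos w t =
     (let S = {s. 0 \<le> s \<and> s \<le> t \<and> w s \<le> 0} in if S = {} then 0 else Sup S)"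

definition excursion_length :: "(real \<Rightarrow> real) \<Rightarrow> real \<Rightarrow> real" where
  "excursion_length w t = t - last_nonpos w t"

definition hit_nonpos :: "(real \<Rightarrow> real) \<Rightarrow> ereal" where
  "hit_nonpos w = Inf (ereal ` {t. t > 0 \<and> w t \<le> 0})"

definition hit_neg :: "(real \<Rightarrow> real) \<Rightarrow> ereal" where
  "hit_neg w = Inf (ereal ` {t. t > 0 \<and> w t < 0})"

text \<open>The process \<open>U\<close> under \<open>\<P>\<^bsub>u,x\<^esub>\<close>, for which an excursion has already lasted for time \<open>u\<close>.\<close>

definition excursion_length_from :: "real \<Rightarrow> (real \<Rightarrow> real) \<Rightarrow> real \<Rightarrow> real" where
  "excursion_length_from u w t =
     (if ereal t < hit_nonpos w then u + t else excursion_length w t)"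

definition state_space :: "(real \<times> real) set" where
  "state_space = {0<..} \<times> {0<..} \<union> {0} \<times> {..0}"

definition potential ::
    "'a measure \<Rightarrow> real \<Rightarrow> (real \<Rightarrow> 'a \<Rightarrow> 'b) \<Rightarrow> 'b set \<Rightarrow> ennreal" where
  "potential M q Y B =
     (\<integral>\<^sup>+ r\<in>{0..}. ennreal (exp (- q * r)) * emeasure M {\<omega> \<in> space M. Y r \<omega> \<in> B} \<partial>lborel)"

text \<open>
  The two measures on the right-hand side, evaluated at a Borel set \<open>B \<subseteq> (0,\<infinity>)\<^sup>2\<close>:
  \<open>e\<^bsup>-q(v-u)\<^esup> \<P>\<^sub>x(X\<^bsub>v-u\<^esub> \<in> dy, v-u < \<tau>) 1\<^bsub>{v>u}\<^esub> dv\<close> and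
  \<open>(y/v) e\<^bsup>-qv\<^esup> \<P>(X\<^sub>v \<in> dy) dv\<close>.
\<close>

definition first_excursion_part ::
    "'a measure \<Rightarrow> (real \<Rightarrow> 'a \<Rightarrow> real) \<Rightarrow> real \<Rightarrow> real \<Rightarrow> real \<Rightarrow> (real \<times> real) set \<Rightarrow> ennreal" where
  "first_excursion_part M X q u x B =
     (\<integral>\<^sup>+ v\<in>{u<..}. ennreal (exp (- q * (v - u))) *
        emeasure M {\<omega> \<in> space M. (v, x + X (v - u) \<omega>) \<in> B \<and>
                                 ereal (v - u) < hit_neg (\<lambda>t. x + X t \<omega>)} \<partial>lborel)"

definition kendall_part ::
    "'a measure \<Rightarrow> (real \<Rightarrow> 'a \<Rightarrow> real) \<Rightarrow> real \<Rightarrow> (real \<times> real) set \<Rightarrow> ennreal" where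
  "kendall_part M X q B =
     (\<integral>\<^sup>+ v\<in>{0<..}. (\<integral>\<^sup>+ y. ennreal (y / v * exp (- q * v)) * indicator B (v, y)
                      \<partial>distr M borel (X v)) \<partial>lborel)"

end

theory Submission
  imports Defs
begin

text \<open>
  Let \<open>R\<close> be the \<open>q\<close>-resolvent of \<open>X\<close>. Since there are no positive jumps, \<open>X = b\<close> at the first
  passage above \<open>b\<close>, and the strong Markov property makes the tail of \<open>R\<close> on \<open>(0,\<infinity>)\<close> multiplicative:
  \<open>R\<close> has there the density \<open>\<Phi>'(q) e\<^bsup>-\<Phi>(q)z\<^esup>\<close>. Time reversal expresses the resolvent killed below zero, after
  a Laplace transform in the starting point \<open>x\<close>, by the process before first passage, and so
  \<open>\<integral> e\<^bsup>-qs\<^esup> \<P>\<^sub>x(s < \<tau>, X\<^sub>s > c) ds = W(x) e\<^bsup>-\<Phi>(q)c\<^esup>/\<Phi>(q) - \<integral>\<^sub>0\<^bsup>x-c\<^esup> W\<close>.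

  After the first return to \<open>(-\<infinity>,0]\<close> the resolvent thus has on \<open>(0,\<infinity>)\<close> the density \<open>k e\<^bsup>-\<Phi>(q)z\<^esup>\<close> with
  \<open>k = e\<^bsup>\<Phi>(q)x\<^esup>\<Phi>'(q) - W(x)\<close>. By the Markov property at time \<open>t - a\<close>, the corresponding part \<open>\<nu>\<close> of the
  potential of \<open>(U,X)\<close> satisfies
  \<open>\<nu>((a,\<infinity>) \<times> (c,\<infinity>)) = e\<^bsup>-qa\<^esup> k \<integral> e\<^bsup>-\<Phi>(q)z\<^esup> \<P>\<^sub>z(a < \<tau>, X\<^sub>a > c) dz\<close>. A Laplace transform in \<open>a\<close> shows that
  this determines \<open>\<nu>\<close>, and \<open>\<integral>\<^bsub>q\<^esub>\<^bsup>\<infinity>\<^esup> \<Phi>'(r) y e\<^bsup>-\<Phi>(r)y\<^esup> dr = e\<^bsup>-\<Phi>(q)y\<^esup>\<close> shows that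
  \<open>k (y/v) e\<^bsup>-qv\<^esup> \<P>(X\<^sub>v \<in> dy) dv\<close> has the same transform.
\<close>

subsection \<open>Laplace transforms\<close>

text \<open>The path enters only through its values at rescaled dyadic times: right continuity and
  open superlevel sets make the events below functions of such a countable skeleton, so the Markov
  property and time reversal become equalities of laws on countable products, read off from the
  increments. \<Phi>(q) is obtained as the decay rate, in the level, of E exp (- q T) for the first
  passage time T; finite exponential moments, \<psi>(\<Phi>(q)) = q and the derivative of \<Phi> all
  result from computing the transform of R once in time and once in space. The scale function is
  given only through \<beta> > \<Phi>(q), where the transform of R is infinite and nothing can be
  subtracted from it. There an identity in time, inverted from the range of large rates, takes the
  place of the subtraction. At u = x = 0 a cancellation is hidden. If W(0) > 0, the path stays
  nonnegative for some time, so the first term is not zero but W(0) times the Kendall measure, and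
  this offsets - W(0) in the bracket.\<close>

abbreviation discount :: "real \<Rightarrow> real \<Rightarrow> ennreal" where
  "discount q t \<equiv> ennreal (exp (- q * t))"

abbreviation laplace :: "real \<Rightarrow> (real \<Rightarrow> ennreal) \<Rightarrow> ennreal" where
  "laplace q f \<equiv> (\<integral>\<^sup>+t\<in>{0..}. discount q t * f t \<partial>lborel)"

text \<open>Open half-lines are pointwise limits of bounded continuous ramps, and they form a
  generator. This later carries the strong Markov property from continuous test functions to Borel
  ones.\<close>

lemma measure_eqI_continuous:
  fixes M N :: "real measure"
  assumes "finite_measure M" "finite_measure N"
    and sets [measurable_cong]: "sets M = sets borel" "sets N = sets borel"
    and eq: "\<And>f. continuous_on UNIV f \<Longrightarrow> (\<And>y. 0 \<le> f y) \<Longrightarrow> (\<And>y. f y \<le> 1) \<Longrightarrow>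
      (\<integral>\<^sup>+y. ennreal (f y) \<partial>M) = (\<integral>\<^sup>+y. ennreal (f y) \<partial>N)"
  shows "M = N"
proof (rule measure_eqI_lessThan)
  interpret M: finite_measure M by fact
  interpret N: finite_measure N by fact
  have space: "space M = UNIV" "space N = UNIV"
    using sets[THEN sets_eq_imp_space_eq] by auto
  fix x :: real
  \<comment> \<open>The ramp rises from 0 at x with slope n and is capped at 1; it vanishes at x
    itself, so the limit is the indicator of the open half-line.\<close>
  define f where "f n y = max 0 (min 1 (real n * (y - x)))" for n :: nat and y
  have lim: "(\<lambda>n. f n y) \<longlonglongrightarrow> indicator {x<..} y" for y
  proof (cases "y > x")
    case True
    obtain m :: nat where m: "1 / (y - x) \<le> m" using real_arch_simple by blast
    have "f n y = 1" if "n \<ge> m" for n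
    proof -
      have "1 / (y - x) \<le> n" using m that by simp
      then show ?thesis using True by (simp add: f_def field_simps)
    qed
    then show ?thesis using True
      by (intro tendsto_eventually) (auto simp: eventually_sequentially)
  next
    case False
    have *: "max 0 (min 1 z) = 0" if "z \<le> 0" for z :: real using that by auto
    have "f n y = 0" for n
      unfolding f_def by (rule *) (use False in \<open>simp add: mult_nonneg_nonpos\<close>)
    then show ?thesis using False by simp
  qed
  have [measurable]: "f n \<in> borel_measurable borel" for n
    unfolding f_def by measurable
  have L: "(\<lambda>n. \<integral>\<^sup>+y. ennreal (f n y) \<partial>K) \<longlonglongrightarrow> (\<integral>\<^sup>+y. indicator {x<..} y \<partial>K)"
    if "finite_measure K" and [measurable_cong]: "sets K = sets borel" for K
  proof -
    interpret K: finite_measure K by fact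
    have "(\<lambda>n. \<integral>\<^sup>+y. ennreal (f n y) \<partial>K) \<longlonglongrightarrow> (\<integral>\<^sup>+y. ennreal (indicator {x<..} y) \<partial>K)"
    proof (rule nn_integral_dominated_convergence[where w = "\<lambda>_. 1"])
      show "(\<integral>\<^sup>+y. 1 \<partial>K) < \<infinity>" by (simp add: K.emeasure_eq_measure)
      show "AE y in K. (\<lambda>n. ennreal (f n y)) \<longlonglongrightarrow> ennreal (indicator {x<..} y)"
        by (intro AE_I2 tendsto_ennrealI lim)
    qed (auto simp: f_def)
    then show ?thesis by (simp add: ennreal_indicator)
  qed
  have "(\<integral>\<^sup>+y. ennreal (f n y) \<partial>M) = (\<integral>\<^sup>+y. ennreal (f n y) \<partial>N)" for n
    by (rule eq) (auto simp: f_def intro!: continuous_intros)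
  then have "(\<integral>\<^sup>+y. indicator {x<..} y \<partial>M) = (\<integral>\<^sup>+y. indicator {x<..} y \<partial>N)"
    using L[OF assms(1) sets(1)] L[OF assms(2) sets(2)] LIMSEQ_unique by simp
  then show "emeasure M {x<..} = emeasure N {x<..}"
    by simp
qed (use sets assms in \<open>auto simp: finite_measure.emeasure_eq_measure\<close>)

text \<open>Weierstrass on [0,1]: equal moments give equal integrals of polynomials, uniform
  approximation gives those of continuous functions, and these determine the measure.\<close>

lemma finite_measure_eq_if_moments_eq:
  fixes M N :: "real measure"
  assumes "finite_measure M" "finite_measure N"
    and sets [measurable_cong]: "sets M = sets borel" "sets N = sets borel"
    and supp: "AE y in M. y \<in> {0..1}" "AE y in N. y \<in> {0..1}"
    and mom: "\<And>n::nat. (\<integral>y. y ^ n \<partial>M) = (\<integral>y. y ^ n \<partial>N)"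
  shows "M = N"
proof -
  interpret M: finite_measure M by fact
  interpret N: finite_measure N by fact
  have space: "space M = UNIV" "space N = UNIV"
    using sets[THEN sets_eq_imp_space_eq] by auto
  have bd: "integrable K f" if "finite_measure K" "sets K = sets borel" "AE y in K. y \<in> {0..1}"
    "f \<in> borel_measurable borel" "\<And>y. y \<in> {0..1} \<Longrightarrow> \<bar>f y\<bar> \<le> B" for K and f :: "real \<Rightarrow> real" and B
  proof -
    interpret K: finite_measure K by fact
    have "AE y in K. norm (f y) \<le> B"
      using that(3) by eventually_elim (simp add: that(5))
    then show ?thesis
      by (rule K.integrable_const_bound) (simp add: that(4) measurable_cong_sets[OF that(2) refl])
  qed
  have pow: "integrable M (\<lambda>y. y ^ n)" "integrable N (\<lambda>y. y ^ n)" for n :: nat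
    by (rule bd[of _ _ 1]; use assms in \<open>auto simp: abs_le_iff power_le_one intro: order_trans[of _ 0]\<close>)+
  have poly: "(\<integral>y. p y \<partial>M) = (\<integral>y. p y \<partial>N)" if "real_polynomial_function p" for p
  proof -
    obtain a n where p: "p = (\<lambda>x. \<Sum>i\<le>n. a i * x ^ i)"
      using \<open>real_polynomial_function p\<close> unfolding real_polynomial_function_iff_sum by blast
    show ?thesis
      unfolding p using pow by (simp add: mom)
  qed
  have cont: "(\<integral>y. f y \<partial>M) = (\<integral>y. f y \<partial>N)"
    if f: "continuous_on UNIV f" "\<And>y. \<bar>f y\<bar> \<le> 1" for f :: "real \<Rightarrow> real"
  proof -
    have fb [measurable]: "f \<in> borel_measurable borel"
      using f by (auto intro: borel_measurable_continuous_onI)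
    define c where "c = measure M UNIV + measure N UNIV"
    have c: "c \<ge> 0" by (simp add: c_def)
    have "\<bar>(\<integral>y. f y \<partial>M) - (\<integral>y. f y \<partial>N)\<bar> \<le> e * c" if e: "e > 0" for e
    proof -
      obtain p where p: "real_polynomial_function p" "\<And>x. x \<in> {0..1} \<Longrightarrow> \<bar>f x - p x\<bar> < e"
        using Stone_Weierstrass_real_polynomial_function[of "{0..1}" f e] f(1) e
        by (auto intro: continuous_on_subset)
      have pb [measurable]: "p \<in> borel_measurable borel"
        using p(1) by (intro borel_measurable_continuous_onI)
          (auto intro: continuous_at_imp_continuous_on continuous_real_polymonial_function)
      have pbd: "\<bar>p x\<bar> \<le> 1 + e" if "x \<in> {0..1}" for x
        using p(2)[OF that] f(2)[of x] by linarith
      have i: "integrable M f" "integrable N f" "integrable M p" "integrable N p"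
        by (rule bd[of _ _ 1] bd[of _ _ "1 + e"]; use assms f pbd in auto)+
      have est: "\<bar>(\<integral>y. f y \<partial>K) - (\<integral>y. p y \<partial>K)\<bar> \<le> e * measure K UNIV"
        if K: "finite_measure K" "AE y in K. y \<in> {0..1}" "integrable K f" "integrable K p"
          "space K = UNIV" for K
      proof -
        interpret K: finite_measure K by fact
        have "\<bar>(\<integral>y. f y \<partial>K) - (\<integral>y. p y \<partial>K)\<bar> = \<bar>\<integral>y. f y - p y \<partial>K\<bar>"
          using K by simp
        also have "\<dots> \<le> (\<integral>y. \<bar>f y - p y\<bar> \<partial>K)" by (rule integral_abs_bound)
        also have "AE y in K. \<bar>f y - p y\<bar> \<le> e"
          using K(2) by eventually_elim (intro less_imp_le p(2))
        then have "(\<integral>y. \<bar>f y - p y\<bar> \<partial>K) \<le> (\<integral>y. e \<partial>K)"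
          using K by (intro integral_mono_AE) auto
        finally show ?thesis using K(5) by (simp add: mult.commute)
      qed
      have "\<bar>(\<integral>y. f y \<partial>M) - (\<integral>y. p y \<partial>M)\<bar> \<le> e * measure M UNIV"
        "\<bar>(\<integral>y. f y \<partial>N) - (\<integral>y. p y \<partial>N)\<bar> \<le> e * measure N UNIV"
        by (rule est; use assms i space in auto)+
      then show ?thesis using poly[OF p(1)] by (simp add: c_def distrib_left)
    qed
    note * = this
    have "\<bar>(\<integral>y. f y \<partial>M) - (\<integral>y. f y \<partial>N)\<bar> \<le> 0 + e" if e: "e > 0" for e
    proof -
      \<comment> \<open>The accuracy is scaled by c + 1 and not by c, since the total mass c may be
        zero.\<close>
      have "\<bar>(\<integral>y. f y \<partial>M) - (\<integral>y. f y \<partial>N)\<bar> \<le> (e / (c + 1)) * c"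
        by (rule *) (use e c in auto)
      also have "\<dots> \<le> e" using e c by (simp add: field_simps)
      finally show ?thesis by simp
    qed
    then have "\<bar>(\<integral>y. f y \<partial>M) - (\<integral>y. f y \<partial>N)\<bar> \<le> 0" by (rule field_le_epsilon)
    then show ?thesis by simp
  qed
  show ?thesis
  proof (rule measure_eqI_continuous)
    fix f :: "real \<Rightarrow> real" assume f: "continuous_on UNIV f" "\<And>y. 0 \<le> f y" "\<And>y. f y \<le> 1"
    have [measurable]: "f \<in> borel_measurable borel" using f(1) by (rule borel_measurable_continuous_onI)
    have "integrable M f" "integrable N f"
      by (rule bd[of _ _ 1]; use assms f in \<open>auto simp: abs_le_iff intro: order_trans[of _ 0]\<close>)+
    moreover have "(\<integral>y. f y \<partial>M) = (\<integral>y. f y \<partial>N)"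
      by (rule cont) (use f in \<open>auto simp: abs_le_iff intro: order_trans[of _ 0]\<close>)
    ultimately show "(\<integral>\<^sup>+y. ennreal (f y) \<partial>M) = (\<integral>\<^sup>+y. ennreal (f y) \<partial>N)"
      using f(2) by (simp add: nn_integral_eq_integral)
  qed fact+
qed

text \<open>Tilting by exp (- P x) and substituting y = exp (- x) yields a finite measure on [0,1]
  whose n-th moment is the transform at P + n, so the moments determine it. Equality on a half-line
  of rates is enough, which allows an identity established only for large p to be inverted.\<close>

lemma laplace_unique:
  fixes M N :: "real measure" and p0 :: real
  assumes sets [measurable_cong]: "sets M = sets borel" "sets N = sets borel"
    and supp: "AE x in M. 0 \<le> x" "AE x in N. 0 \<le> x"
    and fin: "\<And>p. p > p0 \<Longrightarrow> (\<integral>\<^sup>+x. discount p x \<partial>M) < \<infinity>"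
    and eq: "\<And>p. p > p0 \<Longrightarrow> (\<integral>\<^sup>+x. discount p x \<partial>M) = (\<integral>\<^sup>+x. discount p x \<partial>N)"
  shows "M = N"
proof -
  define P where "P = p0 + 1"
  define T where "T K = distr (density K (\<lambda>x. discount P x)) borel (\<lambda>x. exp (- x))" for K :: "real measure"
  have nnT: "(\<integral>\<^sup>+y. f y \<partial>T K) = (\<integral>\<^sup>+x. discount P x * f (exp (- x)) \<partial>K)"
    if [measurable_cong]: "sets K = sets borel" and [measurable]: "f \<in> borel_measurable borel" for K f
    unfolding T_def by (simp add: nn_integral_distr nn_integral_density)
  have T: "finite_measure (T K)" "AE y in T K. y \<in> {0..1}"
    "(\<integral>y. y ^ n \<partial>T K) = enn2real (\<integral>\<^sup>+x. discount (P + n) x \<partial>K)"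
    if K: "sets K = sets borel" "AE x in K. 0 \<le> x" "(\<integral>\<^sup>+x. discount P x \<partial>K) < \<infinity>" for K and n :: nat
  proof -
    note [measurable_cong] = K(1)
    have "emeasure (T K) (space (T K)) = (\<integral>\<^sup>+x. discount P x \<partial>K)"
      using nnT[OF K(1), of "\<lambda>_. 1"] by simp
    then show "finite_measure (T K)" using K(3) by (intro finite_measureI) auto
    have s: "sets (T K) = sets borel" by (simp add: T_def)
    note [measurable_cong] = s
    show ae: "AE y in T K. y \<in> {0..1}"
      unfolding T_def by (subst AE_distr_iff) (use K(2) in \<open>auto simp: AE_density\<close>)
    have "(\<integral>y. y ^ n \<partial>T K) = enn2real (\<integral>\<^sup>+y. ennreal (y ^ n) \<partial>T K)"
      by (rule integral_eq_nn_integral) (use ae in \<open>auto elim!: eventually_mono\<close>)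
    also have "(\<integral>\<^sup>+y. ennreal (y ^ n) \<partial>T K) = (\<integral>\<^sup>+x. discount P x * ennreal (exp (- x) ^ n) \<partial>K)"
      by (rule nnT[OF K(1)]) auto
    also have "\<dots> = (\<integral>\<^sup>+x. discount (P + n) x \<partial>K)"
      by (intro nn_integral_cong)
        (simp add: ennreal_mult[symmetric] exp_of_nat_mult[symmetric] exp_add[symmetric] algebra_simps)
    finally show "(\<integral>y. y ^ n \<partial>T K) = enn2real (\<integral>\<^sup>+x. discount (P + n) x \<partial>K)" .
  qed
  have P: "P + real n > p0" "P > p0" for n by (auto simp: P_def)
  have finP: "(\<integral>\<^sup>+x. discount P x \<partial>M) < \<infinity>" "(\<integral>\<^sup>+x. discount P x \<partial>N) < \<infinity>"
    using fin eq P(2) by auto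
  have TT: "T M = T N"
    by (rule finite_measure_eq_if_moments_eq)
      (use T[OF sets(1) supp(1) finP(1)] T[OF sets(2) supp(2) finP(2)] eq[OF P(1)] in \<open>auto simp: T_def\<close>)
  \<comment> \<open>Both operations are undone: \<open>- ln\<close> inverts the substitution, the
    density exp (P x) inverts the tilt.\<close>
  have inv: "K = density (distr (T K) borel (\<lambda>y. - ln y)) (\<lambda>x. ennreal (exp (P * x)))"
    if K: "sets K = sets borel" for K
  proof -
    note [measurable_cong] = K
    have "distr (T K) borel (\<lambda>y. - ln y) = distr (density K (\<lambda>x. discount P x)) borel (\<lambda>x. x)"
      unfolding T_def by (subst distr_distr) (auto simp: comp_def)
    also have "\<dots> = density K (\<lambda>x. discount P x)"
      using K by (intro distr_id2) simp
    finally have "density (distr (T K) borel (\<lambda>y. - ln y)) (\<lambda>x. ennreal (exp (P * x)))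
      = density K (\<lambda>x. discount P x * ennreal (exp (P * x)))"
      by (simp add: density_density_eq)
    also have "\<dots> = density K (\<lambda>x. 1)"
      by (intro density_cong) (auto simp: ennreal_mult[symmetric] exp_add[symmetric])
    finally show ?thesis by (simp add: density_1)
  qed
  show ?thesis
    using inv[OF sets(1)] inv[OF sets(2)] TT by metis
qed

lemma laplace_unique_AE:
  fixes f g :: "real \<Rightarrow> ennreal" and p0 :: real
  assumes [measurable]: "f \<in> borel_measurable borel" "g \<in> borel_measurable borel"
    and fin: "\<And>p. p > p0 \<Longrightarrow> laplace p f < \<infinity>"
    and eq: "\<And>p. p > p0 \<Longrightarrow> laplace p f =
      laplace p g"
  shows "AE x in lborel. 0 \<le> x \<longrightarrow> f x = g x"
proof -
  have *: "(\<integral>\<^sup>+x. discount p x \<partial>density lborel (\<lambda>x. h x * indicator {0..} x))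
    = laplace p h"
    if [measurable]: "h \<in> borel_measurable borel" for h p
    by (subst nn_integral_density) (auto intro!: nn_integral_cong simp: ac_simps)
  have "density lborel (\<lambda>x. f x * indicator {0..} x) = density lborel (\<lambda>x. g x * indicator {0..} x)"
  proof (rule laplace_unique[of _ _ p0])
    fix p :: real assume p: "p > p0"
    show "(\<integral>\<^sup>+x. discount p x \<partial>density lborel (\<lambda>x. f x * indicator {0..} x)) < \<infinity>"
      using fin[OF p] by (subst *) auto
    show "(\<integral>\<^sup>+x. discount p x \<partial>density lborel (\<lambda>x. f x * indicator {0..} x)) =
      (\<integral>\<^sup>+x. discount p x \<partial>density lborel (\<lambda>x. g x * indicator {0..} x))"
      using eq[OF p] unfolding *[OF assms(1)] *[OF assms(2)] .
  qed (auto simp: AE_density indicator_def)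
  then have "AE x in lborel. f x * indicator {0..} x = g x * indicator {0..} x"
    by (subst (asm) sigma_finite_measure.density_unique_iff[OF sigma_finite_lborel]) auto
  then show ?thesis by (auto elim!: eventually_mono split: split_indicator_asm)
qed
subsection \<open>Path properties\<close>

text \<open>
  For a cadlag path, having no positive jumps amounts to all superlevel sets being open.
\<close>

locale lsc_path =
  fixes w :: "real \<Rightarrow> real"
  assumes rc: "\<And>t. continuous (at_right t) w"
    and open_gt: "\<And>c. open {t. c < w t}"
begin

lemma shift: "lsc_path (\<lambda>t. x + w t)"
proof
  show "continuous (at_right t) (\<lambda>t. x + w t)" for t
    using rc[of t] by (intro continuous_intros)
  show "open {t. c < x + w t}" for c
    using open_gt[of "c - x"] by (simp add: algebra_simps)
qed

lemma rcD: "(w \<longlongrightarrow> w t) (at_right t)"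
  using rc[of t] by (simp add: continuous_within)

text \<open>The open sets {w > 1/(m+1)} increase and cover the compact interval, so one of them
  suffices: a strictly positive path has a positive lower bound even though it may jump.\<close>

lemma pos_compact_bound:
  assumes "\<And>r. r \<in> {s..t} \<Longrightarrow> 0 < w r"
  shows "\<exists>m::nat. \<forall>r\<in>{s..t}. 1 / (real m + 1) \<le> w r"
proof -
  define C where "C m = {t. 1 / (real m + 1) < w t}" for m :: nat
  have "{s..t} \<subseteq> (\<Union>m. C m)"
  proof
    fix r assume "r \<in> {s..t}"
    then have "0 < w r" by (rule assms)
    then obtain m :: nat where "1 / (real m + 1) < w r"
      using reals_Archimedean[of "w r"] by (auto simp: inverse_eq_divide add.commute)
    then show "r \<in> (\<Union>m. C m)" by (auto simp: C_def)
  qed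
  then obtain D where D: "finite D" "{s..t} \<subseteq> (\<Union>m\<in>D. C m)"
    using compactE_image[of "{s..t}" UNIV C] open_gt unfolding C_def by (metis compact_Icc UNIV_I)
  have "1 / (real (Max (insert 0 D)) + 1) \<le> w r" if r: "r \<in> {s..t}" for r
  proof -
    obtain m where m: "m \<in> D" "r \<in> C m" using D(2) r by blast
    then have "m \<le> Max (insert 0 D)" using D(1) by (intro Max_ge) auto
    then have "1 / (real (Max (insert 0 D)) + 1) \<le> 1 / (real m + 1)"
      by (intro divide_left_mono) auto
    also have "\<dots> \<le> w r" using m by (auto simp: C_def)
    finally show ?thesis .
  qed
  then show ?thesis by blast
qed

lemma bdd_below_compact: "\<exists>b>0. \<forall>r\<in>{s..t}. - b < w r"
proof -
  define C where "C m = {t. - real m < w t}" for m :: nat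
  have "{s..t} \<subseteq> (\<Union>m. C m)"
  proof
    fix r
    obtain m :: nat where "- w r < m" using reals_Archimedean2 by blast
    then show "r \<in> (\<Union>m. C m)" by (auto simp: C_def intro!: exI[of _ m])
  qed
  then obtain D where D: "finite D" "{s..t} \<subseteq> (\<Union>m\<in>D. C m)"
    using compactE_image[of "{s..t}" UNIV C] open_gt unfolding C_def by (metis compact_Icc UNIV_I)
  have "- (real (Max (insert 0 D)) + 1) < w r" if r: "r \<in> {s..t}" for r
  proof -
    obtain m where m: "m \<in> D" "r \<in> C m" using D(2) r by blast
    then have "m \<le> Max (insert 0 D)" using D(1) by (intro Max_ge) auto
    then show ?thesis using m(2) by (auto simp: C_def)
  qed
  then show ?thesis by (intro exI[of _ "real (Max (insert 0 D)) + 1"]) auto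
qed

lemma closed_nonpos: "closed {t. w t \<le> 0}"
proof -
  have "{t. w t \<le> 0} = - {t. 0 < w t}" by auto
  then show ?thesis using open_gt[of 0] by (simp add: closed_def)
qed

text \<open>The set {w \<le> 0} is closed because superlevel sets are open, so the supremum in
  \<open>last_nonpos\<close> is attained.\<close>

lemma last_nonpos_mem:
  assumes "0 \<le> r" "r \<le> t" "w r \<le> 0"
  shows "last_nonpos w t \<in> {s. 0 \<le> s \<and> s \<le> t \<and> w s \<le> 0}" "r \<le> last_nonpos w t"
proof -
  let ?S = "{s. 0 \<le> s \<and> s \<le> t \<and> w s \<le> 0}"
  have S: "?S = {0..t} \<inter> {s. w s \<le> 0}" by auto
  have r: "r \<in> ?S" using assms by simp
  have bdd: "bdd_above ?S" by (intro bdd_aboveI[of _ t]) auto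
  have cl: "closed ?S" unfolding S by (intro closed_Int closed_nonpos closed_atLeastAtMost)
  have eq: "last_nonpos w t = Sup ?S" using r by (auto simp: last_nonpos_def Let_def)
  show "last_nonpos w t \<in> ?S" unfolding eq by (rule closed_contains_Sup[OF _ bdd cl]) (use r in auto)
  show "r \<le> last_nonpos w t" unfolding eq by (rule cSup_upper[OF r bdd])
qed

text \<open>An age larger than a means that the last nonpositive time precedes t - a. That time is
  attained, which is why the strict inequality becomes positivity on the closed interval [t - a, t].
  The right-hand side joins a past event at time t - a with a condition on the following stretch of
  length a, the form to which the Markov property applies.\<close>

lemma excursion_length_gt_iff:
  assumes t: "0 \<le> t" and a: "0 \<le> a"
  shows "(\<exists>r\<in>{0..t}. w r \<le> 0) \<and> a < excursion_length w t \<longleftrightarrow>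
    a \<le> t \<and> (\<exists>r\<in>{0..t - a}. w r \<le> 0) \<and> (\<forall>r\<in>{t - a..t}. 0 < w r)"
proof safe
  fix r assume r: "r \<in> {0..t}" "w r \<le> 0" and l: "a < excursion_length w t"
  note g = last_nonpos_mem[of r t]
  have gt: "last_nonpos w t < t - a" using l by (simp add: excursion_length_def)
  show "a \<le> t" using g(1) r gt by auto
  show "\<exists>r\<in>{0..t - a}. w r \<le> 0" using g(1) r gt by (intro bexI[of _ "last_nonpos w t"]) auto
  fix r' assume r': "r' \<in> {t - a..t}"
  show "0 < w r'"
    using last_nonpos_mem(2)[of r' t] r' gt \<open>a \<le> t\<close> by force
next
  fix r assume r: "r \<in> {0..t - a}" "w r \<le> 0" "a \<le> t" and pos: "\<forall>r\<in>{t - a..t}. 0 < w r"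
  show "\<exists>r\<in>{0..t}. w r \<le> 0" using r a by (intro bexI[of _ r]) auto
  have g: "last_nonpos w t \<in> {s. 0 \<le> s \<and> s \<le> t \<and> w s \<le> 0}"
    using last_nonpos_mem(1)[of r t] r a by auto
  then have "last_nonpos w t < t - a" using pos by (auto simp: not_le[symmetric])
  then show "a < excursion_length w t" by (simp add: excursion_length_def)
qed

text \<open>The superlevel set of 0 is open, so positivity at t lasts beyond t and the infimum of
  the hitting times exceeds t strictly.\<close>

lemma less_hit_nonpos_iff:
  assumes "0 < w 0" "0 \<le> t"
  shows "ereal t < hit_nonpos w \<longleftrightarrow> (\<forall>r\<in>{0..t}. 0 < w r)"
proof
  assume l: "ereal t < hit_nonpos w"
  show "\<forall>r\<in>{0..t}. 0 < w r"
  proof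
    fix r assume r: "r \<in> {0..t}"
    show "0 < w r"
    proof (rule ccontr)
      assume n: "\<not> 0 < w r"
      then have "r > 0" using r assms(1) by (cases "r = 0") auto
      then have "hit_nonpos w \<le> ereal r"
        unfolding hit_nonpos_def using n by (intro Inf_lower) auto
      also have "\<dots> \<le> ereal t" using r by simp
      finally show False using l by simp
    qed
  qed
next
  assume pos: "\<forall>r\<in>{0..t}. 0 < w r"
  then have "t \<in> {t. 0 < w t}" using assms by auto
  then obtain e where e: "e > 0" "\<And>r. dist r t < e \<Longrightarrow> 0 < w r"
    using open_gt[of 0] unfolding open_dist by blast
  have "ereal (t + e) \<le> hit_nonpos w"
    unfolding hit_nonpos_def
  proof (rule Inf_greatest)
    fix x assume "x \<in> ereal ` {t. 0 < t \<and> w t \<le> 0}"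
    then obtain r where r: "x = ereal r" "0 < r" "w r \<le> 0" by auto
    then have "\<not> r \<le> t" using pos by (auto simp: not_le[symmetric])
    moreover have "\<not> dist r t < e" using e(2)[of r] r by auto
    ultimately show "ereal (t + e) \<le> x" using r by (auto simp: dist_real_def)
  qed
  then show "ereal t < hit_nonpos w" using e(1) by (metis ereal_less_eq(3) less_add_same_cancel1 less_le_trans linorder_not_le order_less_irrefl)
qed

text \<open>\<open>hit_nonpos\<close> disregards time 0 while \<open>last_nonpos\<close> does not.
  If the path is positive on (0, t], the last nonpositive time is 0, and both branches of the
  definition give t.\<close>

lemma excursion_length_from_nonpos_start:
  assumes "w 0 \<le> 0" "0 \<le> t"
  shows "excursion_length_from 0 w t = excursion_length w t"
proof (cases "ereal t < hit_nonpos w")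
  case True
  have "0 < w r" if "0 < r" "r \<le> t" for r
  proof (rule ccontr)
    assume n: "\<not> 0 < w r"
    then have "hit_nonpos w \<le> ereal r"
      unfolding hit_nonpos_def using that by (intro Inf_lower) auto
    also have "\<dots> \<le> ereal t" using that by simp
    finally show False using True by simp
  qed
  then have "{s. 0 \<le> s \<and> s \<le> t \<and> w s \<le> 0} = {0}"
    using assms by (auto simp: not_le[symmetric]) force
  then show ?thesis using True by (simp add: excursion_length_from_def excursion_length_def last_nonpos_def)
qed (simp add: excursion_length_from_def)

lemma less_hit_neg_imp:
  assumes "0 \<le> w 0" "ereal t < hit_neg w" "r \<in> {0..t}"
  shows "0 \<le> w r"
proof (rule ccontr)
  assume n: "\<not> 0 \<le> w r"
  then have "r > 0" using assms by (cases "r = 0") auto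
  then have "hit_neg w \<le> ereal r"
    unfolding hit_neg_def using n by (intro Inf_lower) auto
  also have "\<dots> \<le> ereal t" using assms by simp
  finally show False using assms by simp
qed

text \<open>Positivity at the end point is what makes the inequality strict: from w t = 0 the path
  might become negative at once.\<close>

lemma less_hit_negI:
  assumes "0 < w t" "\<And>r. r \<in> {0..t} \<Longrightarrow> 0 \<le> w r"
  shows "ereal t < hit_neg w"
proof -
  have "t \<in> {t. 0 < w t}" using assms by auto
  then obtain e where e: "e > 0" "\<And>r. dist r t < e \<Longrightarrow> 0 < w r"
    using open_gt[of 0] unfolding open_dist by blast
  have "ereal (t + e) \<le> hit_neg w"
    unfolding hit_neg_def
  proof (rule Inf_greatest)
    fix x assume "x \<in> ereal ` {t. 0 < t \<and> w t < 0}"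
    then obtain r where r: "x = ereal r" "0 < r" "w r < 0" by auto
    then have "\<not> r \<le> t" using assms(2)[of r] by auto
    moreover have "\<not> dist r t < e" using e(2)[of r] r by auto
    ultimately show "ereal (t + e) \<le> x" using r by (auto simp: dist_real_def)
  qed
  then show ?thesis using e(1) by (metis ereal_less_eq(3) less_add_same_cancel1 less_le_trans linorder_not_le order_less_irrefl)
qed

text \<open>\<open>hit_neg\<close> looks at positive times only, but by right continuity a negative
  start is followed by negative values at arbitrarily small positive times.\<close>

lemma hit_neg_neg_start:
  assumes "w 0 < 0"
  shows "hit_neg w \<le> 0"
proof -
  have "eventually (\<lambda>r. w r < 0) (at_right 0)"
    using rcD[of 0] assms by (rule order_tendstoD)
  then obtain b where b: "b > 0" "\<And>r. 0 < r \<Longrightarrow> r < b \<Longrightarrow> w r < 0"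
    unfolding eventually_at_right[OF zero_less_one] by blast
  show ?thesis
  proof (rule ereal_le_epsilon2)
    fix e :: real assume e: "0 < e"
    define r where "r = min (b / 2) e"
    have "hit_neg w \<le> ereal r"
      unfolding hit_neg_def using b e by (intro Inf_lower imageI) (auto simp: r_def)
    also have "\<dots> \<le> 0 + ereal e" by (simp add: r_def)
    finally show "hit_neg w \<le> 0 + ereal e" .
  qed
qed

text \<open>The level is reached exactly. Values above b accumulate at the infimum T from the right,
  so w T \<ge> b by right continuity; w T > b would, the superlevel set being open, put values above
  b before T.\<close>

lemma passage_time:
  assumes w0: "w 0 = 0" and b: "0 < b" and ex: "\<exists>r\<ge>0. b < w r"
  obtains T where "0 < T" "w T = b" "\<And>s. (\<exists>r\<in>{0..<s}. b < w r) \<longleftrightarrow> T < s"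
proof
  let ?S = "{r. 0 \<le> r \<and> b < w r}"
  define T where "T = Inf ?S"
  have ne: "?S \<noteq> {}" using ex by auto
  have bdd: "bdd_below ?S" by (intro bdd_belowI[of _ 0]) auto
  show iff: "(\<exists>r\<in>{0..<s}. b < w r) \<longleftrightarrow> T < s" for s
    unfolding T_def cInf_less_iff[OF ne bdd] by auto
  have T0: "0 \<le> T" unfolding T_def by (rule cInf_greatest[OF ne]) auto
  have le: "w r \<le> b" if "0 \<le> r" "r < T" for r
    using iff[of T] that by (auto simp: not_le[symmetric])
  have "\<not> b < w T"
  proof
    assume "b < w T"
    then have "T \<in> {t. b < w t}" by simp
    then obtain e where e: "e > 0" "\<And>r. dist r T < e \<Longrightarrow> b < w r"
      using open_gt[of b] unfolding open_dist by blast
    have "T > 0" using T0 \<open>b < w T\<close> w0 b by (cases "T = 0") auto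
    then have "b < w (max 0 (T - e/2))" using e by (intro e(2)) (auto simp: dist_real_def)
    then show False using le[of "max 0 (T - e/2)"] e(1) \<open>T > 0\<close> by auto
  qed
  moreover have "\<not> w T < b"
  proof
    assume "w T < b"
    then have "eventually (\<lambda>r. w r < b) (at_right T)"
      using rcD[of T] by (auto intro: order_tendstoD)
    then obtain c where c: "c > T" "\<And>r. T < r \<Longrightarrow> r < c \<Longrightarrow> w r < b"
      unfolding eventually_at_right[OF less_add_one] by blast
    then obtain r where r: "0 \<le> r" "r < c" "b < w r" using iff[of c] by auto
    have "r \<ge> T" unfolding T_def using r by (intro cInf_lower[OF _ bdd]) auto
    then show False using c(2)[of r] r \<open>w T < b\<close> by (cases "r = T") auto
  qed
  ultimately show "w T = b" by auto
  then show "0 < T" using T0 w0 b by (cases "T = 0") auto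
qed

end

subsection \<open>Dyadic fractions\<close>

text \<open>Fractions of a time horizon, to be multiplied by its length: K = 1 describes a path on
  [0, s], K = 2 two consecutive stretches, one per unit. Finitely many of them lie on a common grid,
  the end point K belongs to the set, and for K = 1 the set is symmetric under l to 1 - l, as time
  reversal requires.\<close>

definition dyadics :: "nat \<Rightarrow> real set" where
  "dyadics K = {real i / 2 ^ n | i n :: nat. i \<le> K * 2 ^ n}"

lemma countable_dyadics [simp, intro]: "countable (dyadics K)"
proof -
  have "dyadics K \<subseteq> range (\<lambda>(i, n). real i / 2 ^ n)" for K by (auto simp: dyadics_def)
  then show ?thesis by (rule countable_subset) auto
qed

lemma dyadics_subset: "dyadics K \<subseteq> {0..real K}"
proof
  fix x assume "x \<in> dyadics K"
  then obtain i n :: nat where x: "x = i / 2 ^ n" "i \<le> K * 2 ^ n" by (auto simp: dyadics_def)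
  have "real i \<le> real (K * 2 ^ n)" using x(2) by (simp only: of_nat_le_iff)
  then show "x \<in> {0..real K}" using x(1) by (simp add: divide_le_eq)
qed

lemma nat_mem_dyadics: "k \<le> K \<Longrightarrow> real k \<in> dyadics K"
  unfolding dyadics_def by (intro CollectI exI[of _ k] exI[of _ "0::nat"]) simp

lemma zero_mem_dyadics [simp]: "0 \<in> dyadics K"
  and one_mem_dyadics [simp]: "0 < K \<Longrightarrow> 1 \<in> dyadics K"
  using nat_mem_dyadics[of 0 K] nat_mem_dyadics[of 1 K] by auto

lemma dyadic_between:
  assumes "0 \<le> x" "x < y" "x < real K"
  obtains l where "l \<in> dyadics K" "x < l" "l < y"
proof -
  define z where "z = min y (real K)"
  have xz: "x < z" using assms by (simp add: z_def)
  obtain n :: nat where n: "1 / (z - x) < 2 ^ n"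
    using real_arch_pow[of 2 "1 / (z - x)"] by auto
  define i where "i = nat (\<lfloor>x * 2 ^ n\<rfloor> + 1)"
  have i: "real i = of_int \<lfloor>x * 2 ^ n\<rfloor> + 1" using assms by (simp add: i_def)
  have 1: "x * 2 ^ n < real i" "real i \<le> x * 2 ^ n + 1" unfolding i by linarith+
  have "1 < (z - x) * 2 ^ n" using n xz by (simp add: field_simps)
  then have 2: "real i < z * 2 ^ n" using 1(2) by (simp add: algebra_simps)
  also have "\<dots> \<le> real K * 2 ^ n" by (simp add: z_def)
  finally have "real i < real (K * 2 ^ n)" by simp
  then have "i \<le> K * 2 ^ n" by (simp only: of_nat_less_iff)
  then have "real i / 2 ^ n \<in> dyadics K" by (auto simp: dyadics_def)
  moreover have "x < real i / 2 ^ n" "real i / 2 ^ n < y"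
    using 1(1) less_le_trans[OF 2, of "y * 2 ^ n"] by (auto simp: field_simps z_def)
  ultimately show thesis using that by blast
qed

text \<open>Right continuity carries the bound from dyadic points to every point with room on its
  right; the right end point has none, but is itself dyadic.\<close>

lemma (in lsc_path) ge_on_interval_iff:
  assumes h: "0 \<le> h"
  shows "(\<forall>r\<in>{s..s + h}. c \<le> w r) \<longleftrightarrow> (\<forall>l\<in>dyadics 1. c \<le> w (s + l * h))"
proof
  assume "\<forall>r\<in>{s..s + h}. c \<le> w r"
  then show "\<forall>l\<in>dyadics 1. c \<le> w (s + l * h)"
    using dyadics_subset[of 1] h by (auto simp: mult_left_le_one_le)
next
  assume d: "\<forall>l\<in>dyadics 1. c \<le> w (s + l * h)"
  show "\<forall>r\<in>{s..s + h}. c \<le> w r"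
  proof (rule ballI, rule ccontr)
    fix r assume r: "r \<in> {s..s + h}" and n: "\<not> c \<le> w r"
    have "r \<noteq> s + h" using d[rule_format, OF one_mem_dyadics[of 1]] n by auto
    then have rh: "r < s + h" "0 < h" using r by auto
    have "eventually (\<lambda>r. w r < c) (at_right r)"
      using rcD[of r] n by (auto intro: order_tendstoD)
    then obtain b where b: "b > r" "\<And>r'. r < r' \<Longrightarrow> r' < b \<Longrightarrow> w r' < c"
      unfolding eventually_at_right[OF less_add_one] by blast
    obtain l where l: "l \<in> dyadics 1" "(r - s) / h < l" "l < (b - s) / h"
      using dyadic_between[of "(r - s) / h" "(b - s) / h" 1] r rh b(1) by (auto simp: divide_simps)
    have "w (s + l * h) < c" using l rh by (intro b(2)) (auto simp: field_simps)
    then show False using d l(1) by force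
  qed
qed

text \<open>Strict positivity at dyadic points would not exclude a zero in between. A lower bound
  1/(m+1) is a closed condition that passes to all points, and compactness provides such a
  bound.\<close>

lemma (in lsc_path) pos_on_interval_iff:
  assumes h: "0 \<le> h"
  shows "(\<forall>r\<in>{s..s + h}. 0 < w r) \<longleftrightarrow> (\<exists>m::nat. \<forall>l\<in>dyadics 1. 1 / (real m + 1) \<le> w (s + l * h))"
proof -
  have "(\<forall>r\<in>{s..s + h}. 0 < w r) \<longleftrightarrow> (\<exists>m::nat. \<forall>r\<in>{s..s + h}. 1 / (real m + 1) \<le> w r)"
  proof
    assume "\<exists>m::nat. \<forall>r\<in>{s..s + h}. 1 / (real m + 1) \<le> w r"
    then obtain m :: nat where "\<forall>r\<in>{s..s + h}. 1 / (real m + 1) \<le> w r" by auto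
    moreover have "0 < 1 / (real m + 1)" by simp
    ultimately show "\<forall>r\<in>{s..s + h}. 0 < w r" by (meson less_le_trans)
  qed (use pos_compact_bound in blast)
  then show ?thesis by (simp add: ge_on_interval_iff[OF h])
qed

text \<open>An exceedance persists for a moment to the right and is therefore seen at a dyadic time.
  The horizon h is kept apart from s so that exceedance before different times s \<le> h can be read
  off one skeleton.\<close>

lemma (in lsc_path) exceeds_iff:
  assumes h: "0 < h" and s: "s \<le> h"
  shows "(\<exists>r\<in>{0..<s}. b < w r) \<longleftrightarrow> (\<exists>l\<in>dyadics 1. l * h < s \<and> b < w (l * h))"
proof
  assume "\<exists>r\<in>{0..<s}. b < w r"
  then obtain r where r: "0 \<le> r" "r < s" "b < w r" by auto
  have "eventually (\<lambda>r. b < w r) (at_right r)"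
    using rcD[of r] r by (auto intro: order_tendstoD)
  then obtain c where c: "c > r" "\<And>r'. r < r' \<Longrightarrow> r' < c \<Longrightarrow> b < w r'"
    unfolding eventually_at_right[OF less_add_one] by blast
  have "r / h < real 1" using r s h by simp
  then obtain l where l: "l \<in> dyadics 1" "r / h < l" "l < min c s / h"
    using dyadic_between[of "r / h" "min c s / h" 1] r c(1) h by (auto simp: divide_strict_right_mono)
  have "b < w (l * h)" "l * h < s" using l h by (auto intro!: c(2) simp: field_simps)
  then show "\<exists>l\<in>dyadics 1. l * h < s \<and> b < w (l * h)" using l by blast
next
  assume "\<exists>l\<in>dyadics 1. l * h < s \<and> b < w (l * h)"
  then show "\<exists>r\<in>{0..<s}. b < w r" using dyadics_subset[of 1] h by force
qed
subsection \<open>Law of the process on dyadic times\<close>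

lemma restrict_mem_prod_emb:
  "J \<subseteq> I \<Longrightarrow> restrict f I \<in> prod_emb I (\<lambda>_. borel) J (Pi\<^sub>E J A) \<longleftrightarrow> (\<forall>j\<in>J. f j \<in> A j)"
  by (auto simp: prod_emb_def space_PiM PiE_iff Int_absorb1)

text \<open>Finitely many dyadic times lie on a common grid, where the values are telescoping sums
  of increments starting from 0; the law is thus determined by the joint laws of the grid
  increments, and for those it suffices to compare boxes.\<close>

lemma dyadic_law_eq:
  fixes Y :: "real \<Rightarrow> 'a \<Rightarrow> real" and Y' :: "real \<Rightarrow> 'b \<Rightarrow> real"
  assumes P: "prob_space P" and Q: "prob_space Q"
    and meas [measurable]: "\<And>t. Y t \<in> borel_measurable P" "\<And>t. Y' t \<in> borel_measurable Q"
    and zero: "\<And>\<omega>. \<omega> \<in> space P \<Longrightarrow> Y 0 \<omega> = 0" "\<And>\<omega>. \<omega> \<in> space Q \<Longrightarrow> Y' 0 \<omega> = 0"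
    and eq: "\<And>n A. (\<And>i. A i \<in> sets borel) \<Longrightarrow>
      emeasure P {\<omega>\<in>space P. \<forall>i<K * 2 ^ n. Y (real (Suc i) / 2 ^ n) \<omega> - Y (real i / 2 ^ n) \<omega> \<in> A i} =
      emeasure Q {\<omega>\<in>space Q. \<forall>i<K * 2 ^ n. Y' (real (Suc i) / 2 ^ n) \<omega> - Y' (real i / 2 ^ n) \<omega> \<in> A i}"
  shows "distr P (PiM (dyadics K) (\<lambda>_. borel)) (\<lambda>\<omega>. \<lambda>t\<in>dyadics K. Y t \<omega>) =
    distr Q (PiM (dyadics K) (\<lambda>_. borel)) (\<lambda>\<omega>. \<lambda>t\<in>dyadics K. Y' t \<omega>)"
proof -
  define D where "D n \<omega> = (\<lambda>i\<in>{..<K * 2 ^ n}. Y (real (Suc i) / 2 ^ n) \<omega> - Y (real i / 2 ^ n) \<omega>)" for n \<omega>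
  define D' where "D' n \<omega> = (\<lambda>i\<in>{..<K * 2 ^ n}. Y' (real (Suc i) / 2 ^ n) \<omega> - Y' (real i / 2 ^ n) \<omega>)" for n \<omega>
  let ?L = "\<lambda>n. PiM {..<K * 2 ^ n} (\<lambda>_. borel :: real measure)"
  have [measurable]: "D n \<in> measurable P (?L n)" "D' n \<in> measurable Q (?L n)" for n
    unfolding D_def D'_def by measurable
  have law: "distr P (?L n) (D n) = distr Q (?L n) (D' n)" for n
  proof (rule measure_eqI_PiM_infinite)
    show "finite_measure (distr P (?L n) (D n))"
      using prob_space.prob_space_distr[OF P, of "D n" "?L n"] prob_space.finite_measure by auto
    fix A :: "nat \<Rightarrow> real set" and J
    assume J: "finite J" "J \<subseteq> {..<K * 2 ^ n}" and A: "\<And>i. i \<in> J \<Longrightarrow> A i \<in> sets borel"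
    \<comment> \<open>Coordinates outside J are padded with \<open>UNIV\<close>, so that the
      hypothesis on full boxes applies.\<close>
    define B where "B i = (if i \<in> J then A i else UNIV)" for i
    have JI: "j < K * 2 ^ n" if "j \<in> J" for j using J(2) that by auto
    have [measurable]: "prod_emb {..<K * 2 ^ n} (\<lambda>_. borel) J (Pi\<^sub>E J A) \<in> sets (?L n)"
      using J A by (intro sets_PiM_I) auto
    have 1: "D n -` prod_emb {..<K * 2 ^ n} (\<lambda>_. borel) J (Pi\<^sub>E J A) \<inter> space P =
      {\<omega>\<in>space P. \<forall>i<K * 2 ^ n. Y (real (Suc i) / 2 ^ n) \<omega> - Y (real i / 2 ^ n) \<omega> \<in> B i}"
      using JI unfolding D_def by (auto simp: restrict_mem_prod_emb[OF J(2)] B_def simp del: of_nat_Suc)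
    have 2: "D' n -` prod_emb {..<K * 2 ^ n} (\<lambda>_. borel) J (Pi\<^sub>E J A) \<inter> space Q =
      {\<omega>\<in>space Q. \<forall>i<K * 2 ^ n. Y' (real (Suc i) / 2 ^ n) \<omega> - Y' (real i / 2 ^ n) \<omega> \<in> B i}"
      using JI unfolding D'_def by (auto simp: restrict_mem_prod_emb[OF J(2)] B_def simp del: of_nat_Suc)
    show "emeasure (distr P (?L n) (D n)) (prod_emb {..<K * 2 ^ n} (\<lambda>_. borel) J (Pi\<^sub>E J A)) =
      emeasure (distr Q (?L n) (D' n)) (prod_emb {..<K * 2 ^ n} (\<lambda>_. borel) J (Pi\<^sub>E J A))"
    proof -
      have "emeasure P (D n -` prod_emb {..<K * 2 ^ n} (\<lambda>_. borel) J (Pi\<^sub>E J A) \<inter> space P) =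
        emeasure Q (D' n -` prod_emb {..<K * 2 ^ n} (\<lambda>_. borel) J (Pi\<^sub>E J A) \<inter> space Q)"
        unfolding 1 2 by (rule eq) (simp add: B_def A)
      then show ?thesis by (simp add: emeasure_distr)
    qed
  qed auto
  let ?I = "PiM (dyadics K) (\<lambda>_. borel :: real measure)"
  have [measurable]: "(\<lambda>\<omega>. \<lambda>t\<in>dyadics K. Y t \<omega>) \<in> measurable P ?I"
    "(\<lambda>\<omega>. \<lambda>t\<in>dyadics K. Y' t \<omega>) \<in> measurable Q ?I"
    by measurable
  show ?thesis
  proof (rule measure_eqI_PiM_infinite)
    show "finite_measure (distr P ?I (\<lambda>\<omega>. \<lambda>t\<in>dyadics K. Y t \<omega>))"
      using prob_space.prob_space_distr[OF P, of "\<lambda>\<omega>. \<lambda>t\<in>dyadics K. Y t \<omega>" ?I] prob_space.finite_measure by auto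
    fix A :: "real \<Rightarrow> real set" and J
    assume J: "finite J" "J \<subseteq> dyadics K" and A: "\<And>i. i \<in> J \<Longrightarrow> A i \<in> sets borel"
    have "\<forall>j\<in>J. \<exists>i m. j = real i / 2 ^ m \<and> i \<le> K * 2 ^ m" using J(2) by (auto simp: dyadics_def)
    then obtain i m where im: "\<And>j. j \<in> J \<Longrightarrow> j = real (i j) / 2 ^ m j \<and> i j \<le> K * 2 ^ m j"
      by metis
    \<comment> \<open>The finest level among the finitely many times in J; \<open>k j\<close> is the
      index of j on that grid.\<close>
    define n where "n = Max (insert 0 (m ` J))"
    define k where "k j = i j * 2 ^ (n - m j)" for j
    have k: "j = real (k j) / 2 ^ n \<and> k j \<le> K * 2 ^ n" if "j \<in> J" for j
    proof -
      have "m j \<le> n" using J(1) that unfolding n_def by (intro Max_ge) auto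
      then have "(2::real) ^ n = 2 ^ m j * 2 ^ (n - m j)" "(2::nat) ^ n = 2 ^ m j * 2 ^ (n - m j)"
        by (simp_all flip: power_add)
      then show ?thesis using im[OF that] by (auto simp: k_def)
    qed
    define B where "B = {d \<in> space (?L n). \<forall>j\<in>J. (\<Sum>i<k j. d i) \<in> A j}"
    have [measurable]: "(\<lambda>d. \<Sum>i<k j. d i) \<in> borel_measurable (?L n)" if "j \<in> J" for j
      using k[OF that] by (intro borel_measurable_sum measurable_component_singleton) auto
    have B [measurable]: "B \<in> sets (?L n)"
      unfolding B_def using J(1) A by measurable
    have tel: "(\<Sum>i<l. Z (real (Suc i) / 2 ^ n) - Z (real i / 2 ^ n)) = Z (real l / 2 ^ n) - Z 0" for Z :: "real \<Rightarrow> real" and l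
      using sum_lessThan_telescope[of "\<lambda>i. Z (real i / 2 ^ n)" l] by simp
    have S: "(\<Sum>i<k j. D n \<omega> i) = Y j \<omega>" if "j \<in> J" "\<omega> \<in> space P" for j \<omega>
    proof -
      have "(\<Sum>i<k j. D n \<omega> i) = (\<Sum>i<k j. Y (real (Suc i) / 2 ^ n) \<omega> - Y (real i / 2 ^ n) \<omega>)"
        using k[OF that(1)] by (intro sum.cong) (auto simp: D_def)
      then show ?thesis using tel[of "\<lambda>t. Y t \<omega>" "k j"] zero that k[OF that(1)] by simp
    qed
    have S': "(\<Sum>i<k j. D' n \<omega> i) = Y' j \<omega>" if "j \<in> J" "\<omega> \<in> space Q" for j \<omega>
    proof -
      have "(\<Sum>i<k j. D' n \<omega> i) = (\<Sum>i<k j. Y' (real (Suc i) / 2 ^ n) \<omega> - Y' (real i / 2 ^ n) \<omega>)"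
        using k[OF that(1)] by (intro sum.cong) (auto simp: D'_def)
      then show ?thesis using tel[of "\<lambda>t. Y' t \<omega>" "k j"] zero that k[OF that(1)] by simp
    qed
    have [measurable]: "prod_emb (dyadics K) (\<lambda>_. borel) J (Pi\<^sub>E J A) \<in> sets ?I"
      using J A by (intro sets_PiM_I) auto
    have sp: "D n \<omega> \<in> space (?L n)" "D' n \<omega>' \<in> space (?L n)" for \<omega> \<omega>'
      by (auto simp: D_def D'_def space_PiM)
    have "emeasure (distr P ?I (\<lambda>\<omega>. \<lambda>t\<in>dyadics K. Y t \<omega>)) (prod_emb (dyadics K) (\<lambda>_. borel) J (Pi\<^sub>E J A)) =
      emeasure P (D n -` B \<inter> space P)"
    proof -
      have "(\<lambda>\<omega>. \<lambda>t\<in>dyadics K. Y t \<omega>) -` prod_emb (dyadics K) (\<lambda>_. borel) J (Pi\<^sub>E J A) \<inter> space P = D n -` B \<inter> space P"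
        using sp by (auto simp: restrict_mem_prod_emb[OF J(2)] B_def S)
      then show ?thesis by (simp add: emeasure_distr)
    qed
    also have "\<dots> = emeasure (distr P (?L n) (D n)) B" by (simp add: emeasure_distr)
    also have "\<dots> = emeasure Q (D' n -` B \<inter> space Q)" unfolding law by (simp add: emeasure_distr)
    also have "\<dots> = emeasure (distr Q ?I (\<lambda>\<omega>. \<lambda>t\<in>dyadics K. Y' t \<omega>)) (prod_emb (dyadics K) (\<lambda>_. borel) J (Pi\<^sub>E J A))"
    proof -
      have "(\<lambda>\<omega>. \<lambda>t\<in>dyadics K. Y' t \<omega>) -` prod_emb (dyadics K) (\<lambda>_. borel) J (Pi\<^sub>E J A) \<inter> space Q = D' n -` B \<inter> space Q"
        using sp by (auto simp: restrict_mem_prod_emb[OF J(2)] B_def S')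
      then show ?thesis by (simp add: emeasure_distr)
    qed
    finally show "emeasure (distr P ?I (\<lambda>\<omega>. \<lambda>t\<in>dyadics K. Y t \<omega>)) (prod_emb (dyadics K) (\<lambda>_. borel) J (Pi\<^sub>E J A)) =
      emeasure (distr Q ?I (\<lambda>\<omega>. \<lambda>t\<in>dyadics K. Y' t \<omega>)) (prod_emb (dyadics K) (\<lambda>_. borel) J (Pi\<^sub>E J A))" .
  qed auto
qed

text \<open>X 0 = 0 is required everywhere and negative times are frozen at 0, so that neither null
  sets nor sign conditions on the time accompany the events below. A general process is brought into
  this form by \<open>normalized\<close> at the end.\<close>

locale normalized_snlp = spectrally_negative_levy M X
  for M :: "'a measure" and X :: "real \<Rightarrow> 'a \<Rightarrow> real" +
  assumes zero: "\<And>t \<omega>. t \<le> 0 \<Longrightarrow> X t \<omega> = 0"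
begin

text \<open>For b > 0 the half-open interval makes this the event T < t, where T is the first
  passage time above b; its complement is t \<le> T, with T infinite if b is never exceeded.\<close>

abbreviation exceeds :: "real \<Rightarrow> real \<Rightarrow> 'a \<Rightarrow> bool" where
  "exceeds b t \<omega> \<equiv> \<exists>r\<in>{0..<t}. b < X r \<omega>"

abbreviation stays_pos :: "real \<Rightarrow> real \<Rightarrow> 'a \<Rightarrow> bool" where
  "stays_pos x t \<omega> \<equiv> \<forall>r\<in>{0..t}. 0 < x + X r \<omega>"

abbreviation stays_nonneg :: "real \<Rightarrow> real \<Rightarrow> 'a \<Rightarrow> bool" where
  "stays_nonneg x t \<omega> \<equiv> \<forall>r\<in>{0..t}. 0 \<le> x + X r \<omega>"

abbreviation returns :: "real \<Rightarrow> real \<Rightarrow> 'a \<Rightarrow> bool" where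
  "returns x t \<omega> \<equiv> \<exists>r\<in>{0..t}. x + X r \<omega> \<le> 0"

lemma X_measurable [measurable]: "X t \<in> borel_measurable M"
proof (cases "t \<ge> 0")
  case False
  then have "X t = (\<lambda>_. 0)" by (auto simp: zero)
  then show ?thesis by simp
qed (rule random_variable)

text \<open>To the left of t > 0 the path approaches a limit l \<ge> X t, since jumps are not
  positive; together with right continuity this makes {X > c} a neighbourhood of each of its points.
  At t \<le> 0 the path vanishes to the left.\<close>

lemma lsc_path_X:
  assumes \<omega>: "\<omega> \<in> space M"
  shows "lsc_path (\<lambda>t. X t \<omega>)"
proof
  show rc: "continuous (at_right t) (\<lambda>t. X t \<omega>)" for t
  proof (cases "t \<ge> 0")
    case False
    then have "eventually (\<lambda>s. s \<in> {t<..<0}) (at_right t)" by (intro eventually_at_right_real) auto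
    then have "eventually (\<lambda>s. X s \<omega> = 0) (at_right t)" by eventually_elim (simp add: zero)
    then have "((\<lambda>s. X s \<omega>) \<longlongrightarrow> 0) (at_right t)" by (rule tendsto_eventually)
    then show ?thesis using False by (simp add: continuous_within zero)
  qed (use right_continuous[OF \<omega>] in auto)
  have R: "eventually (\<lambda>s. c < X s \<omega>) (at_right t)" if "c < X t \<omega>" for c t
    using rc[of t] that by (auto simp: continuous_within intro: order_tendstoD)
  have L: "eventually (\<lambda>s. c < X s \<omega>) (at_left t)" if "c < X t \<omega>" for c t
  proof (cases "t > 0")
    case True
    obtain l where l: "((\<lambda>s. X s \<omega>) \<longlongrightarrow> l) (at_left t)" using left_limits[OF \<omega> True] by auto
    have "c < l" using no_positive_jumps[OF \<omega> True l] that by simp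
    then show ?thesis using l by (auto intro: order_tendstoD)
  next
    case False
    have "eventually (\<lambda>s. s < t) (at_left t)" by (rule eventually_at_leftI[of "t - 1"]) auto
    then show ?thesis by eventually_elim (use False that in \<open>auto simp: zero\<close>)
  qed
  show "open {t. c < X t \<omega>}" for c
  proof (subst open_subopen, safe)
    fix t assume t: "c < X t \<omega>"
    have "eventually (\<lambda>s. c < X s \<omega>) (nhds t)"
      using L[OF t] R[OF t] t by (auto simp: eventually_nhds_conv_at eventually_at_split)
    then show "\<exists>T. open T \<and> t \<in> T \<and> T \<subseteq> {t. c < X t \<omega>}"
      by (auto simp: eventually_nhds)
  qed
qed

lemma lsc_path_shift: "\<omega> \<in> space M \<Longrightarrow> lsc_path (\<lambda>t. x + X t \<omega>)"
  by (intro lsc_path.shift lsc_path_X)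

lemma X_joint [measurable]: "(\<lambda>(t, \<omega>). X t \<omega>) \<in> borel_measurable (borel \<Otimes>\<^sub>M M)"
proof (rule borel_measurable_LIMSEQ_real)
  \<comment> \<open>The added 1 places the grid point strictly to the right of t, where right
    continuity gives convergence.\<close>
  define A where "A n = (\<lambda>(t::real, \<omega>). X ((of_int \<lfloor>t * (real n + 1)\<rfloor> + 1) / (real n + 1)) \<omega>)" for n :: nat
  show "A n \<in> borel_measurable (borel \<Otimes>\<^sub>M M)" for n
  proof -
    have "(\<lambda>x. (\<lambda>i x. X ((of_int i + 1) / (real n + 1)) (snd x)) \<lfloor>fst x * (real n + 1)\<rfloor> x)
      \<in> borel_measurable (borel \<Otimes>\<^sub>M M)"
      by (rule measurable_compose_countable) measurable
    then show ?thesis by (simp add: A_def case_prod_beta')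
  qed
  fix x :: "real \<times> 'a" assume "x \<in> space (borel \<Otimes>\<^sub>M M)"
  then obtain t \<omega> where x: "x = (t, \<omega>)" and \<omega>: "\<omega> \<in> space M" by (auto simp: space_pair_measure)
  interpret lsc_path "\<lambda>t. X t \<omega>" by (rule lsc_path_X[OF \<omega>])
  define g where "g n = (of_int \<lfloor>t * (real n + 1)\<rfloor> + 1) / (real n + 1)" for n :: nat
  have g: "t < g n" "g n \<le> t + 1 / (real n + 1)" for n
  proof -
    have "t * (real n + 1) < of_int \<lfloor>t * (real n + 1)\<rfloor> + 1" by linarith
    then show "t < g n" by (simp add: g_def pos_less_divide_eq)
    have "of_int \<lfloor>t * (real n + 1)\<rfloor> + 1 \<le> t * (real n + 1) + 1" by linarith
    then have "g n \<le> (t * (real n + 1) + 1) / (real n + 1)" unfolding g_def by (intro divide_right_mono) auto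
    also have "\<dots> = t + 1 / (real n + 1)" by (simp add: field_simps)
    finally show "g n \<le> t + 1 / (real n + 1)" .
  qed
  have "g \<longlonglongrightarrow> t"
  proof (rule tendsto_sandwich[of "\<lambda>_. t" _ _ "\<lambda>n. t + 1 / (real n + 1)"])
    show "(\<lambda>n. t + 1 / (real n + 1)) \<longlonglongrightarrow> t"
      using tendsto_add[OF tendsto_const LIMSEQ_inverse_real_of_nat, of t]
      by (simp add: inverse_eq_divide add.commute)
  qed (use g in \<open>auto intro!: always_eventually less_imp_le\<close>)
  then have "filterlim g (at_right t) sequentially"
    using g(1) by (auto simp: filterlim_at intro!: always_eventually)
  then have "(\<lambda>n. X (g n) \<omega>) \<longlonglongrightarrow> X t \<omega>" by (rule filterlim_compose[OF rcD])
  then show "(\<lambda>n. A n x) \<longlonglongrightarrow> (case x of (t, \<omega>) \<Rightarrow> X t \<omega>)" by (simp add: A_def x g_def)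
qed

lemma X_joint_compose [measurable (raw)]:
  assumes [measurable]: "f \<in> borel_measurable N" "g \<in> measurable N M"
  shows "(\<lambda>x. X (f x) (g x)) \<in> borel_measurable N"
proof -
  have "(\<lambda>x. (\<lambda>(t, \<omega>). X t \<omega>) (f x, g x)) \<in> borel_measurable N" by measurable
  then show ?thesis by simp
qed

section \<open>Independent increments, time reversal and the Markov property on dyadic times\<close>

lemma prob_increment:
  assumes "s \<ge> 0" "s \<le> t" and [measurable]: "A \<in> sets borel"
  shows "prob {\<omega>\<in>space M. X t \<omega> - X s \<omega> \<in> A} = prob {\<omega>\<in>space M. X (t - s) \<omega> \<in> A}"
proof -
  have "measure (distr M borel (\<lambda>\<omega>. X (s + (t - s)) \<omega> - X s \<omega>)) A = measure (distr M borel (X (t - s))) A"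
    by (subst stationary_increments) (use assms in auto)
  then show ?thesis by (simp add: measure_distr vimage_def Int_def conj_commute)
qed

lemma prob_increments:
  assumes t: "t 0 \<ge> (0::real)" "\<And>i. i < n \<Longrightarrow> t i \<le> t (Suc i)" and A: "\<And>i::nat. A i \<in> sets borel"
  shows "prob {\<omega>\<in>space M. \<forall>i<n. X (t (Suc i)) \<omega> - X (t i) \<omega> \<in> A i} =
    (\<Prod>i<n. prob {\<omega>\<in>space M. X (t (Suc i) - t i) \<omega> \<in> A i})"
proof (cases "n = 0")
  case False
  have t0: "0 \<le> t i" if "i < n" for i
    using that by (induction i) (use t in \<open>auto intro: order_trans\<close>)
  have "prob {\<omega>\<in>space M. \<forall>i<n. X (t (Suc i)) \<omega> - X (t i) \<omega> \<in> A i} =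
    prob (\<Inter>i\<in>{..<n}. (\<lambda>\<omega>. X (t (Suc i)) \<omega> - X (t i) \<omega>) -` A i \<inter> space M)"
    using False by (intro arg_cong[where f = prob]) auto
  also have "\<dots> = (\<Prod>i<n. prob ((\<lambda>\<omega>. X (t (Suc i)) \<omega> - X (t i) \<omega>) -` A i \<inter> space M))"
    using False A by (intro indep_varsD_finite[OF independent_increments] t) auto
  also have "\<dots> = (\<Prod>i<n. prob {\<omega>\<in>space M. X (t (Suc i)) \<omega> - X (t i) \<omega> \<in> A i})"
    by (intro prod.cong refl arg_cong[where f = prob]) auto
  also have "\<dots> = (\<Prod>i<n. prob {\<omega>\<in>space M. X (t (Suc i) - t i) \<omega> \<in> A i})"
    by (intro prod.cong refl prob_increment) (use t t0 A in auto)
  finally show ?thesis .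
qed (simp add: prob_space)

text \<open>On an equidistant grid the reversed path has the same increments in the opposite order,
  and these are independent with a common law. Only values at fixed dyadic times are compared, so
  left limits do not enter the reversed path.\<close>

lemma time_reversal_law:
  assumes s: "0 \<le> s"
  shows "distr M (PiM (dyadics 1) (\<lambda>_. borel)) (\<lambda>\<omega>. \<lambda>l\<in>dyadics 1. X s \<omega> - X (s - l * s) \<omega>) =
    distr M (PiM (dyadics 1) (\<lambda>_. borel)) (\<lambda>\<omega>. \<lambda>l\<in>dyadics 1. X (l * s) \<omega>)"
proof (rule dyadic_law_eq)
  fix n :: nat and A :: "nat \<Rightarrow> real set" assume A: "\<And>i. A i \<in> sets borel"
  define N :: nat where "N = 2 ^ n"
  have N: "N > 0" "real N = 2 ^ n" by (auto simp: N_def)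
  define t where "t i = real i / real N * s" for i
  have t: "t 0 \<ge> 0" "t i \<le> t (Suc i)" "t (Suc i) - t i = s / N" for i
    using s N by (auto simp: t_def divide_simps algebra_simps)
  have refl: "s - real j / N * s = t (N - j)" if "j \<le> N" for j
    using that N(1) by (simp add: t_def of_nat_diff field_simps)
  have "prob {\<omega>\<in>space M. \<forall>i<N. (X s \<omega> - X (s - real (Suc i) / N * s) \<omega>) - (X s \<omega> - X (s - real i / N * s) \<omega>) \<in> A i}
    = prob {\<omega>\<in>space M. \<forall>i<N. X (t (Suc i)) \<omega> - X (t i) \<omega> \<in> A (N - Suc i)}"
  proof (intro arg_cong[where f = prob] Collect_cong conj_cong HOL.refl)
    fix \<omega>
    have "(\<forall>i<N. (X s \<omega> - X (s - real (Suc i) / N * s) \<omega>) - (X s \<omega> - X (s - real i / N * s) \<omega>) \<in> A i)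
      \<longleftrightarrow> (\<forall>i<N. X (t (N - i)) \<omega> - X (t (N - Suc i)) \<omega> \<in> A i)"
      using refl by (intro all_cong) (auto simp del: of_nat_Suc)
    also have "\<dots> \<longleftrightarrow> (\<forall>i<N. X (t (Suc i)) \<omega> - X (t i) \<omega> \<in> A (N - Suc i))"
    proof safe
      fix i assume "\<forall>i<N. X (t (N - i)) \<omega> - X (t (N - Suc i)) \<omega> \<in> A i" "i < N"
      then show "X (t (Suc i)) \<omega> - X (t i) \<omega> \<in> A (N - Suc i)"
        by (auto dest!: spec[of _ "N - Suc i"] simp: Suc_diff_Suc)
    next
      fix i assume "\<forall>i<N. X (t (Suc i)) \<omega> - X (t i) \<omega> \<in> A (N - Suc i)" "i < N"
      then show "X (t (N - i)) \<omega> - X (t (N - Suc i)) \<omega> \<in> A i"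
        by (auto dest!: spec[of _ "N - Suc i"] simp: Suc_diff_Suc)
    qed
    finally show "(\<forall>i<N. (X s \<omega> - X (s - real (Suc i) / N * s) \<omega>) - (X s \<omega> - X (s - real i / N * s) \<omega>) \<in> A i)
      \<longleftrightarrow> (\<forall>i<N. X (t (Suc i)) \<omega> - X (t i) \<omega> \<in> A (N - Suc i))" .
  qed
  also have "\<dots> = (\<Prod>i<N. prob {\<omega>\<in>space M. X (s / N) \<omega> \<in> A (N - Suc i)})"
    by (subst prob_increments) (use t A in auto)
  also have "\<dots> = (\<Prod>i<N. prob {\<omega>\<in>space M. X (s / N) \<omega> \<in> A i})"
    by (rule prod.nat_diff_reindex)
  also have "\<dots> = prob {\<omega>\<in>space M. \<forall>i<N. X (t (Suc i)) \<omega> - X (t i) \<omega> \<in> A i}"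
    by (subst prob_increments) (use t A in auto)
  finally show "emeasure M {\<omega>\<in>space M. \<forall>i<1 * 2 ^ n. (X s \<omega> - X (s - real (Suc i) / 2 ^ n * s) \<omega>) - (X s \<omega> - X (s - real i / 2 ^ n * s) \<omega>) \<in> A i}
    = emeasure M {\<omega>\<in>space M. \<forall>i<1 * 2 ^ n. X (real (Suc i) / 2 ^ n * s) \<omega> - X (real i / 2 ^ n * s) \<omega> \<in> A i}"
    by (simp add: emeasure_eq_measure t_def N_def)
qed (auto simp: zero intro: prob_space_axioms)

text \<open>The Markov property as an equality of laws: the skeleton on [0,1] describes X on [0, s],
  that on [1,2] the stretch from s to s + a, and on the right the second stretch comes from an
  independent copy.\<close>

lemma concatenation_law:
  assumes s: "0 \<le> s" and a: "0 \<le> a"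
  shows "distr M (PiM (dyadics 2) (\<lambda>_. borel)) (\<lambda>\<omega>. \<lambda>l\<in>dyadics 2. if l \<le> 1 then X (l * s) \<omega> else X (s + (l - 1) * a) \<omega>) =
    distr (M \<Otimes>\<^sub>M M) (PiM (dyadics 2) (\<lambda>_. borel))
      (\<lambda>\<omega>. \<lambda>l\<in>dyadics 2. if l \<le> 1 then X (l * s) (fst \<omega>) else X s (fst \<omega>) + X ((l - 1) * a) (snd \<omega>))"
proof (rule dyadic_law_eq)
  interpret MM: pair_prob_space M M ..
  show "prob_space M" "prob_space (M \<Otimes>\<^sub>M M)" by unfold_locales
  fix n :: nat and A :: "nat \<Rightarrow> real set" assume A [measurable]: "\<And>i. A i \<in> sets borel"
  define N :: nat where "N = 2 ^ n"
  have N: "N > 0" "real N = 2 ^ n" by (auto simp: N_def)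
  \<comment> \<open>The grid of level n is mapped to N steps of length s / N followed by N steps of
    length a / N; the product over all 2 N steps splits accordingly.\<close>
  define t where "t i = (if i \<le> N then real i / N * s else s + (real i / N - 1) * a)" for i
  define u where "u i = real i / N * a" for i
  have u: "u 0 \<ge> 0" "u i \<le> u (Suc i)" "u (Suc i) - u i = a / N" for i
    using a N by (auto simp: u_def divide_simps algebra_simps)
  have tN: "t (N + i) = s + u i" for i
    using N(1) by (auto simp: t_def u_def field_simps)
  have t1: "t i = real i / N * s" if "i \<le> N" for i using that by (simp add: t_def)
  have t: "t 0 \<ge> 0" "t i \<le> t (Suc i)" for i
  proof -
    show "t 0 \<ge> 0" by (simp add: t_def)
    show "t i \<le> t (Suc i)"
    proof (cases "i < N")
      case True
      then show ?thesis using s by (simp add: t1 divide_right_mono mult_right_mono)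
    next
      case False
      then obtain j where "i = N + j" using le_Suc_ex not_less by blast
      then show ?thesis using tN[of j] tN[of "Suc j"] u(2)[of j] by simp
    qed
  qed
  have prod_split: "(\<Prod>i<N. f i) * (\<Prod>i<N. f (N + i)) = (\<Prod>i<2 * N. f i)" for f :: "nat \<Rightarrow> real"
    using prod.atLeastLessThan_concat[of 0 N "2 * N" f] prod.shift_bounds_nat_ivl[of f 0 N N]
    by (simp add: atLeast0LessThan mult_2 add.commute)
  let ?Y = "\<lambda>l \<omega>. if l \<le> 1 then X (l * s) \<omega> else X (s + (l - 1) * a) \<omega>"
  let ?Y' = "\<lambda>l \<omega>. if l \<le> 1 then X (l * s) (fst \<omega>) else X s (fst \<omega>) + X ((l - 1) * a) (snd \<omega>)"
  have le1: "real i / real N \<le> 1 \<longleftrightarrow> i \<le> N" for i using N(1) by (simp add: divide_le_eq)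
  have Y: "?Y (real i / N) \<omega> = X (t i) \<omega>" for i \<omega> by (simp only: le1 t_def if_distrib[of "\<lambda>t. X t \<omega>"])
  define V where "V i \<omega> = (if i \<le> N then X (t i) (fst \<omega>) else X s (fst \<omega>) + X (u (i - N)) (snd \<omega>))" for i \<omega>
  have Y': "?Y' (real i / N) \<omega> = V i \<omega>" for i \<omega>
  proof (cases "i \<le> N")
    case False
    then have "real i / N - 1 = real (i - N) / N" using N(1) by (simp add: field_simps)
    then show ?thesis using False by (simp only: le1 V_def u_def if_False)
  qed (simp only: le1 V_def t1 if_True)
  have V1: "V i \<omega> = X (t i) (fst \<omega>)" if "i \<le> N" for i \<omega> using that by (simp add: V_def)
  have V2: "V (N + i) \<omega> = X s (fst \<omega>) + X (u i) (snd \<omega>)" for i \<omega>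
    using N(1) by (cases "i = 0") (auto simp: V_def zero u_def t_def)
  define S1 where "S1 = {\<omega>\<in>space M. \<forall>i<N. X (t (Suc i)) \<omega> - X (t i) \<omega> \<in> A i}"
  define S2 where "S2 = {\<omega>\<in>space M. \<forall>i<N. X (u (Suc i)) \<omega> - X (u i) \<omega> \<in> A (N + i)}"
  have [measurable]: "S1 \<in> sets M" "S2 \<in> sets M" unfolding S1_def S2_def by measurable
  have split: "(\<forall>i<2 * N. Q i) \<longleftrightarrow> (\<forall>i<N. Q i) \<and> (\<forall>i<N. Q (N + i))" for Q
  proof safe
    fix i assume *: "\<forall>i<N. Q i" "\<forall>i<N. Q (N + i)" "i < 2 * N"
    show "Q i"
    proof (cases "i < N")
      case False
      then obtain j where "i = N + j" using le_Suc_ex not_less by blast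
      then show ?thesis using * by simp
    qed (use * in simp)
  qed auto
  have "(\<forall>i<2 * N. V (Suc i) \<omega> - V i \<omega> \<in> A i) \<longleftrightarrow>
    (\<forall>i<N. X (t (Suc i)) (fst \<omega>) - X (t i) (fst \<omega>) \<in> A i) \<and>
    (\<forall>i<N. X (u (Suc i)) (snd \<omega>) - X (u i) (snd \<omega>) \<in> A (N + i))" for \<omega>
  proof -
    have "V (Suc i) \<omega> - V i \<omega> = X (t (Suc i)) (fst \<omega>) - X (t i) (fst \<omega>)" if "i < N" for i
      using that by (simp add: V1)
    moreover have "V (Suc (N + i)) \<omega> - V (N + i) \<omega> = X (u (Suc i)) (snd \<omega>) - X (u i) (snd \<omega>)" for i
      using V2[of "Suc i" \<omega>] V2[of i \<omega>] by simp
    ultimately show ?thesis unfolding split by simp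
  qed
  then have "{\<omega>\<in>space (M \<Otimes>\<^sub>M M). \<forall>i<2 * N. V (Suc i) \<omega> - V i \<omega> \<in> A i} = S1 \<times> S2"
    by (auto simp: S1_def S2_def space_pair_measure)
  then have "emeasure (M \<Otimes>\<^sub>M M) {\<omega>\<in>space (M \<Otimes>\<^sub>M M). \<forall>i<2 * N. ?Y' (real (Suc i) / N) \<omega> - ?Y' (real i / N) \<omega> \<in> A i}
    = ennreal (prob S1 * prob S2)"
    unfolding Y' by (simp add: emeasure_pair_measure_Times emeasure_eq_measure ennreal_mult)
  also have "prob S1 * prob S2 = (\<Prod>i<N. prob {\<omega>\<in>space M. X (t (Suc i) - t i) \<omega> \<in> A i}) *
      (\<Prod>i<N. prob {\<omega>\<in>space M. X (u (Suc i) - u i) \<omega> \<in> A (N + i)})"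
    unfolding S1_def S2_def by (subst (1 2) prob_increments) (use t u A in auto)
  also have "(\<Prod>i<N. prob {\<omega>\<in>space M. X (u (Suc i) - u i) \<omega> \<in> A (N + i)}) =
      (\<Prod>i<N. prob {\<omega>\<in>space M. X (t (N + Suc i) - t (N + i)) \<omega> \<in> A (N + i)})"
    by (simp only: tN add_diff_cancel_left)
  also have "(\<Prod>i<N. prob {\<omega>\<in>space M. X (t (Suc i) - t i) \<omega> \<in> A i}) *
      (\<Prod>i<N. prob {\<omega>\<in>space M. X (t (N + Suc i) - t (N + i)) \<omega> \<in> A (N + i)}) =
      (\<Prod>i<2 * N. prob {\<omega>\<in>space M. X (t (Suc i) - t i) \<omega> \<in> A i})"
    unfolding add_Suc_right by (rule prod_split)
  also have "\<dots> = prob {\<omega>\<in>space M. \<forall>i<2 * N. X (t (Suc i)) \<omega> - X (t i) \<omega> \<in> A i}"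
    by (subst prob_increments) (use t A in auto)
  also have "ennreal \<dots> = emeasure M {\<omega>\<in>space M. \<forall>i<2 * N. ?Y (real (Suc i) / N) \<omega> - ?Y (real i / N) \<omega> \<in> A i}"
    unfolding Y by (simp add: emeasure_eq_measure)
  finally show "emeasure M {\<omega>\<in>space M. \<forall>i<2 * 2 ^ n. ?Y (real (Suc i) / 2 ^ n) \<omega> - ?Y (real i / 2 ^ n) \<omega> \<in> A i} =
    emeasure (M \<Otimes>\<^sub>M M) {\<omega>\<in>space (M \<Otimes>\<^sub>M M). \<forall>i<2 * 2 ^ n. ?Y' (real (Suc i) / 2 ^ n) \<omega> - ?Y' (real i / 2 ^ n) \<omega> \<in> A i}"
    unfolding N(2) by (simp only: N_def)
qed (auto simp: zero)

lemma nn_integral_time_reversal: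
  assumes s: "0 \<le> s" and [measurable]: "F \<in> borel_measurable (PiM (dyadics 1) (\<lambda>_. borel))"
  shows "(\<integral>\<^sup>+\<omega>. F (\<lambda>l\<in>dyadics 1. X s \<omega> - X (s - l * s) \<omega>) \<partial>M) = (\<integral>\<^sup>+\<omega>. F (\<lambda>l\<in>dyadics 1. X (l * s) \<omega>) \<partial>M)"
proof -
  have "(\<integral>\<^sup>+v. F v \<partial>distr M (PiM (dyadics 1) (\<lambda>_. borel)) (\<lambda>\<omega>. \<lambda>l\<in>dyadics 1. X s \<omega> - X (s - l * s) \<omega>)) =
    (\<integral>\<^sup>+v. F v \<partial>distr M (PiM (dyadics 1) (\<lambda>_. borel)) (\<lambda>\<omega>. \<lambda>l\<in>dyadics 1. X (l * s) \<omega>))"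
    unfolding time_reversal_law[OF s] ..
  then show ?thesis by (subst (asm) (1 2) nn_integral_distr) (auto simp del: One_nat_def)
qed

lemma nn_integral_markov:
  assumes s: "0 \<le> s" and a: "0 \<le> a"
    and F [measurable]: "F \<in> borel_measurable (PiM (dyadics 1) (\<lambda>_. borel) \<Otimes>\<^sub>M PiM (dyadics 1) (\<lambda>_. borel))"
  shows "(\<integral>\<^sup>+\<omega>. F (\<lambda>l\<in>dyadics 1. X (l * s) \<omega>, \<lambda>l\<in>dyadics 1. X (s + l * a) \<omega> - X s \<omega>) \<partial>M) =
    (\<integral>\<^sup>+\<omega>. \<integral>\<^sup>+\<omega>'. F (\<lambda>l\<in>dyadics 1. X (l * s) \<omega>, \<lambda>l\<in>dyadics 1. X (l * a) \<omega>') \<partial>M \<partial>M)"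
proof -
  have d1: "l \<in> dyadics 2" "l + 1 \<in> dyadics 2" "l \<le> 1" "0 \<le> l" if l: "l \<in> dyadics 1" for l
  proof -
    obtain i n where "l = real i / 2 ^ n" "i \<le> 2 ^ n" using l by (auto simp: dyadics_def)
    then show "l \<in> dyadics 2" "l + 1 \<in> dyadics 2"
      unfolding dyadics_def by (force, intro CollectI exI[of _ "i + 2 ^ n"] exI[of _ n]) (auto simp: field_simps)
    show "l \<le> 1" "0 \<le> l" using dyadics_subset[of 1] l by auto
  qed
  \<comment> \<open>The future enters through its increments from time s, recovered from the
    skeleton by subtracting the value at 1.\<close>
  define G where "G v = F (\<lambda>l\<in>dyadics 1. v l, \<lambda>l\<in>dyadics 1. v (l + 1) - v 1)" for v :: "real \<Rightarrow> real"
  have [measurable]: "G \<in> borel_measurable (PiM (dyadics 2) (\<lambda>_. borel))"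
  proof -
    have 1: "(\<lambda>v. \<lambda>l\<in>dyadics 1. v l) \<in> measurable (PiM (dyadics 2) (\<lambda>_. borel :: real measure)) (PiM (dyadics 1) (\<lambda>_. borel))"
      by (intro measurable_restrict measurable_component_singleton d1)
    have 2: "(\<lambda>v. \<lambda>l\<in>dyadics 1. v (l + 1) - v 1) \<in> measurable (PiM (dyadics 2) (\<lambda>_. borel :: real measure)) (PiM (dyadics 1) (\<lambda>_. borel))"
      by (intro measurable_restrict borel_measurable_diff measurable_component_singleton d1 one_mem_dyadics) auto
    show ?thesis unfolding G_def by (rule measurable_compose[OF measurable_Pair[OF 1 2] F])
  qed
  let ?Y = "\<lambda>l \<omega>. if l \<le> 1 then X (l * s) \<omega> else X (s + (l - 1) * a) \<omega>"
  let ?Y' = "\<lambda>l \<omega>. if l \<le> 1 then X (l * s) (fst \<omega>) else X s (fst \<omega>) + X ((l - 1) * a) (snd \<omega>)"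
  have Y: "?Y (l + 1) \<omega> = X (s + l * a) \<omega>" if "0 \<le> l" for l \<omega> using that by (cases "l = 0") auto
  have Y': "?Y' (l + 1) \<omega> = X s (fst \<omega>) + X (l * a) (snd \<omega>)" if "0 \<le> l" for l \<omega>
    using that by (cases "l = 0") (auto simp: zero)
  have e1: "G (\<lambda>l\<in>dyadics 2. ?Y l \<omega>) = F (\<lambda>l\<in>dyadics 1. X (l * s) \<omega>, \<lambda>l\<in>dyadics 1. X (s + l * a) \<omega> - X s \<omega>)" for \<omega>
    unfolding G_def
  proof (intro arg_cong[where f = F] arg_cong2[where f = Pair] restrict_ext)
    fix l assume l: "l \<in> dyadics 1"
    show "(\<lambda>l\<in>dyadics 2. ?Y l \<omega>) l = X (l * s) \<omega>" using d1[OF l] by simp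
    show "(\<lambda>l\<in>dyadics 2. ?Y l \<omega>) (l + 1) - (\<lambda>l\<in>dyadics 2. ?Y l \<omega>) 1 = X (s + l * a) \<omega> - X s \<omega>"
      using d1[OF l] Y[of l \<omega>] by simp
  qed
  have e2: "G (\<lambda>l\<in>dyadics 2. ?Y' l \<omega>) = F (\<lambda>l\<in>dyadics 1. X (l * s) (fst \<omega>), \<lambda>l\<in>dyadics 1. X (l * a) (snd \<omega>))" for \<omega>
    unfolding G_def
  proof (intro arg_cong[where f = F] arg_cong2[where f = Pair] restrict_ext)
    fix l assume l: "l \<in> dyadics 1"
    show "(\<lambda>l\<in>dyadics 2. ?Y' l \<omega>) l = X (l * s) (fst \<omega>)" using d1[OF l] by simp
    show "(\<lambda>l\<in>dyadics 2. ?Y' l \<omega>) (l + 1) - (\<lambda>l\<in>dyadics 2. ?Y' l \<omega>) 1 = X (l * a) (snd \<omega>)"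
      using d1[OF l] Y'[of l \<omega>] by simp
  qed
  have m1: "(\<lambda>\<omega>. \<lambda>l\<in>dyadics 2. ?Y l \<omega>) \<in> measurable M (PiM (dyadics 2) (\<lambda>_. borel))"
    by (intro measurable_restrict) simp
  have m2: "(\<lambda>\<omega>. \<lambda>l\<in>dyadics 2. ?Y' l \<omega>) \<in> measurable (M \<Otimes>\<^sub>M M) (PiM (dyadics 2) (\<lambda>_. borel))"
    by (intro measurable_restrict) simp
  have "(\<integral>\<^sup>+\<omega>. G (\<lambda>l\<in>dyadics 2. ?Y l \<omega>) \<partial>M) = (\<integral>\<^sup>+\<omega>. G (\<lambda>l\<in>dyadics 2. ?Y' l \<omega>) \<partial>(M \<Otimes>\<^sub>M M))"
  proof -
    have "(\<integral>\<^sup>+v. G v \<partial>distr M (PiM (dyadics 2) (\<lambda>_. borel)) (\<lambda>\<omega>. \<lambda>l\<in>dyadics 2. ?Y l \<omega>)) =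
      (\<integral>\<^sup>+v. G v \<partial>distr (M \<Otimes>\<^sub>M M) (PiM (dyadics 2) (\<lambda>_. borel)) (\<lambda>\<omega>. \<lambda>l\<in>dyadics 2. ?Y' l \<omega>))"
      unfolding concatenation_law[OF s a] ..
    then show ?thesis using m1 m2 by (subst (asm) (1 2) nn_integral_distr) (auto simp del: One_nat_def)
  qed
  then have "(\<integral>\<^sup>+\<omega>. F (\<lambda>l\<in>dyadics 1. X (l * s) \<omega>, \<lambda>l\<in>dyadics 1. X (s + l * a) \<omega> - X s \<omega>) \<partial>M) =
    (\<integral>\<^sup>+\<omega>. F (\<lambda>l\<in>dyadics 1. X (l * s) (fst \<omega>), \<lambda>l\<in>dyadics 1. X (l * a) (snd \<omega>)) \<partial>(M \<Otimes>\<^sub>M M))"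
    unfolding e1 e2 .
  also have "\<dots> = (\<integral>\<^sup>+\<omega>. \<integral>\<^sup>+\<omega>'. F (\<lambda>l\<in>dyadics 1. X (l * s) \<omega>, \<lambda>l\<in>dyadics 1. X (l * a) \<omega>') \<partial>M \<partial>M)"
    by (subst nn_integral_fst[symmetric]) (auto simp del: One_nat_def)
  finally show ?thesis .
qed

end
subsection \<open>Exponential integrals\<close>

declare One_nat_def [simp del]

lemma nn_integral_exp_tail:
  assumes "0 < (r::real)"
  shows "(\<integral>\<^sup>+t\<in>{c..}. discount r t \<partial>lborel) = ennreal (exp (- r * c) / r)"
    and "(\<integral>\<^sup>+t\<in>{c<..}. discount r t \<partial>lborel) = ennreal (exp (- r * c) / r)"
proof -
  have "((\<lambda>t. - exp (- r * t) / r) \<longlongrightarrow> - 0 / r) at_top"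
    using assms by (intro tendsto_intros filterlim_compose[OF exp_at_bot]
        filterlim_tendsto_neg_mult_at_bot[of "\<lambda>_. - r" "- r"] filterlim_ident) auto
  then have "(\<integral>\<^sup>+t. discount r t * indicator {c..} t \<partial>lborel) = ennreal (- 0 / r - (- exp (- r * c) / r))"
    by (intro nn_integral_FTC_atLeast) (use assms in \<open>auto intro!: derivative_eq_intros\<close>)
  then show 1: "(\<integral>\<^sup>+t\<in>{c..}. discount r t \<partial>lborel) = ennreal (exp (- r * c) / r)" by simp
  have "AE t in lborel. t \<noteq> c" by (rule AE_lborel_singleton)
  then have "(\<integral>\<^sup>+t\<in>{c<..}. discount r t \<partial>lborel) = (\<integral>\<^sup>+t\<in>{c..}. discount r t \<partial>lborel)"
    by (intro nn_integral_cong_AE) (auto elim!: eventually_mono split: split_indicator)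
  with 1 show "(\<integral>\<^sup>+t\<in>{c<..}. discount r t \<partial>lborel) = ennreal (exp (- r * c) / r)" by simp
qed

text \<open>Restricted to the positive half-line, the measure is compared with its exponential
  density on the generator of half-lines; \<open>max 0 x\<close> accounts for those that begin below
  0. This converts the exponential tail formulas below into densities.\<close>

lemma nn_integral_of_exp_tails:
  fixes N :: "real measure"
  assumes sets [measurable_cong]: "sets N = sets borel" and r: "0 < r" and k: "0 \<le> k"
    and tail: "\<And>c. 0 \<le> c \<Longrightarrow> emeasure N {c<..} = ennreal (k * exp (- r * c) / r)"
    and [measurable]: "f \<in> borel_measurable borel"
  shows "(\<integral>\<^sup>+y\<in>{0<..}. f y \<partial>N) = (\<integral>\<^sup>+y\<in>{0<..}. ennreal (k * exp (- r * y)) * f y \<partial>lborel)"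
proof -
  let ?A = "density N (indicator {0<..})"
  let ?B = "density lborel (\<lambda>y. ennreal (k * exp (- r * y)) * indicator {0<..} y)"
  have A: "emeasure ?A {x<..} = ennreal (k * exp (- r * max 0 x) / r)" for x
  proof -
    have "emeasure ?A {x<..} = (\<integral>\<^sup>+y. indicator {max 0 x<..} y \<partial>N)"
      by (subst emeasure_density) (auto intro!: nn_integral_cong simp del: nn_integral_indicator split: split_indicator)
    also have "\<dots> = emeasure N {max 0 x<..}" by simp
    finally show ?thesis by (simp add: tail)
  qed
  have B: "emeasure ?B {x<..} = ennreal (k * exp (- r * max 0 x) / r)" for x
  proof -
    have "emeasure ?B {x<..} = (\<integral>\<^sup>+y. ennreal k * (discount r y * indicator {max 0 x<..} y) \<partial>lborel)"
      by (subst emeasure_density) (use k in \<open>auto intro!: nn_integral_cong simp: ennreal_mult split: split_indicator\<close>)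
    also have "\<dots> = ennreal k * ennreal (exp (- r * max 0 x) / r)"
    proof -
      have *: "(\<lambda>y. discount r y * indicator {max 0 x<..} y) \<in> borel_measurable lborel"
      by measurable
      show ?thesis
      using nn_integral_cmult[of "\<lambda>y. discount r y * indicator {max 0 x<..} y" lborel "ennreal k"]
        nn_integral_exp_tail(2)[OF r, of "max 0 x"] by (simp only: *)
    qed
    finally show ?thesis using k r by (simp add: ennreal_mult[symmetric])
  qed
  have eq: "?A = ?B" by (rule measure_eqI_lessThan) (use A B sets in simp_all)
  have "(\<integral>\<^sup>+y\<in>{0<..}. f y \<partial>N) = (\<integral>\<^sup>+y. f y \<partial>?A)"
    by (subst nn_integral_density) (auto simp: mult.commute)
  also have "\<dots> = (\<integral>\<^sup>+y\<in>{0<..}. ennreal (k * exp (- r * y)) * f y \<partial>lborel)"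
    unfolding eq by (subst nn_integral_density) (auto intro!: nn_integral_cong simp: ac_simps)
  finally show ?thesis .
qed

text \<open>For large N, monotonicity traps N g x between k g 1 and (k + 1) g 1, where k is the
  integer part of N x.\<close>

lemma additive_mono_linear:
  fixes g :: "real \<Rightarrow> real"
  assumes add: "\<And>a b. 0 < a \<Longrightarrow> 0 < b \<Longrightarrow> g (a + b) = g a + g b"
    and mono: "\<And>a b. 0 < a \<Longrightarrow> a \<le> b \<Longrightarrow> g a \<le> g b"
    and x: "0 < x"
  shows "g x = x * g 1"
proof -
  have mult: "g (real (Suc n) * a) = real (Suc n) * g a" if "0 < a" for n a
  proof (induction n)
    case (Suc n)
    have "g (real (Suc (Suc n)) * a) = g (real (Suc n) * a + a)" by (simp add: algebra_simps)
    also have "\<dots> = g (real (Suc n) * a) + g a" using that by (intro add) (auto simp del: of_nat_Suc)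
    finally show ?case using Suc by (simp add: algebra_simps)
  qed simp
  have "\<bar>g x - x * g 1\<bar> \<le> 0 + e" if e: "0 < e" for e
  proof -
    \<comment> \<open>N > 1 / x makes k positive, as g is controlled on positive arguments only; N >
      \<bar>g 1\<bar> / e makes the error g 1 / N smaller than e.\<close>
    obtain N :: nat where N: "max (1 / x) (\<bar>g 1\<bar> / e) < real N" using reals_Archimedean2 by blast
    then have "0 < real N" using x by (smt (verit) divide_pos_pos max_less_iff_conj)
    then obtain N' where N': "N = Suc N'" by (cases N) auto
    have Nx: "1 < real N * x" and Ne: "\<bar>g 1\<bar> < real N * e"
      using N x e by (auto simp: divide_less_eq)
    define k where "k = nat \<lfloor>real N * x\<rfloor>"
    have k: "real k \<le> real N * x" "real N * x < real k + 1" "0 < k"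
      using Nx unfolding k_def by linarith+
    then obtain k' where k': "k = Suc k'" by (cases k) auto
    have 1: "real k * g 1 \<le> real N * g x"
      using mono[of "real k" "real N * x"] mult[of 1 k'] mult[OF x, of N'] k by (simp add: N' k' del: of_nat_Suc)
    have 2: "real N * g x \<le> (real k + 1) * g 1"
      using mono[of "real N * x" "real k + 1"] mult[of 1 k] mult[OF x, of N'] k Nx
      by (simp add: N' del: of_nat_Suc) (simp add: add.commute)
    have g1: "0 \<le> g 1" using 1 2 by (simp add: algebra_simps)
    have "real N * (g x - x * g 1) \<le> g 1"
      using 2 mult_right_mono[OF k(1) g1] by (simp add: algebra_simps)
    moreover have "- g 1 \<le> real N * (g x - x * g 1)"
      using 1 mult_right_mono[OF less_imp_le[OF k(2)] g1] by (simp add: algebra_simps)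
    ultimately have "real N * \<bar>g x - x * g 1\<bar> \<le> \<bar>g 1\<bar>"
      by (simp add: abs_if algebra_simps split: if_splits)
    with Ne have "real N * \<bar>g x - x * g 1\<bar> < real N * e" by simp
    then show ?thesis using \<open>0 < real N\<close> by simp
  qed
  then have "\<bar>g x - x * g 1\<bar> \<le> 0" by (rule field_le_epsilon)
  then show ?thesis by simp
qed

lemma multiplicative_antimono_exp:
  fixes f :: "real \<Rightarrow> real"
  assumes mult: "\<And>a b. 0 < a \<Longrightarrow> 0 < b \<Longrightarrow> f (a + b) = f a * f b"
    and pos: "\<And>a. 0 < a \<Longrightarrow> 0 < f a"
    and mono: "\<And>a b. 0 < a \<Longrightarrow> a \<le> b \<Longrightarrow> f b \<le> f a"
    and x: "0 < x"
  shows "f x = exp (x * ln (f 1))"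
proof -
  have "- ln (f x) = x * (- ln (f 1))"
  proof (rule additive_mono_linear[OF _ _ x])
    fix a b :: real assume "0 < a" "0 < b"
    then show "- ln (f (a + b)) = - ln (f a) + - ln (f b)"
      using pos[of a] pos[of b] by (simp add: mult ln_mult)
  next
    fix a b :: real assume "0 < a" "a \<le> b"
    then show "- ln (f a) \<le> - ln (f b)"
      using pos[of a] pos[of b] mono[of a b] by simp
  qed
  then have "ln (f x) = x * ln (f 1)" by simp
  then show ?thesis using pos[OF x] by (metis exp_ln)
qed

context normalized_snlp
begin

subsection \<open>Path events and the Markov property\<close>

lemma pos_on_measurable [measurable (raw)]:
  assumes [measurable]: "x \<in> borel_measurable N" "s \<in> borel_measurable N" "t \<in> borel_measurable N" "g \<in> measurable N M"
  shows "Measurable.pred N (\<lambda>y. \<forall>r\<in>{s y..t y}. 0 < x y + X r (g y))"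
proof -
  have "(\<forall>r\<in>{s y..t y}. 0 < x y + X r (g y)) \<longleftrightarrow>
    t y < s y \<or> (\<exists>m::nat. \<forall>l\<in>dyadics 1. 1 / (real m + 1) \<le> x y + X (s y + l * (t y - s y)) (g y))" if "y \<in> space N" for y
  proof (cases "t y < s y")
    case False
    interpret lsc_path "\<lambda>t. x y + X t (g y)"
      by (rule lsc_path_shift) (use that measurable_space[OF assms(4)] in auto)
    show ?thesis using pos_on_interval_iff[of "t y - s y" "s y"] False by simp
  qed simp
  then show ?thesis by (subst measurable_cong) (assumption, measurable)
qed

lemma nonneg_on_measurable [measurable (raw)]:
  assumes [measurable]: "x \<in> borel_measurable N" "s \<in> borel_measurable N" "t \<in> borel_measurable N" "g \<in> measurable N M"
  shows "Measurable.pred N (\<lambda>y. \<forall>r\<in>{s y..t y}. 0 \<le> x y + X r (g y))"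
proof -
  have "(\<forall>r\<in>{s y..t y}. 0 \<le> x y + X r (g y)) \<longleftrightarrow>
    t y < s y \<or> (\<forall>l\<in>dyadics 1. 0 \<le> x y + X (s y + l * (t y - s y)) (g y))" if "y \<in> space N" for y
  proof (cases "t y < s y")
    case False
    interpret lsc_path "\<lambda>t. x y + X t (g y)"
      by (rule lsc_path_shift) (use that measurable_space[OF assms(4)] in auto)
    show ?thesis using ge_on_interval_iff[of "t y - s y" "s y" 0] False by simp
  qed simp
  then show ?thesis by (subst measurable_cong) (assumption, measurable)
qed

lemma exceeds_measurable [measurable (raw)]:
  assumes [measurable]: "b \<in> borel_measurable N" "s \<in> borel_measurable N" "g \<in> measurable N M"
  shows "Measurable.pred N (\<lambda>y. \<exists>r\<in>{0..<s y}. b y < X r (g y))"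
proof -
  have "(\<exists>r\<in>{0..<s y}. b y < X r (g y)) \<longleftrightarrow>
    0 < s y \<and> (\<exists>l\<in>dyadics 1. l * s y < s y \<and> b y < X (l * s y) (g y))" if "y \<in> space N" for y
  proof (cases "0 < s y")
    case True
    interpret lsc_path "\<lambda>t. X t (g y)"
      by (rule lsc_path_X) (use that measurable_space[OF assms(3)] in auto)
    show ?thesis using exceeds_iff[OF True, of "s y" "b y"] True by simp
  qed auto
  then show ?thesis by (subst measurable_cong) (assumption, measurable)
qed

lemma markov_event:
  assumes s: "0 \<le> s" and a: "0 \<le> a"
    and [measurable]: "Measurable.pred (PiM (dyadics 1) (\<lambda>_. borel)) G"
      "Measurable.pred (borel \<Otimes>\<^sub>M PiM (dyadics 1) (\<lambda>_. borel)) (\<lambda>(z, v). H z v)"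
  shows "emeasure M {\<omega>\<in>space M. G (\<lambda>l\<in>dyadics 1. X (l * s) \<omega>) \<and> H (x + X s \<omega>) (\<lambda>l\<in>dyadics 1. X (s + l * a) \<omega> - X s \<omega>)} =
    (\<integral>\<^sup>+\<omega>. indicator {\<omega>\<in>space M. G (\<lambda>l\<in>dyadics 1. X (l * s) \<omega>)} \<omega> *
      emeasure M {\<omega>'\<in>space M. H (x + X s \<omega>) (\<lambda>l\<in>dyadics 1. X (l * a) \<omega>')} \<partial>M)"
proof -
  let ?D = "PiM (dyadics 1) (\<lambda>_. borel :: real measure)"
  define F :: "(real \<Rightarrow> real) \<times> (real \<Rightarrow> real) \<Rightarrow> ennreal"
    where "F = (\<lambda>(u, v). indicator {(u, v). G u \<and> H (x + u 1) v} (u, v))"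
  have 1: "1 \<in> dyadics 1" by simp
  have [measurable]: "Measurable.pred (?D \<Otimes>\<^sub>M ?D) (\<lambda>p. H (x + fst p 1) (snd p))"
  proof -
    have "(\<lambda>p. (x + fst p 1, snd p)) \<in> measurable (?D \<Otimes>\<^sub>M ?D) (borel \<Otimes>\<^sub>M ?D)"
      using 1 by (intro measurable_Pair borel_measurable_add measurable_const measurable_snd
          measurable_compose[OF measurable_fst measurable_component_singleton]) simp
    from measurable_compose[OF this assms(4)] show ?thesis by simp
  qed
  have F [measurable]: "F \<in> borel_measurable (?D \<Otimes>\<^sub>M ?D)"
  proof -
    have "F = (\<lambda>p. indicator {p. G (fst p) \<and> H (x + fst p 1) (snd p)} p)"
      by (auto simp: F_def fun_eq_iff split: split_indicator)
    moreover have "(\<lambda>p. indicator {p. G (fst p) \<and> H (x + fst p 1) (snd p)} p :: ennreal) \<in> borel_measurable (?D \<Otimes>\<^sub>M ?D)"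
      by (rule borel_measurable_indicator') measurable
    ultimately show ?thesis by simp
  qed
  have m: "(\<lambda>\<omega>. \<lambda>l\<in>dyadics 1. X (t + l * u) \<omega> - y) \<in> measurable M ?D" for t u y by (intro measurable_restrict) measurable
  have P: "(\<lambda>\<omega>. \<lambda>l\<in>dyadics 1. X (l * s) \<omega>) \<in> measurable M ?D" "(\<lambda>\<omega>. \<lambda>l\<in>dyadics 1. X (s + l * a) \<omega> - X s \<omega>) \<in> measurable M ?D"
    "(\<lambda>\<omega>. \<lambda>l\<in>dyadics 1. X (l * a) \<omega>) \<in> measurable M ?D"
    by (intro measurable_restrict; measurable)+
  have F1: "F (\<lambda>l\<in>dyadics 1. X (l * s) \<omega>, v) =
    indicator {\<omega>. G (\<lambda>l\<in>dyadics 1. X (l * s) \<omega>)} \<omega> * (if H (x + X s \<omega>) v then 1 else 0)" for \<omega> v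
    using 1 by (simp add: F_def indicator_def)
  have HM: "{\<omega>'\<in>space M. H z (\<lambda>l\<in>dyadics 1. X (l * a) \<omega>')} \<in> sets M" for z
  proof -
    have "(\<lambda>\<omega>'. (z, \<lambda>l\<in>dyadics 1. X (l * a) \<omega>')) \<in> measurable M (borel \<Otimes>\<^sub>M ?D)"
      using P(3) by measurable
    from measurable_compose[OF this assms(4)] show ?thesis by simp
  qed
  have "(\<integral>\<^sup>+\<omega>. F (\<lambda>l\<in>dyadics 1. X (l * s) \<omega>, \<lambda>l\<in>dyadics 1. X (s + l * a) \<omega> - X s \<omega>) \<partial>M) =
    emeasure M {\<omega>\<in>space M. G (\<lambda>l\<in>dyadics 1. X (l * s) \<omega>) \<and> H (x + X s \<omega>) (\<lambda>l\<in>dyadics 1. X (s + l * a) \<omega> - X s \<omega>)}"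
  proof -
    have "{\<omega>\<in>space M. G (\<lambda>l\<in>dyadics 1. X (l * s) \<omega>) \<and> H (x + X s \<omega>) (\<lambda>l\<in>dyadics 1. X (s + l * a) \<omega> - X s \<omega>)} \<in> sets M"
    proof -
      have "(\<lambda>\<omega>. (x + X s \<omega>, \<lambda>l\<in>dyadics 1. X (s + l * a) \<omega> - X s \<omega>)) \<in> measurable M (borel \<Otimes>\<^sub>M ?D)"
        using P(2) by measurable
      from measurable_compose[OF this assms(4)] measurable_compose[OF P(1) assms(3)] show ?thesis
        by simp
    qed
    then have "emeasure M {\<omega>\<in>space M. G (\<lambda>l\<in>dyadics 1. X (l * s) \<omega>) \<and> H (x + X s \<omega>) (\<lambda>l\<in>dyadics 1. X (s + l * a) \<omega> - X s \<omega>)} =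
      (\<integral>\<^sup>+\<omega>. indicator {\<omega>\<in>space M. G (\<lambda>l\<in>dyadics 1. X (l * s) \<omega>) \<and> H (x + X s \<omega>) (\<lambda>l\<in>dyadics 1. X (s + l * a) \<omega> - X s \<omega>)} \<omega> \<partial>M)"
      by (rule nn_integral_indicator[symmetric])
    also have "\<dots> = (\<integral>\<^sup>+\<omega>. F (\<lambda>l\<in>dyadics 1. X (l * s) \<omega>, \<lambda>l\<in>dyadics 1. X (s + l * a) \<omega> - X s \<omega>) \<partial>M)"
      unfolding F1 by (intro nn_integral_cong) (simp add: indicator_def)
    finally show ?thesis ..
  qed
  moreover have "(\<integral>\<^sup>+\<omega>. \<integral>\<^sup>+\<omega>'. F (\<lambda>l\<in>dyadics 1. X (l * s) \<omega>, \<lambda>l\<in>dyadics 1. X (l * a) \<omega>') \<partial>M \<partial>M) =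
    (\<integral>\<^sup>+\<omega>. indicator {\<omega>\<in>space M. G (\<lambda>l\<in>dyadics 1. X (l * s) \<omega>)} \<omega> *
      emeasure M {\<omega>'\<in>space M. H (x + X s \<omega>) (\<lambda>l\<in>dyadics 1. X (l * a) \<omega>')} \<partial>M)"
  proof (rule nn_integral_cong)
    fix \<omega> assume "\<omega> \<in> space M"
    have "(\<integral>\<^sup>+\<omega>'. F (\<lambda>l\<in>dyadics 1. X (l * s) \<omega>, \<lambda>l\<in>dyadics 1. X (l * a) \<omega>') \<partial>M) =
      (\<integral>\<^sup>+\<omega>'. indicator {\<omega>. G (\<lambda>l\<in>dyadics 1. X (l * s) \<omega>)} \<omega> * indicator {\<omega>'\<in>space M. H (x + X s \<omega>) (\<lambda>l\<in>dyadics 1. X (l * a) \<omega>')} \<omega>' \<partial>M)"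
      unfolding F1 by (intro nn_integral_cong) (simp add: indicator_def)
    also have "\<dots> = indicator {\<omega>. G (\<lambda>l\<in>dyadics 1. X (l * s) \<omega>)} \<omega> * emeasure M {\<omega>'\<in>space M. H (x + X s \<omega>) (\<lambda>l\<in>dyadics 1. X (l * a) \<omega>')}"
      using HM by (subst nn_integral_cmult) auto
    finally show "(\<integral>\<^sup>+\<omega>'. F (\<lambda>l\<in>dyadics 1. X (l * s) \<omega>, \<lambda>l\<in>dyadics 1. X (l * a) \<omega>') \<partial>M) =
      indicator {\<omega>\<in>space M. G (\<lambda>l\<in>dyadics 1. X (l * s) \<omega>)} \<omega> *
      emeasure M {\<omega>'\<in>space M. H (x + X s \<omega>) (\<lambda>l\<in>dyadics 1. X (l * a) \<omega>')}"
      using \<open>\<omega> \<in> space M\<close> by (simp add: indicator_def)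
  qed
  ultimately show ?thesis using nn_integral_markov[OF s a F] by simp
qed

lemma nn_integral_markov_single:
  assumes s: "0 \<le> s" and a: "0 \<le> a"
    and [measurable]: "Measurable.pred (PiM (dyadics 1) (\<lambda>_. borel)) G" "g \<in> borel_measurable borel"
  shows "(\<integral>\<^sup>+\<omega>. indicator {\<omega>. G (\<lambda>l\<in>dyadics 1. X (l * s) \<omega>)} \<omega> * g (X (s + a) \<omega>) \<partial>M) =
    (\<integral>\<^sup>+\<omega>. indicator {\<omega>. G (\<lambda>l\<in>dyadics 1. X (l * s) \<omega>)} \<omega> * (\<integral>\<^sup>+\<omega>'. g (X s \<omega> + X a \<omega>') \<partial>M) \<partial>M)"
proof -
  let ?D = "PiM (dyadics 1) (\<lambda>_. borel :: real measure)"
  define F :: "(real \<Rightarrow> real) \<times> (real \<Rightarrow> real) \<Rightarrow> ennreal"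
    where "F = (\<lambda>p. indicator {u. G u} (fst p) * g (fst p 1 + snd p 1))"
  have 1: "1 \<in> dyadics 1" by simp
  have [measurable]: "(\<lambda>p. fst p 1 + snd p 1) \<in> borel_measurable (?D \<Otimes>\<^sub>M ?D)"
    using 1 by (intro borel_measurable_add measurable_compose[OF measurable_fst measurable_component_singleton]
      measurable_compose[OF measurable_snd measurable_component_singleton])
  have F [measurable]: "F \<in> borel_measurable (?D \<Otimes>\<^sub>M ?D)"
    unfolding F_def by measurable
  show ?thesis
    using nn_integral_markov[OF s a F] 1 by (simp add: F_def indicator_def nn_integral_cmult)
qed

text \<open>For z > 0 this is P_z(a < \<sigma>, X_a > c) with \<sigma> the first positive time in
  (-\<infinity>,0]; for z \<le> 0 and a \<ge> 0 it vanishes, since time 0 is included.\<close>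

definition stay_prob :: "real \<Rightarrow> real \<Rightarrow> real \<Rightarrow> ennreal" where
  "stay_prob a z c = emeasure M {\<omega>\<in>space M. stays_pos z a \<omega> \<and> c < z + X a \<omega>}"

definition stay_nonneg_prob :: "real \<Rightarrow> real \<Rightarrow> real \<Rightarrow> ennreal" where
  "stay_nonneg_prob a z c = emeasure M {\<omega>\<in>space M. stays_nonneg z a \<omega> \<and> c < z + X a \<omega>}"

lemma stay_prob_measurable [measurable (raw)]:
  assumes [measurable]: "a \<in> borel_measurable N" "z \<in> borel_measurable N" "c \<in> borel_measurable N"
  shows "(\<lambda>y. stay_prob (a y) (z y) (c y)) \<in> borel_measurable N"
  unfolding stay_prob_def by measurable

lemma stay_nonneg_prob_measurable [measurable (raw)]:
  assumes [measurable]: "a \<in> borel_measurable N" "z \<in> borel_measurable N" "c \<in> borel_measurable N"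
  shows "(\<lambda>y. stay_nonneg_prob (a y) (z y) (c y)) \<in> borel_measurable N"
  unfolding stay_nonneg_prob_def by measurable

text \<open>That Q belongs to the past of time s is expressed by a predicate G on the skeleton of
  [0, s]. What follows depends on X_s and on the later increments only, again through a
  skeleton.\<close>

lemma markov_stay:
  assumes s: "0 \<le> s" and a: "0 \<le> a"
    and [measurable]: "Measurable.pred (PiM (dyadics 1) (\<lambda>_. borel)) G"
    and past: "\<And>\<omega>. \<omega> \<in> space M \<Longrightarrow> Q \<omega> \<longleftrightarrow> G (\<lambda>l\<in>dyadics 1. X (l * s) \<omega>)"
  shows "emeasure M {\<omega>\<in>space M. Q \<omega> \<and> (\<forall>r\<in>{s..s + a}. 0 < x + X r \<omega>) \<and> c < x + X (s + a) \<omega>} =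
    (\<integral>\<^sup>+\<omega>. indicator {\<omega>. Q \<omega>} \<omega> * stay_prob a (x + X s \<omega>) c \<partial>M)"
proof -
  define H where "H z v \<longleftrightarrow> (\<exists>m::nat. \<forall>l\<in>dyadics 1. 1 / (real m + 1) \<le> z + v l) \<and> c < z + v 1" for z and v :: "real \<Rightarrow> real"
  have 1: "1 \<in> dyadics 1" by simp
  have comp: "(\<lambda>p. snd p l) \<in> borel_measurable (borel \<Otimes>\<^sub>M PiM (dyadics 1) (\<lambda>_. borel :: real measure))" if "l \<in> dyadics 1" for l
    using that by (intro measurable_compose[OF measurable_snd measurable_component_singleton])
  have [measurable]: "Measurable.pred (borel \<Otimes>\<^sub>M PiM (dyadics 1) (\<lambda>_. borel)) (\<lambda>(z, v). H z v)"
    unfolding H_def case_prod_beta'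
    using comp comp[OF 1] by (intro pred_intros_logic pred_intros_countable_bounded pred_intros_countable countable_dyadics) measurable
  have "{\<omega>\<in>space M. Q \<omega> \<and> (\<forall>r\<in>{s..s + a}. 0 < x + X r \<omega>) \<and> c < x + X (s + a) \<omega>} =
    {\<omega>\<in>space M. G (\<lambda>l\<in>dyadics 1. X (l * s) \<omega>) \<and> H (x + X s \<omega>) (\<lambda>l\<in>dyadics 1. X (s + l * a) \<omega> - X s \<omega>)}"
  proof (intro Collect_cong conj_cong refl past)
    fix \<omega> assume "\<omega> \<in> space M"
    then interpret lsc_path "\<lambda>t. x + X t \<omega>" by (rule lsc_path_shift)
    show "(\<forall>r\<in>{s..s + a}. 0 < x + X r \<omega>) \<and> c < x + X (s + a) \<omega> \<longleftrightarrow>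
      H (x + X s \<omega>) (\<lambda>l\<in>dyadics 1. X (s + l * a) \<omega> - X s \<omega>)"
      unfolding pos_on_interval_iff[OF a] H_def using 1 by simp
  qed
  moreover have "{\<omega>'\<in>space M. H z (\<lambda>l\<in>dyadics 1. X (l * a) \<omega>')} =
    {\<omega>'\<in>space M. stays_pos z a \<omega>' \<and> c < z + X a \<omega>'}" for z
  proof (intro Collect_cong conj_cong refl)
    fix \<omega> assume "\<omega> \<in> space M"
    then interpret lsc_path "\<lambda>t. z + X t \<omega>" by (rule lsc_path_shift)
    show "H z (\<lambda>l\<in>dyadics 1. X (l * a) \<omega>) \<longleftrightarrow> stays_pos z a \<omega> \<and> c < z + X a \<omega>"
      using 1 pos_on_interval_iff[OF a, of 0] by (simp add: H_def)
  qed
  ultimately show ?thesis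
    using markov_event[OF s a, of G H x]
    by (simp add: stay_prob_def) (intro nn_integral_cong, simp add: indicator_def past)
qed

lemma markov_stay_nonneg:
  assumes s: "0 \<le> s" and a: "0 \<le> a"
    and [measurable]: "Measurable.pred (PiM (dyadics 1) (\<lambda>_. borel)) G"
    and past: "\<And>\<omega>. \<omega> \<in> space M \<Longrightarrow> Q \<omega> \<longleftrightarrow> G (\<lambda>l\<in>dyadics 1. X (l * s) \<omega>)"
  shows "emeasure M {\<omega>\<in>space M. Q \<omega> \<and> (\<forall>r\<in>{s..s + a}. 0 \<le> x + X r \<omega>) \<and> c < x + X (s + a) \<omega>} =
    (\<integral>\<^sup>+\<omega>. indicator {\<omega>. Q \<omega>} \<omega> * stay_nonneg_prob a (x + X s \<omega>) c \<partial>M)"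
proof -
  define H where "H z v \<longleftrightarrow> (\<forall>l\<in>dyadics 1. 0 \<le> z + v l) \<and> c < z + v 1" for z and v :: "real \<Rightarrow> real"
  have 1: "1 \<in> dyadics 1" by simp
  have comp: "(\<lambda>p. snd p l) \<in> borel_measurable (borel \<Otimes>\<^sub>M PiM (dyadics 1) (\<lambda>_. borel :: real measure))" if "l \<in> dyadics 1" for l
    using that by (intro measurable_compose[OF measurable_snd measurable_component_singleton])
  have [measurable]: "Measurable.pred (borel \<Otimes>\<^sub>M PiM (dyadics 1) (\<lambda>_. borel)) (\<lambda>(z, v). H z v)"
    unfolding H_def case_prod_beta'
    using comp comp[OF 1] by (intro pred_intros_logic pred_intros_countable_bounded pred_intros_countable countable_dyadics) measurable
  have "{\<omega>\<in>space M. Q \<omega> \<and> (\<forall>r\<in>{s..s + a}. 0 \<le> x + X r \<omega>) \<and> c < x + X (s + a) \<omega>} =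
    {\<omega>\<in>space M. G (\<lambda>l\<in>dyadics 1. X (l * s) \<omega>) \<and> H (x + X s \<omega>) (\<lambda>l\<in>dyadics 1. X (s + l * a) \<omega> - X s \<omega>)}"
  proof (intro Collect_cong conj_cong refl past)
    fix \<omega> assume "\<omega> \<in> space M"
    then interpret lsc_path "\<lambda>t. x + X t \<omega>" by (rule lsc_path_shift)
    show "(\<forall>r\<in>{s..s + a}. 0 \<le> x + X r \<omega>) \<and> c < x + X (s + a) \<omega> \<longleftrightarrow>
      H (x + X s \<omega>) (\<lambda>l\<in>dyadics 1. X (s + l * a) \<omega> - X s \<omega>)"
      unfolding ge_on_interval_iff[OF a] H_def using 1 by simp
  qed
  moreover have "{\<omega>'\<in>space M. H z (\<lambda>l\<in>dyadics 1. X (l * a) \<omega>')} =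
    {\<omega>'\<in>space M. stays_nonneg z a \<omega>' \<and> c < z + X a \<omega>'}" for z
  proof (intro Collect_cong conj_cong refl)
    fix \<omega> assume "\<omega> \<in> space M"
    then interpret lsc_path "\<lambda>t. z + X t \<omega>" by (rule lsc_path_shift)
    show "H z (\<lambda>l\<in>dyadics 1. X (l * a) \<omega>) \<longleftrightarrow> stays_nonneg z a \<omega> \<and> c < z + X a \<omega>"
      using 1 ge_on_interval_iff[OF a, of 0 0] by (simp add: H_def)
  qed
  ultimately show ?thesis
    using markov_event[OF s a, of G H x]
    by (simp add: stay_nonneg_prob_def) (intro nn_integral_cong, simp add: indicator_def past)
qed

subsection \<open>The resolvent and the strong Markov property at first passage\<close>

definition resolvent :: "real \<Rightarrow> real measure" where
  "resolvent q = distr (density (lborel \<Otimes>\<^sub>M M) (\<lambda>p. discount q (fst p) * indicator {0..} (fst p)))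
     borel (\<lambda>p. X (fst p) (snd p))"

lemma sets_resolvent [simp, measurable_cong]: "sets (resolvent q) = sets borel"
  by (simp add: resolvent_def)

lemma space_resolvent [simp]: "space (resolvent q) = UNIV"
  by (simp add: resolvent_def)

lemma nn_integral_resolvent:
  assumes [measurable]: "g \<in> borel_measurable borel"
  shows "(\<integral>\<^sup>+y. g y \<partial>resolvent q) = laplace q (\<lambda>t. (\<integral>\<^sup>+\<omega>. g (X t \<omega>) \<partial>M))"
proof -
  have "(\<integral>\<^sup>+y. g y \<partial>resolvent q) =
    (\<integral>\<^sup>+p. discount q (fst p) * indicator {0..} (fst p) * g (X (fst p) (snd p)) \<partial>(lborel \<Otimes>\<^sub>M M))"
    unfolding resolvent_def by (simp add: nn_integral_distr nn_integral_density)
  also have "\<dots> = (\<integral>\<^sup>+t. \<integral>\<^sup>+\<omega>. discount q t * indicator {0..} t * g (X t \<omega>) \<partial>M \<partial>lborel)"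
    by (subst nn_integral_fst[symmetric]) auto
  also have "\<dots> = laplace q (\<lambda>t. (\<integral>\<^sup>+\<omega>. g (X t \<omega>) \<partial>M))"
  proof (rule nn_integral_cong)
    fix t
    have "(\<integral>\<^sup>+\<omega>. discount q t * indicator {0..} t * g (X t \<omega>) \<partial>M) =
      discount q t * indicator {0..} t * (\<integral>\<^sup>+\<omega>. g (X t \<omega>) \<partial>M)"
      by (rule nn_integral_cmult) measurable
    then show "(\<integral>\<^sup>+\<omega>. discount q t * indicator {0..} t * g (X t \<omega>) \<partial>M) =
      discount q t * (\<integral>\<^sup>+\<omega>. g (X t \<omega>) \<partial>M) * indicator {0..} t"
      by (simp add: ac_simps)
  qed
  finally show ?thesis .
qed

lemma emeasure_resolvent:
  assumes [measurable]: "A \<in> sets borel"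
  shows "emeasure (resolvent q) A =
    laplace q (\<lambda>t. emeasure M {\<omega>\<in>space M. X t \<omega> \<in> A})"
proof -
  have "(\<integral>\<^sup>+\<omega>. indicator A (X t \<omega>) \<partial>M) = emeasure M {\<omega>\<in>space M. X t \<omega> \<in> A}" for t
    by (subst nn_integral_indicator[symmetric]) (auto intro!: nn_integral_cong simp del: nn_integral_indicator simp: indicator_def)
  then show ?thesis using nn_integral_resolvent[of "indicator A" q] by simp
qed

lemma emeasure_resolvent_UNIV:
  assumes "0 < q"
  shows "emeasure (resolvent q) UNIV = ennreal (1 / q)"
  using emeasure_resolvent[of UNIV q] nn_integral_exp_tail(1)[OF assms, of 0] by (simp add: emeasure_space_1)

lemma finite_measure_resolvent: "0 < q \<Longrightarrow> finite_measure (resolvent q)"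
  by (intro finite_measureI) (simp add: emeasure_resolvent_UNIV)

text \<open>For a path that first passes \<open>b\<close> at time \<open>T\<close>, this is \<open>exp (- q T)\<close>, and \<open>0\<close> if it never does.\<close>

definition passage_discount :: "real \<Rightarrow> real \<Rightarrow> 'a \<Rightarrow> ennreal" where
  "passage_discount q b \<omega> = ennreal q * laplace q (\<lambda>t. indicator {t. exceeds b t \<omega>} t)"

text \<open>With T the first passage time above b > 0 this is E exp (- q T), written as q
  \<integral> exp (- q t) P(T < t) dt, so that only the events T < t occur.\<close>

definition passage_transform :: "real \<Rightarrow> real \<Rightarrow> ennreal" where
  "passage_transform q b = ennreal q * laplace q (\<lambda>t. emeasure M {\<omega>\<in>space M. exceeds b t \<omega>})"

lemma passage_discount_measurable [measurable]: "passage_discount q b \<in> borel_measurable M"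
proof -
  have [measurable]: "(\<lambda>p. indicator {t. exceeds b t (fst p)} (snd p) :: ennreal) \<in> borel_measurable (M \<Otimes>\<^sub>M lborel)"
  proof -
    have "(\<lambda>p. indicator {t. exceeds b t (fst p)} (snd p) :: ennreal) =
      (\<lambda>p. indicator {p. exceeds b (snd p) (fst p)} p)" by (auto simp: indicator_def)
    also have "\<dots> \<in> borel_measurable (M \<Otimes>\<^sub>M lborel)"
      by (rule borel_measurable_indicator') measurable
    finally show ?thesis .
  qed
  have "(\<lambda>\<omega>. \<integral>\<^sup>+t. discount q t * indicator {t. exceeds b t \<omega>} t * indicator {0..} t \<partial>lborel) \<in> borel_measurable M"
    by (rule lborel.borel_measurable_nn_integral) (simp add: case_prod_beta')
  then show ?thesis unfolding passage_discount_def by measurable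
qed

lemma nn_integral_passage_discount: "(\<integral>\<^sup>+\<omega>. passage_discount q b \<omega> \<partial>M) = passage_transform q b"
proof -
  interpret L: pair_sigma_finite lborel M ..
  have [measurable]: "(\<lambda>p. indicator {p. exceeds b (fst p) (snd p)} p :: ennreal) \<in> borel_measurable (lborel \<Otimes>\<^sub>M M)"
    by (rule borel_measurable_indicator') measurable
  have i: "indicator {t. exceeds b t \<omega>} t = (indicator {p. exceeds b (fst p) (snd p)} (t, \<omega>) :: ennreal)" for t \<omega>
    by (simp add: indicator_def)
  have "(\<integral>\<^sup>+\<omega>. \<integral>\<^sup>+t. discount q t * indicator {t. exceeds b t \<omega>} t * indicator {0..} t \<partial>lborel \<partial>M) =
    (\<integral>\<^sup>+t. \<integral>\<^sup>+\<omega>. discount q t * indicator {t. exceeds b t \<omega>} t * indicator {0..} t \<partial>M \<partial>lborel)"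
    unfolding i by (rule L.Fubini') measurable
  also have "\<dots> = (\<integral>\<^sup>+t. discount q t * indicator {0..} t * emeasure M {\<omega>\<in>space M. exceeds b t \<omega>} \<partial>lborel)"
  proof (rule nn_integral_cong)
    fix t
    have "(\<integral>\<^sup>+\<omega>. discount q t * indicator {t. exceeds b t \<omega>} t * indicator {0..} t \<partial>M) =
      (\<integral>\<^sup>+\<omega>. discount q t * indicator {0..} t * indicator {\<omega>\<in>space M. exceeds b t \<omega>} \<omega> \<partial>M)"
      by (intro nn_integral_cong) (simp add: indicator_def)
    also have "\<dots> = discount q t * indicator {0..} t * emeasure M {\<omega>\<in>space M. exceeds b t \<omega>}"
      by (rule nn_integral_cmult_indicator) measurable
    finally show "(\<integral>\<^sup>+\<omega>. discount q t * indicator {t. exceeds b t \<omega>} t * indicator {0..} t \<partial>M) = \<dots>" .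
  qed
  finally show ?thesis
    unfolding passage_discount_def passage_transform_def
    by (subst nn_integral_cmult) (auto simp: ac_simps)
qed

lemma resolvent_shift_continuous:
  assumes q: "0 < q" and g: "continuous_on UNIV g" "\<And>y. 0 \<le> g y" "\<And>y. g y \<le> (1::real)" and lim: "z \<longlonglongrightarrow> b"
  shows "(\<lambda>n. \<integral>\<^sup>+y. ennreal (g (z n + y)) \<partial>resolvent q) \<longlonglongrightarrow> (\<integral>\<^sup>+y. ennreal (g (b + y)) \<partial>resolvent q)"
proof (rule nn_integral_dominated_convergence[where w = "\<lambda>_. 1"])
  have [measurable]: "g \<in> borel_measurable borel" using g(1) by (rule borel_measurable_continuous_onI)
  show "(\<lambda>y. ennreal (g (z n + y))) \<in> borel_measurable (resolvent q)" "(\<lambda>y. ennreal (g (b + y))) \<in> borel_measurable (resolvent q)" for n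
    by measurable
  show "AE y in resolvent q. (\<lambda>n. ennreal (g (z n + y))) \<longlonglongrightarrow> ennreal (g (b + y))"
    by (intro AE_I2 tendsto_ennrealI continuous_on_tendsto_compose[OF g(1)] tendsto_intros lim) auto
qed (use g emeasure_resolvent_UNIV[OF q] in \<open>auto simp: less_top[symmetric]\<close>)

text \<open>At a fixed time s this is Fubini and the Markov property for each later time: the
  potential from s onwards is discounted by exp (- q s) and restarted from X s.\<close>

lemma strong_markov_discrete:
  assumes q: "0 < q" and s: "0 \<le> s"
    and [measurable]: "Measurable.pred (PiM (dyadics 1) (\<lambda>_. borel)) G" "g \<in> borel_measurable borel"
    and past: "\<And>\<omega>. \<omega> \<in> space M \<Longrightarrow> Q \<omega> \<longleftrightarrow> G (\<lambda>l\<in>dyadics 1. X (l * s) \<omega>)"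
  shows "(\<integral>\<^sup>+\<omega>. indicator {\<omega>. Q \<omega>} \<omega> * (\<integral>\<^sup>+t\<in>{s..}. discount q t * g (X t \<omega>) \<partial>lborel) \<partial>M) =
    (\<integral>\<^sup>+\<omega>. indicator {\<omega>. Q \<omega>} \<omega> * (discount q s * (\<integral>\<^sup>+y. g (X s \<omega> + y) \<partial>resolvent q)) \<partial>M)"
proof -
  interpret L: pair_sigma_finite lborel M ..
  have Qm [measurable]: "Measurable.pred M Q"
  proof -
    have "(\<lambda>\<omega>. \<lambda>l\<in>dyadics 1. X (l * s) \<omega>) \<in> measurable M (PiM (dyadics 1) (\<lambda>_. borel))"
      by (intro measurable_restrict) measurable
    from measurable_compose[OF this assms(3)] show ?thesis
      using past by (simp cong: measurable_cong)
  qed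
  have "(\<integral>\<^sup>+\<omega>. indicator {\<omega>. Q \<omega>} \<omega> * (\<integral>\<^sup>+t\<in>{s..}. discount q t * g (X t \<omega>) \<partial>lborel) \<partial>M) =
    (\<integral>\<^sup>+\<omega>. \<integral>\<^sup>+t. indicator {\<omega>. Q \<omega>} \<omega> * (discount q t * g (X t \<omega>) * indicator {s..} t) \<partial>lborel \<partial>M)"
    by (intro nn_integral_cong nn_integral_cmult[symmetric]) measurable
  also have "\<dots> = (\<integral>\<^sup>+t. \<integral>\<^sup>+\<omega>. indicator {\<omega>. Q \<omega>} \<omega> * (discount q t * g (X t \<omega>) * indicator {s..} t) \<partial>M \<partial>lborel)"
    by (rule L.Fubini') measurable
  also have "\<dots> = (\<integral>\<^sup>+t. (\<integral>\<^sup>+\<omega>. indicator {\<omega>. Q \<omega>} \<omega> * g (X t \<omega>) \<partial>M) * (discount q t * indicator {s..} t) \<partial>lborel)"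
    by (intro nn_integral_cong) (subst nn_integral_multc[symmetric], auto simp: ac_simps)
  also have "\<dots> = (\<integral>\<^sup>+t. (\<integral>\<^sup>+\<omega>. indicator {\<omega>. Q \<omega>} \<omega> * g (X (s + t) \<omega>) \<partial>M) * (discount q (s + t) * indicator {s..} (s + t)) \<partial>lborel)"
    by (subst nn_integral_real_affine[of _ 1 s]) auto
  also have "\<dots> = (\<integral>\<^sup>+t. (\<integral>\<^sup>+\<omega>. indicator {\<omega>. Q \<omega>} \<omega> * (\<integral>\<^sup>+\<omega>'. g (X s \<omega> + X t \<omega>') \<partial>M) \<partial>M) * (discount q (s + t) * indicator {0..} t) \<partial>lborel)"
  proof (rule nn_integral_cong)
    fix t :: real
    show "(\<integral>\<^sup>+\<omega>. indicator {\<omega>. Q \<omega>} \<omega> * g (X (s + t) \<omega>) \<partial>M) * (discount q (s + t) * indicator {s..} (s + t)) =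
      (\<integral>\<^sup>+\<omega>. indicator {\<omega>. Q \<omega>} \<omega> * (\<integral>\<^sup>+\<omega>'. g (X s \<omega> + X t \<omega>') \<partial>M) \<partial>M) * (discount q (s + t) * indicator {0..} t)"
    proof (cases "0 \<le> t")
      case True
      have i: "indicator {\<omega>. Q \<omega>} \<omega> = (indicator {\<omega>. G (\<lambda>l\<in>dyadics 1. X (l * s) \<omega>)} \<omega> :: ennreal)" if "\<omega> \<in> space M" for \<omega>
        using past[OF that] by (simp add: indicator_def)
      show ?thesis
        using nn_integral_markov_single[OF s True, of G g] by (simp add: i indicator_def[of "{s..}"] indicator_def[of "{0..}"] cong: nn_integral_cong)
    qed auto
  qed
  also have "\<dots> = (\<integral>\<^sup>+t. \<integral>\<^sup>+\<omega>. indicator {\<omega>. Q \<omega>} \<omega> * (\<integral>\<^sup>+\<omega>'. g (X s \<omega> + X t \<omega>') \<partial>M) * (discount q (s + t) * indicator {0..} t) \<partial>M \<partial>lborel)"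
    by (intro nn_integral_cong nn_integral_multc[symmetric]) measurable
  also have "\<dots> = (\<integral>\<^sup>+\<omega>. \<integral>\<^sup>+t. indicator {\<omega>. Q \<omega>} \<omega> * (\<integral>\<^sup>+\<omega>'. g (X s \<omega> + X t \<omega>') \<partial>M) * (discount q (s + t) * indicator {0..} t) \<partial>lborel \<partial>M)"
    by (rule L.Fubini'[symmetric]) measurable
  also have "\<dots> = (\<integral>\<^sup>+\<omega>. indicator {\<omega>. Q \<omega>} \<omega> * (discount q s * (\<integral>\<^sup>+y. g (X s \<omega> + y) \<partial>resolvent q)) \<partial>M)"
  proof (rule nn_integral_cong)
    fix \<omega> assume [measurable]: "\<omega> \<in> space M"
    have "(\<integral>\<^sup>+t. indicator {\<omega>. Q \<omega>} \<omega> * (\<integral>\<^sup>+\<omega>'. g (X s \<omega> + X t \<omega>') \<partial>M) * (discount q (s + t) * indicator {0..} t) \<partial>lborel) =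
      (\<integral>\<^sup>+t. (indicator {\<omega>. Q \<omega>} \<omega> * discount q s) * ((discount q t * (\<integral>\<^sup>+\<omega>'. g (X s \<omega> + X t \<omega>') \<partial>M)) * indicator {0..} t) \<partial>lborel)"
    proof -
      have ex: "discount q (s + t) = discount q s * discount q t" for t
        by (simp add: ennreal_mult[symmetric] exp_add[symmetric] algebra_simps)
      show ?thesis unfolding ex by (simp only: mult.assoc mult.commute mult.left_commute)
    qed
    also have "\<dots> = (indicator {\<omega>. Q \<omega>} \<omega> * discount q s) * laplace q (\<lambda>t. (\<integral>\<^sup>+\<omega>'. g (X s \<omega> + X t \<omega>') \<partial>M))"
      by (rule nn_integral_cmult) measurable
    also have "laplace q (\<lambda>t. (\<integral>\<^sup>+\<omega>'. g (X s \<omega> + X t \<omega>') \<partial>M)) = (\<integral>\<^sup>+y. g (X s \<omega> + y) \<partial>resolvent q)"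
      by (rule nn_integral_resolvent[symmetric]) measurable
    finally show "(\<integral>\<^sup>+t. indicator {\<omega>. Q \<omega>} \<omega> * (\<integral>\<^sup>+\<omega>'. g (X s \<omega> + X t \<omega>') \<partial>M) * (discount q (s + t) * indicator {0..} t) \<partial>lborel) =
      indicator {\<omega>. Q \<omega>} \<omega> * (discount q s * (\<integral>\<^sup>+y. g (X s \<omega> + y) \<partial>resolvent q))"
      by (simp add: mult.assoc)
  qed
  finally show ?thesis .
qed

text \<open>T is approximated from the right by grid times. On the event that T lies in a given
  cell, the property at the fixed right end of that cell applies. As the mesh tends to 0, right
  continuity makes X at the grid time converge to X_T = b, and g is taken continuous so that the
  restarted potential converges as well.\<close>

lemma strong_markov_continuous:
  assumes q: "0 < q" and b: "0 < b"
    and g: "continuous_on UNIV g" "\<And>y. 0 \<le> g y" "\<And>y. g y \<le> (1::real)"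
  shows "(\<integral>\<^sup>+\<omega>. laplace q (\<lambda>t. indicator {t. exceeds b t \<omega>} t * ennreal (g (X t \<omega>))) \<partial>M) =
    passage_transform q b * (\<integral>\<^sup>+y. ennreal (g (b + y)) \<partial>resolvent q)"
proof -
  have gm [measurable]: "g \<in> borel_measurable borel" using g(1) by (rule borel_measurable_continuous_onI)
  define over where "over t \<omega> \<longleftrightarrow> exceeds b t \<omega>" for t \<omega>
  define tk where "tk n k = real k / real (Suc n)" for n k :: nat
  \<comment> \<open>The first passage lies in the cell from \<open>tk n k\<close> (included) to
    \<open>tk n (Suc k)\<close> (excluded).\<close>
  define A where "A n k \<omega> \<longleftrightarrow> \<not> over (tk n k) \<omega> \<and> over (tk n (Suc k)) \<omega>" for n k \<omega>
  define Rg where "Rg z = (\<integral>\<^sup>+y. ennreal (g (z + y)) \<partial>resolvent q)" for z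
  define L where "L n \<omega> = (\<Sum>k. indicator {\<omega>. A n k \<omega>} \<omega> * (\<integral>\<^sup>+t\<in>{tk n (Suc k)..}. discount q t * ennreal (g (X t \<omega>)) \<partial>lborel))" for n \<omega>
  define R where "R n \<omega> = (\<Sum>k. indicator {\<omega>. A n k \<omega>} \<omega> * (ennreal (exp (- q * tk n (Suc k))) * Rg (X (tk n (Suc k)) \<omega>)))" for n \<omega>
  define L0 where "L0 \<omega> = laplace q (\<lambda>t. indicator {t. over t \<omega>} t * ennreal (g (X t \<omega>)))" for \<omega>
  have [measurable]: "Measurable.pred M (A n k)" for n k unfolding A_def over_def by measurable
  have [measurable]: "Rg \<in> borel_measurable borel"
    unfolding Rg_def using finite_measure_resolvent[OF q]
    by (intro sigma_finite_measure.borel_measurable_nn_integral finite_measure.sigma_finite_measure) auto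
  have Lm [measurable]: "L n \<in> borel_measurable M" and Rm [measurable]: "R n \<in> borel_measurable M" for n
    unfolding L_def R_def by measurable
  have LR: "(\<integral>\<^sup>+\<omega>. L n \<omega> \<partial>M) = (\<integral>\<^sup>+\<omega>. R n \<omega> \<partial>M)" for n
  proof -
    have "(\<integral>\<^sup>+\<omega>. L n \<omega> \<partial>M) = (\<Sum>k. \<integral>\<^sup>+\<omega>. indicator {\<omega>. A n k \<omega>} \<omega> * (\<integral>\<^sup>+t\<in>{tk n (Suc k)..}. discount q t * ennreal (g (X t \<omega>)) \<partial>lborel) \<partial>M)"
      unfolding L_def by (rule nn_integral_suminf) measurable
    also have "\<dots> = (\<Sum>k. \<integral>\<^sup>+\<omega>. indicator {\<omega>. A n k \<omega>} \<omega> * (ennreal (exp (- q * tk n (Suc k))) * Rg (X (tk n (Suc k)) \<omega>)) \<partial>M)"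
    proof (rule suminf_cong)
      fix k
      let ?s = "tk n (Suc k)"
      have s: "0 < ?s" by (simp add: tk_def)
      \<comment> \<open>Both conditions in \<open>A n k\<close> are read off the skeleton of the
        longer interval, as both times are at most \<open>?s\<close>.\<close>
      define Gl where "Gl t u \<longleftrightarrow> (\<exists>l\<in>dyadics 1. l * ?s < t \<and> b < u l)" for t and u :: "real \<Rightarrow> real"
      have [measurable]: "Measurable.pred (PiM (dyadics 1) (\<lambda>_. borel)) (Gl t)" for t
        unfolding Gl_def by measurable
      have ov: "over t \<omega> \<longleftrightarrow> Gl t (\<lambda>l\<in>dyadics 1. X (l * ?s) \<omega>)" if "\<omega> \<in> space M" "t \<le> ?s" for t \<omega>
        using lsc_path.exceeds_iff[OF lsc_path_X[OF that(1)] s that(2), of b] unfolding over_def Gl_def by simp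
      show "(\<integral>\<^sup>+\<omega>. indicator {\<omega>. A n k \<omega>} \<omega> * (\<integral>\<^sup>+t\<in>{?s..}. discount q t * ennreal (g (X t \<omega>)) \<partial>lborel) \<partial>M) =
        (\<integral>\<^sup>+\<omega>. indicator {\<omega>. A n k \<omega>} \<omega> * (ennreal (exp (- q * ?s)) * Rg (X ?s \<omega>)) \<partial>M)"
        unfolding Rg_def
      proof (rule strong_markov_discrete[OF q])
        show "0 \<le> ?s" using s by simp
        show "Measurable.pred (PiM (dyadics 1) (\<lambda>_. borel)) (\<lambda>u. \<not> Gl (tk n k) u \<and> Gl ?s u)" by measurable
        show "A n k \<omega> \<longleftrightarrow> \<not> Gl (tk n k) (\<lambda>l\<in>dyadics 1. X (l * ?s) \<omega>) \<and> Gl ?s (\<lambda>l\<in>dyadics 1. X (l * ?s) \<omega>)"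
          if "\<omega> \<in> space M" for \<omega>
          unfolding A_def using ov[OF that, of "tk n k"] ov[OF that, of ?s] by (simp add: tk_def divide_right_mono)
      qed measurable
    qed
    also have "\<dots> = (\<integral>\<^sup>+\<omega>. R n \<omega> \<partial>M)"
      unfolding R_def by (rule nn_integral_suminf[symmetric]) measurable
    finally show ?thesis .
  qed
  have Rg_le: "Rg z \<le> ennreal (1 / q)" for z
  proof -
    have "Rg z \<le> (\<integral>\<^sup>+y. 1 \<partial>resolvent q)" unfolding Rg_def by (intro nn_integral_mono) (simp add: g)
    then show ?thesis by (simp add: emeasure_resolvent_UNIV[OF q])
  qed
  have single: "(\<Sum>k. indicator {\<omega>. A n k \<omega>} \<omega> * f k) = (f K :: ennreal)" if "\<And>k. A n k \<omega> \<longleftrightarrow> k = K" for n \<omega> f K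
  proof -
    have "(\<lambda>k. indicator {\<omega>. A n k \<omega>} \<omega> * f k) = (\<lambda>k. if k = K then f k else 0)"
      using that by (auto simp: indicator_def)
    then show ?thesis using sums_unique[OF sums_single[of K f]] by simp
  qed
  have lims: "(\<lambda>n. L n \<omega>) \<longlonglongrightarrow> L0 \<omega>" "(\<lambda>n. R n \<omega>) \<longlonglongrightarrow> passage_discount q b \<omega> * Rg b"
    "L n \<omega> \<le> ennreal (1 / q)" "R n \<omega> \<le> ennreal (1 / q)" if \<omega>: "\<omega> \<in> space M" for \<omega> n
  proof -
    interpret lsc_path "\<lambda>t. X t \<omega>" by (rule lsc_path_X[OF \<omega>])
    note [measurable] = \<omega>
    have "(\<lambda>n. L n \<omega>) \<longlonglongrightarrow> L0 \<omega> \<and> (\<lambda>n. R n \<omega>) \<longlonglongrightarrow> passage_discount q b \<omega> * Rg b \<and>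
      (\<forall>n. L n \<omega> \<le> ennreal (1 / q) \<and> R n \<omega> \<le> ennreal (1 / q))"
    proof (cases "\<exists>r\<ge>0. b < X r \<omega>")
      case False
      then have "\<not> over t \<omega>" for t by (auto simp: over_def)
      then show ?thesis
        by (simp add: L_def R_def L0_def A_def passage_discount_def over_def[symmetric])
    next
      case True
      obtain T where T: "0 < T" "X T \<omega> = b" "\<And>s. over s \<omega> \<longleftrightarrow> T < s"
        unfolding over_def using passage_time[OF _ b True] zero by (metis order_refl)
      \<comment> \<open>The one cell that contains T; the sums over k reduce to this term.\<close>
      define K where "K n = nat \<lfloor>T * real (Suc n)\<rfloor>" for n
      define Tn where "Tn n = tk n (Suc (K n))" for n
      have AK: "A n k \<omega> \<longleftrightarrow> k = K n" for n k
      proof -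
        have "A n k \<omega> \<longleftrightarrow> tk n k \<le> T \<and> T < tk n (Suc k)" by (auto simp: A_def T(3))
        also have "\<dots> \<longleftrightarrow> real k \<le> T * real (Suc n) \<and> T * real (Suc n) < real k + 1"
          by (simp add: tk_def divide_le_eq less_divide_eq add.commute del: of_nat_Suc) (simp add: add.commute)
        also have "\<dots> \<longleftrightarrow> k = K n"
          unfolding K_def using T(1) by (auto simp: floor_eq_iff nat_eq_iff2 of_nat_eq_iff le_floor_iff)
        finally show ?thesis .
      qed
      have LT: "L n \<omega> = (\<integral>\<^sup>+t\<in>{Tn n..}. discount q t * ennreal (g (X t \<omega>)) \<partial>lborel)" for n
        unfolding L_def Tn_def by (rule single[OF AK])
      have RT: "R n \<omega> = discount q (Tn n) * Rg (X (Tn n) \<omega>)" for n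
        unfolding R_def Tn_def by (rule single[OF AK])
      have Tn: "T < Tn n" "Tn n \<le> T + 1 / real (Suc n)" for n
        using AK[of n "K n"] unfolding A_def T(3) Tn_def by (auto simp: tk_def add_divide_distrib)
      have Tn_lim: "Tn \<longlonglongrightarrow> T"
      proof (rule tendsto_sandwich[of "\<lambda>_. T" _ _ "\<lambda>n. T + 1 / real (Suc n)"])
        show "(\<lambda>n. T + 1 / real (Suc n)) \<longlonglongrightarrow> T"
          using tendsto_add[OF tendsto_const LIMSEQ_inverse_real_of_nat, of T]
          by (simp add: inverse_eq_divide)
      qed (use Tn in \<open>auto intro!: always_eventually less_imp_le\<close>)
      then have "filterlim Tn (at_right T) sequentially"
        using Tn(1) by (auto simp: filterlim_at intro!: always_eventually)
      then have XT: "(\<lambda>n. X (Tn n) \<omega>) \<longlonglongrightarrow> b" using filterlim_compose[OF rcD] T(2) by blast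
      have e: "discount q t * ennreal (g y) \<le> discount q t" for t y
        using g(2,3)[of y] by (simp add: ennreal_mult[symmetric] mult_left_le)
      have ind: "indicator {t. over t \<omega>} t = (indicator {T<..} t :: ennreal)" for t by (simp add: T(3) indicator_def)
      have L0T: "L0 \<omega> = (\<integral>\<^sup>+t\<in>{T<..}. discount q t * ennreal (g (X t \<omega>)) \<partial>lborel)"
        unfolding L0_def ind using T(1) by (intro nn_integral_cong) (auto simp: indicator_def)
      have L1: "(\<lambda>n. L n \<omega>) \<longlonglongrightarrow> L0 \<omega>"
        unfolding LT L0T
      proof (rule nn_integral_dominated_convergence[where w = "\<lambda>t. discount q t * indicator {0..} t"])
        show "AE t in lborel. discount q t * ennreal (g (X t \<omega>)) * indicator {Tn j..} t \<le> discount q t * indicator {0..} t" for j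
          using e Tn(1)[of j] T(1) by (intro AE_I2) (auto simp: indicator_def)
        show "(\<integral>\<^sup>+t\<in>{0..}. discount q t \<partial>lborel) < \<infinity>"
          unfolding nn_integral_exp_tail(1)[OF q] by simp
        show "AE t in lborel. (\<lambda>n. discount q t * ennreal (g (X t \<omega>)) * indicator {Tn n..} t)
          \<longlonglongrightarrow> discount q t * ennreal (g (X t \<omega>)) * indicator {T<..} t"
        proof (rule AE_I2)
          fix t
          have "eventually (\<lambda>n. indicator {Tn n..} t = (indicator {T<..} t :: ennreal)) sequentially"
          proof (cases "T < t")
            case True
            then have "eventually (\<lambda>n. Tn n < t) sequentially" using Tn_lim by (auto intro: order_tendstoD)
            then show ?thesis by eventually_elim (use True in auto)
          next
            case False
            then have "t < Tn n" for n using Tn(1)[of n] by linarith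
            then show ?thesis using False by (intro always_eventually) (auto simp: indicator_def not_le)
          qed
          then show "(\<lambda>n. discount q t * ennreal (g (X t \<omega>)) * indicator {Tn n..} t)
            \<longlonglongrightarrow> discount q t * ennreal (g (X t \<omega>)) * indicator {T<..} t"
            by (intro tendsto_eventually) (auto elim: eventually_mono)
        qed
      qed measurable
      have pd: "passage_discount q b \<omega> = discount q T"
      proof -
        have "laplace q (\<lambda>t. indicator {T<..} t) = (\<integral>\<^sup>+t\<in>{T<..}. discount q t \<partial>lborel)"
          using T(1) by (intro nn_integral_cong) (auto simp: indicator_def)
        then have "passage_discount q b \<omega> = ennreal q * (\<integral>\<^sup>+t\<in>{T<..}. discount q t \<partial>lborel)"
          unfolding passage_discount_def over_def[symmetric] ind by (simp only:)
        then show ?thesis unfolding nn_integral_exp_tail(2)[OF q] using q by (simp add: ennreal_mult[symmetric])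
      qed
      have R1: "(\<lambda>n. R n \<omega>) \<longlonglongrightarrow> passage_discount q b \<omega> * Rg b"
        unfolding RT pd
      proof (rule tendsto_mult_ennreal)
        show "(\<lambda>n. discount q (Tn n)) \<longlonglongrightarrow> discount q T"
          by (intro tendsto_ennrealI tendsto_intros Tn_lim)
        show "(\<lambda>n. Rg (X (Tn n) \<omega>)) \<longlonglongrightarrow> Rg b"
          unfolding Rg_def by (rule resolvent_shift_continuous[OF q g XT])
      qed (use Rg_le[of b] in \<open>auto simp: top_unique\<close>)
      have B1: "L n \<omega> \<le> ennreal (1 / q)" for n
      proof -
        have "L n \<omega> \<le> (\<integral>\<^sup>+t\<in>{0..}. discount q t \<partial>lborel)"
          unfolding LT using e Tn(1)[of n] T(1) by (intro nn_integral_mono) (auto simp: indicator_def)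
        then show ?thesis unfolding nn_integral_exp_tail(1)[OF q] by simp
      qed
      have B2: "R n \<omega> \<le> ennreal (1 / q)" for n
      proof -
        have "discount q (Tn n) * Rg (X (Tn n) \<omega>) \<le> 1 * ennreal (1 / q)"
          using q T(1) Tn(1)[of n] by (intro mult_mono Rg_le) auto
        then show ?thesis unfolding RT by simp
      qed
      show ?thesis using L1 R1 B1 B2 by blast
    qed
    then show "(\<lambda>n. L n \<omega>) \<longlonglongrightarrow> L0 \<omega>" "(\<lambda>n. R n \<omega>) \<longlonglongrightarrow> passage_discount q b \<omega> * Rg b"
      "L n \<omega> \<le> ennreal (1 / q)" "R n \<omega> \<le> ennreal (1 / q)" by blast+
  qed
  have [measurable]: "L0 \<in> borel_measurable M"
  proof -
    have "(\<lambda>p. indicator {t. over t (fst p)} (snd p) :: ennreal) = (\<lambda>p. indicator {p. over (snd p) (fst p)} p)"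
      by (auto simp: indicator_def)
    also have "\<dots> \<in> borel_measurable (M \<Otimes>\<^sub>M lborel)"
      unfolding over_def by (rule borel_measurable_indicator') measurable
    finally have [measurable]: "(\<lambda>p. indicator {t. over t (fst p)} (snd p) :: ennreal) \<in> borel_measurable (M \<Otimes>\<^sub>M lborel)" .
    show ?thesis unfolding L0_def
      by (rule lborel.borel_measurable_nn_integral) (simp add: case_prod_beta')
  qed
  have "(\<lambda>n. \<integral>\<^sup>+\<omega>. L n \<omega> \<partial>M) \<longlonglongrightarrow> (\<integral>\<^sup>+\<omega>. L0 \<omega> \<partial>M)"
    by (rule nn_integral_dominated_convergence[where w = "\<lambda>_. ennreal (1 / q)"])
      (use lims in \<open>auto simp: emeasure_space_1\<close>)
  moreover have "(\<lambda>n. \<integral>\<^sup>+\<omega>. R n \<omega> \<partial>M) \<longlonglongrightarrow> (\<integral>\<^sup>+\<omega>. passage_discount q b \<omega> * Rg b \<partial>M)"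
    by (rule nn_integral_dominated_convergence[where w = "\<lambda>_. ennreal (1 / q)"])
      (use lims in \<open>auto simp: emeasure_space_1\<close>)
  ultimately have "(\<integral>\<^sup>+\<omega>. L0 \<omega> \<partial>M) = (\<integral>\<^sup>+\<omega>. passage_discount q b \<omega> * Rg b \<partial>M)"
    unfolding LR by (rule LIMSEQ_unique)
  also have "\<dots> = passage_transform q b * Rg b"
    by (simp add: nn_integral_multc nn_integral_passage_discount)
  finally show ?thesis unfolding L0_def over_def Rg_def .
qed

end
lemma AE_lborel_ex_between:
  assumes "AE t in lborel. P t" "a < (b::real)"
  shows "\<exists>t. a < t \<and> t < b \<and> P t"
proof (rule ccontr)
  assume n: "\<not> ?thesis"
  obtain N where N: "{t\<in>space lborel. \<not> P t} \<subseteq> N" "emeasure lborel N = 0" "N \<in> sets lborel"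
    using assms(1) by (rule AE_E)
  have "emeasure lborel {a<..<b} \<le> emeasure lborel N"
    using n N(1,3) by (intro emeasure_mono) auto
  then show False using N(2) assms(2) by simp
qed

lemma nn_integral_exp_nonpos_rate:
  assumes "(r::real) \<le> 0"
  shows "(\<integral>\<^sup>+t\<in>{0<..}. discount r t \<partial>lborel) = \<infinity>"
proof -
  have "(\<integral>\<^sup>+t. indicator {0<..} t \<partial>(lborel :: real measure)) \<le> (\<integral>\<^sup>+t\<in>{0<..}. discount r t \<partial>lborel)"
    using assms by (intro nn_integral_mono) (auto simp: indicator_def mult_nonpos_nonneg)
  moreover have "emeasure lborel {0::real<..} = \<infinity>"
  proof (rule ccontr)
    assume "emeasure lborel {0::real<..} \<noteq> \<infinity>"
    then obtain r where r: "emeasure lborel {0::real<..} = ennreal r" "0 \<le> r"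
      by (cases "emeasure lborel {0::real<..}") auto
    obtain n :: nat where n: "r < real n" using reals_Archimedean2 by blast
    have "ennreal (real n) = emeasure lborel {0<..<real n}" by simp
    also have "\<dots> \<le> emeasure lborel {0::real<..}" by (intro emeasure_mono) auto
    finally show False using n r by (simp add: ennreal_le_iff)
  qed
  ultimately show ?thesis by (simp add: top_unique)
qed

text \<open>Rates that converge to a positive limit stay above some c > 0, so exp (- c t)
  dominates.\<close>

lemma laplace_continuous:
  assumes q: "q \<longlonglongrightarrow> (p::real)" "0 < p" "\<And>n. 0 < q n"
    and [measurable]: "F \<in> borel_measurable borel" and F: "\<And>t. F t \<le> 1"
  shows "(\<lambda>n. \<integral>\<^sup>+t\<in>{0..}. ennreal (exp (- q n * t)) * F t \<partial>lborel) \<longlonglongrightarrow> laplace p F"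
proof -
  obtain c where c: "0 < c" "\<And>n. c \<le> q n"
  proof -
    have "eventually (\<lambda>n. p / 2 < q n) sequentially" using order_tendstoD(1)[OF q(1), of "p / 2"] q(2) by simp
    then obtain N where N: "\<And>n. n \<ge> N \<Longrightarrow> p / 2 < q n" by (auto simp: eventually_sequentially)
    show thesis
    proof
      show "0 < Min (insert (p / 2) (q ` {..<N}))" using q by (subst Min_gr_iff) auto
      show "Min (insert (p / 2) (q ` {..<N})) \<le> q n" for n
        using N[of n] by (cases "n < N") (auto intro!: Min_le_iff[THEN iffD2] simp: not_less less_imp_le)
    qed
  qed
  show ?thesis
  proof (rule nn_integral_dominated_convergence[where w = "\<lambda>t. discount c t * indicator {0..} t"])
    show "AE t in lborel. ennreal (exp (- q n * t)) * F t * indicator {0..} t \<le> discount c t * indicator {0..} t" for n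
    proof (rule AE_I2)
      fix t :: real
      show "ennreal (exp (- q n * t)) * F t * indicator {0..} t \<le> discount c t * indicator {0..} t"
      proof (cases "0 \<le> t")
        case True
        then have "ennreal (exp (- q n * t)) * F t \<le> discount c t * 1"
          using c F by (intro mult_mono) (auto intro!: mult_right_mono)
        then show ?thesis using True by simp
      qed simp
    qed
    show "(\<integral>\<^sup>+t\<in>{0..}. discount c t \<partial>lborel) < \<infinity>"
      unfolding nn_integral_exp_tail(1)[OF c(1)] by simp
    show "AE t in lborel. (\<lambda>n. ennreal (exp (- q n * t)) * F t * indicator {0..} t) \<longlonglongrightarrow> discount p t * F t * indicator {0..} t"
    proof (rule AE_I2)
      fix t :: real
      have "(\<lambda>n. ennreal (exp (- q n * t))) \<longlonglongrightarrow> discount p t"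
        by (intro tendsto_ennrealI tendsto_intros q)
      then have "(\<lambda>n. ennreal (exp (- q n * t)) * (F t * indicator {0..} t)) \<longlonglongrightarrow> discount p t * (F t * indicator {0..} t)"
        by (intro tendsto_mult_ennreal tendsto_const) (use F[of t] in \<open>auto simp: top_unique indicator_def\<close>)
      then show "(\<lambda>n. ennreal (exp (- q n * t)) * F t * indicator {0..} t) \<longlonglongrightarrow> discount p t * F t * indicator {0..} t"
        by (simp add: mult.assoc)
    qed
  qed measurable
qed

context normalized_snlp
begin

lemma indicator_exceeds_measurable [measurable]:
  "(\<lambda>p. indicator {t. exceeds b t (fst p)} (snd p) :: ennreal) \<in> borel_measurable (M \<Otimes>\<^sub>M borel)"
proof -
  have "(\<lambda>p. indicator {t. exceeds b t (fst p)} (snd p) :: ennreal) =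
    (\<lambda>p. indicator {p. exceeds b (snd p) (fst p)} p)" by (auto simp: indicator_def)
  also have "\<dots> \<in> borel_measurable (M \<Otimes>\<^sub>M borel)"
    by (rule borel_measurable_indicator') measurable
  finally show ?thesis .
qed

lemma passage_transform_le_1:
  assumes q: "0 < q" shows "passage_transform q b \<le> 1"
proof -
  have "laplace q (\<lambda>t. emeasure M {\<omega>\<in>space M. exceeds b t \<omega>}) \<le>
    (\<integral>\<^sup>+t\<in>{0..}. discount q t \<partial>lborel)"
    using emeasure_le_1 by (intro nn_integral_mono mult_right_mono) (auto intro: mult_left_le)
  also have "\<dots> = ennreal (1 / q)" using nn_integral_exp_tail(1)[OF q, of 0] by simp
  finally have "passage_transform q b \<le> ennreal q * ennreal (1 / q)"
    unfolding passage_transform_def by (intro mult_left_mono) auto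
  also have "\<dots> = 1" using q by (simp add: ennreal_mult[symmetric])
  finally show ?thesis .
qed

text \<open>Both sides are integrals of g against finite measures: S describes the positions after
  the first passage, T the resolvent shifted by b and weighted. They agree on continuous functions,
  hence on Borel functions.\<close>

lemma strong_markov:
  assumes q: "0 < q" and b: "0 < b" and [measurable]: "g \<in> borel_measurable borel"
  shows "(\<integral>\<^sup>+\<omega>. laplace q (\<lambda>t. indicator {t. exceeds b t \<omega>} t * g (X t \<omega>)) \<partial>M) =
    passage_transform q b * (\<integral>\<^sup>+y. g (b + y) \<partial>resolvent q)"
proof -
  define S where "S = distr (density (M \<Otimes>\<^sub>M lborel) (\<lambda>p. discount q (snd p) * indicator {0..} (snd p) *
    indicator {t. exceeds b t (fst p)} (snd p))) borel (\<lambda>p. X (snd p) (fst p))"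
  define T where "T = scale_measure (passage_transform q b) (distr (resolvent q) borel (\<lambda>y. b + y))"
  have nnS: "(\<integral>\<^sup>+y. f y \<partial>S) = (\<integral>\<^sup>+\<omega>. laplace q (\<lambda>t. indicator {t. exceeds b t \<omega>} t * f (X t \<omega>)) \<partial>M)"
    if [measurable]: "f \<in> borel_measurable borel" for f
  proof -
    have "(\<integral>\<^sup>+y. f y \<partial>S) = (\<integral>\<^sup>+p. discount q (snd p) * indicator {0..} (snd p) *
      indicator {t. exceeds b t (fst p)} (snd p) * f (X (snd p) (fst p)) \<partial>(M \<Otimes>\<^sub>M lborel))"
      unfolding S_def by (simp add: nn_integral_distr nn_integral_density)
    also have "\<dots> = (\<integral>\<^sup>+\<omega>. \<integral>\<^sup>+t. discount q t * indicator {0..} t * indicator {t. exceeds b t \<omega>} t * f (X t \<omega>) \<partial>lborel \<partial>M)"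
      by (subst lborel.nn_integral_fst[symmetric]) auto
    finally show ?thesis by (simp add: ac_simps)
  qed
  have nnT: "(\<integral>\<^sup>+y. f y \<partial>T) = passage_transform q b * (\<integral>\<^sup>+y. f (b + y) \<partial>resolvent q)"
    if [measurable]: "f \<in> borel_measurable borel" for f
    unfolding T_def by (simp add: nn_integral_scale_measure nn_integral_distr)
  have fT: "finite_measure T"
  proof (rule finite_measureI)
    have "emeasure T (space T) = passage_transform q b * emeasure (resolvent q) UNIV"
      using nnT[of "\<lambda>_. 1"] by simp
    then show "emeasure T (space T) \<noteq> \<infinity>"
      using passage_transform_le_1[OF q, of b]
      by (auto simp: emeasure_resolvent_UNIV[OF q] ennreal_mult_eq_top_iff top_unique)
  qed
  have eq: "(\<integral>\<^sup>+y. ennreal (f y) \<partial>S) = (\<integral>\<^sup>+y. ennreal (f y) \<partial>T)"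
    if f: "continuous_on UNIV f" "\<And>y. 0 \<le> f y" "\<And>y. f y \<le> 1" for f
  proof -
    have [measurable]: "f \<in> borel_measurable borel" using f(1) by (rule borel_measurable_continuous_onI)
    show ?thesis using strong_markov_continuous[OF q b f] by (simp add: nnS nnT)
  qed
  have "finite_measure S"
  proof (rule finite_measureI)
    have "emeasure S (space S) = emeasure T (space T)"
      using eq[of "\<lambda>_. 1"] by simp
    then show "emeasure S (space S) \<noteq> \<infinity>" using finite_measure.emeasure_finite[OF fT] by simp
  qed
  then have "S = T"
    using fT eq by (intro measure_eqI_continuous) (auto simp: S_def T_def)
  then show ?thesis using nnS[of g] nnT[of g] by simp
qed

subsection \<open>The resolvent on the positive half-line\<close>

text \<open>If the resolvent did not charge the positive half-line, X_t \<le> 0 would hold almost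
  surely for almost every t, by right continuity for every t, and by stationarity for the increments
  between rational times; almost every path would be nonincreasing, which is excluded.\<close>

lemma resolvent_pos: "0 < q \<Longrightarrow> 0 < measure (resolvent q) {0<..}"
proof (rule ccontr)
  assume q: "0 < q" and "\<not> 0 < measure (resolvent q) {0<..}"
  then have "measure (resolvent q) {0<..} = 0" using measure_nonneg[of "resolvent q" "{0<..}"] by linarith
  then have "emeasure (resolvent q) {0<..} = 0"
    using finite_measure.emeasure_eq_measure[OF finite_measure_resolvent[OF q]] by simp
  then have "AE t in lborel. discount q t * emeasure M {\<omega>\<in>space M. X t \<omega> \<in> {0<..}} * indicator {0..} t = 0"
    unfolding emeasure_resolvent[of "{0<..}" q, simplified] by (subst (asm) nn_integral_0_iff_AE) (auto simp: ac_simps)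
  then have AE: "AE t in lborel. 0 \<le> t \<longrightarrow> emeasure M {\<omega>\<in>space M. 0 < X t \<omega>} = 0"
    by eventually_elim (auto simp: indicator_def split: if_splits)
  have all: "AE \<omega> in M. X t \<omega> \<le> 0" if t: "0 \<le> t" for t
  proof -
    have "\<forall>n::nat. \<exists>s. t < s \<and> s < t + 1 / Suc n \<and> (0 \<le> s \<longrightarrow> emeasure M {\<omega>\<in>space M. 0 < X s \<omega>} = 0)"
      using AE_lborel_ex_between[OF AE] by simp
    then obtain s where s: "\<And>n. t < s n" "\<And>n. s n < t + 1 / Suc n" "\<And>n. emeasure M {\<omega>\<in>space M. 0 < X (s n) \<omega>} = 0"
      using t by (metis less_le_trans less_imp_le order_trans)
    have sl: "filterlim s (at_right t) sequentially"
    proof -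
      have "s \<longlonglongrightarrow> t"
      proof (rule tendsto_sandwich[of "\<lambda>_. t" _ _ "\<lambda>n. t + 1 / Suc n"])
        show "(\<lambda>n. t + 1 / real (Suc n)) \<longlonglongrightarrow> t"
          using tendsto_add[OF tendsto_const LIMSEQ_inverse_real_of_nat, of t] by (simp add: inverse_eq_divide)
      qed (use s in \<open>auto intro!: always_eventually less_imp_le\<close>)
      then show ?thesis using s(1) by (auto simp: filterlim_at intro!: always_eventually)
    qed
    have "AE \<omega> in M. \<forall>n. X (s n) \<omega> \<le> 0"
    proof (subst AE_all_countable, intro allI)
      fix n
      show "AE \<omega> in M. X (s n) \<omega> \<le> 0" using s(3)[of n] by (subst AE_iff_measurable[OF _ refl]) (auto simp: not_le)
    qed
    then show ?thesis using AE_space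
    proof eventually_elim
      case (elim \<omega>)
      interpret lsc_path "\<lambda>t. X t \<omega>" by (rule lsc_path_X) fact
      have "(\<lambda>n. X (s n) \<omega>) \<longlonglongrightarrow> X t \<omega>" using filterlim_compose[OF rcD sl] .
      then show ?case using elim(1) by (intro LIMSEQ_le_const2) auto
    qed
  qed
  have "AE \<omega> in M. X (of_rat t) \<omega> - X (of_rat s) \<omega> \<le> 0" if "0 \<le> s" "s \<le> t" for s t :: rat
  proof -
    have st: "0 \<le> real_of_rat s" "real_of_rat s \<le> real_of_rat t" using that by (auto simp: of_rat_less_eq)
    have "prob {\<omega>\<in>space M. X (of_rat t - of_rat s) \<omega> \<in> {..0}} = 1"
      using all[of "of_rat t - of_rat s"] st by (subst prob_Collect_eq_1) auto
    then have "prob {\<omega>\<in>space M. X (of_rat t) \<omega> - X (of_rat s) \<omega> \<in> {..0}} = 1"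
      by (subst prob_increment[OF st]) auto
    then show ?thesis by (subst (asm) prob_Collect_eq_1) auto
  qed
  then have "AE \<omega> in M. \<forall>t s. 0 \<le> s \<longrightarrow> s \<le> t \<longrightarrow> X (of_rat t) \<omega> - X (of_rat s) \<omega> \<le> 0"
    unfolding AE_all_countable by auto
  then have "AE \<omega> in M. monotone_on {0..} (\<le>) (\<ge>) (\<lambda>t. X t \<omega>)"
    using AE_space
  proof eventually_elim
    case (elim \<omega>)
    interpret lsc_path "\<lambda>t. X t \<omega>" by (rule lsc_path_X) fact
    have *: "X t \<omega> \<le> X s \<omega>" if st: "0 \<le> s" "s < t" for s t
    proof (rule ccontr)
      assume n: "\<not> X t \<omega> \<le> X s \<omega>"
      define m where "m = (X t \<omega> + X s \<omega>) / 2"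
      have m: "X s \<omega> < m" "m < X t \<omega>" using n by (auto simp: m_def)
      have "eventually (\<lambda>r. X r \<omega> < m) (at_right s)" "eventually (\<lambda>r. m < X r \<omega>) (at_right t)"
        using rcD[of s] rcD[of t] m by (auto intro: order_tendstoD)
      then obtain c d where cd: "c > s" "\<And>r. s < r \<Longrightarrow> r < c \<Longrightarrow> X r \<omega> < m" "d > t" "\<And>r. t < r \<Longrightarrow> r < d \<Longrightarrow> m < X r \<omega>"
        unfolding eventually_at_right[OF less_add_one] by blast
      obtain u where u: "s < real_of_rat u" "real_of_rat u < min c t" using of_rat_dense[of s "min c t"] cd st by auto
      obtain v where v: "t < real_of_rat v" "real_of_rat v < d" using of_rat_dense[of t d] cd by auto
      have "(0::real) \<le> of_rat u" "real_of_rat u \<le> of_rat v" using u v st by linarith+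
      then have "X (of_rat v) \<omega> - X (of_rat u) \<omega> \<le> 0" using elim(1) by (simp add: of_rat_less_eq)
      moreover have "X (of_rat u) \<omega> < m" "m < X (of_rat v) \<omega>" using u v by (auto intro: cd)
      ultimately show False by simp
    qed
    show ?case
      by (rule monotone_onI) (metis * atLeast_iff le_less order_refl)
  qed
  then show False using not_decreasing by blast
qed

text \<open>E exp (- q T) is exponential in the level, and this is its rate. It is identified with
  \<Phi>(q) in \<open>right_inverse_eq\<close>.\<close>

definition passage_rate :: "real \<Rightarrow> real" where
  "passage_rate q = - ln (enn2real (passage_transform q 1))"

text \<open>An exponential density of rate \<open>passage_rate q\<close> has this value at 0+ if its
  mass is that of the resolvent on (0,\<infinity>). It is identified with the derivative of \<Phi>
  at q in \<open>deriv_right_inverse\<close>.\<close>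

definition resolvent_const :: "real \<Rightarrow> real" where
  "resolvent_const q = passage_rate q * measure (resolvent q) {0<..}"

context
  fixes q :: real
  assumes q: "0 < q"
begin

interpretation R: finite_measure "resolvent q" by (rule finite_measure_resolvent[OF q])

text \<open>X_t > b + c forces, superlevel sets being open, a passage above b strictly before t; at
  this passage the process starts afresh from exactly b.\<close>

lemma resolvent_tail_shift:
  assumes b: "0 < b" and c: "0 \<le> c"
  shows "measure (resolvent q) {b + c<..} = enn2real (passage_transform q b) * measure (resolvent q) {c<..}"
proof -
  interpret L: pair_sigma_finite M lborel ..
  have "emeasure (resolvent q) {b + c<..} = laplace q (\<lambda>t. (\<integral>\<^sup>+\<omega>. indicator {b + c<..} (X t \<omega>) \<partial>M))"
    using nn_integral_resolvent[of "indicator {b + c<..}" q] by simp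
  also have "\<dots> = (\<integral>\<^sup>+t. \<integral>\<^sup>+\<omega>. discount q t * indicator {b + c<..} (X t \<omega>) * indicator {0..} t \<partial>M \<partial>lborel)"
    by (intro nn_integral_cong) (simp add: nn_integral_cmult[symmetric] nn_integral_multc[symmetric])
  also have "\<dots> = (\<integral>\<^sup>+\<omega>. \<integral>\<^sup>+t. discount q t * indicator {b + c<..} (X t \<omega>) * indicator {0..} t \<partial>lborel \<partial>M)"
    by (rule L.Fubini') measurable
  also have "\<dots> = (\<integral>\<^sup>+\<omega>. laplace q (\<lambda>t. indicator {t. exceeds b t \<omega>} t * indicator {b + c<..} (X t \<omega>)) \<partial>M)"
  proof (intro nn_integral_cong)
    fix \<omega> t assume \<omega>: "\<omega> \<in> space M"
    interpret lsc_path "\<lambda>t. X t \<omega>" by (rule lsc_path_X[OF \<omega>])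
    have "exceeds b t \<omega>" if t: "b + c < X t \<omega>"
    proof -
      have t0: "0 < t" using t b c zero[of t \<omega>] by (cases "t \<le> 0") auto
      have "t \<in> {t. b < X t \<omega>}" using t c by simp
      then obtain e where e: "e > 0" "\<And>r. dist r t < e \<Longrightarrow> b < X r \<omega>"
        using open_gt[of b] unfolding open_dist by blast
      have "max 0 (t - e / 2) \<in> {0..<t}" using t0 e(1) by auto
      moreover have "b < X (max 0 (t - e / 2)) \<omega>" using t0 e(1) by (intro e(2)) (auto simp: dist_real_def)
      ultimately show ?thesis by blast
    qed
    then show "discount q t * indicator {b + c<..} (X t \<omega>) * indicator {0..} t =
      discount q t * (indicator {t. exceeds b t \<omega>} t * indicator {b + c<..} (X t \<omega>)) * indicator {0..} t"
      by (auto simp: indicator_def)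
  qed
  also have "\<dots> = passage_transform q b * (\<integral>\<^sup>+y. indicator {b + c<..} (b + y) \<partial>resolvent q)"
    by (rule strong_markov[OF q b]) measurable
  also have "(\<integral>\<^sup>+y. indicator {b + c<..} (b + y) \<partial>resolvent q) = (\<integral>\<^sup>+y. indicator {c<..} y \<partial>resolvent q)"
    by (intro nn_integral_cong) (simp add: indicator_def)
  finally have "emeasure (resolvent q) {b + c<..} = passage_transform q b * emeasure (resolvent q) {c<..}" by simp
  then show ?thesis by (simp add: measure_def enn2real_mult)
qed

text \<open>The tail beyond a + b is computed in one step and in two; the positive mass of
  (0,\<infinity>) cancels.\<close>

lemma passage_transform_mult:
  assumes "0 < a" "0 < b"
  shows "enn2real (passage_transform q (a + b)) = enn2real (passage_transform q a) * enn2real (passage_transform q b)"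
proof -
  have "enn2real (passage_transform q (a + b)) * measure (resolvent q) {0<..} =
    enn2real (passage_transform q a) * (enn2real (passage_transform q b) * measure (resolvent q) {0<..})"
    using resolvent_tail_shift[of "a + b" 0] resolvent_tail_shift[of a b] resolvent_tail_shift[of b 0] assms
    by (simp only: add_0_right add_pos_pos less_imp_le order_refl)
  then show ?thesis using resolvent_pos[OF q] unfolding mult.assoc[symmetric] by (simp only: mult_cancel_right) simp
qed

text \<open>A zero at b would pass to b / 2^n by multiplicativity, so that all tails beyond b / 2^n,
  and with them the mass of (0,\<infinity>), would vanish.\<close>

lemma passage_transform_pos:
  assumes b: "0 < b"
  shows "0 < enn2real (passage_transform q b)"
proof (rule ccontr)
  assume "\<not> 0 < enn2real (passage_transform q b)"
  then have "enn2real (passage_transform q b) = 0" by (simp add: not_less order.antisym)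
  then have "enn2real (passage_transform q (b / 2 ^ n)) = 0" for n
  proof (induction n)
    case (Suc n)
    then show ?case using passage_transform_mult[of "b / 2 ^ Suc n" "b / 2 ^ Suc n"] b by simp
  qed simp
  then have 0: "measure (resolvent q) {b / 2 ^ n<..} = 0" for n
    using resolvent_tail_shift[of "b / 2 ^ n" 0] b by simp
  have "(\<lambda>n. measure (resolvent q) {b / 2 ^ n<..}) \<longlonglongrightarrow> measure (resolvent q) (\<Union>n. {b / 2 ^ n<..})"
  proof (rule R.finite_Lim_measure_incseq)
    show "incseq (\<lambda>n. {b / 2 ^ n<..})"
      using b by (intro incseq_SucI) (auto simp: field_simps intro: le_less_trans[rotated])
  qed auto
  also have "(\<Union>n. {b / 2 ^ n<..}) = {0<..}"
  proof safe
    fix x :: real assume x: "0 < x"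
    obtain n where "b / x < 2 ^ n" using real_arch_pow[of 2 "b / x"] by auto
    then show "x \<in> (\<Union>n. {b / 2 ^ n<..})" using x b by (auto simp: field_simps intro!: exI[of _ n])
  next
    fix n and x :: real assume "b / 2 ^ n < x"
    then show "0 < x" using b by (smt (verit) divide_pos_pos zero_less_power)
  qed
  finally show False using resolvent_pos[OF q] unfolding 0 by (simp add: LIMSEQ_const_iff)
qed

lemma passage_transform_eq:
  assumes b: "0 < b"
  shows "enn2real (passage_transform q b) = exp (- passage_rate q * b)"
proof -
  have "enn2real (passage_transform q b) = exp (b * ln (enn2real (passage_transform q 1)))"
  proof (rule multiplicative_antimono_exp[OF _ _ _ b])
    fix a b :: real assume ab: "0 < a" "a \<le> b"
    have "enn2real (passage_transform q b) \<le> enn2real (passage_transform q a)"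
    proof -
      have "measure (resolvent q) {b<..} \<le> measure (resolvent q) {a<..}" using ab by (intro R.finite_measure_mono) auto
      then show ?thesis
        using resolvent_tail_shift[of a 0] resolvent_tail_shift[of b 0] ab resolvent_pos[OF q] by simp
    qed
    then show "enn2real (passage_transform q b) \<le> enn2real (passage_transform q a)" .
  qed (auto simp: passage_transform_mult passage_transform_pos)
  then show ?thesis by (simp add: passage_rate_def)
qed

lemma measure_resolvent_tail:
  assumes c: "0 \<le> c"
  shows "measure (resolvent q) {c<..} = measure (resolvent q) {0<..} * exp (- passage_rate q * c)"
proof (cases "c = 0")
  case False
  then show ?thesis using c resolvent_tail_shift[of c 0] by (simp add: passage_transform_eq)
qed simp

text \<open>With a nonpositive rate the tails could not decrease to 0, as those of a finite measure
  do.\<close>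

lemma passage_rate_pos: "0 < passage_rate q"
proof (rule ccontr)
  assume n: "\<not> 0 < passage_rate q"
  have "(\<lambda>n. measure (resolvent q) {real n<..}) \<longlonglongrightarrow> measure (resolvent q) (\<Inter>n. {real n<..})"
    by (rule R.finite_Lim_measure_decseq) (auto simp: decseq_def)
  also have "(\<Inter>n. {real n<..}) = {}"
  proof -
    have "x \<notin> (\<Inter>n. {real n<..})" for x
      using reals_Archimedean2[of x] by (auto simp: not_less intro: less_imp_le)
    then show ?thesis by blast
  qed
  finally have "(\<lambda>n. measure (resolvent q) {real n<..}) \<longlonglongrightarrow> 0" by simp
  moreover have "measure (resolvent q) {0<..} \<le> measure (resolvent q) {real n<..}" for n
  proof -
    have "1 \<le> exp (- passage_rate q * real n)" using n by (simp add: mult_nonpos_nonneg)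
    from mult_left_mono[OF this measure_nonneg, of "resolvent q" "{0<..}"]
    show ?thesis by (subst measure_resolvent_tail) auto
  qed
  ultimately have "measure (resolvent q) {0<..} \<le> 0"
    by (intro LIMSEQ_le_const) auto
  then show False using resolvent_pos[OF q] by simp
qed

lemma resolvent_const_pos: "0 < resolvent_const q"
  unfolding resolvent_const_def using passage_rate_pos resolvent_pos[OF q] by simp

lemma emeasure_resolvent_tail:
  assumes c: "0 \<le> c"
  shows "emeasure (resolvent q) {c<..} = ennreal (resolvent_const q * exp (- passage_rate q * c) / passage_rate q)"
  using measure_resolvent_tail[OF c] passage_rate_pos
  by (simp add: R.emeasure_eq_measure resolvent_const_def)

lemma nn_integral_resolvent_pos:
  assumes [measurable]: "f \<in> borel_measurable borel"
  shows "(\<integral>\<^sup>+y\<in>{0<..}. f y \<partial>resolvent q) =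
    (\<integral>\<^sup>+y\<in>{0<..}. ennreal (resolvent_const q * exp (- passage_rate q * y)) * f y \<partial>lborel)"
  by (rule nn_integral_of_exp_tails)
    (use passage_rate_pos resolvent_const_pos emeasure_resolvent_tail in auto)

end

end
context normalized_snlp
begin

subsection \<open>The Laplace exponent and its inverse\<close>

text \<open>The first passage time T above 1 is positive by right continuity at 0, so E exp (- q T)
  tends to 0 as q grows and the rates are unbounded. This provides, for each \<beta>, a q at which
  the transform of the resolvent is finite.\<close>

lemma passage_rate_exceeds: "\<exists>q>0. B < passage_rate q"
proof -
  define F where "F t = emeasure M {\<omega>\<in>space M. exceeds 1 t \<omega>}" for t
  have [measurable]: "F \<in> borel_measurable borel" unfolding F_def by measurable
  have F_le: "F t \<le> 1" for t unfolding F_def by (rule emeasure_le_1)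
  have F_mono: "F s \<le> F t" if "s \<le> t" for s t
    unfolding F_def using that by (intro emeasure_mono) force+
  have "(\<lambda>n. F (1 / real (Suc n))) \<longlonglongrightarrow> emeasure M (\<Inter>n. {\<omega>\<in>space M. exceeds 1 (1 / real (Suc n)) \<omega>})"
    unfolding F_def
  proof (rule Lim_emeasure_decseq)
    show "decseq (\<lambda>n. {\<omega>\<in>space M. exceeds 1 (1 / real (Suc n)) \<omega>})"
    proof (intro decseq_SucI Collect_mono conj_mono impI)
      fix n \<omega> assume "exceeds 1 (1 / real (Suc (Suc n))) \<omega>"
      then obtain r where "0 \<le> r" "r < 1 / real (Suc (Suc n))" "1 < X r \<omega>" by auto
      moreover have "1 / real (Suc (Suc n)) \<le> 1 / real (Suc n)" by (intro divide_left_mono) auto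
      ultimately show "exceeds 1 (1 / real (Suc n)) \<omega>" by force
    qed auto
  qed auto
  also have "(\<Inter>n. {\<omega>\<in>space M. exceeds 1 (1 / real (Suc n)) \<omega>}) = {}"
  proof safe
    fix \<omega> assume \<omega>: "\<omega> \<in> (\<Inter>n. {\<omega>\<in>space M. exceeds 1 (1 / real (Suc n)) \<omega>})"
    then have "\<omega> \<in> space M" by auto
    then interpret lsc_path "\<lambda>t. X t \<omega>" by (rule lsc_path_X)
    have "eventually (\<lambda>r. X r \<omega> < 1) (at_right 0)"
      using rcD[of 0] zero[of 0 \<omega>] by (auto intro: order_tendstoD)
    then obtain b where b: "b > 0" "\<And>r. 0 < r \<Longrightarrow> r < b \<Longrightarrow> X r \<omega> < 1"
      unfolding eventually_at_right[OF zero_less_one] by blast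
    obtain n where n: "1 / real (Suc n) < b" using reals_Archimedean[OF b(1)] by (auto simp: inverse_eq_divide)
    obtain r where r: "0 \<le> r" "r < 1 / real (Suc n)" "1 < X r \<omega>" using INT_D[OF \<omega>, of n] by auto
    then show "\<omega> \<in> {}" using b(2)[of r] n zero[of r \<omega>] by (cases "r = 0") auto
  qed
  finally have F0: "(\<lambda>n. F (1 / real (Suc n))) \<longlonglongrightarrow> 0" by simp
  \<comment> \<open>One half of exp (- B) bounds P(T < t) for t < d, the other half the discount exp
    (- q d) left from time d on.\<close>
  define e where "e = exp (- B) / 2"
  have e: "0 < e" "2 * e = exp (- B)" by (auto simp: e_def)
  have "eventually (\<lambda>n. F (1 / real (Suc n)) < ennreal e) sequentially"
    using F0 e(1) by (auto intro: order_tendstoD)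
  then obtain n where n: "F (1 / real (Suc n)) < ennreal e" by (auto simp: eventually_sequentially)
  define d where "d = 1 / real (Suc n)"
  have d: "0 < d" "F d < ennreal e" using n by (auto simp: d_def)
  obtain q where q: "0 < q" "exp (- q * d) < e"
  proof -
    define q where "q = max 1 ((1 - ln e) / d)"
    have "(1 - ln e) \<le> q * d" using d(1) by (auto simp: q_def max_def field_simps)
    then have "- q * d < ln e" by simp
    then have "exp (- q * d) < exp (ln e)" by (simp only: exp_less_cancel_iff)
    then show thesis using that[of q] e(1) by (auto simp: q_def)
  qed
  have "passage_transform q 1 \<le> ennreal q * ((\<integral>\<^sup>+t. ennreal e * (discount q t * indicator {0..} t) \<partial>lborel) + (\<integral>\<^sup>+t\<in>{d..}. discount q t \<partial>lborel))"
  proof -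
    have "laplace q F \<le>
      (\<integral>\<^sup>+t. ennreal e * (discount q t * indicator {0..} t) + discount q t * indicator {d..} t \<partial>lborel)"
    proof (rule nn_integral_mono)
      fix t :: real
      show "discount q t * F t * indicator {0..} t \<le>
        ennreal e * (discount q t * indicator {0..} t) + discount q t * indicator {d..} t"
      proof (cases "t < d")
        case True
        have "F t \<le> ennreal e" using F_mono[of t d] True d(2) by (intro order.strict_implies_order) auto
        then have "discount q t * F t \<le> discount q t * ennreal e" by (intro mult_left_mono) auto
        then show ?thesis using True by (auto simp: indicator_def ac_simps)
      next
        case False
        have "discount q t * F t \<le> discount q t * 1" by (intro mult_left_mono F_le) auto
        then show ?thesis using False by (auto simp: indicator_def intro: add_increasing)
      qed
    qed
    also have "\<dots> = (\<integral>\<^sup>+t. ennreal e * (discount q t * indicator {0..} t) \<partial>lborel) + (\<integral>\<^sup>+t\<in>{d..}. discount q t \<partial>lborel)"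
      by (rule nn_integral_add) measurable
    finally show ?thesis unfolding passage_transform_def F_def by (intro mult_left_mono) auto
  qed
  also have "(\<integral>\<^sup>+t. ennreal e * (discount q t * indicator {0..} t) \<partial>lborel) = ennreal e * (\<integral>\<^sup>+t\<in>{0..}. discount q t \<partial>lborel)"
    by (rule nn_integral_cmult) measurable
  also have "ennreal q * (ennreal e * (\<integral>\<^sup>+t\<in>{0..}. discount q t \<partial>lborel) + (\<integral>\<^sup>+t\<in>{d..}. discount q t \<partial>lborel)) =
    ennreal (e + exp (- q * d))"
    unfolding nn_integral_exp_tail(1)[OF q(1)] using q(1) e(1)
    by (simp add: ennreal_mult[symmetric] ennreal_plus[symmetric] distrib_left del: ennreal_plus)
  finally have "enn2real (passage_transform q 1) \<le> e + exp (- q * d)"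
    using e(1) by (intro enn2real_leI) (auto simp: add_nonneg_nonneg)
  also have "\<dots> < exp (- B)" using q(2) e(2) by simp
  finally have "exp (- passage_rate q) < exp (- B)" using passage_transform_eq[OF q(1), of 1] by simp
  then show ?thesis using q(1) by auto
qed

text \<open>Values are taken in \<open>ennreal\<close> because finiteness of the exponential moments
  is a result and not an assumption.\<close>

definition mgf :: "real \<Rightarrow> real \<Rightarrow> ennreal" where
  "mgf \<beta> t = (\<integral>\<^sup>+\<omega>. ennreal (exp (\<beta> * X t \<omega>)) \<partial>M)"

lemma mgf_measurable [measurable]: "mgf \<beta> \<in> borel_measurable borel"
  unfolding mgf_def by measurable

lemma mgf_add:
  assumes "0 \<le> s" "0 \<le> t"
  shows "mgf \<beta> (s + t) = mgf \<beta> s * mgf \<beta> t"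
proof -
  have "mgf \<beta> (s + t) = (\<integral>\<^sup>+\<omega>. \<integral>\<^sup>+\<omega>'. ennreal (exp (\<beta> * (X s \<omega> + X t \<omega>'))) \<partial>M \<partial>M)"
    using nn_integral_markov_single[OF assms, of "\<lambda>_. True" "\<lambda>y. ennreal (exp (\<beta> * y))"] by (simp add: mgf_def)
  also have "\<dots> = (\<integral>\<^sup>+\<omega>. ennreal (exp (\<beta> * X s \<omega>)) * mgf \<beta> t \<partial>M)"
    unfolding mgf_def by (intro nn_integral_cong) (simp add: nn_integral_cmult[symmetric] distrib_left exp_add ennreal_mult)
  also have "\<dots> = mgf \<beta> s * mgf \<beta> t" by (simp add: nn_integral_multc mgf_def)
  finally show ?thesis .
qed

lemma mgf_pos: "0 < mgf \<beta> t"
proof -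
  have "mgf \<beta> t \<noteq> 0"
  proof
    assume "mgf \<beta> t = 0"
    then have "AE \<omega> in M. ennreal (exp (\<beta> * X t \<omega>)) = 0"
      unfolding mgf_def by (subst (asm) nn_integral_0_iff_AE) auto
    then have "AE \<omega> in M. False" by eventually_elim auto
    then show False by simp
  qed
  then show ?thesis by (simp add: zero_less_iff_neq_zero)
qed

lemma nn_integral_resolvent_exp:
  "(\<integral>\<^sup>+y. ennreal (exp (\<beta> * y)) \<partial>resolvent q) = laplace q (\<lambda>t. mgf \<beta> t)"
  unfolding mgf_def by (rule nn_integral_resolvent) measurable

text \<open>The part of the transform over (-\<infinity>,0]. It is not computed; the arguments on
  \<Phi> rest on its bound 1 / q alone.\<close>

definition resolvent_neg :: "real \<Rightarrow> real \<Rightarrow> ennreal" where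
  "resolvent_neg q \<beta> = (\<integral>\<^sup>+y\<in>{..0}. ennreal (exp (\<beta> * y)) \<partial>resolvent q)"

lemma resolvent_neg_le:
  assumes "0 < q" "0 \<le> \<beta>" shows "resolvent_neg q \<beta> \<le> ennreal (1 / q)"
proof -
  have "resolvent_neg q \<beta> \<le> (\<integral>\<^sup>+y. 1 \<partial>resolvent q)"
    unfolding resolvent_neg_def using assms(2) by (intro nn_integral_mono) (auto simp: indicator_def mult_nonneg_nonpos)
  then show ?thesis using assms(1) by (simp add: emeasure_resolvent_UNIV)
qed

lemma nn_integral_resolvent_exp_split:
  assumes q: "0 < q"
  shows "(\<integral>\<^sup>+y. ennreal (exp (\<beta> * y)) \<partial>resolvent q) =
    resolvent_neg q \<beta> + ennreal (resolvent_const q) * (\<integral>\<^sup>+y\<in>{0<..}. ennreal (exp (- (passage_rate q - \<beta>) * y)) \<partial>lborel)"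
proof -
  have "(\<integral>\<^sup>+y. ennreal (exp (\<beta> * y)) \<partial>resolvent q) =
    (\<integral>\<^sup>+y. ennreal (exp (\<beta> * y)) * indicator {..0} y + ennreal (exp (\<beta> * y)) * indicator {0<..} y \<partial>resolvent q)"
    by (intro nn_integral_cong) (auto simp: indicator_def)
  also have "\<dots> = resolvent_neg q \<beta> + (\<integral>\<^sup>+y\<in>{0<..}. ennreal (exp (\<beta> * y)) \<partial>resolvent q)"
    unfolding resolvent_neg_def by (rule nn_integral_add) auto
  also have "(\<integral>\<^sup>+y\<in>{0<..}. ennreal (exp (\<beta> * y)) \<partial>resolvent q) =
    (\<integral>\<^sup>+y\<in>{0<..}. ennreal (resolvent_const q * exp (- passage_rate q * y)) * ennreal (exp (\<beta> * y)) \<partial>lborel)"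
    by (rule nn_integral_resolvent_pos[OF q]) measurable
  also have "\<dots> = (\<integral>\<^sup>+y. ennreal (resolvent_const q) * (ennreal (exp (- (passage_rate q - \<beta>) * y)) * indicator {0<..} y) \<partial>lborel)"
    using resolvent_const_pos[OF q]
    by (intro nn_integral_cong) (auto simp: ennreal_mult[symmetric] exp_add[symmetric] indicator_def algebra_simps)
  also have "\<dots> = ennreal (resolvent_const q) * (\<integral>\<^sup>+y\<in>{0<..}. ennreal (exp (- (passage_rate q - \<beta>) * y)) \<partial>lborel)"
    by (rule nn_integral_cmult) measurable
  finally show ?thesis .
qed

lemma nn_integral_resolvent_exp_finite:
  assumes q: "0 < q" and b: "0 \<le> \<beta>" "\<beta> < passage_rate q"
  shows "(\<integral>\<^sup>+y. ennreal (exp (\<beta> * y)) \<partial>resolvent q) = resolvent_neg q \<beta> + ennreal (resolvent_const q / (passage_rate q - \<beta>))"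
  unfolding nn_integral_resolvent_exp_split[OF q]
  using nn_integral_exp_tail(2)[of "passage_rate q - \<beta>" 0] b resolvent_const_pos[OF q]
  by (simp add: ennreal_mult[symmetric])

text \<open>A q whose passage rate exceeds \<beta> makes the transform I of the resolvent finite.
  For u s = exp (- q s) E exp (\<beta> X_s), multiplicativity of the moments in time shows that u s
  times I is the part of I that comes from times t \<ge> s. Hence u is at most 1, decreasing and
  multiplicative, so exponential; that all the moments are finite is part of the conclusion.\<close>

lemma mgf_eq:
  assumes b: "0 \<le> \<beta>" and t: "0 \<le> t"
  shows "mgf \<beta> t = ennreal (exp (t * laplace_exponent M X \<beta>))"
proof -
  obtain q where q: "0 < q" "\<beta> < passage_rate q" using passage_rate_exceeds by blast
  define I where "I = (\<integral>\<^sup>+y. ennreal (exp (\<beta> * y)) \<partial>resolvent q)"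
  have I_eq: "I = laplace q (\<lambda>t. mgf \<beta> t)"
    unfolding I_def by (rule nn_integral_resolvent_exp)
  have If: "I \<noteq> \<infinity>" unfolding I_def nn_integral_resolvent_exp_finite[OF q(1) b q(2)]
    using resolvent_neg_le[OF q(1) b] by (auto simp: top_unique)
  have I0: "I \<noteq> 0"
  proof
    assume "I = 0"
    then have "AE y in resolvent q. ennreal (exp (\<beta> * y)) = 0"
      unfolding I_def by (subst (asm) nn_integral_0_iff_AE) auto
    then have "AE y in resolvent q. False" by eventually_elim auto
    then have "emeasure (resolvent q) UNIV = 0" by (subst (asm) AE_iff_measurable[of UNIV]) auto
    then show False using emeasure_resolvent_UNIV[OF q(1)] q(1) by simp
  qed
  have tail: "discount q s * mgf \<beta> s * I = (\<integral>\<^sup>+t\<in>{s..}. discount q t * mgf \<beta> t \<partial>lborel)" if s: "0 \<le> s" for s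
  proof -
    have "(\<integral>\<^sup>+t\<in>{s..}. discount q t * mgf \<beta> t \<partial>lborel) =
      (\<integral>\<^sup>+t. discount q (s + t) * mgf \<beta> (s + t) * indicator {s..} (s + t) \<partial>lborel)"
      by (subst nn_integral_real_affine[of _ 1 s]) auto
    also have "\<dots> = (\<integral>\<^sup>+t. discount q s * mgf \<beta> s * (discount q t * mgf \<beta> t * indicator {0..} t) \<partial>lborel)"
    proof (rule nn_integral_cong)
      fix t :: real
      have "discount q (s + t) = discount q s * discount q t"
        by (simp add: ennreal_mult[symmetric] exp_add[symmetric] algebra_simps)
      then show "discount q (s + t) * mgf \<beta> (s + t) * indicator {s..} (s + t) =
        discount q s * mgf \<beta> s * (discount q t * mgf \<beta> t * indicator {0..} t)"
        using mgf_add[OF s, of t] by (cases "0 \<le> t") (simp_all add: ac_simps)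
    qed
    also have "\<dots> = discount q s * mgf \<beta> s * I"
      unfolding I_def nn_integral_resolvent_exp by (rule nn_integral_cmult) measurable
    finally show ?thesis ..
  qed
  define u where "u s = enn2real (discount q s * mgf \<beta> s)" for s
  have le1: "discount q s * mgf \<beta> s \<le> 1" if s: "0 \<le> s" for s
  proof -
    have "discount q s * mgf \<beta> s * I \<le> I"
      using s by (subst tail[OF s], subst I_eq) (intro nn_integral_mono, auto simp: indicator_def)
    then have "I * (discount q s * mgf \<beta> s) \<le> I * 1" by (simp add: mult.commute)
    then show ?thesis using I0 If by (subst (asm) ennreal_mult_le_mult_iff) auto
  qed
  have u: "ennreal (u s) = discount q s * mgf \<beta> s" if "0 \<le> s" for s
    unfolding u_def using le1[OF that] by (intro ennreal_enn2real) (auto intro: le_less_trans)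
  have u_pos: "0 < u s" if "0 \<le> s" for s
  proof -
    have "0 < ennreal (u s)" unfolding u[OF that] using mgf_pos[of \<beta> s] by (simp add: ennreal_zero_less_mult_iff)
    then show ?thesis by simp
  qed
  have us: "u s = exp (s * ln (u 1))" if "0 < s" for s
  proof (rule multiplicative_antimono_exp[OF _ _ _ that])
    fix a b :: real assume ab: "0 < a" "0 < b"
    have "discount q (a + b) = discount q a * discount q b"
      by (simp add: ennreal_mult[symmetric] exp_add[symmetric] algebra_simps)
    then have "ennreal (u (a + b)) = ennreal (u a) * ennreal (u b)"
      using ab mgf_add[of a b] by (simp add: u ac_simps)
    then show "u (a + b) = u a * u b" using u_pos[of a] u_pos[of b] u_pos[of "a + b"] ab
      by (simp add: ennreal_mult[symmetric])
  next
    fix a b :: real assume ab: "0 < a" "a \<le> b"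
    have "ennreal (u b) * I \<le> ennreal (u a) * I"
      unfolding u[OF less_imp_le[OF ab(1)]] u[OF order_trans[OF less_imp_le[OF ab(1)] ab(2)]]
      using ab by (simp only: tail less_imp_le order_trans) (intro nn_integral_mono, auto simp: indicator_def)
    then have "ennreal (u b) \<le> ennreal (u a)" using I0 If by (simp add: ennreal_mult_le_mult_iff mult.commute[of _ I])
    then show "u b \<le> u a" using u_pos[of a] ab by (simp add: ennreal_le_iff)
  qed (use u_pos in auto)
  have m: "mgf \<beta> s = ennreal (exp (s * (q + ln (u 1))))" if "0 < s" for s
  proof -
    have "mgf \<beta> s = ennreal (exp (q * s)) * (discount q s * mgf \<beta> s)"
      by (simp add: mult.assoc[symmetric] ennreal_mult[symmetric] exp_add[symmetric])
    also have "\<dots> = ennreal (exp (q * s)) * ennreal (exp (s * ln (u 1)))"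
      using that us[OF that] u[of s] by simp
    finally show ?thesis by (simp add: ennreal_mult[symmetric] exp_add[symmetric] algebra_simps)
  qed
  \<comment> \<open>Time 1 identifies the exponent found with the definition of \<psi>(\<beta>); the
    integral there is a Bochner integral, which is meaningful now that the moment is known to be
    finite.\<close>
  have "integral\<^sup>L M (\<lambda>\<omega>. exp (\<beta> * X 1 \<omega>)) = exp (q + ln (u 1))"
    using m[of 1] unfolding mgf_def by (intro integral_eq_nn_integral[THEN trans]) auto
  then have "laplace_exponent M X \<beta> = q + ln (u 1)" by (simp add: laplace_exponent_def)
  then show ?thesis using m[of t] t
    by (cases "t = 0") (auto simp: mgf_def zero emeasure_space_1)
qed

lemma nn_integral_resolvent_exp_eq:
  assumes "0 \<le> \<beta>" "laplace_exponent M X \<beta> < q"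
  shows "(\<integral>\<^sup>+y. ennreal (exp (\<beta> * y)) \<partial>resolvent q) = ennreal (1 / (q - laplace_exponent M X \<beta>))"
proof -
  have "laplace q (\<lambda>t. mgf \<beta> t) =
    (\<integral>\<^sup>+t\<in>{0..}. ennreal (exp (- (q - laplace_exponent M X \<beta>) * t)) \<partial>lborel)"
    using assms(1) by (intro nn_integral_cong)
      (auto simp: mgf_eq indicator_def ennreal_mult[symmetric] exp_add[symmetric] algebra_simps)
  then show ?thesis
    unfolding nn_integral_resolvent_exp using nn_integral_exp_tail(1)[of "q - laplace_exponent M X \<beta>" 0] assms(2) by simp
qed

text \<open>Both inequalities are equivalent to finiteness of \<integral> exp (\<beta> y) R(dy).
  Computed in time it is 1 / (q - \<psi>(\<beta>)) or infinite; computed in space, the half-line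
  (0,\<infinity>) contributes a multiple of the integral of exp ((\<beta> - \<Phi>(q)) y), and the
  rest is bounded.\<close>

lemma laplace_exponent_less_iff:
  assumes q: "0 < q" and b: "0 \<le> \<beta>"
  shows "laplace_exponent M X \<beta> < q \<longleftrightarrow> \<beta> < passage_rate q"
proof
  assume l: "laplace_exponent M X \<beta> < q"
  show "\<beta> < passage_rate q"
  proof (rule ccontr)
    assume "\<not> \<beta> < passage_rate q"
    then have "(\<integral>\<^sup>+y. ennreal (exp (\<beta> * y)) \<partial>resolvent q) = \<infinity>"
      unfolding nn_integral_resolvent_exp_split[OF q] using resolvent_const_pos[OF q]
      by (subst nn_integral_exp_nonpos_rate) (auto simp: ennreal_mult_top)
    then show False using nn_integral_resolvent_exp_eq[OF b l] by simp
  qed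
next
  assume l: "\<beta> < passage_rate q"
  show "laplace_exponent M X \<beta> < q"
  proof (rule ccontr)
    assume n: "\<not> laplace_exponent M X \<beta> < q"
    have "(\<integral>\<^sup>+t\<in>{0<..}. ennreal (exp (- (q - laplace_exponent M X \<beta>) * t)) \<partial>lborel) \<le>
      laplace q (\<lambda>t. mgf \<beta> t)"
      using b by (intro nn_integral_mono)
        (auto simp: mgf_eq indicator_def ennreal_mult[symmetric] exp_add[symmetric] algebra_simps)
    then have "(\<integral>\<^sup>+y. ennreal (exp (\<beta> * y)) \<partial>resolvent q) = \<infinity>"
      unfolding nn_integral_resolvent_exp using n by (subst (asm) nn_integral_exp_nonpos_rate) (auto simp: top_unique)
    then show False
      unfolding nn_integral_resolvent_exp_finite[OF q b l] using resolvent_neg_le[OF q b] by (auto simp: top_unique)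
  qed
qed

text \<open>Strictly below the passage rate \<psi> < q, and continuity of the moments along
  arguments increasing to it gives \<psi> \<le> q in the limit; there the strict inequality
  fails.\<close>

lemma laplace_exponent_passage_rate:
  assumes q: "0 < q"
  shows "laplace_exponent M X (passage_rate q) = q"
proof -
  define \<Phi> where "\<Phi> = passage_rate q"
  have P: "0 < \<Phi>" unfolding \<Phi>_def by (rule passage_rate_pos[OF q])
  define b where "b n = \<Phi> * (1 - 1 / real (Suc n))" for n
  have b: "0 \<le> b n" "b n < \<Phi>" for n
  proof -
    have "0 \<le> 1 - 1 / real (Suc n)" "1 - 1 / real (Suc n) < 1" by auto
    then show "0 \<le> b n" "b n < \<Phi>" unfolding b_def using P mult_strict_left_mono[of "1 - 1 / real (Suc n)" 1 \<Phi>] by auto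
  qed
  have bl: "b \<longlonglongrightarrow> \<Phi>"
  proof -
    have "(\<lambda>n. \<Phi> * (1 - 1 / real (Suc n))) \<longlonglongrightarrow> \<Phi> * (1 - 0)"
      using LIMSEQ_inverse_real_of_nat by (intro tendsto_intros) (simp add: inverse_eq_divide)
    then show ?thesis by (simp add: b_def[abs_def])
  qed
  have "(\<lambda>n. mgf (b n) 1) \<longlonglongrightarrow> mgf \<Phi> 1"
    unfolding mgf_def
  proof (rule nn_integral_dominated_convergence[where w = "\<lambda>\<omega>. 1 + ennreal (exp (\<Phi> * X 1 \<omega>))"])
    show "AE \<omega> in M. ennreal (exp (b n * X 1 \<omega>)) \<le> 1 + ennreal (exp (\<Phi> * X 1 \<omega>))" for n
    proof (rule AE_I2)
      fix \<omega>
      have "exp (b n * X 1 \<omega>) \<le> 1 + exp (\<Phi> * X 1 \<omega>)"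
      proof (cases "0 \<le> X 1 \<omega>")
        case True
        then have "exp (b n * X 1 \<omega>) \<le> exp (\<Phi> * X 1 \<omega>)" using b(2)[of n] by (auto intro!: mult_right_mono)
        then show ?thesis by linarith
      next
        case False
        then have "exp (b n * X 1 \<omega>) \<le> 1" using b(1)[of n] by (auto simp: mult_nonneg_nonpos)
        then show ?thesis by (smt (verit) exp_gt_zero)
      qed
      then have "ennreal (exp (b n * X 1 \<omega>)) \<le> ennreal (1 + exp (\<Phi> * X 1 \<omega>))" by (rule ennreal_leI)
      then show "ennreal (exp (b n * X 1 \<omega>)) \<le> 1 + ennreal (exp (\<Phi> * X 1 \<omega>))" by (simp add: ennreal_plus)
    qed
    show "(\<integral>\<^sup>+\<omega>. 1 + ennreal (exp (\<Phi> * X 1 \<omega>)) \<partial>M) < \<infinity>"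
      using mgf_eq[of \<Phi> 1] P by (subst nn_integral_add) (auto simp: mgf_def emeasure_space_1)
    show "AE \<omega> in M. (\<lambda>n. ennreal (exp (b n * X 1 \<omega>))) \<longlonglongrightarrow> ennreal (exp (\<Phi> * X 1 \<omega>))"
      by (intro AE_I2 tendsto_ennrealI tendsto_intros bl)
  qed measurable
  moreover have "mgf (b n) 1 \<le> ennreal (exp q)" for n
    using laplace_exponent_less_iff[OF q b(1)[of n]] b(2)[of n] by (simp add: mgf_eq b(1) \<Phi>_def ennreal_leI)
  ultimately have "mgf \<Phi> 1 \<le> ennreal (exp q)" by (intro LIMSEQ_le_const2) auto
  then have "laplace_exponent M X \<Phi> \<le> q" using P by (simp add: mgf_eq ennreal_le_iff)
  moreover have "\<not> laplace_exponent M X \<Phi> < q" using laplace_exponent_less_iff[OF q, of \<Phi>] P by (simp add: \<Phi>_def)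
  ultimately show ?thesis by (simp add: \<Phi>_def)
qed

lemma passage_rate_mono:
  assumes "0 < p" "p < q" shows "passage_rate p < passage_rate q"
  using laplace_exponent_less_iff[of q "passage_rate p"] laplace_exponent_passage_rate[of p] passage_rate_pos[of p] assms by simp

text \<open>E exp (- q T) for level 1 is a Laplace transform in q, hence continuous, and it is
  positive, so that its logarithm is continuous too.\<close>

lemma continuous_passage_rate: "continuous_on {0<..} passage_rate"
proof (rule continuous_on_sequentiallyI)
  fix u p assume u: "\<forall>n. u n \<in> {0<..}" and p: "p \<in> {0<..}" and l: "u \<longlonglongrightarrow> (p::real)"
  let ?F = "\<lambda>t. emeasure M {\<omega>\<in>space M. exceeds 1 t \<omega>}"
  have 1: "(\<lambda>n. \<integral>\<^sup>+t\<in>{0..}. ennreal (exp (- u n * t)) * ?F t \<partial>lborel) \<longlonglongrightarrow> laplace p ?F"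
    by (rule laplace_continuous) (use u p l emeasure_le_1 in auto)
  have "laplace p ?F \<noteq> \<infinity>"
  proof
    assume "laplace p ?F = \<infinity>"
    then have "passage_transform p 1 = \<infinity>" using p by (simp add: passage_transform_def ennreal_mult_top)
    then show False using passage_transform_le_1[of p 1] p by (auto simp: top_unique)
  qed
  then have "(\<lambda>n. passage_transform (u n) 1) \<longlonglongrightarrow> passage_transform p 1"
    unfolding passage_transform_def using l p
    by (intro tendsto_mult_ennreal 1 tendsto_ennrealI) auto
  then have "(\<lambda>n. enn2real (passage_transform (u n) 1)) \<longlonglongrightarrow> enn2real (passage_transform p 1)"
    using passage_transform_le_1[of p 1] p by (intro tendsto_enn2real) (auto simp: top_unique ennreal_enn2real_if)
  then show "(\<lambda>n. passage_rate (u n)) \<longlonglongrightarrow> passage_rate p"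
    unfolding passage_rate_def using passage_transform_pos[of p 1] p by (intro tendsto_minus tendsto_ln) auto
qed

text \<open>A root \<beta> is not below the passage rate at q, yet below the one at every larger q;
  continuity of the rate closes the gap.\<close>

lemma passage_rate_unique:
  assumes q: "0 < q" and b: "0 \<le> \<beta>" "laplace_exponent M X \<beta> = q"
  shows "passage_rate q = \<beta>"
proof (rule order.antisym)
  show "passage_rate q \<le> \<beta>" using laplace_exponent_less_iff[OF q b(1)] b(2) by simp
  show "\<beta> \<le> passage_rate q"
  proof (rule LIMSEQ_le_const)
    have "(\<lambda>n. q + 1 / real (Suc n)) \<longlonglongrightarrow> q"
      using tendsto_add[OF tendsto_const LIMSEQ_inverse_real_of_nat, of q] by (simp add: inverse_eq_divide)
    then show "(\<lambda>n. passage_rate (q + 1 / real (Suc n))) \<longlonglongrightarrow> passage_rate q"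
      using q by (intro continuous_on_tendsto_compose[OF continuous_passage_rate]) (auto intro!: always_eventually add_pos_pos)
    have "\<beta> < passage_rate (q + 1 / real (Suc n))" for n
    proof -
      have "0 < 1 / real (Suc n)" by simp
      then have "0 < q + 1 / real (Suc n)" "laplace_exponent M X \<beta> < q + 1 / real (Suc n)" using q b(2) by linarith+
      then show ?thesis using laplace_exponent_less_iff[of "q + 1 / real (Suc n)" \<beta>] b(1) by simp
    qed
    then show "\<exists>N. \<forall>n\<ge>N. \<beta> \<le> passage_rate (q + 1 / real (Suc n))" by (auto intro: less_imp_le)
  qed
qed

lemma right_inverse_eq:
  assumes q: "0 < q" shows "right_inverse M X q = passage_rate q"
proof -
  have "{\<beta>. \<beta> \<ge> 0 \<and> laplace_exponent M X \<beta> = q} = {passage_rate q}"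
    using passage_rate_unique[OF q] laplace_exponent_passage_rate[OF q] passage_rate_pos[OF q] by force
  then show ?thesis by (simp add: right_inverse_def)
qed

lemma continuous_resolvent_const: "continuous_on {0<..} resolvent_const"
proof (rule continuous_on_sequentiallyI)
  fix u p assume u: "\<forall>n. u n \<in> {0<..}" and p: "p \<in> {0<..}" and l: "u \<longlonglongrightarrow> (p::real)"
  let ?F = "\<lambda>t. emeasure M {\<omega>\<in>space M. X t \<omega> \<in> {0<..}}"
  have "(\<lambda>n. emeasure (resolvent (u n)) {0<..}) \<longlonglongrightarrow> emeasure (resolvent p) {0<..}"
    unfolding emeasure_resolvent[OF borel_open[OF open_greaterThan]]
    by (rule laplace_continuous) (use u p l emeasure_le_1 in auto)
  then have "(\<lambda>n. measure (resolvent (u n)) {0<..}) \<longlonglongrightarrow> measure (resolvent p) {0<..}"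
    unfolding measure_def using finite_measure.emeasure_finite[OF finite_measure_resolvent, of p "{0<..}"] p
    by (intro tendsto_enn2real) (auto simp: ennreal_enn2real_if)
  moreover have "(\<lambda>n. passage_rate (u n)) \<longlonglongrightarrow> passage_rate p"
    using u p by (intro continuous_on_tendsto_compose[OF continuous_passage_rate l]) auto
  ultimately show "(\<lambda>n. resolvent_const (u n)) \<longlonglongrightarrow> resolvent_const p"
    unfolding resolvent_const_def by (intro tendsto_intros)
qed

text \<open>At \<beta> = \<Phi>(p) the two expressions for the transform of the resolvent give 1 /
  (q - p) = N + C / (\<Phi>(q) - \<Phi>(p)), where N \<le> 1 / q is the part over (-\<infinity>,0]
  and C is \<open>resolvent_const q\<close>. Multiplied by \<Phi>(q) - \<Phi>(p), this is a
  difference quotient with an explicit error.\<close>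

lemma passage_rate_difference:
  assumes p: "0 < p" "p < q"
  shows "\<bar>(passage_rate q - passage_rate p) / (q - p) - resolvent_const q\<bar> \<le> (passage_rate q - passage_rate p) / q"
proof -
  have q: "0 < q" using p by simp
  define \<beta> where "\<beta> = passage_rate p"
  have b: "0 \<le> \<beta>" "laplace_exponent M X \<beta> = p" "\<beta> < passage_rate q"
    using passage_rate_pos[OF p(1)] laplace_exponent_passage_rate[OF p(1)] passage_rate_mono[OF p] by (auto simp: \<beta>_def)
  define N where "N = enn2real (resolvent_neg q \<beta>)"
  have N: "resolvent_neg q \<beta> = ennreal N" "0 \<le> N" "N \<le> 1 / q"
  proof -
    have f: "resolvent_neg q \<beta> < \<top>" using resolvent_neg_le[OF q b(1)] by (rule le_less_trans) simp
    then show "resolvent_neg q \<beta> = ennreal N" by (simp add: N_def)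
    show "0 \<le> N" by (simp add: N_def)
    show "N \<le> 1 / q" unfolding N_def using resolvent_neg_le[OF q b(1)] q by (intro enn2real_leI) auto
  qed
  define D where "D = passage_rate q - \<beta>"
  have D: "0 < D" using b(3) by (simp add: D_def)
  have "ennreal (1 / (q - p)) = ennreal N + ennreal (resolvent_const q / D)"
    using nn_integral_resolvent_exp_eq[OF b(1), of q] nn_integral_resolvent_exp_finite[OF q b(1,3)] p b(2) N(1)
    by (simp add: D_def)
  also have "\<dots> = ennreal (N + resolvent_const q / D)"
    using N(2) D resolvent_const_pos[OF q] by (simp add: ennreal_plus)
  finally have "1 / (q - p) = N + resolvent_const q / D"
    using p N(2) D resolvent_const_pos[OF q] by (subst (asm) ennreal_inj) auto
  then have "D / (q - p) = N * D + resolvent_const q" using D by (simp add: field_simps)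
  then have "D / (q - p) - resolvent_const q = N * D" by simp
  moreover have "N * D \<le> D / q" using mult_right_mono[OF N(3), of D] D by simp
  ultimately show ?thesis using N(2) D by (simp add: D_def \<beta>_def)
qed

text \<open>The estimate for a difference quotient involves the constant at the larger of its two
  arguments. It is therefore compared with \<open>resolvent_const (max x q)\<close>, which tends to
  the value at q; this treats both one-sided limits at once.\<close>

lemma has_real_derivative_passage_rate:
  assumes q: "0 < q"
  shows "(passage_rate has_real_derivative resolvent_const q) (at q)"
  unfolding has_field_derivative_iff
proof (rule Lim_transform)
  have cont: "isCont passage_rate q" "isCont resolvent_const q"
    using continuous_passage_rate continuous_resolvent_const q
    by (auto simp: continuous_on_eq_continuous_at[OF open_greaterThan])
  have max: "((\<lambda>x. max x q) \<longlongrightarrow> q) (at q)" using tendsto_max[OF tendsto_ident_at[of q UNIV] tendsto_const[of q]] by simp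
  show "((\<lambda>x. resolvent_const (max x q)) \<longlongrightarrow> resolvent_const q) (at q)"
    by (rule isCont_tendsto_compose[OF cont(2) max])
  show "((\<lambda>x. (passage_rate x - passage_rate q) / (x - q) - resolvent_const (max x q)) \<longlongrightarrow> 0) (at q)"
  proof (rule Lim_null_comparison)
    show "((\<lambda>x. \<bar>passage_rate x - passage_rate q\<bar> / q) \<longlongrightarrow> 0) (at q)"
      using tendsto_divide[OF tendsto_rabs[OF tendsto_diff[OF cont(1)[unfolded isCont_def] tendsto_const[of "passage_rate q"]]] tendsto_const[of q]] q
      by simp
    have "eventually (\<lambda>x. x \<in> {0<..}) (at q)"
      using q by (intro eventually_at_in_open') auto
    then show "eventually (\<lambda>x. norm ((passage_rate x - passage_rate q) / (x - q) - resolvent_const (max x q)) \<le> \<bar>passage_rate x - passage_rate q\<bar> / q) (at q)"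
      using eventually_neq_at_within[of q q UNIV]
    proof eventually_elim
      case (elim x)
      show ?case
      proof (cases "x < q")
        case True
        have "(passage_rate x - passage_rate q) / (x - q) = (passage_rate q - passage_rate x) / (q - x)"
          using True by (simp add: divide_simps) (simp add: algebra_simps)
        then show ?thesis using passage_rate_difference[of x q] passage_rate_mono[of x q] elim True by (simp add: max_def abs_minus_commute)
      next
        case False
        then have x: "q < x" using elim by simp
        have "(passage_rate x - passage_rate q) / x \<le> (passage_rate x - passage_rate q) / q"
          using passage_rate_mono[OF q x] q x by (intro divide_left_mono) auto
        then show ?thesis using passage_rate_difference[OF q x] passage_rate_mono[OF q x] x by (simp add: max_def abs_minus_commute)
      qed
    qed
  qed
qed

lemma deriv_right_inverse:
  assumes q: "0 < q" shows "deriv (right_inverse M X) q = resolvent_const q"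
proof (rule DERIV_imp_deriv)
  show "(right_inverse M X has_real_derivative resolvent_const q) (at q)"
    by (rule has_field_derivative_transform_within_open[OF has_real_derivative_passage_rate[OF q] open_greaterThan])
      (use q right_inverse_eq in auto)
qed

lemma passage_rate_at_top: "filterlim passage_rate at_top at_top"
proof (rule filterlim_at_top_gt[THEN iffD2, of 0], intro allI impI)
  fix B :: real assume "B > 0"
  obtain q where q: "0 < q" "B < passage_rate q" using passage_rate_exceeds by blast
  show "eventually (\<lambda>x. B \<le> passage_rate x) at_top"
    using eventually_gt_at_top[of q]
  proof eventually_elim
    case (elim x)
    then show ?case using passage_rate_mono[OF q(1) elim] q(2) by simp
  qed
qed

end
lemma nn_integral_exp_diff:
  fixes a b k c :: real
  assumes ab: "0 < a" "a \<le> b" and k: "0 \<le> k" and c: "0 \<le> c"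
  shows "(\<integral>\<^sup>+z\<in>{c<..}. ennreal (k * (exp (- a * z) - exp (- b * z))) \<partial>lborel) =
    ennreal (k * (exp (- a * c) / a - exp (- b * c) / b))"
proof -
  let ?I = "\<integral>\<^sup>+z\<in>{c<..}. ennreal (k * (exp (- a * z) - exp (- b * z))) \<partial>lborel"
  have kI: "(\<integral>\<^sup>+z\<in>{c<..}. ennreal (k * exp (- r * z)) \<partial>lborel) = ennreal (k * (exp (- r * c) / r))" if r: "0 < r" for r
  proof -
    have "(\<integral>\<^sup>+z\<in>{c<..}. ennreal (k * exp (- r * z)) \<partial>lborel) =
      (\<integral>\<^sup>+z. ennreal k * (discount r z * indicator {c<..} z) \<partial>lborel)"
      using k by (intro nn_integral_cong) (simp add: ennreal_mult mult.assoc)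
    also have "\<dots> = ennreal k * (\<integral>\<^sup>+z\<in>{c<..}. discount r z \<partial>lborel)"
      by (rule nn_integral_cmult) measurable
    finally show ?thesis unfolding nn_integral_exp_tail(2)[OF r] using k r by (simp add: ennreal_mult[symmetric])
  qed
  have "?I + (\<integral>\<^sup>+z\<in>{c<..}. ennreal (k * exp (- b * z)) \<partial>lborel) =
    (\<integral>\<^sup>+z. ennreal (k * (exp (- a * z) - exp (- b * z))) * indicator {c<..} z + ennreal (k * exp (- b * z)) * indicator {c<..} z \<partial>lborel)"
    by (rule nn_integral_add[symmetric]) measurable
  also have "\<dots> = (\<integral>\<^sup>+z\<in>{c<..}. ennreal (k * exp (- a * z)) \<partial>lborel)"
  proof (rule nn_integral_cong)
    fix z :: real
    show "ennreal (k * (exp (- a * z) - exp (- b * z))) * indicator {c<..} z + ennreal (k * exp (- b * z)) * indicator {c<..} z =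
      ennreal (k * exp (- a * z)) * indicator {c<..} z"
    proof (cases "c < z")
      case True
      then have "exp (- b * z) \<le> exp (- a * z)" using ab c by (simp add: mult_right_mono)
      then have "ennreal (k * (exp (- a * z) - exp (- b * z))) + ennreal (k * exp (- b * z)) =
        ennreal (k * (exp (- a * z) - exp (- b * z)) + k * exp (- b * z))"
        using k by (intro ennreal_plus[symmetric]) auto
      then show ?thesis using True by (simp add: algebra_simps)
    qed simp
  qed
  finally have eq: "?I + ennreal (k * (exp (- b * c) / b)) = ennreal (k * (exp (- a * c) / a))"
    using ab by (simp only: kI)
  have le: "k * (exp (- b * c) / b) \<le> k * (exp (- a * c) / a)"
    using ab k c by (intro mult_left_mono frac_le) (auto intro: mult_right_mono)
  have "?I = ennreal (k * (exp (- a * c) / a)) - ennreal (k * (exp (- b * c) / b))"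
    unfolding eq[symmetric] by simp
  also have "\<dots> = ennreal (k * (exp (- a * c) / a) - k * (exp (- b * c) / b))"
    using k ab by (intro ennreal_minus) auto
  finally show ?thesis by (simp only: right_diff_distrib)
qed

lemma nn_integral_exp_convolution:
  fixes p s r :: real
  assumes "p \<noteq> s" "0 \<le> r"
  shows "(\<integral>\<^sup>+t. ennreal (exp (- p * t) * exp (- s * (r - t))) * indicator {0..r} t \<partial>lborel) =
    ennreal ((exp (- s * r) - exp (- p * r)) / (p - s))"
proof -
  define k where "k = p - s"
  have k: "k \<noteq> 0" using assms(1) by (simp add: k_def)
  define F where "F t = exp (- s * r) * (- exp (- k * t) / k)" for t
  have "(\<integral>\<^sup>+t. ennreal (exp (- p * t) * exp (- s * (r - t))) * indicator {0..r} t \<partial>lborel) = ennreal (F r - F 0)"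
  proof (rule nn_integral_FTC_Icc)
    fix t :: real
    have "((\<lambda>t. - exp (- k * t) / k) has_real_derivative exp (- k * t)) (at t)"
      using k by (auto intro!: derivative_eq_intros)
    then have "(F has_real_derivative exp (- s * r) * exp (- k * t)) (at t)"
      unfolding F_def by (rule DERIV_cmult)
    moreover have "exp (- s * r) * exp (- k * t) = exp (- p * t) * exp (- s * (r - t))"
      by (simp add: exp_add[symmetric] algebra_simps k_def)
    ultimately show "(F has_real_derivative exp (- p * t) * exp (- s * (r - t))) (at t)"
      by simp
  qed (use assms in auto)
  also have "F r - F 0 = (exp (- s * r) - exp (- s * r) * exp (- k * r)) / k"
    by (simp add: F_def diff_divide_distrib)
  also have "exp (- s * r) * exp (- k * r) = exp (- p * r)"
    by (simp add: exp_add[symmetric] algebra_simps k_def)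
  finally show ?thesis by (simp add: k_def)
qed

context normalized_snlp
begin

subsection \<open>Duality for the process killed below zero\<close>

definition killed_tail :: "real \<Rightarrow> real \<Rightarrow> real \<Rightarrow> ennreal" where
  "killed_tail p x c = laplace p (\<lambda>s. stay_prob s x c)"

text \<open>For z > 0 this is E(exp (\<beta> X_s); s \<le> T), where T is the first passage time
  above z.\<close>

definition below_mgf :: "real \<Rightarrow> real \<Rightarrow> real \<Rightarrow> ennreal" where
  "below_mgf \<beta> z s = (\<integral>\<^sup>+\<omega>. indicator {\<omega>. \<not> exceeds z s \<omega>} \<omega> * ennreal (exp (\<beta> * X s \<omega>)) \<partial>M)"

lemma below_mgf_measurable [measurable (raw)]:
  assumes [measurable]: "z \<in> borel_measurable N" "s \<in> borel_measurable N"
  shows "(\<lambda>y. below_mgf \<beta> (z y) (s y)) \<in> borel_measurable N"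
  unfolding below_mgf_def by measurable

lemma killed_tail_measurable [measurable (raw)]:
  assumes [measurable]: "x \<in> borel_measurable N" "c \<in> borel_measurable N"
  shows "(\<lambda>y. killed_tail p (x y) (c y)) \<in> borel_measurable N"
  unfolding killed_tail_def by measurable

lemma not_exceeds_imp_le:
  assumes \<omega>: "\<omega> \<in> space M" and s: "0 < s" and n: "\<not> exceeds z s \<omega>" and l: "l \<in> {0..s}"
  shows "X l \<omega> \<le> z"
proof (rule ccontr)
  interpret lsc_path "\<lambda>t. X t \<omega>" by (rule lsc_path_X[OF \<omega>])
  assume "\<not> X l \<omega> \<le> z"
  then have X: "z < X l \<omega>" by simp
  then have ls: "l = s" using n l by force
  have "s \<in> {t. z < X t \<omega>}" using X ls by simp
  then obtain e where e: "e > 0" "\<And>r. dist r s < e \<Longrightarrow> z < X r \<omega>"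
    using open_gt[of z] unfolding open_dist by blast
  have "max 0 (s - e / 2) \<in> {0..<s}" using s e(1) by auto
  moreover have "z < X (max 0 (s - e / 2)) \<omega>" using s e(1) by (intro e(2)) (auto simp: dist_real_def)
  ultimately show False using n by blast
qed

lemma one_minus_dyadics: "l \<in> dyadics 1 \<Longrightarrow> 1 - l \<in> dyadics 1"
proof -
  assume "l \<in> dyadics 1"
  then obtain i n :: nat where l: "l = real i / 2 ^ n" "i \<le> 2 ^ n" by (auto simp: dyadics_def)
  then have "1 - l = real (2 ^ n - i) / 2 ^ n" by (simp add: of_nat_diff diff_divide_distrib)
  then show "1 - l \<in> dyadics 1" unfolding dyadics_def by (intro CollectI exI[of _ "2 ^ n - i"] exI[of _ n]) auto
qed

text \<open>Substitute z = x + X_s for the starting point. The condition x + X_r > 0 becomes X_s -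
  X_r < z, the weight exp (- \<beta> x) becomes exp (- \<beta> z) exp (\<beta> X_s), and time
  reversal replaces X_s - X_r by the path itself; staying positive thus turns into not having passed
  z.\<close>

lemma dual_stay_prob:
  assumes s: "0 < s" and c: "0 \<le> c"
  shows "(\<integral>\<^sup>+x\<in>{0..}. discount \<beta> x * stay_prob s x c \<partial>lborel) =
    (\<integral>\<^sup>+z\<in>{c<..}. discount \<beta> z * below_mgf \<beta> z s \<partial>lborel)"
proof -
  interpret L: pair_sigma_finite lborel M ..
  \<comment> \<open>The path v stays below z with a margin: strict positivity of z - v on the whole
    interval, expressed on the skeleton.\<close>
  define B where "B z v \<longleftrightarrow> (\<exists>m::nat. \<forall>l\<in>dyadics 1. 1 / (real m + 1) \<le> z - v l)" for z and v :: "real \<Rightarrow> real"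
  have [measurable]: "Measurable.pred N (\<lambda>y. B (z y) (\<lambda>l. X (f l y) (g y) ))"
    if [measurable]: "z \<in> borel_measurable N" "g \<in> measurable N M" "\<And>l. f l \<in> borel_measurable N" for N z f g
    unfolding B_def by measurable
  have [measurable]: "Measurable.pred N (\<lambda>y. B (z y) (\<lambda>l. X s (g y) - X (l * s) (g y) ))"
    if [measurable]: "z \<in> borel_measurable N" "g \<in> measurable N M" for N z g
    unfolding B_def by measurable
  have pos: "stays_pos x s \<omega> \<longleftrightarrow> (\<exists>m::nat. \<forall>l\<in>dyadics 1. 1 / (real m + 1) \<le> x + X (l * s) \<omega>)" if "\<omega> \<in> space M" for x \<omega>
    using lsc_path.pos_on_interval_iff[OF lsc_path_shift[OF that, of x], of s 0] s by simp
  have sp: "stay_prob s x c = (\<integral>\<^sup>+\<omega>. indicator {x. (\<exists>m::nat. \<forall>l\<in>dyadics 1. 1 / (real m + 1) \<le> x + X (l * s) \<omega>) \<and> c < x + X s \<omega>} x \<partial>M)" for x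
  proof -
    have "stay_prob s x c = (\<integral>\<^sup>+\<omega>. indicator {\<omega>\<in>space M. stays_pos x s \<omega> \<and> c < x + X s \<omega>} \<omega> \<partial>M)"
      unfolding stay_prob_def by (rule nn_integral_indicator[symmetric]) measurable
    also have "\<dots> = (\<integral>\<^sup>+\<omega>. indicator {x. (\<exists>m::nat. \<forall>l\<in>dyadics 1. 1 / (real m + 1) \<le> x + X (l * s) \<omega>) \<and> c < x + X s \<omega>} x \<partial>M)"
      by (intro nn_integral_cong) (simp add: pos indicator_def)
    finally show ?thesis .
  qed
  define P where "P x \<omega> \<longleftrightarrow> (\<exists>m::nat. \<forall>l\<in>dyadics 1. 1 / (real m + 1) \<le> x + X (l * s) \<omega>) \<and> c < x + X s \<omega>" for x \<omega>
  have Pm [measurable]: "Measurable.pred (lborel \<Otimes>\<^sub>M M) (\<lambda>p. P (fst p) (snd p))" "Measurable.pred borel (\<lambda>x. P x \<omega>)" for \<omega>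
    unfolding P_def by measurable
  have Pi [measurable]: "(\<lambda>p. indicator {x. P x (snd p)} (fst p) :: ennreal) \<in> borel_measurable (lborel \<Otimes>\<^sub>M M)"
  proof -
    have "(\<lambda>p. indicator {x. P x (snd p)} (fst p) :: ennreal) = (\<lambda>p. indicator {p. P (fst p) (snd p)} p)"
      by (auto simp: indicator_def)
    also have "\<dots> \<in> borel_measurable (lborel \<Otimes>\<^sub>M M)" by (rule borel_measurable_indicator') measurable
    finally show ?thesis .
  qed
  \<comment> \<open>Time 0 is dyadic and X 0 = 0, so survival forces a positive starting point and
    the restriction to x \<ge> 0 disappears after the substitution.\<close>
  have P0: "0 < x" if P: "P x \<omega>" for x \<omega>
  proof -
    obtain m :: nat where "\<forall>l\<in>dyadics 1. 1 / (real m + 1) \<le> x + X (l * s) \<omega>" using P unfolding P_def by blast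
    from bspec[OF this zero_mem_dyadics] have "1 / (real m + 1) \<le> x" by (simp add: zero)
    moreover have "0 < 1 / (real m + 1)" by simp
    ultimately show ?thesis by linarith
  qed
  have "(\<integral>\<^sup>+x\<in>{0..}. discount \<beta> x * stay_prob s x c \<partial>lborel) =
    (\<integral>\<^sup>+x. \<integral>\<^sup>+\<omega>. discount \<beta> x * indicator {x. P x \<omega>} x * indicator {0..} x \<partial>M \<partial>lborel)"
  proof (rule nn_integral_cong)
    fix x :: real
    have "discount \<beta> x * stay_prob s x c * indicator {0..} x =
      discount \<beta> x * indicator {0..} x * (\<integral>\<^sup>+\<omega>. indicator {x. P x \<omega>} x \<partial>M)"
      by (simp add: sp P_def ac_simps)
    also have "\<dots> = (\<integral>\<^sup>+\<omega>. discount \<beta> x * indicator {0..} x * indicator {x. P x \<omega>} x \<partial>M)"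
      by (rule nn_integral_cmult[symmetric]) (use measurable_compose[OF measurable_Pair1' Pi, of x] in simp)
    finally show "discount \<beta> x * stay_prob s x c * indicator {0..} x =
      (\<integral>\<^sup>+\<omega>. discount \<beta> x * indicator {x. P x \<omega>} x * indicator {0..} x \<partial>M)" by (simp add: ac_simps)
  qed
  also have "\<dots> = (\<integral>\<^sup>+\<omega>. \<integral>\<^sup>+x. discount \<beta> x * indicator {x. P x \<omega>} x * indicator {0..} x \<partial>lborel \<partial>M)"
    by (rule L.Fubini'[symmetric]) measurable
  also have "\<dots> = (\<integral>\<^sup>+\<omega>. \<integral>\<^sup>+z. discount \<beta> z * ennreal (exp (\<beta> * X s \<omega>)) * indicator {z. B z (\<lambda>l. X s \<omega> - X (l * s) \<omega>)} z * indicator {c<..} z \<partial>lborel \<partial>M)"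
  proof (rule nn_integral_cong)
    fix \<omega> assume [measurable]: "\<omega> \<in> space M"
    have "(\<integral>\<^sup>+x. discount \<beta> x * indicator {x. P x \<omega>} x * indicator {0..} x \<partial>lborel) =
      (\<integral>\<^sup>+z. ennreal (exp (- \<beta> * (- X s \<omega> + z))) * indicator {x. P x \<omega>} (- X s \<omega> + z) * indicator {0..} (- X s \<omega> + z) \<partial>lborel)"
      by (subst nn_integral_real_affine[of _ 1 "- X s \<omega>"]) auto
    also have "\<dots> = (\<integral>\<^sup>+z. discount \<beta> z * ennreal (exp (\<beta> * X s \<omega>)) * indicator {z. B z (\<lambda>l. X s \<omega> - X (l * s) \<omega>)} z * indicator {c<..} z \<partial>lborel)"
    proof (rule nn_integral_cong)
      fix z
      have e: "ennreal (exp (- \<beta> * (- X s \<omega> + z))) = discount \<beta> z * ennreal (exp (\<beta> * X s \<omega>))"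
        by (simp add: ennreal_mult[symmetric] exp_add[symmetric] algebra_simps)
      have "P (- X s \<omega> + z) \<omega> \<longleftrightarrow> B z (\<lambda>l. X s \<omega> - X (l * s) \<omega>) \<and> c < z"
        by (simp add: P_def B_def algebra_simps)
      then show "ennreal (exp (- \<beta> * (- X s \<omega> + z))) * indicator {x. P x \<omega>} (- X s \<omega> + z) * indicator {0..} (- X s \<omega> + z) =
        discount \<beta> z * ennreal (exp (\<beta> * X s \<omega>)) * indicator {z. B z (\<lambda>l. X s \<omega> - X (l * s) \<omega>)} z * indicator {c<..} z"
        unfolding e using P0[of "- X s \<omega> + z" \<omega>] by (auto simp: indicator_def)
    qed
    finally show "(\<integral>\<^sup>+x. discount \<beta> x * indicator {x. P x \<omega>} x * indicator {0..} x \<partial>lborel) = \<dots>" .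
  qed
  also have "\<dots> = (\<integral>\<^sup>+z. \<integral>\<^sup>+\<omega>. discount \<beta> z * ennreal (exp (\<beta> * X s \<omega>)) * indicator {z. B z (\<lambda>l. X s \<omega> - X (l * s) \<omega>)} z * indicator {c<..} z \<partial>M \<partial>lborel)"
  proof (rule L.Fubini')
    have "(\<lambda>p. indicator {z. B z (\<lambda>l. X s (snd p) - X (l * s) (snd p))} (fst p) :: ennreal) =
      (\<lambda>p. indicator {p. B (fst p) (\<lambda>l. X s (snd p) - X (l * s) (snd p))} p)" by (auto simp: indicator_def)
    also have "\<dots> \<in> borel_measurable (lborel \<Otimes>\<^sub>M M)" by (rule borel_measurable_indicator') measurable
    finally have [measurable]: "(\<lambda>p. indicator {z. B z (\<lambda>l. X s (snd p) - X (l * s) (snd p))} (fst p) :: ennreal) \<in> borel_measurable (lborel \<Otimes>\<^sub>M M)" .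
    show "(\<lambda>(z, \<omega>). discount \<beta> z * ennreal (exp (\<beta> * X s \<omega>)) * indicator {z. B z (\<lambda>l. X s \<omega> - X (l * s) \<omega>)} z * indicator {c<..} z) \<in> borel_measurable (lborel \<Otimes>\<^sub>M M)"
      unfolding case_prod_beta' by measurable
  qed
  also have "\<dots> = (\<integral>\<^sup>+z. \<integral>\<^sup>+\<omega>. discount \<beta> z * ennreal (exp (\<beta> * X s \<omega>)) * indicator {z. B z (\<lambda>l. X (l * s) \<omega>)} z * indicator {c<..} z \<partial>M \<partial>lborel)"
  proof (rule nn_integral_cong)
    fix z :: real
    \<comment> \<open>The skeleton is read backwards, l to 1 - l: the reversed path consists of the
      values X s - X (s - l * s), whereas the condition is stated for X s - X (l * s).\<close>
    define F where "F v = discount \<beta> z * ennreal (exp (\<beta> * v 1)) * indicator {v. B z (\<lambda>l. v (1 - l))} v * indicator {c<..} z" for v :: "real \<Rightarrow> real"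
    have one: "1 \<in> dyadics 1" by simp
    have [measurable]: "F \<in> borel_measurable (PiM (dyadics 1) (\<lambda>_. borel))"
    proof -
      have "Measurable.pred (PiM (dyadics 1) (\<lambda>_. borel)) (\<lambda>v. B z (\<lambda>l. v (1 - l)))"
        unfolding B_def using one_minus_dyadics by measurable
      then have [measurable]: "(\<lambda>v. indicator {v. B z (\<lambda>l. v (1 - l))} v :: ennreal) \<in> borel_measurable (PiM (dyadics 1) (\<lambda>_. borel))"
        by (intro borel_measurable_indicator') simp
      have [measurable]: "(\<lambda>v. v 1) \<in> borel_measurable (PiM (dyadics 1) (\<lambda>_. borel :: real measure))"
        using one by (rule measurable_component_singleton)
      show ?thesis unfolding F_def by measurable
    qed
    have "F (\<lambda>l\<in>dyadics 1. X s \<omega> - X (s - l * s) \<omega>) = discount \<beta> z * ennreal (exp (\<beta> * X s \<omega>)) * indicator {z. B z (\<lambda>l. X s \<omega> - X (l * s) \<omega>)} z * indicator {c<..} z" for \<omega>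
    proof -
      have "B z (\<lambda>l. (\<lambda>l\<in>dyadics 1. X s \<omega> - X (s - l * s) \<omega>) (1 - l)) \<longleftrightarrow> B z (\<lambda>l. X s \<omega> - X (l * s) \<omega>)"
        unfolding B_def using one_minus_dyadics by (intro ex_cong1 ball_cong refl) (simp add: algebra_simps)
      then show ?thesis using one by (simp add: F_def indicator_def zero)
    qed
    moreover have "F (\<lambda>l\<in>dyadics 1. X (l * s) \<omega>) = discount \<beta> z * ennreal (exp (\<beta> * X s \<omega>)) * indicator {z. B z (\<lambda>l. X (l * s) \<omega>)} z * indicator {c<..} z" for \<omega>
    proof -
      have "(\<forall>l\<in>dyadics 1. Q (1 - l)) \<longleftrightarrow> (\<forall>l\<in>dyadics 1. Q l)" for Q
        using one_minus_dyadics by (metis diff_diff_eq2 add_diff_cancel_left' diff_add_cancel)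
      then have "(\<forall>l\<in>dyadics 1. 1 / (real m + 1) \<le> z - X ((1 - l) * s) \<omega>) \<longleftrightarrow> (\<forall>l\<in>dyadics 1. 1 / (real m + 1) \<le> z - X (l * s) \<omega>)" for m :: nat .
      then have "B z (\<lambda>l. (\<lambda>l\<in>dyadics 1. X (l * s) \<omega>) (1 - l)) \<longleftrightarrow> B z (\<lambda>l. X (l * s) \<omega>)"
        unfolding B_def using one_minus_dyadics by simp
      then show ?thesis using one by (simp add: F_def indicator_def)
    qed
    ultimately show "(\<integral>\<^sup>+\<omega>. discount \<beta> z * ennreal (exp (\<beta> * X s \<omega>)) * indicator {z. B z (\<lambda>l. X s \<omega> - X (l * s) \<omega>)} z * indicator {c<..} z \<partial>M) =
      (\<integral>\<^sup>+\<omega>. discount \<beta> z * ennreal (exp (\<beta> * X s \<omega>)) * indicator {z. B z (\<lambda>l. X (l * s) \<omega>)} z * indicator {c<..} z \<partial>M)"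
      using nn_integral_time_reversal[OF less_imp_le[OF s], of F] by simp
  qed
  also have "\<dots> = (\<integral>\<^sup>+\<omega>. \<integral>\<^sup>+z. discount \<beta> z * ennreal (exp (\<beta> * X s \<omega>)) * indicator {z. B z (\<lambda>l. X (l * s) \<omega>)} z * indicator {c<..} z \<partial>lborel \<partial>M)"
  proof (rule L.Fubini'[symmetric])
    have "(\<lambda>p. indicator {z. B z (\<lambda>l. X (l * s) (snd p))} (fst p) :: ennreal) =
      (\<lambda>p. indicator {p. B (fst p) (\<lambda>l. X (l * s) (snd p))} p)" by (auto simp: indicator_def)
    also have "\<dots> \<in> borel_measurable (lborel \<Otimes>\<^sub>M M)" by (rule borel_measurable_indicator') measurable
    finally have [measurable]: "(\<lambda>p. indicator {z. B z (\<lambda>l. X (l * s) (snd p))} (fst p) :: ennreal) \<in> borel_measurable (lborel \<Otimes>\<^sub>M M)" .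
    show "(\<lambda>(z, \<omega>). discount \<beta> z * ennreal (exp (\<beta> * X s \<omega>)) * indicator {z. B z (\<lambda>l. X (l * s) \<omega>)} z * indicator {c<..} z) \<in> borel_measurable (lborel \<Otimes>\<^sub>M M)"
      unfolding case_prod_beta' by measurable
  qed
  also have "\<dots> = (\<integral>\<^sup>+\<omega>. \<integral>\<^sup>+z. discount \<beta> z * indicator {c<..} z * (indicator {\<omega>. \<not> exceeds z s \<omega>} \<omega> * ennreal (exp (\<beta> * X s \<omega>))) \<partial>lborel \<partial>M)"
  proof (rule nn_integral_cong)
    fix \<omega> assume \<omega>: "\<omega> \<in> space M"
    have imp: "\<not> exceeds z s \<omega>" if Bz: "B z (\<lambda>l. X (l * s) \<omega>)" for z
    proof -
      obtain m :: nat where m: "\<And>l. l \<in> dyadics 1 \<Longrightarrow> 1 / (real m + 1) \<le> z - X (l * s) \<omega>" using Bz by (auto simp: B_def)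
      have "X (l * s) \<omega> \<le> z" if "l \<in> dyadics 1" for l
      proof -
        have "0 < 1 / (real m + 1)" by simp
        then show ?thesis using m[OF that] by linarith
      qed
      then show ?thesis
        using lsc_path.exceeds_iff[OF lsc_path_X[OF \<omega>] s order_refl, of z] by (auto simp: not_less)
    qed
    have conv: "B z' (\<lambda>l. X (l * s) \<omega>)" if n: "\<not> exceeds z s \<omega>" and z': "z < z'" for z z'
    proof -
      obtain m :: nat where m: "1 / (real m + 1) < z' - z"
        using reals_Archimedean[of "z' - z"] z' by (auto simp: inverse_eq_divide add.commute)
      have "1 / (real m + 1) \<le> z' - X (l * s) \<omega>" if "l \<in> dyadics 1" for l
      proof -
        have "l * s \<in> {0..s}" using dyadics_subset[of 1] that s by (auto simp: mult_left_le_one_le)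
        then show ?thesis using not_exceeds_imp_le[OF \<omega> s n, of "l * s"] m by linarith
      qed
      then show ?thesis unfolding B_def by blast
    qed
    \<comment> \<open>The margin and the plain bound differ at most when z is the supremum of the
      path, that is for one z per path, which is a null set.\<close>
    define Z where "Z = {z. \<not> exceeds z s \<omega> \<and> \<not> B z (\<lambda>l. X (l * s) \<omega>)}"
    have "countable Z"
    proof (cases "Z = {}")
      case False
      then obtain z0 where z0: "z0 \<in> Z" by auto
      have "z = z0" if "z \<in> Z" for z using that z0 conv unfolding Z_def by (metis (mono_tags, lifting) linorder_neqE_linordered_idom mem_Collect_eq)
      then have "Z \<subseteq> {z0}" by auto
      then show ?thesis by (rule countable_subset) simp
    qed simp
    then have "Z \<in> null_sets lborel" by (rule countable_imp_null_set_lborel)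
    then have "AE z in lborel. z \<notin> Z" by (rule AE_not_in)
    then show "(\<integral>\<^sup>+z. discount \<beta> z * ennreal (exp (\<beta> * X s \<omega>)) * indicator {z. B z (\<lambda>l. X (l * s) \<omega>)} z * indicator {c<..} z \<partial>lborel) =
      (\<integral>\<^sup>+z. discount \<beta> z * indicator {c<..} z * (indicator {\<omega>. \<not> exceeds z s \<omega>} \<omega> * ennreal (exp (\<beta> * X s \<omega>))) \<partial>lborel)"
    proof (intro nn_integral_cong_AE, eventually_elim)
      case (elim z)
      then have "B z (\<lambda>l. X (l * s) \<omega>) \<longleftrightarrow> \<not> exceeds z s \<omega>" using imp[of z] unfolding Z_def by blast
      then show ?case by (simp add: indicator_def)
    qed
  qed
  also have "\<dots> = (\<integral>\<^sup>+z. \<integral>\<^sup>+\<omega>. discount \<beta> z * indicator {c<..} z * (indicator {\<omega>. \<not> exceeds z s \<omega>} \<omega> * ennreal (exp (\<beta> * X s \<omega>))) \<partial>M \<partial>lborel)"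
    by (rule L.Fubini') (unfold case_prod_beta', measurable)
  also have "\<dots> = (\<integral>\<^sup>+z\<in>{c<..}. discount \<beta> z * below_mgf \<beta> z s \<partial>lborel)"
  proof (rule nn_integral_cong)
    fix z
    have "(\<integral>\<^sup>+\<omega>. discount \<beta> z * indicator {c<..} z * (indicator {\<omega>. \<not> exceeds z s \<omega>} \<omega> * ennreal (exp (\<beta> * X s \<omega>))) \<partial>M) =
      discount \<beta> z * indicator {c<..} z * below_mgf \<beta> z s"
      unfolding below_mgf_def by (rule nn_integral_cmult) measurable
    then show "(\<integral>\<^sup>+\<omega>. discount \<beta> z * indicator {c<..} z * (indicator {\<omega>. \<not> exceeds z s \<omega>} \<omega> * ennreal (exp (\<beta> * X s \<omega>))) \<partial>M) =
      discount \<beta> z * below_mgf \<beta> z s * indicator {c<..} z" by (simp add: ac_simps)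
  qed
  finally show ?thesis .
qed

definition below_transform :: "real \<Rightarrow> real \<Rightarrow> real \<Rightarrow> ennreal" where
  "below_transform p \<beta> z = laplace p (\<lambda>s. below_mgf \<beta> z s)"

lemma dual_killed_tail:
  assumes c: "0 \<le> c"
  shows "(\<integral>\<^sup>+x\<in>{0..}. discount \<beta> x * killed_tail p x c \<partial>lborel) =
    (\<integral>\<^sup>+z\<in>{c<..}. discount \<beta> z * below_transform p \<beta> z \<partial>lborel)"
proof -
  have pull: "a * (\<integral>\<^sup>+s\<in>{0..}. f s \<partial>lborel) * b = (\<integral>\<^sup>+s. a * b * (f s * indicator {0..} s) \<partial>lborel)"
    if [measurable]: "f \<in> borel_measurable borel" for a b :: ennreal and f :: "real \<Rightarrow> ennreal"
    by (subst nn_integral_cmult) (auto simp: ac_simps)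
  have "(\<integral>\<^sup>+x\<in>{0..}. discount \<beta> x * killed_tail p x c \<partial>lborel) =
    (\<integral>\<^sup>+x. \<integral>\<^sup>+s. discount \<beta> x * indicator {0..} x * (discount p s * stay_prob s x c * indicator {0..} s) \<partial>lborel \<partial>lborel)"
    unfolding killed_tail_def by (intro nn_integral_cong pull) measurable
  also have "\<dots> = (\<integral>\<^sup>+s. \<integral>\<^sup>+x. discount \<beta> x * indicator {0..} x * (discount p s * stay_prob s x c * indicator {0..} s) \<partial>lborel \<partial>lborel)"
    by (rule lborel_pair.Fubini') measurable
  also have "\<dots> = (\<integral>\<^sup>+s. \<integral>\<^sup>+z. discount \<beta> z * indicator {c<..} z * (discount p s * below_mgf \<beta> z s * indicator {0..} s) \<partial>lborel \<partial>lborel)"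
  proof (rule nn_integral_cong_AE)
    have "AE s in lborel. s \<noteq> (0::real)" by (rule AE_lborel_singleton)
    then show "AE s in lborel. (\<integral>\<^sup>+x. discount \<beta> x * indicator {0..} x * (discount p s * stay_prob s x c * indicator {0..} s) \<partial>lborel) =
      (\<integral>\<^sup>+z. discount \<beta> z * indicator {c<..} z * (discount p s * below_mgf \<beta> z s * indicator {0..} s) \<partial>lborel)"
    proof eventually_elim
      case (elim s)
      show ?case
      proof (cases "0 < s")
        case True
        have "(\<integral>\<^sup>+x. discount \<beta> x * indicator {0..} x * (discount p s * stay_prob s x c * indicator {0..} s) \<partial>lborel) =
          (\<integral>\<^sup>+x. discount p s * indicator {0..} s * (discount \<beta> x * stay_prob s x c * indicator {0..} x) \<partial>lborel)"
          by (intro nn_integral_cong) (simp add: ac_simps)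
        also have "\<dots> = discount p s * indicator {0..} s * (\<integral>\<^sup>+x\<in>{0..}. discount \<beta> x * stay_prob s x c \<partial>lborel)"
          by (rule nn_integral_cmult) measurable
        also have "\<dots> = discount p s * indicator {0..} s * (\<integral>\<^sup>+z\<in>{c<..}. discount \<beta> z * below_mgf \<beta> z s \<partial>lborel)"
          by (simp only: dual_stay_prob[OF True c])
        also have "\<dots> = (\<integral>\<^sup>+z. discount p s * indicator {0..} s * (discount \<beta> z * below_mgf \<beta> z s * indicator {c<..} z) \<partial>lborel)"
          by (rule nn_integral_cmult[symmetric]) measurable
        also have "\<dots> = (\<integral>\<^sup>+z. discount \<beta> z * indicator {c<..} z * (discount p s * below_mgf \<beta> z s * indicator {0..} s) \<partial>lborel)"
          by (intro nn_integral_cong) (simp add: ac_simps)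
        finally show ?thesis .
      qed (use elim in simp)
    qed
  qed
  also have "\<dots> = (\<integral>\<^sup>+z. \<integral>\<^sup>+s. discount \<beta> z * indicator {c<..} z * (discount p s * below_mgf \<beta> z s * indicator {0..} s) \<partial>lborel \<partial>lborel)"
    by (rule lborel_pair.Fubini'[symmetric]) measurable
  also have "\<dots> = (\<integral>\<^sup>+z\<in>{c<..}. discount \<beta> z * below_transform p \<beta> z \<partial>lborel)"
    unfolding below_transform_def by (intro nn_integral_cong pull[symmetric]) measurable
  finally show ?thesis .
qed

lemma passage_transform_eq':
  assumes p: "0 < p" and z: "0 < z"
  shows "passage_transform p z = ennreal (exp (- passage_rate p * z))"
proof -
  have "passage_transform p z < \<top>" using passage_transform_le_1[OF p, of z] by (rule le_less_trans) simp
  then have "passage_transform p z = ennreal (enn2real (passage_transform p z))" by simp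
  then show ?thesis unfolding passage_transform_eq[OF p z] .
qed

text \<open>For p > \<psi>(\<beta>) the transform of the whole resolvent is finite, namely 1 / (p -
  \<psi>(\<beta>)). The part after the first passage of z is, by the strong Markov property, the
  same quantity times exp (- \<Phi>(p) z) exp (\<beta> z), and is subtracted.\<close>

lemma below_transform_supercritical:
  assumes p: "0 < p" and b: "0 \<le> \<beta>" "laplace_exponent M X \<beta> < p" and z: "0 < z"
  shows "below_transform p \<beta> z = ennreal ((1 - exp ((\<beta> - passage_rate p) * z)) / (p - laplace_exponent M X \<beta>))"
proof -
  interpret L: pair_sigma_finite M lborel ..
  define \<psi> where "\<psi> = laplace_exponent M X \<beta>"
  have lt: "\<beta> < passage_rate p" using laplace_exponent_less_iff[OF p b(1)] b(2) by simp
  note pt = passage_transform_eq'[OF p z]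
  have bt: "below_transform p \<beta> z = (\<integral>\<^sup>+\<omega>. (\<integral>\<^sup>+t. discount p t * indicator {0..} t * (indicator {\<omega>. \<not> exceeds z t \<omega>} \<omega> * ennreal (exp (\<beta> * X t \<omega>))) \<partial>lborel) \<partial>M)"
  proof -
    have "below_transform p \<beta> z = (\<integral>\<^sup>+t. \<integral>\<^sup>+\<omega>. discount p t * indicator {0..} t * (indicator {\<omega>. \<not> exceeds z t \<omega>} \<omega> * ennreal (exp (\<beta> * X t \<omega>))) \<partial>M \<partial>lborel)"
    proof -
      have "(\<integral>\<^sup>+\<omega>. discount p t * indicator {0..} t * (indicator {\<omega>. \<not> exceeds z t \<omega>} \<omega> * ennreal (exp (\<beta> * X t \<omega>))) \<partial>M) =
        discount p t * indicator {0..} t * below_mgf \<beta> z t" for t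
        unfolding below_mgf_def by (rule nn_integral_cmult) measurable
      then show ?thesis unfolding below_transform_def by (simp only: ac_simps)
    qed
    also have "\<dots> = (\<integral>\<^sup>+\<omega>. (\<integral>\<^sup>+t. discount p t * indicator {0..} t * (indicator {\<omega>. \<not> exceeds z t \<omega>} \<omega> * ennreal (exp (\<beta> * X t \<omega>))) \<partial>lborel) \<partial>M)"
      by (rule L.Fubini') (unfold case_prod_beta', measurable)
    finally show ?thesis .
  qed
  have tot: "(\<integral>\<^sup>+y. ennreal (exp (\<beta> * y)) \<partial>resolvent p) = (\<integral>\<^sup>+\<omega>. laplace p (\<lambda>t. ennreal (exp (\<beta> * X t \<omega>))) \<partial>M)"
  proof -
    have "(\<integral>\<^sup>+y. ennreal (exp (\<beta> * y)) \<partial>resolvent p) = (\<integral>\<^sup>+t. \<integral>\<^sup>+\<omega>. discount p t * ennreal (exp (\<beta> * X t \<omega>)) * indicator {0..} t \<partial>M \<partial>lborel)"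
      unfolding nn_integral_resolvent_exp mgf_def
      by (intro nn_integral_cong) (subst nn_integral_multc, auto simp: nn_integral_cmult)
    also have "\<dots> = (\<integral>\<^sup>+\<omega>. laplace p (\<lambda>t. ennreal (exp (\<beta> * X t \<omega>))) \<partial>M)"
      by (rule L.Fubini') (unfold case_prod_beta', measurable)
    finally show ?thesis .
  qed
  have [measurable]: "(\<lambda>y. indicator {t. exceeds z t (fst y)} (snd y) :: ennreal) \<in> borel_measurable (M \<Otimes>\<^sub>M lborel)"
    using indicator_exceeds_measurable[of z] by (simp cong: measurable_cong_sets)
  have "below_transform p \<beta> z + passage_transform p z * (\<integral>\<^sup>+y. ennreal (exp (\<beta> * (z + y))) \<partial>resolvent p) =
    (\<integral>\<^sup>+y. ennreal (exp (\<beta> * y)) \<partial>resolvent p)"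
  proof -
    have "below_transform p \<beta> z + passage_transform p z * (\<integral>\<^sup>+y. ennreal (exp (\<beta> * (z + y))) \<partial>resolvent p) =
      (\<integral>\<^sup>+\<omega>. (\<integral>\<^sup>+t. discount p t * indicator {0..} t * (indicator {\<omega>. \<not> exceeds z t \<omega>} \<omega> * ennreal (exp (\<beta> * X t \<omega>))) \<partial>lborel) +
        laplace p (\<lambda>t. indicator {t. exceeds z t \<omega>} t * ennreal (exp (\<beta> * X t \<omega>))) \<partial>M)"
      unfolding bt by (subst strong_markov[OF p z, symmetric], measurable)
        (rule nn_integral_add[symmetric]; rule lborel.borel_measurable_nn_integral; unfold case_prod_beta'; measurable)
    also have "\<dots> = (\<integral>\<^sup>+\<omega>. laplace p (\<lambda>t. ennreal (exp (\<beta> * X t \<omega>))) \<partial>M)"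
    proof (rule nn_integral_cong)
      fix \<omega> assume [measurable]: "\<omega> \<in> space M"
      have [measurable]: "(\<lambda>t. indicator {t. exceeds z t \<omega>} t :: ennreal) \<in> borel_measurable lborel"
        by (rule borel_measurable_indicator') measurable
      have "(\<integral>\<^sup>+t. discount p t * indicator {0..} t * (indicator {\<omega>. \<not> exceeds z t \<omega>} \<omega> * ennreal (exp (\<beta> * X t \<omega>))) \<partial>lborel) +
        laplace p (\<lambda>t. indicator {t. exceeds z t \<omega>} t * ennreal (exp (\<beta> * X t \<omega>))) =
        (\<integral>\<^sup>+t. discount p t * indicator {0..} t * (indicator {\<omega>. \<not> exceeds z t \<omega>} \<omega> * ennreal (exp (\<beta> * X t \<omega>))) +
          discount p t * (indicator {t. exceeds z t \<omega>} t * ennreal (exp (\<beta> * X t \<omega>))) * indicator {0..} t \<partial>lborel)"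
        by (rule nn_integral_add[symmetric]) measurable
      also have "\<dots> = laplace p (\<lambda>t. ennreal (exp (\<beta> * X t \<omega>)))"
        by (intro nn_integral_cong) (simp add: indicator_def)
      finally show "(\<integral>\<^sup>+t. discount p t * indicator {0..} t * (indicator {\<omega>. \<not> exceeds z t \<omega>} \<omega> * ennreal (exp (\<beta> * X t \<omega>))) \<partial>lborel) +
        laplace p (\<lambda>t. indicator {t. exceeds z t \<omega>} t * ennreal (exp (\<beta> * X t \<omega>))) =
        laplace p (\<lambda>t. ennreal (exp (\<beta> * X t \<omega>)))" .
    qed
    finally show ?thesis unfolding tot .
  qed
  moreover have "(\<integral>\<^sup>+y. ennreal (exp (\<beta> * (z + y))) \<partial>resolvent p) = ennreal (exp (\<beta> * z)) * ennreal (1 / (p - \<psi>))"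
    unfolding \<psi>_def nn_integral_resolvent_exp_eq[OF b, symmetric]
    by (subst nn_integral_cmult[symmetric]) (auto simp: distrib_left exp_add ennreal_mult)
  ultimately have eq: "below_transform p \<beta> z + ennreal (exp ((\<beta> - passage_rate p) * z) / (p - \<psi>)) = ennreal (1 / (p - \<psi>))"
    unfolding nn_integral_resolvent_exp_eq[OF b] pt using b(2)
    by (simp add: \<psi>_def ennreal_mult[symmetric] mult.assoc[symmetric] exp_add[symmetric] algebra_simps)
  have "below_transform p \<beta> z = ennreal (1 / (p - \<psi>)) - ennreal (exp ((\<beta> - passage_rate p) * z) / (p - \<psi>))"
    unfolding eq[symmetric] by simp
  also have "\<dots> = ennreal (1 / (p - \<psi>) - exp ((\<beta> - passage_rate p) * z) / (p - \<psi>))"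
    using b(2) by (intro ennreal_minus) (simp add: \<psi>_def)
  finally show ?thesis by (simp add: \<psi>_def diff_divide_distrib)
qed

lemma laplace_exceeds:
  assumes p: "0 < p" and z: "0 < z"
  shows "laplace p (\<lambda>t. emeasure M {\<omega>\<in>space M. exceeds z t \<omega>}) =
    ennreal (exp (- passage_rate p * z) / p)"
proof -
  define I where "I = laplace p (\<lambda>t. emeasure M {\<omega>\<in>space M. exceeds z t \<omega>})"
  have pI: "ennreal p * I = ennreal (exp (- passage_rate p * z))"
    using passage_transform_eq'[OF p z] by (simp only: passage_transform_def I_def)
  have "I = ennreal (1 / p * p) * I" using p by simp
  also have "\<dots> = ennreal (1 / p) * (ennreal p * I)"
    using p by (subst ennreal_mult) (auto simp: mult.assoc)
  also have "\<dots> = ennreal (1 / p * exp (- passage_rate p * z))"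
    unfolding pI using p by (intro ennreal_mult[symmetric]) auto
  finally show ?thesis by (simp add: I_def)
qed

text \<open>Substituting r = t + u, the kernel is the convolution of the two exponentials on
  [0, r].\<close>

lemma laplace_convolution:
  fixes F :: "real \<Rightarrow> ennreal"
  assumes [measurable]: "F \<in> borel_measurable borel" and ps: "p \<noteq> s"
  shows "laplace p (\<lambda>t. laplace s (\<lambda>u. F (t + u))) =
    (\<integral>\<^sup>+r\<in>{0..}. ennreal ((exp (- s * r) - exp (- p * r)) / (p - s)) * F r \<partial>lborel)"
proof -
  have "laplace p (\<lambda>t. laplace s (\<lambda>u. F (t + u))) =
    (\<integral>\<^sup>+t. \<integral>\<^sup>+r. ennreal (exp (- p * t) * exp (- s * (r - t))) * indicator {0..r} t * (F r * indicator {0..} r) \<partial>lborel \<partial>lborel)"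
  proof (rule nn_integral_cong)
    fix t :: real
    have "laplace s (\<lambda>u. F (t + u)) =
      (\<integral>\<^sup>+r. ennreal (exp (- s * (- t + r))) * F (t + (- t + r)) * indicator {0..} (- t + r) \<partial>lborel)"
      by (subst nn_integral_real_affine[of _ 1 "- t"]) auto
    then have "discount p t * laplace s (\<lambda>u. F (t + u)) * indicator {0..} t =
      discount p t * indicator {0..} t * (\<integral>\<^sup>+r. ennreal (exp (- s * (- t + r))) * F (t + (- t + r)) * indicator {0..} (- t + r) \<partial>lborel)"
      by (simp only: ac_simps)
    also have "\<dots> = (\<integral>\<^sup>+r. discount p t * indicator {0..} t * (ennreal (exp (- s * (- t + r))) * F (t + (- t + r)) * indicator {0..} (- t + r)) \<partial>lborel)"
      by (rule nn_integral_cmult[symmetric]) measurable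
    also have "\<dots> = (\<integral>\<^sup>+r. ennreal (exp (- p * t) * exp (- s * (r - t))) * indicator {0..r} t * (F r * indicator {0..} r) \<partial>lborel)"
      by (intro nn_integral_cong) (auto simp: indicator_def ennreal_mult mult.assoc)
    finally show "discount p t * laplace s (\<lambda>u. F (t + u)) * indicator {0..} t = \<dots>" .
  qed
  also have "\<dots> = (\<integral>\<^sup>+r. \<integral>\<^sup>+t. ennreal (exp (- p * t) * exp (- s * (r - t))) * indicator {0..r} t * (F r * indicator {0..} r) \<partial>lborel \<partial>lborel)"
  proof (rule lborel_pair.Fubini')
    have [measurable]: "(\<lambda>y. indicator {0..fst y} (snd y) :: ennreal) \<in> borel_measurable ((lborel :: real measure) \<Otimes>\<^sub>M lborel)"
    proof -
      have "(\<lambda>y. indicator {0..fst y} (snd y) :: ennreal) = (\<lambda>y. indicator {y. 0 \<le> snd y \<and> snd y \<le> fst y} y)"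
        by (auto simp: indicator_def)
      also have "\<dots> \<in> borel_measurable ((lborel :: real measure) \<Otimes>\<^sub>M lborel)"
        by (rule borel_measurable_indicator') measurable
      finally show ?thesis .
    qed
    show "(\<lambda>(r, t). ennreal (exp (- p * t) * exp (- s * (r - t))) * indicator {0..r} t * (F r * indicator {0..} r)) \<in> borel_measurable (lborel \<Otimes>\<^sub>M lborel)"
      unfolding case_prod_beta' by measurable
  qed
  also have "\<dots> = (\<integral>\<^sup>+r\<in>{0..}. ennreal ((exp (- s * r) - exp (- p * r)) / (p - s)) * F r \<partial>lborel)"
  proof (rule nn_integral_cong)
    fix r :: real
    have "(\<integral>\<^sup>+t. ennreal (exp (- p * t) * exp (- s * (r - t))) * indicator {0..r} t * (F r * indicator {0..} r) \<partial>lborel) =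
      (\<integral>\<^sup>+t. ennreal (exp (- p * t) * exp (- s * (r - t))) * indicator {0..r} t \<partial>lborel) * (F r * indicator {0..} r)"
      by (rule nn_integral_multc) measurable
    also have "\<dots> = ennreal ((exp (- s * r) - exp (- p * r)) / (p - s)) * F r * indicator {0..} r"
      using nn_integral_exp_convolution[OF ps, of r] by (cases "0 \<le> r") (simp_all add: mult.assoc)
    finally show "(\<integral>\<^sup>+t. ennreal (exp (- p * t) * exp (- s * (r - t))) * indicator {0..r} t * (F r * indicator {0..} r) \<partial>lborel) = \<dots>" .
  qed
  finally show ?thesis .
qed

text \<open>The kernel (exp (- s r) - exp (- p r)) / (p - s) is symmetric in p and s, so the case s
  < p is enough; there the integral is the difference of two known transforms divided by p -
  s.\<close>

lemma laplace_exceeds_convolution: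
  assumes p: "0 < p" and s: "0 < s" and ps: "p \<noteq> s" and z: "0 < z"
  shows "laplace p (\<lambda>t. laplace s (\<lambda>u. emeasure M {\<omega>\<in>space M. exceeds z (t + u) \<omega>})) =
    ennreal ((exp (- passage_rate s * z) / s - exp (- passage_rate p * z) / p) / (p - s))"
proof -
  define F where "F t = emeasure M {\<omega>\<in>space M. exceeds z t \<omega>}" for t
  have [measurable]: "F \<in> borel_measurable borel" unfolding F_def by measurable
  define J where "J a b = (\<integral>\<^sup>+r\<in>{0..}. ennreal ((exp (- b * r) - exp (- a * r)) / (a - b)) * F r \<partial>lborel)" for a b
  have L: "laplace a F = ennreal (exp (- passage_rate a * z) / a)" if "0 < a" for a
    unfolding F_def by (rule laplace_exceeds[OF that z])
  have J: "J a b = ennreal ((exp (- passage_rate b * z) / b - exp (- passage_rate a * z) / a) / (a - b))"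
    if ab: "0 < b" "b < a" for a b
  proof -
    have "ennreal (a - b) * J a b + laplace a F =
      (\<integral>\<^sup>+r. ennreal (a - b) * (ennreal ((exp (- b * r) - exp (- a * r)) / (a - b)) * F r * indicator {0..} r) + discount a r * F r * indicator {0..} r \<partial>lborel)"
      unfolding J_def by (subst nn_integral_add) (auto simp: nn_integral_cmult)
    also have "\<dots> = laplace b F"
    proof (rule nn_integral_cong)
      fix r :: real
      show "ennreal (a - b) * (ennreal ((exp (- b * r) - exp (- a * r)) / (a - b)) * F r * indicator {0..} r) + discount a r * F r * indicator {0..} r =
        discount b r * F r * indicator {0..} r"
      proof (cases "0 \<le> r")
        case True
        then have le: "exp (- a * r) \<le> exp (- b * r)" using ab by (simp add: mult_right_mono)
        have "ennreal (a - b) * ennreal ((exp (- b * r) - exp (- a * r)) / (a - b)) + discount a r = discount b r"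
          using ab le by (simp add: ennreal_mult[symmetric] ennreal_plus[symmetric] del: ennreal_plus)
        then show ?thesis using True by (simp add: mult.assoc[symmetric] distrib_right[symmetric])
      qed simp
    qed
    finally have eq: "ennreal (a - b) * J a b + ennreal (exp (- passage_rate a * z) / a) = ennreal (exp (- passage_rate b * z) / b)"
      using ab by (simp only: L less_trans[OF ab])
    have "ennreal (a - b) * J a b = ennreal (exp (- passage_rate b * z) / b) - ennreal (exp (- passage_rate a * z) / a)"
      unfolding eq[symmetric] by simp
    also have "\<dots> = ennreal (exp (- passage_rate b * z) / b - exp (- passage_rate a * z) / a)"
      using ab by (intro ennreal_minus) auto
    finally have "ennreal (1 / (a - b)) * (ennreal (a - b) * J a b) = ennreal (1 / (a - b)) * ennreal (exp (- passage_rate b * z) / b - exp (- passage_rate a * z) / a)"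
      by simp
    then show ?thesis using ab
      by (simp add: mult.assoc[symmetric] ennreal_mult[symmetric] ennreal_mult'[symmetric])
  qed
  have sym: "J p s = J s p"
  proof -
    have "(a - b) / (p - s) = (b - a) / (s - p)" for a b :: real by (metis minus_diff_eq minus_divide_divide)
    then show ?thesis unfolding J_def by simp
  qed
  show ?thesis
    unfolding F_def[symmetric] laplace_convolution[OF \<open>F \<in> borel_measurable borel\<close> ps] J_def[symmetric]
  proof (cases "s < p")
    case False
    then have "p < s" using ps by simp
    then have "J p s = ennreal ((exp (- passage_rate p * z) / p - exp (- passage_rate s * z) / s) / (s - p))"
      using J[OF p] sym by simp
    also have "(exp (- passage_rate p * z) / p - exp (- passage_rate s * z) / s) / (s - p) =
      (exp (- passage_rate s * z) / s - exp (- passage_rate p * z) / p) / (p - s)"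
      by (metis minus_diff_eq minus_divide_divide)
    finally show "J p s = ennreal ((exp (- passage_rate s * z) / s - exp (- passage_rate p * z) / p) / (p - s))" .
  qed (use J[OF s] in simp)
qed

text \<open>With T the first passage time above z, the right-hand side is exp (\<beta> z) times the
  expectation of exp (- \<psi>(\<beta>) (T - t)^+) on T < \<infinity>. The identity thus says that
  E(exp (\<beta> X_t); t \<le> T) equals E(exp (\<beta> z - \<psi>(\<beta>) (T - t)); t \<le> T <
  \<infinity>), which is optional stopping. It is obtained by inverting Laplace transforms in t that
  are known for p > \<psi>(\<beta>), and it no longer contains p, which opens the range p <
  \<psi>(\<beta>).\<close>

lemma AE_below_mgf:
  assumes b: "0 \<le> \<beta>" "0 < laplace_exponent M X \<beta>" and z: "0 < z"
  shows "AE t in lborel. 0 \<le> t \<longrightarrow>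
    below_mgf \<beta> z t + ennreal (exp (\<beta> * z)) * emeasure M {\<omega>\<in>space M. exceeds z t \<omega>} =
    ennreal (exp (\<beta> * z) * laplace_exponent M X \<beta>) * laplace (laplace_exponent M X \<beta>) (\<lambda>u. emeasure M {\<omega>\<in>space M. exceeds z (t + u) \<omega>})"
proof -
  define \<psi> where "\<psi> = laplace_exponent M X \<beta>"
  define F where "F t = emeasure M {\<omega>\<in>space M. exceeds z t \<omega>}" for t
  have [measurable]: "F \<in> borel_measurable borel" unfolding F_def by measurable
  define G where "G t = laplace \<psi> (\<lambda>u. F (t + u))" for t
  have [measurable]: "G \<in> borel_measurable borel" unfolding G_def by measurable
  have psi: "0 < \<psi>" using b by (simp add: \<psi>_def)
  \<comment> \<open>As \<psi>(\<beta>) > 0, \<beta> is the root at this level, so discounting T at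
    rate \<psi>(\<beta>) gives exp (- \<beta> z).\<close>
  have beta: "passage_rate \<psi> = \<beta>" unfolding \<psi>_def by (rule passage_rate_unique[OF b(2,1) refl])
  have lhs: "laplace p (\<lambda>t. below_mgf \<beta> z t + ennreal (exp (\<beta> * z)) * F t) =
    below_transform p \<beta> z + ennreal (exp (\<beta> * z)) * laplace p F" for p
  proof -
    have "laplace p (\<lambda>t. below_mgf \<beta> z t + ennreal (exp (\<beta> * z)) * F t) =
      (\<integral>\<^sup>+t. discount p t * below_mgf \<beta> z t * indicator {0..} t + ennreal (exp (\<beta> * z)) * (discount p t * F t * indicator {0..} t) \<partial>lborel)"
      by (intro nn_integral_cong) (simp add: distrib_left distrib_right ac_simps)
    then show ?thesis unfolding below_transform_def by (simp add: nn_integral_add nn_integral_cmult)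
  qed
  have eq: "laplace p (\<lambda>t. below_mgf \<beta> z t + ennreal (exp (\<beta> * z)) * F t) =
    ennreal (exp (\<beta> * z) * \<psi> * ((exp (- \<beta> * z) / \<psi> - exp (- passage_rate p * z) / p) / (p - \<psi>)))"
    (is "?L = ennreal ?r") and eq2: "laplace p (\<lambda>t. ennreal (exp (\<beta> * z) * \<psi>) * G t) =
    ennreal (exp (\<beta> * z) * \<psi> * ((exp (- \<beta> * z) / \<psi> - exp (- passage_rate p * z) / p) / (p - \<psi>)))"
    if p: "\<psi> < p" for p
  proof -
    have p0: "0 < p" using p psi by simp
    have lt: "\<beta> < passage_rate p" using laplace_exponent_less_iff[OF p0 b(1)] p by (simp add: \<psi>_def)
    have nn: "0 \<le> (1 - exp ((\<beta> - passage_rate p) * z)) / (p - \<psi>)"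
      using lt p z by (intro divide_nonneg_pos) (auto simp: mult_nonpos_nonneg)
    have "?L = ennreal ((1 - exp ((\<beta> - passage_rate p) * z)) / (p - \<psi>)) + ennreal (exp (\<beta> * z)) * ennreal (exp (- passage_rate p * z) / p)"
      using below_transform_supercritical[OF p0 b(1) _ z] laplace_exceeds[OF p0 z] p
      unfolding lhs by (simp add: \<psi>_def F_def)
    also have "\<dots> = ennreal ((1 - exp ((\<beta> - passage_rate p) * z)) / (p - \<psi>) + exp (\<beta> * z) * (exp (- passage_rate p * z) / p))"
      using nn p0 by (simp add: ennreal_mult[symmetric] ennreal_plus[symmetric] del: ennreal_plus)
    also have "(1 - exp ((\<beta> - passage_rate p) * z)) / (p - \<psi>) + exp (\<beta> * z) * (exp (- passage_rate p * z) / p) = ?r"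
    proof -
      define E where "E = exp (\<beta> * z)"
      define Q where "Q = exp (- passage_rate p * z)"
      have E: "0 < E" "exp (- \<beta> * z) = 1 / E" "exp ((\<beta> - passage_rate p) * z) = E * Q"
        by (simp add: E_def, simp add: E_def exp_minus inverse_eq_divide, simp add: E_def Q_def exp_add[symmetric] algebra_simps)
      show ?thesis unfolding E(2,3) E_def[symmetric] Q_def[symmetric] using E(1) p p0 psi
        by (simp add: field_simps)
    qed
    finally show "?L = ennreal ?r" .
    have "laplace p (\<lambda>t. ennreal (exp (\<beta> * z) * \<psi>) * G t) =
      (\<integral>\<^sup>+t. ennreal (exp (\<beta> * z) * \<psi>) * (discount p t * G t * indicator {0..} t) \<partial>lborel)"
      by (intro nn_integral_cong) (simp add: ac_simps)
    also have "\<dots> = ennreal (exp (\<beta> * z) * \<psi>) * laplace p G"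
      by (rule nn_integral_cmult) measurable
    also have "laplace p G =
      ennreal ((exp (- \<beta> * z) / \<psi> - exp (- passage_rate p * z) / p) / (p - \<psi>))"
      unfolding G_def F_def using laplace_exceeds_convolution[OF p0 psi _ z] p by (simp add: beta)
    also have "ennreal (exp (\<beta> * z) * \<psi>) * \<dots> = ennreal ?r"
      using psi by (intro ennreal_mult'[symmetric]) simp
    finally show "laplace p (\<lambda>t. ennreal (exp (\<beta> * z) * \<psi>) * G t) = ennreal ?r" .
  qed
  have "AE t in lborel. 0 \<le> t \<longrightarrow> below_mgf \<beta> z t + ennreal (exp (\<beta> * z)) * F t = ennreal (exp (\<beta> * z) * \<psi>) * G t"
  proof (rule laplace_unique_AE[of _ _ \<psi>])
    fix p assume p: "\<psi> < p"
    show "laplace p (\<lambda>t. below_mgf \<beta> z t + ennreal (exp (\<beta> * z)) * F t) < \<infinity>"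
      unfolding eq[OF p] by simp
    show "laplace p (\<lambda>t. below_mgf \<beta> z t + ennreal (exp (\<beta> * z)) * F t) =
      laplace p (\<lambda>t. ennreal (exp (\<beta> * z) * \<psi>) * G t)"
      unfolding eq[OF p] eq2[OF p] ..
  qed measurable
  then show ?thesis by (simp add: F_def G_def \<psi>_def)
qed

text \<open>The transform of the whole resolvent is infinite here, so the part after the passage
  cannot be subtracted from it. Instead the identity in time is transformed at the small rate
  p.\<close>

lemma below_transform_subcritical:
  assumes p: "0 < p" and b: "passage_rate p < \<beta>" and z: "0 < z"
  shows "below_transform p \<beta> z = ennreal ((exp ((\<beta> - passage_rate p) * z) - 1) / (laplace_exponent M X \<beta> - p))"
    and "p < laplace_exponent M X \<beta>"
proof -
  define \<psi> where "\<psi> = laplace_exponent M X \<beta>"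
  have b0: "0 \<le> \<beta>" using passage_rate_pos[OF p] b by simp
  have "\<not> \<psi> < p" using laplace_exponent_less_iff[OF p b0] b by (simp add: \<psi>_def)
  moreover have "\<psi> \<noteq> p" using passage_rate_unique[OF p b0] b by (auto simp: \<psi>_def)
  ultimately have psi: "p < \<psi>" by simp
  then show "p < laplace_exponent M X \<beta>" by (simp add: \<psi>_def)
  have psi0: "0 < \<psi>" using p psi by simp
  have beta: "passage_rate \<psi> = \<beta>" unfolding \<psi>_def by (rule passage_rate_unique[OF _ b0 refl]) (use psi0 in \<open>simp add: \<psi>_def\<close>)
  define F where "F t = emeasure M {\<omega>\<in>space M. exceeds z t \<omega>}" for t
  have [measurable]: "F \<in> borel_measurable borel" unfolding F_def by measurable
  define G where "G t = laplace \<psi> (\<lambda>u. F (t + u))" for t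
  have [measurable]: "G \<in> borel_measurable borel" unfolding G_def by measurable
  have AE: "AE t in lborel. 0 \<le> t \<longrightarrow> below_mgf \<beta> z t + ennreal (exp (\<beta> * z)) * F t = ennreal (exp (\<beta> * z) * \<psi>) * G t"
    using AE_below_mgf[OF b0 _ z] psi0 unfolding \<psi>_def[symmetric] F_def[symmetric] G_def[symmetric] by simp
  have "below_transform p \<beta> z + ennreal (exp (\<beta> * z)) * laplace p F =
    (\<integral>\<^sup>+t. discount p t * below_mgf \<beta> z t * indicator {0..} t + ennreal (exp (\<beta> * z)) * (discount p t * F t * indicator {0..} t) \<partial>lborel)"
    unfolding below_transform_def by (simp add: nn_integral_add nn_integral_cmult)
  also have "(\<integral>\<^sup>+t. discount p t * below_mgf \<beta> z t * indicator {0..} t + ennreal (exp (\<beta> * z)) * (discount p t * F t * indicator {0..} t) \<partial>lborel) =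
    (\<integral>\<^sup>+t. ennreal (exp (\<beta> * z) * \<psi>) * (discount p t * G t * indicator {0..} t) \<partial>lborel)"
  proof (rule nn_integral_cong_AE)
    show "AE t in lborel. discount p t * below_mgf \<beta> z t * indicator {0..} t + ennreal (exp (\<beta> * z)) * (discount p t * F t * indicator {0..} t) =
      ennreal (exp (\<beta> * z) * \<psi>) * (discount p t * G t * indicator {0..} t)"
      using AE
    proof (rule AE_mp, intro AE_I2 impI)
      fix t assume *: "0 \<le> t \<longrightarrow> below_mgf \<beta> z t + ennreal (exp (\<beta> * z)) * F t = ennreal (exp (\<beta> * z) * \<psi>) * G t"
      have "discount p t * below_mgf \<beta> z t * indicator {0..} t + ennreal (exp (\<beta> * z)) * (discount p t * F t * indicator {0..} t) =
        discount p t * indicator {0..} t * (below_mgf \<beta> z t + ennreal (exp (\<beta> * z)) * F t)"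
        by (simp add: distrib_left ac_simps)
      also have "\<dots> = discount p t * indicator {0..} t * (ennreal (exp (\<beta> * z) * \<psi>) * G t)"
        using * by (simp add: indicator_def)
      finally show "discount p t * below_mgf \<beta> z t * indicator {0..} t + ennreal (exp (\<beta> * z)) * (discount p t * F t * indicator {0..} t) =
        ennreal (exp (\<beta> * z) * \<psi>) * (discount p t * G t * indicator {0..} t)" by (simp add: ac_simps)
    qed
  qed
  also have "\<dots> = ennreal (exp (\<beta> * z) * \<psi>) * laplace p G"
    by (rule nn_integral_cmult) measurable
  also have "laplace p G =
    ennreal ((exp (- \<beta> * z) / \<psi> - exp (- passage_rate p * z) / p) / (p - \<psi>))"
    unfolding G_def F_def using laplace_exceeds_convolution[OF p psi0 _ z] psi by (simp add: beta)
  also have "laplace p F = ennreal (exp (- passage_rate p * z) / p)"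
    unfolding F_def by (rule laplace_exceeds[OF p z])
  also have "ennreal (exp (\<beta> * z)) * ennreal (exp (- passage_rate p * z) / p) = ennreal (exp (\<beta> * z) * (exp (- passage_rate p * z) / p))"
    by (intro ennreal_mult'[symmetric]) simp
  also have "ennreal (exp (\<beta> * z) * \<psi>) * ennreal ((exp (- \<beta> * z) / \<psi> - exp (- passage_rate p * z) / p) / (p - \<psi>)) =
    ennreal (exp (\<beta> * z) * \<psi> * ((exp (- \<beta> * z) / \<psi> - exp (- passage_rate p * z) / p) / (p - \<psi>)))"
    using psi0 by (intro ennreal_mult'[symmetric]) simp
  finally have eq: "below_transform p \<beta> z + ennreal (exp (\<beta> * z) * (exp (- passage_rate p * z) / p)) =
    ennreal (exp (\<beta> * z) * \<psi> * ((exp (- \<beta> * z) / \<psi> - exp (- passage_rate p * z) / p) / (p - \<psi>)))" .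
  have "below_transform p \<beta> z = ennreal (exp (\<beta> * z) * \<psi> * ((exp (- \<beta> * z) / \<psi> - exp (- passage_rate p * z) / p) / (p - \<psi>))) -
    ennreal (exp (\<beta> * z) * (exp (- passage_rate p * z) / p))"
    unfolding eq[symmetric] by simp
  also have "\<dots> = ennreal (exp (\<beta> * z) * \<psi> * ((exp (- \<beta> * z) / \<psi> - exp (- passage_rate p * z) / p) / (p - \<psi>)) - exp (\<beta> * z) * (exp (- passage_rate p * z) / p))"
    using p by (intro ennreal_minus) simp
  also have "exp (\<beta> * z) * \<psi> * ((exp (- \<beta> * z) / \<psi> - exp (- passage_rate p * z) / p) / (p - \<psi>)) - exp (\<beta> * z) * (exp (- passage_rate p * z) / p) =
    (exp ((\<beta> - passage_rate p) * z) - 1) / (\<psi> - p)"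
  proof -
    define E where "E = exp (\<beta> * z)"
    define Q where "Q = exp (- passage_rate p * z)"
    have E: "0 < E" "exp (- \<beta> * z) = 1 / E" "exp ((\<beta> - passage_rate p) * z) = E * Q"
      by (simp add: E_def, simp add: E_def exp_minus inverse_eq_divide, simp add: E_def Q_def exp_add[symmetric] algebra_simps)
    have nz: "p \<noteq> 0" "\<psi> \<noteq> 0" "p - \<psi> \<noteq> 0" "\<psi> - p \<noteq> 0" "E \<noteq> 0" using p psi psi0 E(1) by auto
    show ?thesis unfolding E(2,3) E_def[symmetric] Q_def[symmetric] using nz
      by (simp add: divide_simps) (simp add: algebra_simps)
  qed
  finally show "below_transform p \<beta> z = ennreal ((exp ((\<beta> - passage_rate p) * z) - 1) / (laplace_exponent M X \<beta> - p))"
    by (simp add: \<psi>_def)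
qed

text \<open>The two ranges of \<beta> yield one formula, as the signs of numerator and denominator
  change together. The range \<beta> < \<Phi>(p) serves the identification of the excursion measure,
  the range \<beta> > \<Phi>(p) the comparison with W; at \<beta> = \<Phi>(p) the quotient is 0 /
  0.\<close>

lemma laplace_killed_tail:
  assumes p: "0 < p" and b: "0 < \<beta>" "\<beta> \<noteq> passage_rate p" and c: "0 \<le> c"
  shows "(\<integral>\<^sup>+x\<in>{0..}. discount \<beta> x * killed_tail p x c \<partial>lborel) =
    ennreal ((exp (- \<beta> * c) / \<beta> - exp (- passage_rate p * c) / passage_rate p) / (p - laplace_exponent M X \<beta>))"
proof (cases "\<beta> < passage_rate p")
  case True
  define d where "d = p - laplace_exponent M X \<beta>"
  have lt: "laplace_exponent M X \<beta> < p" using laplace_exponent_less_iff[OF p, of \<beta>] b True by simp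
  have d: "0 < d" using lt by (simp add: d_def)
  have "(\<integral>\<^sup>+z\<in>{c<..}. discount \<beta> z * below_transform p \<beta> z \<partial>lborel) =
    (\<integral>\<^sup>+z\<in>{c<..}. ennreal (1 / d * (exp (- \<beta> * z) - exp (- passage_rate p * z))) \<partial>lborel)"
  proof (rule nn_integral_cong)
    fix z
    have "exp (- \<beta> * z) * exp ((\<beta> - passage_rate p) * z) = exp (- passage_rate p * z)"
      by (simp add: exp_add[symmetric] algebra_simps)
    then have e: "exp (- \<beta> * z) * ((1 - exp ((\<beta> - passage_rate p) * z)) / d) = 1 / d * (exp (- \<beta> * z) - exp (- passage_rate p * z))"
      by (simp add: right_diff_distrib diff_divide_distrib)
    have "discount \<beta> z * ennreal ((1 - exp ((\<beta> - passage_rate p) * z)) / d) =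
      ennreal (1 / d * (exp (- \<beta> * z) - exp (- passage_rate p * z)))"
      unfolding e[symmetric] by (intro ennreal_mult'[symmetric]) simp
    then show "discount \<beta> z * below_transform p \<beta> z * indicator {c<..} z =
      ennreal (1 / d * (exp (- \<beta> * z) - exp (- passage_rate p * z))) * indicator {c<..} z"
      using below_transform_supercritical[OF p less_imp_le[OF b(1)] lt, of z] c
      unfolding d_def by (cases "c < z") simp_all
  qed
  then show ?thesis
    unfolding dual_killed_tail[OF c] using nn_integral_exp_diff[OF b(1) less_imp_le[OF True] _ c, of "1 / d"] d
    by (simp add: d_def)
next
  case False
  then have l: "passage_rate p < \<beta>" using b by simp
  define d where "d = laplace_exponent M X \<beta> - p"
  have d: "0 < d" using below_transform_subcritical(2)[OF p l zero_less_one] by (simp add: d_def)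
  have "(\<integral>\<^sup>+z\<in>{c<..}. discount \<beta> z * below_transform p \<beta> z \<partial>lborel) =
    (\<integral>\<^sup>+z\<in>{c<..}. ennreal (1 / d * (exp (- passage_rate p * z) - exp (- \<beta> * z))) \<partial>lborel)"
  proof (rule nn_integral_cong)
    fix z
    have "exp (- \<beta> * z) * exp ((\<beta> - passage_rate p) * z) = exp (- passage_rate p * z)"
      by (simp add: exp_add[symmetric] algebra_simps)
    then have e: "exp (- \<beta> * z) * ((exp ((\<beta> - passage_rate p) * z) - 1) / d) = 1 / d * (exp (- passage_rate p * z) - exp (- \<beta> * z))"
      by (simp add: right_diff_distrib diff_divide_distrib)
    have "discount \<beta> z * ennreal ((exp ((\<beta> - passage_rate p) * z) - 1) / d) =
      ennreal (1 / d * (exp (- passage_rate p * z) - exp (- \<beta> * z)))"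
      unfolding e[symmetric] by (intro ennreal_mult'[symmetric]) simp
    then show "discount \<beta> z * below_transform p \<beta> z * indicator {c<..} z =
      ennreal (1 / d * (exp (- passage_rate p * z) - exp (- \<beta> * z))) * indicator {c<..} z"
      using below_transform_subcritical(1)[OF p l, of z] c
      unfolding d_def by (cases "c < z") simp_all
  qed
  then have "(\<integral>\<^sup>+x\<in>{0..}. discount \<beta> x * killed_tail p x c \<partial>lborel) =
    ennreal (1 / d * (exp (- passage_rate p * c) / passage_rate p - exp (- \<beta> * c) / \<beta>))"
    unfolding dual_killed_tail[OF c] using nn_integral_exp_diff[OF passage_rate_pos[OF p] less_imp_le[OF l] _ c, of "1 / d"] d
    by simp
  also have "1 / d * (exp (- passage_rate p * c) / passage_rate p - exp (- \<beta> * c) / \<beta>) =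
    (exp (- \<beta> * c) / \<beta> - exp (- passage_rate p * c) / passage_rate p) / (p - laplace_exponent M X \<beta>)"
    unfolding d_def by (metis (no_types, opaque_lifting) minus_diff_eq minus_divide_divide mult_1 times_divide_eq_left)
  finally show ?thesis .
qed

end
text \<open>Open quadrants generate the Borel sets and are stable under intersection. Restricting
  both measures to the positive quadrant replaces the coordinates of a corner by their positive
  parts.\<close>

lemma quadrant_measure_eqI:
  fixes M N :: "(real \<times> real) measure"
  assumes sets [measurable_cong]: "sets M = sets borel" "sets N = sets borel"
    and fin: "emeasure M ({0<..} \<times> {0<..}) \<noteq> \<infinity>"
    and eq: "\<And>a c. 0 \<le> a \<Longrightarrow> 0 \<le> c \<Longrightarrow> emeasure M ({a<..} \<times> {c<..}) = emeasure N ({a<..} \<times> {c<..})"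
    and B: "B \<in> sets borel" "B \<subseteq> {0<..} \<times> {0<..}"
  shows "emeasure M B = emeasure N B"
proof -
  define Q :: "(real \<times> real) set" where "Q = {0<..} \<times> {0<..}"
  have Q [measurable]: "Q \<in> sets borel" by (simp add: Q_def open_Times borel_open)
  have D: "emeasure (density K (indicator Q)) A = emeasure K (Q \<inter> A)" if K: "sets K = sets borel" and A: "A \<in> sets borel" for K A
  proof -
    have "emeasure (density K (indicator Q)) A = (\<integral>\<^sup>+x. indicator Q x * indicator A x \<partial>K)"
      using A K Q by (intro emeasure_density) (auto simp: measurable_cong_sets[OF K refl])
    also have "\<dots> = (\<integral>\<^sup>+x. indicator (Q \<inter> A) x \<partial>K)" by (intro nn_integral_cong) (simp add: indicator_def)
    finally show ?thesis using A Q K by simp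
  qed
  let ?E = "range (\<lambda>a::real \<times> real. {fst a<..} \<times> {snd a<..})"
  have borel: "sets (borel :: (real \<times> real) measure) = sigma_sets UNIV ?E"
  proof -
    have "{x. eucl_less a x} = {fst a<..} \<times> {snd a<..}" for a :: "real \<times> real"
      by (auto simp: eucl_less_def Basis_prod_def inner_prod_def)
    then have "sets (borel :: (real \<times> real) measure) = sets (sigma UNIV ?E)"
      by (subst borel_eq_greaterThan) simp
    also have "\<dots> = sigma_sets UNIV ?E" by (rule sets_measure_of) simp
    finally show ?thesis .
  qed
  have op: "{a<..} \<times> {c<..} \<in> sets borel" for a c :: real by (simp add: open_Times borel_open)
  have QI: "Q \<inter> {a<..} \<times> {c<..} = {max 0 a<..} \<times> {max 0 c<..}" for a c by (auto simp: Q_def)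
  have "density M (indicator Q) = density N (indicator Q)"
  proof (rule measure_eqI_generator_eq[where E = ?E and \<Omega> = UNIV and A = "\<lambda>i::nat. {- real i<..} \<times> {- real i<..}"])
    show "Int_stable ?E"
    proof (rule Int_stableI)
      fix A B assume "A \<in> ?E" "B \<in> ?E"
      then obtain a b where ab: "A = {fst a<..} \<times> {snd a<..}" "B = {fst b<..} \<times> {snd b<..}" by auto
      have "A \<inter> B = {fst (max (fst a) (fst b), max (snd a) (snd b))<..} \<times> {snd (max (fst a) (fst b), max (snd a) (snd b))<..}"
        unfolding ab by auto
      then show "A \<inter> B \<in> ?E" by blast
    qed
    show "emeasure (density M (indicator Q)) X = emeasure (density N (indicator Q)) X" if "X \<in> ?E" for X
      using that eq sets by (auto simp: D op QI)
    show "range (\<lambda>i::nat. {- real i<..} \<times> {- real i<..}) \<subseteq> ?E" by (auto intro!: image_eqI[of _ _ "(_, _)"])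
    show "(\<Union>i::nat. {- real i<..} \<times> {- real i<..}) = UNIV"
    proof safe
      fix x y :: real
      obtain n :: nat where "max (- x) (- y) < n" using reals_Archimedean2 by blast
      then show "(x, y) \<in> (\<Union>i::nat. {- real i<..} \<times> {- real i<..})" by (auto intro!: exI[of _ n])
    qed auto
    show "emeasure (density M (indicator Q)) ({- real i<..} \<times> {- real i<..}) \<noteq> \<infinity>" for i :: nat
      using fin sets by (simp add: D op QI)
  qed (use borel sets in auto)
  then have "emeasure M (Q \<inter> B) = emeasure N (Q \<inter> B)" using D[OF sets(1) B(1)] D[OF sets(2) B(1)] by simp
  then show ?thesis using B(2) by (simp add: Q_def Int_absorb1)
qed

context normalized_snlp
begin

subsection \<open>The Kendall measure\<close>

text \<open>\<open>ennreal\<close> sends negative values to 0, so the factor X / v confines the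
  measure to y > 0. It is realised on time and path together, so that Fubini applies.\<close>

definition kendall_measure :: "real \<Rightarrow> (real \<times> real) measure" where
  "kendall_measure q = distr (density (lborel \<Otimes>\<^sub>M M)
     (\<lambda>p. ennreal (X (fst p) (snd p) / fst p * exp (- q * fst p)) * indicator {0<..} (fst p)))
     borel (\<lambda>p. (fst p, X (fst p) (snd p)))"

lemma sets_kendall_measure [simp, measurable_cong]: "sets (kendall_measure q) = sets borel"
  by (simp add: kendall_measure_def)

lemma nn_integral_kendall_measure:
  assumes [measurable]: "f \<in> borel_measurable borel"
  shows "(\<integral>\<^sup>+y. f y \<partial>kendall_measure q) =
    (\<integral>\<^sup>+v\<in>{0<..}. (\<integral>\<^sup>+\<omega>. ennreal (X v \<omega> / v * exp (- q * v)) * f (v, X v \<omega>) \<partial>M) \<partial>lborel)"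
proof -
  have [measurable]: "(\<lambda>p. (fst p, X (fst p) (snd p))) \<in> measurable (lborel \<Otimes>\<^sub>M M) borel"
    unfolding borel_prod[symmetric] by measurable
  have "(\<lambda>p. f (fst p, X (fst p) (snd p))) \<in> borel_measurable (lborel \<Otimes>\<^sub>M M)"
    by (rule measurable_compose) fact+
  then have *: "(\<lambda>p. ennreal (X (fst p) (snd p) / fst p * exp (- q * fst p)) * indicator {0<..} (fst p) * f (fst p, X (fst p) (snd p)))
      \<in> borel_measurable (lborel \<Otimes>\<^sub>M M)"
    by (intro borel_measurable_times_ennreal) measurable
  have "(\<integral>\<^sup>+y. f y \<partial>kendall_measure q) = (\<integral>\<^sup>+p. ennreal (X (fst p) (snd p) / fst p * exp (- q * fst p)) * indicator {0<..} (fst p) * f (fst p, X (fst p) (snd p)) \<partial>(lborel \<Otimes>\<^sub>M M))"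
    unfolding kendall_measure_def by (subst nn_integral_distr, measurable) (rule nn_integral_density, measurable)
  also have "\<dots> = (\<integral>\<^sup>+v. \<integral>\<^sup>+\<omega>. ennreal (X v \<omega> / v * exp (- q * v)) * indicator {0<..} v * f (v, X v \<omega>) \<partial>M \<partial>lborel)"
    using nn_integral_fst[OF *] by simp
  also have "\<dots> = (\<integral>\<^sup>+v\<in>{0<..}. (\<integral>\<^sup>+\<omega>. ennreal (X v \<omega> / v * exp (- q * v)) * f (v, X v \<omega>) \<partial>M) \<partial>lborel)"
    by (intro nn_integral_cong) (auto simp: indicator_def)
  finally show ?thesis .
qed

lemma emeasure_kendall_measure:
  assumes [measurable]: "B \<in> sets borel"
  shows "emeasure (kendall_measure q) B = kendall_part M X q B"
proof -
  have "emeasure (kendall_measure q) B = (\<integral>\<^sup>+y. indicator B y \<partial>kendall_measure q)" by simp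
  also have "\<dots> = (\<integral>\<^sup>+v\<in>{0<..}. (\<integral>\<^sup>+\<omega>. ennreal (X v \<omega> / v * exp (- q * v)) * indicator B (v, X v \<omega>) \<partial>M) \<partial>lborel)"
    by (rule nn_integral_kendall_measure) measurable
  also have "\<dots> = kendall_part M X q B"
  proof -
    have [measurable]: "(\<lambda>y. indicator B (v, y) :: ennreal) \<in> borel_measurable borel" for v
    proof -
      have "(\<lambda>y. (v, y)) \<in> measurable borel (borel :: (real \<times> real) measure)" unfolding borel_prod[symmetric] by measurable
      from measurable_compose[OF this, of "indicator B" borel] show ?thesis by simp
    qed
    show ?thesis unfolding kendall_part_def by (subst nn_integral_distr) auto
  qed
  finally show ?thesis .
qed

lemma borel_measurable_passage_rate_pos [measurable]:
  "(\<lambda>s. passage_rate s * indicator {0<..} s) \<in> borel_measurable borel"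
  "(\<lambda>s. resolvent_const s * indicator {0<..} s) \<in> borel_measurable borel"
  using borel_measurable_continuous_on_indicator[OF _ continuous_passage_rate]
    borel_measurable_continuous_on_indicator[OF _ continuous_resolvent_const]
  by (simp_all add: mult.commute)

text \<open>The integrand is the derivative in r of - exp (- \<Phi>(r) y), because
  \<open>resolvent_const\<close> is the derivative of \<Phi>, and \<Phi>(r) tends to
  infinity.\<close>

lemma nn_integral_rate:
  assumes s: "0 < s" and y: "0 < y"
  shows "(\<integral>\<^sup>+r. ennreal (resolvent_const r * y * exp (- passage_rate r * y)) * indicator {s..} r \<partial>lborel) = ennreal (exp (- passage_rate s * y))"
proof -
  define f where "f r = (resolvent_const r * indicator {0<..} r) * y * exp (- (passage_rate r * indicator {0<..} r) * y)" for r :: real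
  have "(\<integral>\<^sup>+r. ennreal (resolvent_const r * y * exp (- passage_rate r * y)) * indicator {s..} r \<partial>lborel) =
    (\<integral>\<^sup>+r. ennreal (f r) * indicator {s..} r \<partial>lborel)"
    using s by (intro nn_integral_cong) (auto simp: f_def indicator_def)
  also have "\<dots> = ennreal (0 - (- exp (- passage_rate s * y)))"
  proof (rule nn_integral_FTC_atLeast)
    show "f \<in> borel_measurable borel" unfolding f_def by measurable
    show "((\<lambda>r. - exp (- passage_rate r * y)) has_real_derivative f r) (at r)" if "s \<le> r" for r
      using has_real_derivative_passage_rate[of r] s that
      by (auto intro!: derivative_eq_intros simp: f_def)
    show "0 \<le> f r" if "s \<le> r" for r
      using resolvent_const_pos[of r] s that y by (simp add: f_def)
    have "filterlim (\<lambda>r. passage_rate r * y) at_top at_top"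
      using filterlim_tendsto_pos_mult_at_top[OF tendsto_const y passage_rate_at_top] by (simp add: mult.commute)
    then have "((\<lambda>r. exp (- (passage_rate r * y))) \<longlongrightarrow> 0) at_top"
      by (intro filterlim_compose[OF exp_at_bot] filterlim_compose[OF filterlim_uminus_at_bot_at_top])
    then show "((\<lambda>r. - exp (- passage_rate r * y)) \<longlongrightarrow> 0) at_top"
      using tendsto_minus by fastforce
  qed
  finally show ?thesis by simp
qed

text \<open>
  Writing \<open>1 / v\<close> as an integral of exponentials reduces this to the resolvent on the positive half-line.
\<close>

lemma kendall_transform:
  assumes q: "0 < q" and p: "0 \<le> p" and c: "0 \<le> c"
  shows "(\<integral>\<^sup>+y. discount p (fst y) * indicator ({0<..} \<times> {c<..}) y \<partial>kendall_measure q) =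
    ennreal (exp (- passage_rate (p + q) * c) / passage_rate (p + q))"
proof -
  interpret L: pair_sigma_finite lborel M ..
  define s where "s = p + q"
  have s: "0 < s" using q p by (simp add: s_def)
  have [measurable]: "(\<lambda>y. discount p (fst y) * indicator ({0<..} \<times> {c<..}) y) \<in> borel_measurable borel"
    unfolding borel_prod[symmetric] by measurable
  have "(\<integral>\<^sup>+y. discount p (fst y) * indicator ({0<..} \<times> {c<..}) y \<partial>kendall_measure q) =
    (\<integral>\<^sup>+v. \<integral>\<^sup>+\<omega>. ennreal (X v \<omega>) * indicator {c<..} (X v \<omega>) * (\<integral>\<^sup>+r\<in>{s..}. discount v r \<partial>lborel) * indicator {0<..} v \<partial>M \<partial>lborel)"
    unfolding nn_integral_kendall_measure[OF \<open>_ \<in> borel_measurable borel\<close>]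
  proof (rule nn_integral_cong)
    fix v :: real
    show "(\<integral>\<^sup>+\<omega>. ennreal (X v \<omega> / v * exp (- q * v)) * (ennreal (exp (- p * fst (v, X v \<omega>))) * indicator ({0<..} \<times> {c<..}) (v, X v \<omega>)) \<partial>M) * indicator {0<..} v =
      (\<integral>\<^sup>+\<omega>. ennreal (X v \<omega>) * indicator {c<..} (X v \<omega>) * (\<integral>\<^sup>+r\<in>{s..}. discount v r \<partial>lborel) * indicator {0<..} v \<partial>M)"
    proof (cases "0 < v")
      case True
      have "ennreal (X v \<omega> / v * exp (- q * v)) * (ennreal (exp (- p * fst (v, X v \<omega>))) * indicator ({0<..} \<times> {c<..}) (v, X v \<omega>)) =
        ennreal (X v \<omega>) * indicator {c<..} (X v \<omega>) * (\<integral>\<^sup>+r\<in>{s..}. discount v r \<partial>lborel)" for \<omega>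
      proof (cases "c < X v \<omega>")
        case X: True
        have "ennreal (X v \<omega> / v * exp (- q * v)) * discount p v = ennreal (X v \<omega>) * ennreal (exp (- v * s) / v)"
          using X c True by (simp add: ennreal_mult[symmetric] s_def exp_add[symmetric] algebra_simps)
        then show ?thesis unfolding nn_integral_exp_tail(1)[OF True] using X True by simp
      qed simp
      then show ?thesis using True by simp
    qed simp
  qed
  also have "\<dots> = (\<integral>\<^sup>+v. \<integral>\<^sup>+\<omega>. \<integral>\<^sup>+r. ennreal (X v \<omega>) * indicator {c<..} (X v \<omega>) * indicator {0<..} v * (discount v r * indicator {s..} r) \<partial>lborel \<partial>M \<partial>lborel)"
    by (intro nn_integral_cong) (subst nn_integral_cmult, auto simp: ac_simps)
  also have "\<dots> = (\<integral>\<^sup>+v. \<integral>\<^sup>+r. \<integral>\<^sup>+\<omega>. ennreal (X v \<omega>) * indicator {c<..} (X v \<omega>) * indicator {0<..} v * (discount v r * indicator {s..} r) \<partial>M \<partial>lborel \<partial>lborel)"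
    by (intro nn_integral_cong L.Fubini') (unfold case_prod_beta', measurable)
  also have "\<dots> = (\<integral>\<^sup>+r. \<integral>\<^sup>+v. \<integral>\<^sup>+\<omega>. ennreal (X v \<omega>) * indicator {c<..} (X v \<omega>) * indicator {0<..} v * (discount v r * indicator {s..} r) \<partial>M \<partial>lborel \<partial>lborel)"
    by (rule lborel_pair.Fubini') (unfold case_prod_beta', measurable)
  also have "\<dots> = (\<integral>\<^sup>+r. (\<integral>\<^sup>+y\<in>{0<..}. ennreal y * indicator {c<..} y \<partial>resolvent r) * indicator {s..} r \<partial>lborel)"
  proof (rule nn_integral_cong)
    fix r :: real
    have "(\<integral>\<^sup>+y\<in>{0<..}. ennreal y * indicator {c<..} y \<partial>resolvent r) =
      (\<integral>\<^sup>+y. ennreal y * indicator {c<..} y \<partial>resolvent r)"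
      using c by (intro nn_integral_cong) (auto simp: indicator_def)
    also have "\<dots> = laplace r (\<lambda>v. (\<integral>\<^sup>+\<omega>. ennreal (X v \<omega>) * indicator {c<..} (X v \<omega>) \<partial>M))"
      by (rule nn_integral_resolvent) measurable
    also have "\<dots> = (\<integral>\<^sup>+v. \<integral>\<^sup>+\<omega>. ennreal (X v \<omega>) * indicator {c<..} (X v \<omega>) * indicator {0<..} v * discount v r \<partial>M \<partial>lborel)"
    proof (rule nn_integral_cong)
      fix v :: real
      have "(\<integral>\<^sup>+\<omega>. ennreal (X v \<omega>) * indicator {c<..} (X v \<omega>) * indicator {0<..} v * discount v r \<partial>M) =
        (\<integral>\<^sup>+\<omega>. discount r v * indicator {0<..} v * (ennreal (X v \<omega>) * indicator {c<..} (X v \<omega>)) \<partial>M)"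
        by (intro nn_integral_cong) (simp add: ac_simps)
      also have "\<dots> = discount r v * indicator {0<..} v * (\<integral>\<^sup>+\<omega>. ennreal (X v \<omega>) * indicator {c<..} (X v \<omega>) \<partial>M)"
        by (rule nn_integral_cmult) measurable
      finally show "discount r v * (\<integral>\<^sup>+\<omega>. ennreal (X v \<omega>) * indicator {c<..} (X v \<omega>) \<partial>M) * indicator {0..} v =
        (\<integral>\<^sup>+\<omega>. ennreal (X v \<omega>) * indicator {c<..} (X v \<omega>) * indicator {0<..} v * discount v r \<partial>M)"
        by (cases "v = 0") (simp_all add: zero ac_simps indicator_def)
    qed
    finally show "(\<integral>\<^sup>+v. \<integral>\<^sup>+\<omega>. ennreal (X v \<omega>) * indicator {c<..} (X v \<omega>) * indicator {0<..} v * (discount v r * indicator {s..} r) \<partial>M \<partial>lborel) =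
      (\<integral>\<^sup>+y\<in>{0<..}. ennreal y * indicator {c<..} y \<partial>resolvent r) * indicator {s..} r"
      by (cases "s \<le> r") simp_all
  qed
  also have "\<dots> = (\<integral>\<^sup>+r. \<integral>\<^sup>+y. ennreal ((resolvent_const r * indicator {0<..} r) * y * exp (- (passage_rate r * indicator {0<..} r) * y)) * indicator {c<..} y * indicator {s..} r \<partial>lborel \<partial>lborel)"
  proof (rule nn_integral_cong)
    fix r :: real
    show "(\<integral>\<^sup>+y\<in>{0<..}. ennreal y * indicator {c<..} y \<partial>resolvent r) * indicator {s..} r =
      (\<integral>\<^sup>+y. ennreal ((resolvent_const r * indicator {0<..} r) * y * exp (- (passage_rate r * indicator {0<..} r) * y)) * indicator {c<..} y * indicator {s..} r \<partial>lborel)"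
    proof (cases "s \<le> r")
      case True
      then have r: "0 < r" using s by simp
      have "(\<integral>\<^sup>+y\<in>{0<..}. ennreal y * indicator {c<..} y \<partial>resolvent r) =
        (\<integral>\<^sup>+y\<in>{0<..}. ennreal (resolvent_const r * exp (- passage_rate r * y)) * (ennreal y * indicator {c<..} y) \<partial>lborel)"
        by (rule nn_integral_resolvent_pos[OF r]) measurable
      also have "\<dots> = (\<integral>\<^sup>+y. ennreal (resolvent_const r * y * exp (- passage_rate r * y)) * indicator {c<..} y \<partial>lborel)"
        using resolvent_const_pos[OF r] c
        by (intro nn_integral_cong) (auto simp: indicator_def ennreal_mult[symmetric] ac_simps)
      finally show ?thesis using True r by simp
    qed simp
  qed
  also have "\<dots> = (\<integral>\<^sup>+y. \<integral>\<^sup>+r. ennreal ((resolvent_const r * indicator {0<..} r) * y * exp (- (passage_rate r * indicator {0<..} r) * y)) * indicator {c<..} y * indicator {s..} r \<partial>lborel \<partial>lborel)"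
    by (rule lborel_pair.Fubini') (unfold case_prod_beta', measurable)
  also have "\<dots> = (\<integral>\<^sup>+y\<in>{c<..}. ennreal (exp (- passage_rate s * y)) \<partial>lborel)"
  proof (rule nn_integral_cong)
    fix y :: real
    show "(\<integral>\<^sup>+r. ennreal ((resolvent_const r * indicator {0<..} r) * y * exp (- (passage_rate r * indicator {0<..} r) * y)) * indicator {c<..} y * indicator {s..} r \<partial>lborel) =
      ennreal (exp (- passage_rate s * y)) * indicator {c<..} y"
    proof (cases "c < y")
      case True
      then have y: "0 < y" using c by simp
      have "(\<integral>\<^sup>+r. ennreal ((resolvent_const r * indicator {0<..} r) * y * exp (- (passage_rate r * indicator {0<..} r) * y)) * indicator {c<..} y * indicator {s..} r \<partial>lborel) =
        (\<integral>\<^sup>+r. ennreal (resolvent_const r * y * exp (- passage_rate r * y)) * indicator {s..} r \<partial>lborel)"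
        using s True by (intro nn_integral_cong) (auto simp: indicator_def)
      then show ?thesis using nn_integral_rate[OF s y] True by simp
    qed simp
  qed
  finally show ?thesis unfolding s_def[symmetric] nn_integral_exp_tail(2)[OF passage_rate_pos[OF s]] .
qed

lemma stay_prob_0:
  assumes c: "0 \<le> c" shows "stay_prob 0 z c = indicator {c<..} z"
proof -
  have "{\<omega>\<in>space M. stays_pos z 0 \<omega> \<and> c < z + X 0 \<omega>} = (if c < z then space M else {})"
    using c by (auto simp: zero)
  then show ?thesis by (simp add: stay_prob_def emeasure_space_1 indicator_def)
qed

text \<open>Integrating the tail in a against p exp (- p a) gives \<integral> (1 - exp (- p v)) over
  {y > c} on the left. On the right it gives the killed resolvent at rate p + q, transformed in the
  starting point at \<Phi>(q); since \<psi>(\<Phi>(q)) = q, the denominator is exactly p and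
  cancels. Subtraction from the total mass leaves k exp (- \<Phi>(p + q) c) / \<Phi>(p + q), the
  transform of k times the Kendall measure.\<close>

lemma eq_kendall_measure:
  fixes N :: "(real \<times> real) measure"
  assumes q: "0 < q" and k: "0 \<le> k" and sets [measurable_cong]: "sets N = sets borel"
    and N: "\<And>a c. 0 \<le> a \<Longrightarrow> 0 \<le> c \<Longrightarrow> emeasure N ({a<..} \<times> {c<..}) =
      discount q a * (\<integral>\<^sup>+z\<in>{0<..}. ennreal (k * exp (- passage_rate q * z)) * stay_prob a z c \<partial>lborel)"
    and B: "B \<in> sets borel" "B \<subseteq> {0<..} \<times> {0<..}"
  shows "emeasure N B = ennreal k * kendall_part M X q B"
proof -
  let ?P = "passage_rate q"
  let ?K = "kendall_measure q"
  have P: "0 < ?P" by (rule passage_rate_pos[OF q])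
  have sm: "{a<..} \<times> {c<..} \<in> sets (borel :: (real \<times> real) measure)" for a c :: real by (simp add: open_Times borel_open)
  have [measurable]: "indicator ({0<..} \<times> {c<..}) \<in> borel_measurable (borel :: (real \<times> real) measure)" for c :: real
    using sm by simp
  have fst_m [measurable]: "fst \<in> borel_measurable (borel :: (real \<times> real) measure)" unfolding borel_prod[symmetric] by measurable
  \<comment> \<open>At a = 0 survival is trivial for z > 0, which gives the total mass above level
    c; its finiteness permits the subtraction below.\<close>
  have N0: "emeasure N ({0<..} \<times> {c<..}) = ennreal (k * exp (- ?P * c) / ?P)" if c: "0 \<le> c" for c
  proof -
    have "emeasure N ({0<..} \<times> {c<..}) = (\<integral>\<^sup>+z. ennreal k * (discount ?P z * indicator {c<..} z) \<partial>lborel)"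
      using N[of 0 c] c k by (simp add: stay_prob_0) (intro nn_integral_cong, auto simp: indicator_def ennreal_mult)
    also have "\<dots> = ennreal k * (\<integral>\<^sup>+z\<in>{c<..}. discount ?P z \<partial>lborel)" by (rule nn_integral_cmult) measurable
    finally show ?thesis unfolding nn_integral_exp_tail(2)[OF P] using k P by (simp add: ennreal_mult[symmetric])
  qed
  have lap: "(\<integral>\<^sup>+y. discount p (fst y) * indicator ({0<..} \<times> {c<..}) y \<partial>N) =
    ennreal (k * exp (- passage_rate (p + q) * c) / passage_rate (p + q))" if p: "0 < p" and c: "0 \<le> c" for p c
  proof -
    define R where "R = passage_rate (p + q)"
    have R: "0 < R" "?P < R" using passage_rate_pos[of "p + q"] passage_rate_mono[of q "p + q"] p q by (auto simp: R_def)
    have NQ: "finite_measure (density N (indicator ({0<..} \<times> {c<..})))"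
    proof (rule finite_measureI)
      have "emeasure (density N (indicator ({0<..} \<times> {c<..}))) (space (density N (indicator ({0<..} \<times> {c<..})))) = emeasure N ({0<..} \<times> {c<..})"
        using sm sets by (subst emeasure_density) (auto simp: sets_eq_imp_space_eq[OF sets])
      then show "emeasure (density N (indicator ({0<..} \<times> {c<..}))) (space (density N (indicator ({0<..} \<times> {c<..})))) \<noteq> \<infinity>"
        using N0[OF c] by simp
    qed
    interpret D: finite_measure "density N (indicator ({0<..} \<times> {c<..}))" by (rule NQ)
    interpret LD: pair_sigma_finite lborel "density N (indicator ({0<..} \<times> {c<..}))" ..
    have e1: "(\<integral>\<^sup>+a. ennreal (p * exp (- p * a)) * indicator {0..} a * emeasure N ({a<..} \<times> {c<..}) \<partial>lborel) =
      (\<integral>\<^sup>+y. ennreal (1 - exp (- p * fst y)) * indicator ({0<..} \<times> {c<..}) y \<partial>N)"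
    proof -
      have [measurable]: "(\<lambda>y. indicator {0..<fst (snd y)} (fst y) :: ennreal) \<in> borel_measurable (lborel \<Otimes>\<^sub>M density N (indicator ({0<..} \<times> {c<..})))"
      proof -
        have "(\<lambda>y. indicator {0..<fst (snd y)} (fst y) :: ennreal) = (\<lambda>y::real \<times> real \<times> real. indicator {y. 0 \<le> fst y \<and> fst y < fst (snd y)} y)"
          by (auto simp: indicator_def)
        also have "\<dots> \<in> borel_measurable (lborel \<Otimes>\<^sub>M density N (indicator ({0<..} \<times> {c<..})))"
          by (rule borel_measurable_indicator') measurable
        finally show ?thesis .
      qed
      have "(\<integral>\<^sup>+a. ennreal (p * exp (- p * a)) * indicator {0..} a * emeasure N ({a<..} \<times> {c<..}) \<partial>lborel) =
        (\<integral>\<^sup>+a. \<integral>\<^sup>+y. ennreal (p * exp (- p * a)) * indicator {0..<fst y} a \<partial>density N (indicator ({0<..} \<times> {c<..})) \<partial>lborel)"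
      proof (rule nn_integral_cong)
        fix a :: real
        have [measurable]: "(\<lambda>y. indicator {0..<fst y} a :: ennreal) \<in> borel_measurable (borel :: (real \<times> real) measure)"
        proof -
          have "(\<lambda>y. indicator {0..<fst y} a :: ennreal) = (\<lambda>y::real \<times> real. indicator {y. 0 \<le> a \<and> a < fst y} y)"
            by (auto simp: indicator_def)
          also have "\<dots> \<in> borel_measurable borel" by (rule borel_measurable_indicator') measurable
          finally show ?thesis .
        qed
        have "(\<integral>\<^sup>+y. ennreal (p * exp (- p * a)) * indicator {0..<fst y} a \<partial>density N (indicator ({0<..} \<times> {c<..}))) =
          (\<integral>\<^sup>+y. indicator ({0<..} \<times> {c<..}) y * (ennreal (p * exp (- p * a)) * indicator {0..<fst y} a) \<partial>N)"
          by (rule nn_integral_density) measurable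
        also have "\<dots> = (\<integral>\<^sup>+y. ennreal (p * exp (- p * a)) * indicator {0..} a * indicator ({a<..} \<times> {c<..}) y \<partial>N)"
          by (intro nn_integral_cong) (auto simp: indicator_def)
        also have "\<dots> = ennreal (p * exp (- p * a)) * indicator {0..} a * emeasure N ({a<..} \<times> {c<..})"
          using sm sets by (intro nn_integral_cmult_indicator) auto
        finally show "ennreal (p * exp (- p * a)) * indicator {0..} a * emeasure N ({a<..} \<times> {c<..}) =
          (\<integral>\<^sup>+y. ennreal (p * exp (- p * a)) * indicator {0..<fst y} a \<partial>density N (indicator ({0<..} \<times> {c<..})))" ..
      qed
      also have "\<dots> = (\<integral>\<^sup>+y. \<integral>\<^sup>+a. ennreal (p * exp (- p * a)) * indicator {0..<fst y} a \<partial>lborel \<partial>density N (indicator ({0<..} \<times> {c<..})))"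
        by (rule LD.Fubini'[symmetric]) (unfold case_prod_beta', measurable)
      also have "\<dots> = (\<integral>\<^sup>+y. indicator ({0<..} \<times> {c<..}) y * (\<integral>\<^sup>+a. ennreal (p * exp (- p * a)) * indicator {0..<fst y} a \<partial>lborel) \<partial>N)"
      proof (rule nn_integral_density)
        have [measurable]: "(\<lambda>y. indicator {0..<fst (fst y)} (snd y) :: ennreal) \<in> borel_measurable (N \<Otimes>\<^sub>M lborel)"
        proof -
          have "(\<lambda>y. indicator {0..<fst (fst y)} (snd y) :: ennreal) = (\<lambda>y::(real \<times> real) \<times> real. indicator {y. 0 \<le> snd y \<and> snd y < fst (fst y)} y)"
            by (auto simp: indicator_def)
          also have "\<dots> \<in> borel_measurable (N \<Otimes>\<^sub>M lborel)"
            by (rule borel_measurable_indicator') measurable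
          finally show ?thesis .
        qed
        show "(\<lambda>y. \<integral>\<^sup>+a. ennreal (p * exp (- p * a)) * indicator {0..<fst y} a \<partial>lborel) \<in> borel_measurable N"
          by (rule lborel.borel_measurable_nn_integral) (unfold case_prod_beta', measurable)
      qed measurable
      also have "\<dots> = (\<integral>\<^sup>+y. ennreal (1 - exp (- p * fst y)) * indicator ({0<..} \<times> {c<..}) y \<partial>N)"
      proof (rule nn_integral_cong)
        fix y :: "real \<times> real"
        show "indicator ({0<..} \<times> {c<..}) y * (\<integral>\<^sup>+a. ennreal (p * exp (- p * a)) * indicator {0..<fst y} a \<partial>lborel) =
          ennreal (1 - exp (- p * fst y)) * indicator ({0<..} \<times> {c<..}) y"
        proof (cases "0 < fst y")
          case True
          have "AE a in lborel. a \<noteq> fst y" by (rule AE_lborel_singleton)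
          then have "(\<integral>\<^sup>+a. ennreal (p * exp (- p * a)) * indicator {0..<fst y} a \<partial>lborel) = (\<integral>\<^sup>+a. ennreal (p * exp (- p * a)) * indicator {0..fst y} a \<partial>lborel)"
            by (intro nn_integral_cong_AE) (auto elim!: eventually_mono simp: indicator_def)
          also have "\<dots> = ennreal (- exp (- p * fst y) - - exp (- p * 0))"
            by (rule nn_integral_FTC_Icc) (use p True in \<open>auto intro!: derivative_eq_intros\<close>)
          finally show ?thesis by (simp add: mult.commute)
        qed (auto simp: indicator_def)
      qed
      finally show ?thesis .
    qed
    have e2: "(\<integral>\<^sup>+a. ennreal (p * exp (- p * a)) * indicator {0..} a * emeasure N ({a<..} \<times> {c<..}) \<partial>lborel) =
      ennreal (k * (exp (- ?P * c) / ?P - exp (- R * c) / R))"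
    proof -
      have "(\<integral>\<^sup>+a. ennreal (p * exp (- p * a)) * indicator {0..} a * emeasure N ({a<..} \<times> {c<..}) \<partial>lborel) =
        (\<integral>\<^sup>+a. \<integral>\<^sup>+z. ennreal (p * k) * (discount ?P z * indicator {0<..} z) * (discount (p + q) a * stay_prob a z c * indicator {0..} a) \<partial>lborel \<partial>lborel)"
      proof (rule nn_integral_cong)
        fix a :: real
        show "ennreal (p * exp (- p * a)) * indicator {0..} a * emeasure N ({a<..} \<times> {c<..}) =
          (\<integral>\<^sup>+z. ennreal (p * k) * (discount ?P z * indicator {0<..} z) * (discount (p + q) a * stay_prob a z c * indicator {0..} a) \<partial>lborel)"
        proof (cases "0 \<le> a")
          case True
          have "ennreal (p * exp (- p * a)) * emeasure N ({a<..} \<times> {c<..}) =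
            (ennreal (p * exp (- p * a)) * discount q a) * (\<integral>\<^sup>+z\<in>{0<..}. ennreal (k * exp (- ?P * z)) * stay_prob a z c \<partial>lborel)"
            by (simp add: N[OF True c] mult.assoc)
          also have "\<dots> = (\<integral>\<^sup>+z. (ennreal (p * exp (- p * a)) * discount q a) * (ennreal (k * exp (- ?P * z)) * stay_prob a z c * indicator {0<..} z) \<partial>lborel)"
            by (rule nn_integral_cmult[symmetric]) measurable
          also have "\<dots> = (\<integral>\<^sup>+z. ennreal (p * k) * (discount ?P z * indicator {0<..} z) * (discount (p + q) a * stay_prob a z c) \<partial>lborel)"
          proof (rule nn_integral_cong)
            fix z :: real
            have "ennreal (p * exp (- p * a)) * discount q a * ennreal (k * exp (- ?P * z)) =
              ennreal (p * k) * discount ?P z * discount (p + q) a"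
              using p k by (simp add: ennreal_mult[symmetric] exp_add[symmetric] algebra_simps)
            from arg_cong[OF this, of "\<lambda>e. e * (stay_prob a z c * indicator {0<..} z)"]
            show "(ennreal (p * exp (- p * a)) * discount q a) * (ennreal (k * exp (- ?P * z)) * stay_prob a z c * indicator {0<..} z) =
              ennreal (p * k) * (discount ?P z * indicator {0<..} z) * (discount (p + q) a * stay_prob a z c)"
              by (simp only: mult.assoc mult.commute mult.left_commute)
          qed
          finally show ?thesis using True by simp
        qed simp
      qed
      also have "\<dots> = (\<integral>\<^sup>+z. \<integral>\<^sup>+a. ennreal (p * k) * (discount ?P z * indicator {0<..} z) * (discount (p + q) a * stay_prob a z c * indicator {0..} a) \<partial>lborel \<partial>lborel)"
        by (rule lborel_pair.Fubini') (unfold case_prod_beta', measurable)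
      also have "\<dots> = (\<integral>\<^sup>+z. ennreal (p * k) * (discount ?P z * killed_tail (p + q) z c * indicator {0..} z) \<partial>lborel)"
      proof (rule nn_integral_cong_AE)
        have "AE z in lborel. z \<noteq> (0::real)" by (rule AE_lborel_singleton)
        then show "AE z in lborel. (\<integral>\<^sup>+a. ennreal (p * k) * (discount ?P z * indicator {0<..} z) * (discount (p + q) a * stay_prob a z c * indicator {0..} a) \<partial>lborel) =
          ennreal (p * k) * (discount ?P z * killed_tail (p + q) z c * indicator {0..} z)"
        proof eventually_elim
          case (elim z)
          have "(\<integral>\<^sup>+a. ennreal (p * k) * (discount ?P z * indicator {0<..} z) * (discount (p + q) a * stay_prob a z c * indicator {0..} a) \<partial>lborel) =
            ennreal (p * k) * (discount ?P z * indicator {0<..} z) * killed_tail (p + q) z c"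
            unfolding killed_tail_def by (rule nn_integral_cmult) measurable
          then show ?case using elim by (simp add: indicator_def ac_simps)
        qed
      qed
      also have "\<dots> = ennreal (p * k) * (\<integral>\<^sup>+z\<in>{0..}. discount ?P z * killed_tail (p + q) z c \<partial>lborel)"
        by (rule nn_integral_cmult) measurable
      also have "(\<integral>\<^sup>+z\<in>{0..}. discount ?P z * killed_tail (p + q) z c \<partial>lborel) = ennreal ((exp (- ?P * c) / ?P - exp (- R * c) / R) / p)"
        using laplace_killed_tail[of "p + q" ?P c] p q P R c laplace_exponent_passage_rate[OF q] by (simp add: R_def)
      also have "ennreal (p * k) * \<dots> = ennreal (p * k * ((exp (- ?P * c) / ?P - exp (- R * c) / R) / p))"
        using p k by (intro ennreal_mult'[symmetric]) simp
      also have "p * k * ((exp (- ?P * c) / ?P - exp (- R * c) / R) / p) = k * (exp (- ?P * c) / ?P - exp (- R * c) / R)"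
        using p by simp
      finally show ?thesis .
    qed
    have "(\<integral>\<^sup>+y. discount p (fst y) * indicator ({0<..} \<times> {c<..}) y \<partial>N) + ennreal (k * (exp (- ?P * c) / ?P - exp (- R * c) / R)) =
      (\<integral>\<^sup>+y. discount p (fst y) * indicator ({0<..} \<times> {c<..}) y + ennreal (1 - exp (- p * fst y)) * indicator ({0<..} \<times> {c<..}) y \<partial>N)"
      unfolding e2[symmetric] e1 by (rule nn_integral_add[symmetric]) measurable
    also have "\<dots> = (\<integral>\<^sup>+y. indicator ({0<..} \<times> {c<..}) y \<partial>N)"
    proof (rule nn_integral_cong)
      fix y :: "real \<times> real"
      show "discount p (fst y) * indicator ({0<..} \<times> {c<..}) y + ennreal (1 - exp (- p * fst y)) * indicator ({0<..} \<times> {c<..}) y = indicator ({0<..} \<times> {c<..}) y"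
        using p by (auto simp: indicator_def ennreal_plus[symmetric] simp del: ennreal_plus)
    qed
    also have "\<dots> = ennreal (k * exp (- ?P * c) / ?P)" using N0[OF c] sm sets by simp
    finally have eq: "(\<integral>\<^sup>+y. discount p (fst y) * indicator ({0<..} \<times> {c<..}) y \<partial>N) + ennreal (k * (exp (- ?P * c) / ?P - exp (- R * c) / R)) = ennreal (k * exp (- ?P * c) / ?P)" .
    have le: "exp (- R * c) / R \<le> exp (- ?P * c) / ?P"
      using P R c by (intro frac_le) (auto intro: mult_right_mono)
    have "(\<integral>\<^sup>+y. discount p (fst y) * indicator ({0<..} \<times> {c<..}) y \<partial>N) =
      ennreal (k * exp (- ?P * c) / ?P) - ennreal (k * (exp (- ?P * c) / ?P - exp (- R * c) / R))"
      unfolding eq[symmetric] by simp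
    also have "\<dots> = ennreal (k * exp (- ?P * c) / ?P - k * (exp (- ?P * c) / ?P - exp (- R * c) / R))"
      using k le by (intro ennreal_minus mult_nonneg_nonneg) auto
    finally show ?thesis by (simp add: R_def right_diff_distrib)
  qed
  \<comment> \<open>The image of the strip y > c under projection to the age v. Its Laplace
    transform in v is known for each c, so the measures agree on all quadrants.\<close>
  define T where "T c K = distr (density K (indicator ({0<..} \<times> {c<..}))) borel fst" for c :: real and K :: "(real \<times> real) measure"
  have nnT: "(\<integral>\<^sup>+v. f v \<partial>T c K) = (\<integral>\<^sup>+y. f (fst y) * indicator ({0<..} \<times> {c<..}) y \<partial>K)"
    if K [measurable_cong]: "sets K = sets borel" and [measurable]: "f \<in> borel_measurable borel" for c K f
    unfolding T_def by (subst nn_integral_distr, measurable) (subst nn_integral_density, measurable, simp add: mult.commute)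
  have sc: "sets (scale_measure (ennreal k) ?K) = sets borel" by simp
  have TT: "T c N = T c (scale_measure (ennreal k) ?K)" if c: "0 \<le> c" for c
  proof (rule laplace_unique[of _ _ 0])
    have ae: "AE v in T c K. 0 \<le> v" if K [measurable_cong]: "sets K = sets borel" for K
    proof -
      have "AE y in density K (indicator ({0<..} \<times> {c<..})). 0 \<le> fst y"
        by (subst AE_density) (auto simp: indicator_def)
      then show ?thesis unfolding T_def by (subst AE_distr_iff) auto
    qed
    show "AE v in T c N. 0 \<le> v" "AE v in T c (scale_measure (ennreal k) ?K). 0 \<le> v" by (rule ae, simp add: sets)+
    fix p :: real assume p: "0 < p"
    have 1: "(\<integral>\<^sup>+v. discount p v \<partial>T c N) = ennreal (k * exp (- passage_rate (p + q) * c) / passage_rate (p + q))"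
      by (subst nnT[OF sets]) (measurable, rule lap[OF p c])
    show "(\<integral>\<^sup>+v. discount p v \<partial>T c N) < \<infinity>" unfolding 1 by simp
    have "(\<integral>\<^sup>+v. discount p v \<partial>T c (scale_measure (ennreal k) ?K)) =
      ennreal k * (\<integral>\<^sup>+y. discount p (fst y) * indicator ({0<..} \<times> {c<..}) y \<partial>?K)"
      by (subst nnT[OF sc]) (measurable, rule nn_integral_scale_measure, measurable)
    also have "\<dots> = ennreal k * ennreal (exp (- passage_rate (p + q) * c) / passage_rate (p + q))"
      by (simp only: kendall_transform[OF q less_imp_le[OF p] c])
    finally show "(\<integral>\<^sup>+v. discount p v \<partial>T c N) = (\<integral>\<^sup>+v. discount p v \<partial>T c (scale_measure (ennreal k) ?K))"
      unfolding 1 using k passage_rate_pos[of "p + q"] p q by (simp add: ennreal_mult[symmetric])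
  qed (simp_all add: T_def)
  have "emeasure N B = emeasure (scale_measure (ennreal k) ?K) B"
  proof (rule quadrant_measure_eqI[OF sets sc _ _ B])
    show "emeasure N ({0<..} \<times> {0<..}) \<noteq> \<infinity>" using N0[of 0] by simp
    fix a c :: real assume a: "0 \<le> a" and c: "0 \<le> c"
    have "emeasure (T c K) {a<..} = emeasure K ({a<..} \<times> {c<..})" if K: "sets K = sets borel" for K
    proof -
      have "emeasure (T c K) {a<..} = (\<integral>\<^sup>+v. indicator {a<..} v \<partial>T c K)" by (simp add: T_def)
      also have "\<dots> = (\<integral>\<^sup>+y. indicator {a<..} (fst y) * indicator ({0<..} \<times> {c<..}) y \<partial>K)"
        by (rule nnT[OF K]) measurable
      also have "\<dots> = (\<integral>\<^sup>+y. indicator ({a<..} \<times> {c<..}) y \<partial>K)"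
        using a by (intro nn_integral_cong) (auto simp: indicator_def)
      finally show ?thesis using sm K by simp
    qed
    then show "emeasure N ({a<..} \<times> {c<..}) = emeasure (scale_measure (ennreal k) ?K) ({a<..} \<times> {c<..})"
      using TT[OF c] sets sc by metis
  qed
  then show ?thesis by (simp add: emeasure_kendall_measure[OF B(1)])
qed

lemma kendall_part_finite:
  assumes q: "0 < q" and B: "B \<in> sets borel" "B \<subseteq> {0<..} \<times> {0<..}"
  shows "kendall_part M X q B < \<infinity>"
proof -
  have sm: "{0<..} \<times> {0<..} \<in> sets (borel :: (real \<times> real) measure)" by (simp add: open_Times borel_open)
  have "kendall_part M X q B \<le> emeasure (kendall_measure q) ({0<..} \<times> {0<..})"
    unfolding emeasure_kendall_measure[OF B(1), symmetric] using B sm by (intro emeasure_mono) auto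
  also have "\<dots> < \<infinity>" using kendall_transform[OF q order_refl order_refl] sm by simp
  finally show ?thesis .
qed

end
lemma laplace_primitive:
  fixes g :: "real \<Rightarrow> ennreal"
  assumes [measurable]: "g \<in> borel_measurable borel" and b: "0 < \<beta>" and c: "0 \<le> c"
  shows "(\<integral>\<^sup>+x\<in>{0..}. discount \<beta> x * (\<integral>\<^sup>+y\<in>{0..x - c}. g y \<partial>lborel) \<partial>lborel) =
    ennreal (exp (- \<beta> * c) / \<beta>) * (\<integral>\<^sup>+y\<in>{0..}. discount \<beta> y * g y \<partial>lborel)"
proof -
  have [measurable]: "(\<lambda>p. indicator {0..f p} (h p) :: ennreal) \<in> borel_measurable N"
    if [measurable]: "f \<in> borel_measurable N" "h \<in> borel_measurable N" for f h :: "real \<times> real \<Rightarrow> real" and N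
  proof -
    have "(\<lambda>p. indicator {0..f p} (h p) :: ennreal) = (\<lambda>p. indicator {p. 0 \<le> h p \<and> h p \<le> f p} p)"
      by (auto simp: indicator_def)
    also have "\<dots> \<in> borel_measurable N" by (rule borel_measurable_indicator') measurable
    finally show ?thesis .
  qed
  have "(\<integral>\<^sup>+x\<in>{0..}. discount \<beta> x * (\<integral>\<^sup>+y\<in>{0..x - c}. g y \<partial>lborel) \<partial>lborel) =
    (\<integral>\<^sup>+x. \<integral>\<^sup>+y. discount \<beta> x * indicator {0..} x * (g y * indicator {0..x - c} y) \<partial>lborel \<partial>lborel)"
  proof (rule nn_integral_cong)
    fix x :: real
    have "(\<integral>\<^sup>+y. discount \<beta> x * indicator {0..} x * (g y * indicator {0..x - c} y) \<partial>lborel) =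
      discount \<beta> x * indicator {0..} x * (\<integral>\<^sup>+y\<in>{0..x - c}. g y \<partial>lborel)"
      by (rule nn_integral_cmult) measurable
    then show "discount \<beta> x * (\<integral>\<^sup>+y\<in>{0..x - c}. g y \<partial>lborel) * indicator {0..} x =
      (\<integral>\<^sup>+y. discount \<beta> x * indicator {0..} x * (g y * indicator {0..x - c} y) \<partial>lborel)"
      by (simp only: mult.assoc mult.commute mult.left_commute)
  qed
  also have "\<dots> = (\<integral>\<^sup>+y. \<integral>\<^sup>+x. discount \<beta> x * indicator {0..} x * (g y * indicator {0..x - c} y) \<partial>lborel \<partial>lborel)"
    by (rule lborel_pair.Fubini') (unfold case_prod_beta', measurable)
  also have "\<dots> = (\<integral>\<^sup>+y. ennreal (exp (- \<beta> * c) / \<beta>) * (discount \<beta> y * g y * indicator {0..} y) \<partial>lborel)"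
  proof (rule nn_integral_cong)
    fix y :: real
    have "(\<integral>\<^sup>+x. discount \<beta> x * indicator {0..} x * (g y * indicator {0..x - c} y) \<partial>lborel) =
      (\<integral>\<^sup>+x. g y * indicator {0..} y * (discount \<beta> x * indicator {y + c..} x) \<partial>lborel)"
      using c by (intro nn_integral_cong) (auto simp: indicator_def mult.commute)
    also have "\<dots> = g y * indicator {0..} y * (\<integral>\<^sup>+x\<in>{y + c..}. discount \<beta> x \<partial>lborel)"
      by (rule nn_integral_cmult) measurable
    also have "\<dots> = g y * indicator {0..} y * (ennreal (exp (- \<beta> * c) / \<beta>) * discount \<beta> y)"
      unfolding nn_integral_exp_tail(1)[OF b] using b
      by (simp add: ennreal_mult[symmetric] exp_add[symmetric] algebra_simps)
    finally show "(\<integral>\<^sup>+x. discount \<beta> x * indicator {0..} x * (g y * indicator {0..x - c} y) \<partial>lborel) =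
      ennreal (exp (- \<beta> * c) / \<beta>) * (discount \<beta> y * g y * indicator {0..} y)"
      by (simp only: mult.assoc mult.commute mult.left_commute)
  qed
  also have "\<dots> = ennreal (exp (- \<beta> * c) / \<beta>) * (\<integral>\<^sup>+y\<in>{0..}. discount \<beta> y * g y \<partial>lborel)"
    by (rule nn_integral_cmult) measurable
  finally show ?thesis .
qed

context normalized_snlp
begin

subsection \<open>The killed resolvent in terms of the scale function\<close>

text \<open>Two dominated convergences, over paths and over time. The assumption is pointwise: for
  each path and time the truth value settles.\<close>

lemma laplace_prob_tendsto:
  assumes q: "0 < q"
    and [measurable]: "\<And>n. Measurable.pred (borel \<Otimes>\<^sub>M M) (\<lambda>p. P n (fst p) (snd p))"
      "Measurable.pred (borel \<Otimes>\<^sub>M M) (\<lambda>p. P' (fst p) (snd p))"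
    and lim: "\<And>s \<omega>. 0 \<le> s \<Longrightarrow> \<omega> \<in> space M \<Longrightarrow> eventually (\<lambda>n. P n s \<omega> \<longleftrightarrow> P' s \<omega>) sequentially"
  shows "(\<lambda>n. laplace q (\<lambda>s. emeasure M {\<omega>\<in>space M. P n s \<omega>})) \<longlonglongrightarrow>
    laplace q (\<lambda>s. emeasure M {\<omega>\<in>space M. P' s \<omega>})"
proof (rule nn_integral_dominated_convergence[where w = "\<lambda>s. discount q s * indicator {0..} s"])
  have pm: "Measurable.pred M (\<lambda>\<omega>. P n s \<omega>)" "Measurable.pred M (\<lambda>\<omega>. P' s \<omega>)" for n s
    using measurable_compose[OF measurable_Pair1' assms(2), of s n] measurable_compose[OF measurable_Pair1' assms(3), of s]
    by simp_all
  have em: "emeasure M {\<omega>\<in>space M. Q s \<omega>} = (\<integral>\<^sup>+\<omega>. indicator {p. Q (fst p) (snd p)} (s, \<omega>) \<partial>M)"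
    if "Measurable.pred M (\<lambda>\<omega>. Q s \<omega>)" for Q s
  proof -
    have "emeasure M {\<omega>\<in>space M. Q s \<omega>} = (\<integral>\<^sup>+\<omega>. indicator {\<omega>\<in>space M. Q s \<omega>} \<omega> \<partial>M)"
      using that by (intro nn_integral_indicator[symmetric]) simp
    also have "\<dots> = (\<integral>\<^sup>+\<omega>. indicator {p. Q (fst p) (snd p)} (s, \<omega>) \<partial>M)"
      by (intro nn_integral_cong) (simp add: indicator_def)
    finally show ?thesis .
  qed
  have e1: "(\<lambda>s. emeasure M {\<omega>\<in>space M. P n s \<omega>}) = (\<lambda>s. \<integral>\<^sup>+\<omega>. indicator {p. P n (fst p) (snd p)} (s, \<omega>) \<partial>M)" for n
    by (intro ext em pm)
  have e2: "(\<lambda>s. emeasure M {\<omega>\<in>space M. P' s \<omega>}) = (\<lambda>s. \<integral>\<^sup>+\<omega>. indicator {p. P' (fst p) (snd p)} (s, \<omega>) \<partial>M)"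
    by (intro ext em pm)
  have [measurable]: "(\<lambda>s. emeasure M {\<omega>\<in>space M. P n s \<omega>}) \<in> borel_measurable borel" for n
    unfolding e1
    by (rule borel_measurable_nn_integral) (unfold case_prod_beta' prod.collapse, rule borel_measurable_indicator', measurable)
  have [measurable]: "(\<lambda>s. emeasure M {\<omega>\<in>space M. P' s \<omega>}) \<in> borel_measurable borel"
    unfolding e2
    by (rule borel_measurable_nn_integral) (unfold case_prod_beta' prod.collapse, rule borel_measurable_indicator', measurable)
  show "(\<lambda>s. discount q s * emeasure M {\<omega>\<in>space M. P n s \<omega>} * indicator {0..} s) \<in> borel_measurable lborel" for n
    by measurable
  show "(\<lambda>s. discount q s * emeasure M {\<omega>\<in>space M. P' s \<omega>} * indicator {0..} s) \<in> borel_measurable lborel"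
    by measurable
  show "AE s in lborel. discount q s * emeasure M {\<omega>\<in>space M. P n s \<omega>} * indicator {0..} s \<le> discount q s * indicator {0..} s" for n
    using emeasure_le_1 by (intro AE_I2 mult_right_mono) (auto intro: mult_left_le)
  show "(\<integral>\<^sup>+s\<in>{0..}. discount q s \<partial>lborel) < \<infinity>"
    unfolding nn_integral_exp_tail(1)[OF q] by simp
  show "AE s in lborel. (\<lambda>n. discount q s * emeasure M {\<omega>\<in>space M. P n s \<omega>} * indicator {0..} s) \<longlonglongrightarrow>
    discount q s * emeasure M {\<omega>\<in>space M. P' s \<omega>} * indicator {0..} s"
  proof (rule AE_I2)
    fix s :: real
    show "(\<lambda>n. discount q s * emeasure M {\<omega>\<in>space M. P n s \<omega>} * indicator {0..} s) \<longlonglongrightarrow>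
      discount q s * emeasure M {\<omega>\<in>space M. P' s \<omega>} * indicator {0..} s"
    proof (cases "0 \<le> s")
      case True
      have "(\<lambda>n. emeasure M {\<omega>\<in>space M. P n s \<omega>}) \<longlonglongrightarrow> emeasure M {\<omega>\<in>space M. P' s \<omega>}"
        unfolding fun_cong[OF e1, of _ s] fun_cong[OF e2, of s]
      proof (rule nn_integral_dominated_convergence[where w = "\<lambda>_. 1"])
        show "(\<lambda>\<omega>. indicator {p. P n (fst p) (snd p)} (s, \<omega>) :: ennreal) \<in> borel_measurable M" for n
        proof -
          have "(\<lambda>\<omega>. indicator {p. P n (fst p) (snd p)} (s, \<omega>) :: ennreal) = (\<lambda>\<omega>. indicator {\<omega>. P n s \<omega>} \<omega>)" by (auto simp: indicator_def)
          also have "\<dots> \<in> borel_measurable M" by (rule borel_measurable_indicator') (use pm(1)[of n s] in simp)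
          finally show ?thesis .
        qed
        show "(\<lambda>\<omega>. indicator {p. P' (fst p) (snd p)} (s, \<omega>) :: ennreal) \<in> borel_measurable M"
        proof -
          have "(\<lambda>\<omega>. indicator {p. P' (fst p) (snd p)} (s, \<omega>) :: ennreal) = (\<lambda>\<omega>. indicator {\<omega>. P' s \<omega>} \<omega>)" by (auto simp: indicator_def)
          also have "\<dots> \<in> borel_measurable M" by (rule borel_measurable_indicator') (use pm(2)[of s] in simp)
          finally show ?thesis .
        qed
        show "AE \<omega> in M. (\<lambda>n. indicator {p. P n (fst p) (snd p)} (s, \<omega>) :: ennreal) \<longlonglongrightarrow> indicator {p. P' (fst p) (snd p)} (s, \<omega>)"
        proof (intro AE_I2 tendsto_eventually)
          fix \<omega> assume "\<omega> \<in> space M"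
          from lim[OF True this]
          show "eventually (\<lambda>n. indicator {p. P n (fst p) (snd p)} (s, \<omega>) = (indicator {p. P' (fst p) (snd p)} (s, \<omega>) :: ennreal)) sequentially"
            by eventually_elim (simp add: indicator_def)
        qed
      qed (auto simp: emeasure_space_1 indicator_def)
      from tendsto_mult_ennreal[OF tendsto_const this, of "discount q s"] show ?thesis
        using True by simp
    qed simp
  qed
qed measurable

text \<open>A path that survives strictly has a positive margin on the compact interval [0, s], and
  so survives from slightly lower starting points too; the strict inequalities make the tail
  left-continuous in x.\<close>

lemma killed_tail_left_limit:
  assumes q: "0 < q" and lim: "z \<longlonglongrightarrow> x" and le: "\<And>n. z n < x"
  shows "(\<lambda>n. killed_tail q (z n) c) \<longlonglongrightarrow> killed_tail q x c"
  unfolding killed_tail_def stay_prob_def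
proof (rule laplace_prob_tendsto[OF q])
  fix s :: real and \<omega> assume s: "0 \<le> s" and \<omega>: "\<omega> \<in> space M"
  interpret lsc_path "\<lambda>t. x + X t \<omega>" by (rule lsc_path_shift[OF \<omega>])
  show "eventually (\<lambda>n. (stays_pos (z n) s \<omega> \<and> c < z n + X s \<omega>) \<longleftrightarrow>
    (stays_pos x s \<omega> \<and> c < x + X s \<omega>)) sequentially"
  proof (cases "stays_pos x s \<omega> \<and> c < x + X s \<omega>")
    case True
    then obtain m :: nat where m: "\<And>r. r \<in> {0..s} \<Longrightarrow> 1 / (real m + 1) \<le> x + X r \<omega>"
      using pos_compact_bound[of 0 s] by blast
    define e where "e = min (1 / (real m + 1)) (x + X s \<omega> - c)"
    have "0 < e" using True by (simp add: e_def)
    then have "eventually (\<lambda>n. x - e < z n) sequentially" using lim by (intro order_tendstoD) auto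
    then show ?thesis
    proof eventually_elim
      case (elim n)
      have "0 < z n + X r \<omega>" if "r \<in> {0..s}" for r using m[OF that] elim unfolding e_def by linarith
      moreover have "c < z n + X s \<omega>" using elim unfolding e_def by linarith
      ultimately show ?case using True by blast
    qed
  next
    case False
    have "stays_pos x s \<omega> \<and> c < x + X s \<omega>" if "stays_pos (z n) s \<omega> \<and> c < z n + X s \<omega>" for n
      using that le[of n] by (meson add_strict_right_mono less_trans)
    then show ?thesis using False by (intro always_eventually) blast
  qed
qed measurable

text \<open>This is the limit from the right: for decreasing starting points the strict
  inequalities, also the one at c, become weak ones.\<close>

definition killed_nonneg_tail :: "real \<Rightarrow> real \<Rightarrow> real \<Rightarrow> ennreal" where
  "killed_nonneg_tail q x c = laplace q (\<lambda>s. emeasure M {\<omega>\<in>space M. stays_nonneg x s \<omega> \<and> c \<le> x + X s \<omega>})"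

lemma killed_tail_right_limit:
  assumes q: "0 < q"
  shows "(\<lambda>n. killed_tail q (x + 1 / real (Suc n)) c) \<longlonglongrightarrow> killed_nonneg_tail q x c"
  unfolding killed_tail_def stay_prob_def killed_nonneg_tail_def
proof (rule laplace_prob_tendsto[OF q])
  fix s :: real and \<omega> assume s: "0 \<le> s" and \<omega>: "\<omega> \<in> space M"
  have lim: "(\<lambda>n. x + 1 / real (Suc n)) \<longlonglongrightarrow> x"
    using tendsto_add[OF tendsto_const LIMSEQ_inverse_real_of_nat, of x] by (simp add: inverse_eq_divide)
  have gt: "x < x + 1 / real (Suc n)" for n by simp
  show "eventually (\<lambda>n. ((\<forall>r\<in>{0..s}. 0 < x + 1 / real (Suc n) + X r \<omega>) \<and> c < x + 1 / real (Suc n) + X s \<omega>) \<longleftrightarrow>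
    (stays_nonneg x s \<omega> \<and> c \<le> x + X s \<omega>)) sequentially"
  proof (cases "stays_nonneg x s \<omega> \<and> c \<le> x + X s \<omega>")
    case True
    have "(\<forall>r\<in>{0..s}. 0 < x + 1 / real (Suc n) + X r \<omega>) \<and> c < x + 1 / real (Suc n) + X s \<omega>" for n
    proof -
      have "0 < 1 / real (Suc n)" by simp
      then show ?thesis using True by (smt (verit))
    qed
    then show ?thesis using True by (intro always_eventually) blast
  next
    case False
    then consider r where "r \<in> {0..s}" "x + X r \<omega> < 0" | "x + X s \<omega> < c" by force
    then show ?thesis
    proof cases
      case 1
      have "eventually (\<lambda>n. x + 1 / real (Suc n) < - X r \<omega>) sequentially"
        using lim 1 by (intro order_tendstoD) auto
      then show ?thesis
      proof eventually_elim
        case (elim n)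
        then have "\<not> 0 < x + 1 / real (Suc n) + X r \<omega>" by linarith
        then show ?case using False 1(1) by blast
      qed
    next
      case 2
      have "eventually (\<lambda>n. x + 1 / real (Suc n) < c - X s \<omega>) sequentially"
        using lim 2 by (intro order_tendstoD) auto
      then show ?thesis
      proof eventually_elim
        case (elim n)
        then have "\<not> c < x + 1 / real (Suc n) + X s \<omega>" by linarith
        then show ?case using False by blast
      qed
    qed
  qed
qed measurable

text \<open>Lifting start and level together moves the killing boundary to -\<infinity>, and a path
  is bounded below on [0, s], so the killed resolvent recovers the free one.\<close>

lemma killed_tail_shift_limit:
  assumes q: "0 < q"
  shows "(\<lambda>n. killed_tail q (x + real n) (c + real n)) \<longlonglongrightarrow> emeasure (resolvent q) {c - x<..}"
  unfolding killed_tail_def stay_prob_def emeasure_resolvent[OF borel_open[OF open_greaterThan]]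
proof (rule laplace_prob_tendsto[OF q])
  fix s :: real and \<omega> assume s: "0 \<le> s" and \<omega>: "\<omega> \<in> space M"
  interpret lsc_path "\<lambda>t. X t \<omega>" by (rule lsc_path_X[OF \<omega>])
  obtain b where b: "\<And>r. r \<in> {0..s} \<Longrightarrow> - b < X r \<omega>" using bdd_below_compact[of 0 s] by blast
  have "eventually (\<lambda>n. b - x < real n) sequentially"
    using filterlim_real_sequentially by (simp add: filterlim_at_top_dense)
  then show "eventually (\<lambda>n. ((\<forall>r\<in>{0..s}. 0 < x + real n + X r \<omega>) \<and> c + real n < x + real n + X s \<omega>) \<longleftrightarrow>
    X s \<omega> \<in> {c - x<..}) sequentially"
  proof eventually_elim
    case (elim n)
    have "\<forall>r\<in>{0..s}. 0 < x + real n + X r \<omega>" using b elim by force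
    then show ?case by auto
  qed
qed measurable

lemma killed_tail_le:
  assumes q: "0 < q" shows "killed_tail q x c \<le> ennreal (1 / q)"
proof -
  have "killed_tail q x c \<le> (\<integral>\<^sup>+s\<in>{0..}. discount q s \<partial>lborel)"
    unfolding killed_tail_def stay_prob_def using emeasure_le_1
    by (intro nn_integral_mono mult_right_mono) (auto intro: mult_left_le)
  then show ?thesis using nn_integral_exp_tail(1)[OF q, of 0] by simp
qed

end

locale snlp_scale = normalized_snlp M X
  for M :: "'a measure" and X :: "real \<Rightarrow> 'a \<Rightarrow> real" +
  fixes q :: real and W :: "real \<Rightarrow> real"
  assumes q: "0 < q" and scale: "is_scale_function M X q W"
begin

definition "\<Phi> = passage_rate q"

lemma Phi_pos: "0 < \<Phi>" unfolding \<Phi>_def by (rule passage_rate_pos[OF q])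

lemma W_neg: "x < 0 \<Longrightarrow> W x = 0"
  and W_cont: "continuous_on {0..} W"
  and W_mono: "strict_mono_on {0..} W"
  and W_laplace: "\<Phi> < \<beta> \<Longrightarrow> ((\<lambda>x. exp (- \<beta> * x) * W x) has_integral 1 / (laplace_exponent M X \<beta> - q)) {0..}"
  using scale right_inverse_eq[OF q] by (auto simp: is_scale_function_def \<Phi>_def)

text \<open>
  \<open>W 0 \<ge> 0\<close> is only known a posteriori, so \<open>W\<close> is raised by \<open>w0\<close> to work with nonnegative functions.
\<close>

definition "w0 = max 0 (- W 0)"

definition "W_int d = integral {0..max 0 d} W"

definition "killed_formula x c = W x * exp (- \<Phi> * c) / \<Phi> - W_int (x - c)"

lemma W_w0_nonneg: "0 \<le> x \<Longrightarrow> 0 \<le> W x + w0"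
  using strict_mono_on_leD[OF W_mono, of 0 x] by (auto simp: w0_def)

lemma W_measurable [measurable]: "(\<lambda>x. (W x + w0) * indicator {0..} x) \<in> borel_measurable borel"
  using borel_measurable_continuous_on_indicator[of "{0..}" "\<lambda>x. W x + w0"] W_cont
  by (simp add: continuous_on_add mult.commute)

lemma W_integrable: "0 \<le> d \<Longrightarrow> W integrable_on {0..d}"
  using W_cont by (intro integrable_continuous_real) (auto intro: continuous_on_subset)

lemma continuous_W_int: "continuous_on UNIV W_int"
proof -
  have "continuous_on {0..b} (\<lambda>d. integral {0..d} W)" for b
    by (cases "0 \<le> b") (auto intro: indefinite_integral_continuous_1 W_integrable)
  then have c: "continuous_on {0..} (\<lambda>d. integral {0..d} W)"
  proof -
    assume *: "\<And>b. continuous_on {0..b} (\<lambda>d. integral {0..d} W)"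
    show ?thesis
    proof (rule continuous_on_sequentiallyI)
      fix u and a :: real assume u: "\<forall>n. u n \<in> {0..}" "a \<in> {0..}" "u \<longlonglongrightarrow> a"
      obtain B where B: "\<And>n. u n \<le> B" using convergent_imp_bounded[OF u(3)] by (auto simp: bounded_real abs_le_iff)
      show "(\<lambda>n. integral {0..u n} W) \<longlonglongrightarrow> integral {0..a} W"
        using u B LIMSEQ_le_const2[OF u(3), of B] by (intro continuous_on_tendsto_compose[OF *[of B] u(3)]) auto
    qed
  qed
  show ?thesis
    unfolding W_int_def by (rule continuous_on_compose2[OF c]) (auto intro!: continuous_intros)
qed

lemma nn_integral_W: "(\<integral>\<^sup>+y\<in>{0..d}. ennreal ((W y + w0) * indicator {0..} y) \<partial>lborel) = ennreal (W_int d + w0 * max 0 d)"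
proof (cases "0 \<le> d")
  case True
  have "((\<lambda>y. W y + w0) has_integral (integral {0..d} W + w0 * d)) {0..d}"
    using has_integral_add[OF integrable_integral[OF W_integrable[OF True]] has_integral_const_real[of w0 0 d]] True
    by (simp add: mult.commute)
  then have "(\<integral>\<^sup>+y. ennreal (W y + w0) * indicator {0..d} y \<partial>lborel) = ennreal (integral {0..d} W + w0 * d)"
    using W_w0_nonneg by (intro nn_integral_has_integral_lebesgue') auto
  then show ?thesis using True
    by (simp add: W_int_def max_def) (subst nn_integral_cong, auto simp: indicator_def)
qed (simp add: W_int_def)

lemma laplace_W:
  assumes b: "\<Phi> < \<beta>"
  shows "(\<integral>\<^sup>+x\<in>{0..}. discount \<beta> x * ennreal ((W x + w0) * indicator {0..} x) \<partial>lborel) =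
    ennreal (1 / (laplace_exponent M X \<beta> - q) + w0 / \<beta>)"
proof -
  have b0: "0 < \<beta>" using b Phi_pos by simp
  have "((\<lambda>x. exp (- \<beta> * x) * W x + w0 * exp (- \<beta> * x)) has_integral (1 / (laplace_exponent M X \<beta> - q) + w0 * (exp (- \<beta> * 0) / \<beta>))) {0..}"
    by (intro has_integral_add W_laplace b has_integral_mult_right has_integral_exp_minus_to_infinity b0)
  then have "((\<lambda>x. exp (- \<beta> * x) * (W x + w0)) has_integral (1 / (laplace_exponent M X \<beta> - q) + w0 / \<beta>)) {0..}"
    by (simp add: algebra_simps)
  then have "(\<integral>\<^sup>+x. ennreal (exp (- \<beta> * x) * (W x + w0)) * indicator {0..} x \<partial>lborel) = ennreal (1 / (laplace_exponent M X \<beta> - q) + w0 / \<beta>)"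
    using W_w0_nonneg by (intro nn_integral_has_integral_lebesgue') auto
  then show ?thesis
    by (subst (asm) nn_integral_cong[where v = "\<lambda>x. discount \<beta> x * ennreal ((W x + w0) * indicator {0..} x) * indicator {0..} x"])
      (auto simp: indicator_def ennreal_mult')
qed

text \<open>With E = exp (- \<Phi> c) / \<Phi> and B = exp (- \<beta> c) / \<beta>, the transform in
  x of the killed tail is (E - B) / (\<psi>(\<beta>) - q). Its first term is E times the transform
  of W, its second the transform of the primitive of W shifted by c; their difference is
  \<open>killed_formula\<close>.\<close>

lemma AE_killed_tail:
  assumes c: "0 \<le> c"
  shows "AE x in lborel. 0 \<le> x \<longrightarrow> killed_tail q x c = ennreal (killed_formula x c) \<and> 0 \<le> killed_formula x c"
proof -
  define E where "E = exp (- \<Phi> * c) / \<Phi>"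
  have E: "0 < E" using Phi_pos by (simp add: E_def)
  let ?w = "\<lambda>x. ennreal ((W x + w0) * indicator {0..} x)"
  have w0: "0 \<le> w0" by (simp add: w0_def)
  define Jw where "Jw x = (\<integral>\<^sup>+y\<in>{0..x - c}. ?w y \<partial>lborel)" for x
  define J0 where "J0 x = (\<integral>\<^sup>+y\<in>{0..x - c}. ennreal w0 \<partial>lborel)" for x
  \<comment> \<open>The formula with its negative terms moved to the other side, so that no
    difference occurs in \<open>ennreal\<close>; the multiples of \<open>w0\<close> balance between
    f and g.\<close>
  define f where "f x = killed_tail q x c + Jw x + ennreal (w0 * E)" for x
  define g where "g x = ?w x * ennreal E + J0 x" for x
  have [measurable]: "W_int \<in> borel_measurable borel" by (rule borel_measurable_continuous_onI[OF continuous_W_int])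
  have [measurable]: "?w \<in> borel_measurable borel" using W_measurable by (rule measurable_compose) simp
  have [measurable]: "Jw \<in> borel_measurable borel"
    unfolding Jw_def nn_integral_W by measurable
  have w0_int: "(\<integral>\<^sup>+y\<in>{0..d}. ennreal w0 \<partial>lborel) = ennreal (w0 * max 0 d)" for d
    using w0 by (cases "0 \<le> d") (simp_all add: nn_integral_cmult_indicator ennreal_mult')
  have [measurable]: "J0 \<in> borel_measurable borel" unfolding J0_def w0_int by measurable
  have [measurable]: "f \<in> borel_measurable borel" "g \<in> borel_measurable borel"
    unfolding f_def g_def by measurable
  have "AE x in lborel. 0 \<le> x \<longrightarrow> f x = g x"
  proof (rule laplace_unique_AE[of _ _ \<Phi>])
    fix \<beta> assume b: "\<Phi> < \<beta>"
    then have b0: "0 < \<beta>" using Phi_pos by simp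
    define D where "D = laplace_exponent M X \<beta> - q"
    have D: "0 < D" using below_transform_subcritical(2)[OF q, of \<beta> 1] b by (simp add: D_def \<Phi>_def)
    define B where "B = exp (- \<beta> * c) / \<beta>"
    have B: "0 < B" "B \<le> E"
      using b0 b c Phi_pos unfolding B_def E_def by (simp, intro frac_le) (auto intro: mult_right_mono)
    have K: "(\<integral>\<^sup>+x\<in>{0..}. discount \<beta> x * killed_tail q x c \<partial>lborel) = ennreal ((E - B) / D)"
    proof -
      have "(B - E) / (q - laplace_exponent M X \<beta>) = (E - B) / D"
        unfolding D_def by (metis minus_diff_eq minus_divide_divide)
      then show ?thesis using laplace_killed_tail[OF q b0 _ c] b by (simp add: B_def E_def \<Phi>_def)
    qed
    have cnst: "(\<integral>\<^sup>+x\<in>{0..}. discount \<beta> x * ennreal k \<partial>lborel) = ennreal (k / \<beta>)" if "0 \<le> k" for k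
    proof -
      have "(\<integral>\<^sup>+x\<in>{0..}. discount \<beta> x * ennreal k \<partial>lborel) = (\<integral>\<^sup>+x. ennreal k * (discount \<beta> x * indicator {0..} x) \<partial>lborel)"
        by (intro nn_integral_cong) (simp only: mult.assoc mult.commute mult.left_commute)
      also have "\<dots> = ennreal k * (\<integral>\<^sup>+x\<in>{0..}. discount \<beta> x \<partial>lborel)" by (rule nn_integral_cmult) measurable
      finally show ?thesis unfolding nn_integral_exp_tail(1)[OF b0] using that b0 by (simp add: ennreal_mult[symmetric])
    qed
    have Jw: "(\<integral>\<^sup>+x\<in>{0..}. discount \<beta> x * Jw x \<partial>lborel) = ennreal B * ennreal (1 / D + w0 / \<beta>)"
      unfolding Jw_def B_def D_def laplace_W[OF b, symmetric] by (rule laplace_primitive[OF _ b0 c]) measurable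
    have J0: "(\<integral>\<^sup>+x\<in>{0..}. discount \<beta> x * J0 x \<partial>lborel) = ennreal B * ennreal (w0 / \<beta>)"
      unfolding J0_def B_def cnst[OF w0, symmetric] by (rule laplace_primitive[OF _ b0 c]) measurable
    have "(\<integral>\<^sup>+x\<in>{0..}. discount \<beta> x * f x \<partial>lborel) =
      (\<integral>\<^sup>+x. discount \<beta> x * killed_tail q x c * indicator {0..} x + discount \<beta> x * Jw x * indicator {0..} x +
        discount \<beta> x * ennreal (w0 * E) * indicator {0..} x \<partial>lborel)"
      unfolding f_def distrib_left distrib_right ..
    also have "\<dots> = (\<integral>\<^sup>+x. discount \<beta> x * killed_tail q x c * indicator {0..} x + discount \<beta> x * Jw x * indicator {0..} x \<partial>lborel) +
      (\<integral>\<^sup>+x\<in>{0..}. discount \<beta> x * ennreal (w0 * E) \<partial>lborel)"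
      by (rule nn_integral_add) measurable
    also have "(\<integral>\<^sup>+x. discount \<beta> x * killed_tail q x c * indicator {0..} x + discount \<beta> x * Jw x * indicator {0..} x \<partial>lborel) =
      (\<integral>\<^sup>+x\<in>{0..}. discount \<beta> x * killed_tail q x c \<partial>lborel) + (\<integral>\<^sup>+x\<in>{0..}. discount \<beta> x * Jw x \<partial>lborel)"
      by (rule nn_integral_add) measurable
    also have "\<dots> + (\<integral>\<^sup>+x\<in>{0..}. discount \<beta> x * ennreal (w0 * E) \<partial>lborel) =
      ennreal ((E - B) / D) + ennreal B * ennreal (1 / D + w0 / \<beta>) + ennreal (w0 * E / \<beta>)"
      unfolding K Jw using w0 E by (subst cnst) auto
    also have "\<dots> = ennreal ((E - B) / D + B * (1 / D + w0 / \<beta>) + w0 * E / \<beta>)"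
      using B E D w0 b0 by (simp add: ennreal_mult[symmetric] ennreal_plus[symmetric] del: ennreal_plus)
    also have "(E - B) / D + B * (1 / D + w0 / \<beta>) + w0 * E / \<beta> = E * (1 / D + w0 / \<beta>) + B * (w0 / \<beta>)"
      by (simp add: diff_divide_distrib algebra_simps)
    finally have f: "(\<integral>\<^sup>+x\<in>{0..}. discount \<beta> x * f x \<partial>lborel) = ennreal (E * (1 / D + w0 / \<beta>) + B * (w0 / \<beta>))" .
    have "(\<integral>\<^sup>+x\<in>{0..}. discount \<beta> x * g x \<partial>lborel) =
      (\<integral>\<^sup>+x. ennreal E * (discount \<beta> x * ?w x * indicator {0..} x) + discount \<beta> x * J0 x * indicator {0..} x \<partial>lborel)"
      unfolding g_def by (intro nn_integral_cong) (simp only: distrib_left distrib_right mult.assoc mult.commute mult.left_commute)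
    also have "\<dots> = (\<integral>\<^sup>+x. ennreal E * (discount \<beta> x * ?w x * indicator {0..} x) \<partial>lborel) +
      (\<integral>\<^sup>+x\<in>{0..}. discount \<beta> x * J0 x \<partial>lborel)"
      by (rule nn_integral_add) measurable
    also have "(\<integral>\<^sup>+x. ennreal E * (discount \<beta> x * ?w x * indicator {0..} x) \<partial>lborel) =
      ennreal E * (\<integral>\<^sup>+x\<in>{0..}. discount \<beta> x * ?w x \<partial>lborel)"
      by (rule nn_integral_cmult) measurable
    also have "\<dots> + (\<integral>\<^sup>+x\<in>{0..}. discount \<beta> x * J0 x \<partial>lborel) = ennreal E * ennreal (1 / D + w0 / \<beta>) + ennreal B * ennreal (w0 / \<beta>)"
      unfolding J0 D_def laplace_W[OF b] ..
    also have "\<dots> = ennreal (E * (1 / D + w0 / \<beta>) + B * (w0 / \<beta>))"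
      using B E D w0 b0 by (simp add: ennreal_mult[symmetric] ennreal_plus[symmetric] del: ennreal_plus)
    finally have g: "(\<integral>\<^sup>+x\<in>{0..}. discount \<beta> x * g x \<partial>lborel) = \<dots>" .
    show "(\<integral>\<^sup>+x\<in>{0..}. discount \<beta> x * f x \<partial>lborel) < \<infinity>" unfolding f by simp
    show "(\<integral>\<^sup>+x\<in>{0..}. discount \<beta> x * f x \<partial>lborel) = (\<integral>\<^sup>+x\<in>{0..}. discount \<beta> x * g x \<partial>lborel)"
      unfolding f g ..
  qed measurable
  then show ?thesis
  proof (rule AE_mp, intro AE_I2 impI)
    fix x :: real assume fg: "0 \<le> x \<longrightarrow> f x = g x" and x: "0 \<le> x"
    have "killed_tail q x c \<noteq> \<top>" using killed_tail_le[OF q, of x c] by (auto simp: top_unique)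
    then obtain k where k: "killed_tail q x c = ennreal k" "0 \<le> k" by (cases "killed_tail q x c") auto
    have I: "0 \<le> W_int (x - c) + w0 * max 0 (x - c)"
    proof (cases "c \<le> x")
      case True
      have "((\<lambda>y. W y + w0) has_integral (integral {0..x - c} W + w0 * (x - c))) {0..x - c}"
        using has_integral_add[OF integrable_integral[OF W_integrable] has_integral_const_real[of w0 0 "x - c"]] True
        by (simp add: mult.commute)
      then have "0 \<le> integral {0..x - c} W + w0 * (x - c)" by (rule has_integral_nonneg) (use W_w0_nonneg in auto)
      then show ?thesis using True by (simp add: W_int_def)
    qed (simp add: W_int_def)
    have "f x = ennreal (k + (W_int (x - c) + w0 * max 0 (x - c)) + w0 * E)"
      unfolding f_def Jw_def nn_integral_W k(1) using k(2) I w0 E by (simp add: ennreal_plus[symmetric] del: ennreal_plus)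
    moreover have "g x = ennreal ((W x + w0) * E + w0 * max 0 (x - c))"
      unfolding g_def J0_def w0_int using x W_w0_nonneg[OF x] w0 E by (simp add: ennreal_mult[symmetric] ennreal_plus[symmetric] del: ennreal_plus)
    ultimately have "ennreal (k + (W_int (x - c) + w0 * max 0 (x - c)) + w0 * E) = ennreal ((W x + w0) * E + w0 * max 0 (x - c))"
      using fg x by simp
    moreover have "0 \<le> k + (W_int (x - c) + w0 * max 0 (x - c)) + w0 * E" "0 \<le> (W x + w0) * E + w0 * max 0 (x - c)"
      using k(2) I w0 E W_w0_nonneg[OF x] by (auto intro!: add_nonneg_nonneg mult_nonneg_nonneg)
    ultimately have "k + (W_int (x - c) + w0 * max 0 (x - c)) + w0 * E = (W x + w0) * E + w0 * max 0 (x - c)"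
      by (simp only: ennreal_inj)
    then have "k = W x * E - W_int (x - c)" by (simp add: distrib_right)
    then have "k = killed_formula x c" by (simp add: killed_formula_def E_def)
    then show "killed_tail q x c = ennreal (killed_formula x c) \<and> 0 \<le> killed_formula x c" using k by simp
  qed
qed

lemma continuous_killed_formula: "continuous_on {0..} (\<lambda>x. killed_formula x c)"
  unfolding killed_formula_def using Phi_pos
  by (intro continuous_intros W_cont continuous_on_compose2[OF continuous_W_int]) auto

text \<open>Equality almost everywhere becomes equality at x along points increasing to x, as the
  tail is left-continuous and the formula continuous.\<close>

lemma killed_tail_eq:
  assumes c: "0 \<le> c" and x: "0 < x"
  shows "killed_tail q x c = ennreal (killed_formula x c)" "0 \<le> killed_formula x c"
proof -
  have "\<forall>n::nat. \<exists>z. x - x / Suc n < z \<and> z < x \<and> (0 \<le> z \<longrightarrow> killed_tail q z c = ennreal (killed_formula z c) \<and> 0 \<le> killed_formula z c)"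
    using x by (intro allI AE_lborel_ex_between[OF AE_killed_tail[OF c]]) simp
  then obtain z where z: "\<And>n. x - x / Suc n < z n" "\<And>n. z n < x"
    "\<And>n. 0 \<le> z n \<longrightarrow> killed_tail q (z n) c = ennreal (killed_formula (z n) c) \<and> 0 \<le> killed_formula (z n) c"
    by metis
  have z0: "0 \<le> z n" for n
  proof -
    have "x / Suc n \<le> x" using x by (simp add: divide_le_eq_1 mult_le_cancel_left1 divide_le_eq)
    then show ?thesis using z(1)[of n] by linarith
  qed
  have lim: "z \<longlonglongrightarrow> x"
  proof (rule tendsto_sandwich[of "\<lambda>n. x - x / Suc n" _ _ "\<lambda>_. x"])
    have "(\<lambda>n. x - x * (1 / real (Suc n))) \<longlonglongrightarrow> x - x * 0"
      using LIMSEQ_inverse_real_of_nat by (intro tendsto_intros) (simp add: inverse_eq_divide)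
    then show "(\<lambda>n. x - x / real (Suc n)) \<longlonglongrightarrow> x" by simp
  qed (use z in \<open>auto intro!: always_eventually less_imp_le\<close>)
  have fl: "(\<lambda>n. killed_formula (z n) c) \<longlonglongrightarrow> killed_formula x c"
    using x z0 by (intro continuous_on_tendsto_compose[OF continuous_killed_formula lim]) auto
  have "(\<lambda>n. killed_tail q (z n) c) \<longlonglongrightarrow> ennreal (killed_formula x c)"
    using z(3) z0 fl by (simp add: tendsto_ennrealI)
  moreover have "(\<lambda>n. killed_tail q (z n) c) \<longlonglongrightarrow> killed_tail q x c"
    by (rule killed_tail_left_limit[OF q lim z(2)])
  ultimately show "killed_tail q x c = ennreal (killed_formula x c)" using LIMSEQ_unique by blast
  show "0 \<le> killed_formula x c" by (rule LIMSEQ_le_const[OF fl]) (use z(3) z0 in auto)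
qed

text \<open>The same formula is reached from the right. The weak version therefore agrees with the
  strict one for x > 0 and keeps the formula at x = 0, where the strict tail vanishes.\<close>

lemma killed_nonneg_tail_eq:
  assumes c: "0 \<le> c" and x: "0 \<le> x"
  shows "killed_nonneg_tail q x c = ennreal (killed_formula x c)" "0 \<le> killed_formula x c"
proof -
  have p: "0 < x + 1 / real (Suc n)" for n using x by (intro add_nonneg_pos) auto
  have lim: "(\<lambda>n. x + 1 / real (Suc n)) \<longlonglongrightarrow> x"
    using tendsto_add[OF tendsto_const LIMSEQ_inverse_real_of_nat, of x] by (simp add: inverse_eq_divide)
  have fl: "(\<lambda>n. killed_formula (x + 1 / real (Suc n)) c) \<longlonglongrightarrow> killed_formula x c"
    using x p by (intro continuous_on_tendsto_compose[OF continuous_killed_formula lim]) (auto intro!: always_eventually less_imp_le)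
  have "(\<lambda>n. killed_tail q (x + 1 / real (Suc n)) c) \<longlonglongrightarrow> ennreal (killed_formula x c)"
    unfolding killed_tail_eq(1)[OF c p] by (rule tendsto_ennrealI[OF fl])
  then show "killed_nonneg_tail q x c = ennreal (killed_formula x c)"
    using killed_tail_right_limit[OF q, of x c] LIMSEQ_unique by blast
  show "0 \<le> killed_formula x c" by (rule LIMSEQ_le_const[OF fl]) (use killed_tail_eq(2)[OF c p] in auto)
qed

text \<open>The formula is evaluated at x + n and c + n. For c = x it yields the growth of W: exp (-
  \<Phi> y) W(y) tends to \<open>resolvent_const q\<close> along y = x + n. Inserted for general c,
  this gives the resolvent tail also for negative c - x, which the exponential law does not
  reach.\<close>

lemma measure_resolvent_tail_eq:
  "measure (resolvent q) {c - x<..} = resolvent_const q * exp (\<Phi> * (x - c)) / \<Phi> - W_int (x - c)"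
proof -
  have R: "emeasure (resolvent q) A = ennreal (measure (resolvent q) A)" for A
    using finite_measure.emeasure_eq_measure[OF finite_measure_resolvent[OF q]] .
  have lim: "(\<lambda>n. killed_formula (x + real n) (c + real n)) \<longlonglongrightarrow> measure (resolvent q) {c - x<..}" for x c
  proof -
    have "eventually (\<lambda>n. max (- c) (- x) < real n) sequentially"
      using filterlim_real_sequentially by (simp only: filterlim_at_top_dense)
    then have "eventually (\<lambda>n. enn2real (killed_tail q (x + real n) (c + real n)) = killed_formula (x + real n) (c + real n)) sequentially"
    proof eventually_elim
      case (elim n)
      then show ?case using killed_tail_eq[of "c + real n" "x + real n"] by simp
    qed
    moreover have "(\<lambda>n. enn2real (killed_tail q (x + real n) (c + real n))) \<longlonglongrightarrow> measure (resolvent q) {c - x<..}"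
      using killed_tail_shift_limit[OF q, of x c] unfolding R by (intro tendsto_enn2real) auto
    ultimately show ?thesis using tendsto_cong by force
  qed
  have P: "\<Phi> \<noteq> 0" using Phi_pos by simp
  have ex: "exp (- (\<Phi> * (c + real n))) = exp (- (\<Phi> * (x + real n))) * exp (\<Phi> * (x - c))" for n
    by (simp add: exp_add[symmetric] algebra_simps)
  have "(\<lambda>n. W (x + real n) * exp (- \<Phi> * (x + real n)) / \<Phi>) \<longlonglongrightarrow> resolvent_const q / \<Phi>"
    using lim[of x x] P by (simp add: killed_formula_def W_int_def resolvent_const_def \<Phi>_def)
  then have "(\<lambda>n. W (x + real n) * exp (- \<Phi> * (x + real n)) / \<Phi> * exp (\<Phi> * (x - c)) - W_int (x - c)) \<longlonglongrightarrow>
    resolvent_const q / \<Phi> * exp (\<Phi> * (x - c)) - W_int (x - c)"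
    by (intro tendsto_diff tendsto_mult tendsto_const)
  then have "(\<lambda>n. killed_formula (x + real n) (c + real n)) \<longlonglongrightarrow> resolvent_const q / \<Phi> * exp (\<Phi> * (x - c)) - W_int (x - c)"
    by (simp add: killed_formula_def ex mult.assoc)
  then have "measure (resolvent q) {c - x<..} = resolvent_const q / \<Phi> * exp (\<Phi> * (x - c)) - W_int (x - c)"
    using lim[of x c] LIMSEQ_unique by blast
  then show ?thesis by simp
qed

end

section \<open>Occupation measures and further properties of the path functionals\<close>

lemma borel_measurable_indicator_pred:
  assumes "Measurable.pred N P"
  shows "(\<lambda>x. indicator {x. P x} x :: ennreal) \<in> borel_measurable N"
  using assms by (intro borel_measurable_indicator') (simp add: pred_def)

lemma nn_integral_lborel_shift:
  fixes a :: real
  assumes "f \<in> borel_measurable borel"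
  shows "(\<integral>\<^sup>+t. f t \<partial>lborel) = (\<integral>\<^sup>+s. f (a + s) \<partial>lborel)"
  using nn_integral_real_affine[OF assms, of 1 a] by simp

lemma (in prob_space) emeasure_event_measurable:
  assumes P: "Measurable.pred (borel \<Otimes>\<^sub>M M) (\<lambda>p. P (fst p) (snd p))"
  shows "(\<lambda>t. emeasure M {\<omega>\<in>space M. P t \<omega>}) \<in> borel_measurable borel"
proof -
  have S: "{p \<in> space (borel \<Otimes>\<^sub>M M). P (fst p) (snd p)} \<in> sets (borel \<Otimes>\<^sub>M M)" using P by (simp add: pred_def)
  have "Pair t -` {p \<in> space (borel \<Otimes>\<^sub>M M). P (fst p) (snd p)} = {\<omega>\<in>space M. P t \<omega>}" for t
    by (auto simp: space_pair_measure)
  then show ?thesis using measurable_emeasure_Pair[OF S] by simp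
qed

text \<open>The discounted occupation is realised as an image measure on time and path, which makes
  countable additivity automatic; Q selects the times and paths that are counted.\<close>

lemma (in prob_space) obtain_occupation_measure:
  assumes Q: "Measurable.pred (borel \<Otimes>\<^sub>M M) (\<lambda>p. Q (fst p) (snd p))"
    and Y [measurable]: "(\<lambda>p. Y (fst p) (snd p)) \<in> measurable (borel \<Otimes>\<^sub>M M) K"
  obtains N where "sets N = sets K" "\<And>A. A \<in> sets K \<Longrightarrow> emeasure N A =
    laplace q (\<lambda>t. emeasure M {\<omega>\<in>space M. Q t \<omega> \<and> Y t \<omega> \<in> A})"
proof
  define D where "D = density (lborel \<Otimes>\<^sub>M M)
    (\<lambda>p. discount q (fst p) * indicator {0..} (fst p) * indicator {p. Q (fst p) (snd p)} p)"
  let ?N = "distr D K (\<lambda>p. Y (fst p) (snd p))"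
  show "sets ?N = sets K" by simp
  have sL: "sets (lborel \<Otimes>\<^sub>M M) = sets (borel \<Otimes>\<^sub>M M)" by (intro sets_pair_measure_cong) auto
  have Ym: "(\<lambda>p. Y (fst p) (snd p)) \<in> measurable (lborel \<Otimes>\<^sub>M M) K" using Y sL by (simp cong: measurable_cong_sets)
  have [measurable]: "(\<lambda>p. indicator {p. Q (fst p) (snd p)} p :: ennreal) \<in> borel_measurable (borel \<Otimes>\<^sub>M M)"
    by (rule borel_measurable_indicator_pred[OF Q])
  fix A assume A: "A \<in> sets K"
  define S where "S = {p \<in> space (borel \<Otimes>\<^sub>M M). Q (fst p) (snd p) \<and> Y (fst p) (snd p) \<in> A}"
  have S: "S \<in> sets (borel \<Otimes>\<^sub>M M)"
    using sets.Int[OF Q[unfolded pred_def] measurable_sets[OF Y A]] by (simp add: S_def vimage_def Int_def conj_ac)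
  have Am: "(\<lambda>p. indicator A (Y (fst p) (snd p)) :: ennreal) \<in> borel_measurable (lborel \<Otimes>\<^sub>M M)"
    using A by (intro measurable_compose[OF Ym]) simp
  have "emeasure ?N A = (\<integral>\<^sup>+y. indicator A y \<partial>?N)" using A by simp
  also have "\<dots> = (\<integral>\<^sup>+p. indicator A (Y (fst p) (snd p)) \<partial>D)"
    using A Ym by (subst nn_integral_distr) (auto simp: D_def)
  also have "\<dots> = (\<integral>\<^sup>+p. discount q (fst p) * indicator {0..} (fst p) * indicator {p. Q (fst p) (snd p)} p *
      indicator A (Y (fst p) (snd p)) \<partial>(lborel \<Otimes>\<^sub>M M))"
    unfolding D_def by (rule nn_integral_density[OF _ Am]) measurable
  also have "\<dots> = (\<integral>\<^sup>+p. discount q (fst p) * indicator {0..} (fst p) * indicator S p \<partial>(lborel \<Otimes>\<^sub>M M))"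
    by (intro nn_integral_cong) (auto simp: indicator_def S_def space_pair_measure)
  also have "\<dots> = (\<integral>\<^sup>+t. \<integral>\<^sup>+\<omega>. discount q t * indicator {0..} t * indicator S (t, \<omega>) \<partial>M \<partial>lborel)"
  proof (subst nn_integral_fst[symmetric])
    show "(\<lambda>p. discount q (fst p) * indicator {0..} (fst p) * indicator S p) \<in> borel_measurable (lborel \<Otimes>\<^sub>M M)"
      using S sL by (intro borel_measurable_times_ennreal borel_measurable_indicator) auto
  qed (simp only: fst_conv)
  also have "\<dots> = laplace q (\<lambda>t. emeasure M {\<omega>\<in>space M. Q t \<omega> \<and> Y t \<omega> \<in> A})"
  proof (rule nn_integral_cong)
    fix t :: real
    have eq: "Pair t -` S = {\<omega>\<in>space M. Q t \<omega> \<and> Y t \<omega> \<in> A}" by (auto simp: S_def space_pair_measure)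
    have "(\<integral>\<^sup>+\<omega>. discount q t * indicator {0..} t * indicator S (t, \<omega>) \<partial>M) =
      (\<integral>\<^sup>+\<omega>. discount q t * indicator {0..} t * indicator {\<omega>\<in>space M. Q t \<omega> \<and> Y t \<omega> \<in> A} \<omega> \<partial>M)"
      unfolding eq[symmetric] by (intro nn_integral_cong) (simp add: indicator_def)
    also have "\<dots> = discount q t * indicator {0..} t * emeasure M {\<omega>\<in>space M. Q t \<omega> \<and> Y t \<omega> \<in> A}"
      using sets_Pair1[OF S, of t] unfolding eq by (rule nn_integral_cmult_indicator)
    finally show "(\<integral>\<^sup>+\<omega>. discount q t * indicator {0..} t * indicator S (t, \<omega>) \<partial>M) =
      discount q t * emeasure M {\<omega>\<in>space M. Q t \<omega> \<and> Y t \<omega> \<in> A} * indicator {0..} t"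
      by (simp only: mult.assoc mult.commute mult.left_commute)
  qed
  finally show "emeasure ?N A =
    laplace q (\<lambda>t. emeasure M {\<omega>\<in>space M. Q t \<omega> \<and> Y t \<omega> \<in> A})" .
qed

lemma path_functionals_cong:
  assumes "\<And>t. 0 \<le> t \<Longrightarrow> w t = w' t"
  shows "last_nonpos w t = last_nonpos w' t" "excursion_length w t = excursion_length w' t"
    "hit_nonpos w = hit_nonpos w'" "hit_neg w = hit_neg w'" "excursion_length_from u w t = excursion_length_from u w' t"
proof -
  have "{s. 0 \<le> s \<and> s \<le> t \<and> w s \<le> 0} = {s. 0 \<le> s \<and> s \<le> t \<and> w' s \<le> 0}" using assms by auto
  then show l: "last_nonpos w t = last_nonpos w' t" by (simp add: last_nonpos_def)
  then show e: "excursion_length w t = excursion_length w' t" by (simp add: excursion_length_def)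
  have "{t. 0 < t \<and> w t \<le> 0} = {t. 0 < t \<and> w' t \<le> 0}" "{t. 0 < t \<and> w t < 0} = {t. 0 < t \<and> w' t < 0}"
    using assms by auto
  then show "hit_nonpos w = hit_nonpos w'" "hit_neg w = hit_neg w'" by (simp_all add: hit_nonpos_def hit_neg_def)
  with e show "excursion_length_from u w t = excursion_length_from u w' t" by (simp add: excursion_length_from_def)
qed

context lsc_path
begin

text \<open>\<open>hit_nonpos\<close> ignores time 0, and the start may be nonpositive, so (0, t] is
  exhausted by compact intervals; the minimum with t keeps them nonempty.\<close>

lemma less_hit_nonpos_iff_pos_on:
  assumes "0 < t"
  shows "ereal t < hit_nonpos w \<longleftrightarrow> (\<forall>n::nat. \<forall>r\<in>{min t (1 / real (Suc n))..t}. 0 < w r)"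
proof
  assume l: "ereal t < hit_nonpos w"
  show "\<forall>n::nat. \<forall>r\<in>{min t (1 / real (Suc n))..t}. 0 < w r"
  proof (intro allI ballI, rule ccontr)
    fix n :: nat and r assume r: "r \<in> {min t (1 / real (Suc n))..t}" and n: "\<not> 0 < w r"
    have "0 < min t (1 / real (Suc n))" using assms by simp
    then have "0 < r" using r by (meson atLeastAtMost_iff less_le_trans)
    then have "hit_nonpos w \<le> ereal r" unfolding hit_nonpos_def using n by (intro Inf_lower) auto
    also have "\<dots> \<le> ereal t" using r by simp
    finally show False using l by simp
  qed
next
  assume *: "\<forall>n::nat. \<forall>r\<in>{min t (1 / real (Suc n))..t}. 0 < w r"
  have pos: "0 < w r" if r: "0 < r" "r \<le> t" for r
  proof -
    obtain n where "1 / real (Suc n) < r" using reals_Archimedean[OF r(1)] by (auto simp: inverse_eq_divide)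
    then have "r \<in> {min t (1 / real (Suc n))..t}" using r by (auto simp: min_le_iff_disj)
    then show ?thesis using * by blast
  qed
  then have "t \<in> {t. 0 < w t}" using assms by auto
  then obtain e where e: "e > 0" "\<And>r. dist r t < e \<Longrightarrow> 0 < w r"
    using open_gt[of 0] unfolding open_dist by blast
  have "ereal (t + e) \<le> hit_nonpos w"
    unfolding hit_nonpos_def
  proof (rule Inf_greatest)
    fix x assume "x \<in> ereal ` {t. 0 < t \<and> w t \<le> 0}"
    then obtain r where r: "x = ereal r" "0 < r" "w r \<le> 0" by auto
    then have "\<not> r \<le> t" using pos[of r] by auto
    moreover have "\<not> dist r t < e" using e(2)[of r] r by auto
    ultimately show "ereal (t + e) \<le> x" using r by (auto simp: dist_real_def)
  qed
  then show "ereal t < hit_nonpos w" using e(1) by (metis ereal_less_eq(3) less_add_same_cancel1 less_le_trans linorder_not_le order_less_irrefl)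
qed

lemma not_less_hit_nonpos_imp:
  assumes "0 < t" "\<not> ereal t < hit_nonpos w"
  shows "\<exists>r\<in>{0..t}. w r \<le> 0"
proof (rule ccontr)
  assume n: "\<not> ?thesis"
  have "\<forall>r\<in>{min t (1 / real (Suc n))..t}. 0 < w r" for n :: nat
  proof
    fix r assume r: "r \<in> {min t (1 / real (Suc n))..t}"
    have "0 < min t (1 / real (Suc n))" using assms by simp
    also have "\<dots> \<le> r" using r by (simp only: atLeastAtMost_iff)
    finally have "r \<in> {0..t}" using r by simp
    then show "0 < w r" using n by force
  qed
  then show False using less_hit_nonpos_iff_pos_on[OF assms(1)] assms(2) by blast
qed

lemma less_hit_neg_iff:
  assumes "0 \<le> t" "0 < w t"
  shows "ereal t < hit_neg w \<longleftrightarrow> (\<forall>r\<in>{0..t}. 0 \<le> w r)"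
proof (cases "0 \<le> w 0")
  case True
  then show ?thesis using less_hit_neg_imp[of t] less_hit_negI[of t] assms by blast
next
  case False
  then have "hit_neg w \<le> 0" using hit_neg_neg_start by simp
  then have "\<not> ereal t < hit_neg w" using assms(1) by (metis ereal_less_eq(5) leD order_trans)
  moreover have "\<not> (\<forall>r\<in>{0..t}. 0 \<le> w r)" using False assms(1) by force
  ultimately show ?thesis by blast
qed

lemma excursion_length_nonneg: "(\<exists>r\<in>{0..t}. w r \<le> 0) \<Longrightarrow> 0 \<le> excursion_length w t"
  using last_nonpos_mem(1)[of _ t] by (fastforce simp: excursion_length_def)

end

context normalized_snlp
begin

subsection \<open>Measurability of the excursion length\<close>

text \<open>The age after a return to (-\<infinity>,0]. Before any return it is set to 0, which
  keeps the running first excursion out of the events that the age exceeds some a \<ge> 0.\<close>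

definition excursion :: "real \<Rightarrow> real \<Rightarrow> 'a \<Rightarrow> real" where
  "excursion z t \<omega> = (if \<exists>r\<in>{0..t}. z + X r \<omega> \<le> 0 then excursion_length (\<lambda>t. z + X t \<omega>) t else 0)"

lemma nonpos_event_measurable [measurable (raw)]:
  assumes [measurable]: "x \<in> borel_measurable N" "s \<in> borel_measurable N" "t \<in> borel_measurable N" "g \<in> measurable N M"
  shows "Measurable.pred N (\<lambda>y. \<exists>r\<in>{s y..t y}. x y + X r (g y) \<le> 0)"
proof -
  have "(\<lambda>y. \<exists>r\<in>{s y..t y}. x y + X r (g y) \<le> 0) = (\<lambda>y. \<not> (\<forall>r\<in>{s y..t y}. 0 < x y + X r (g y)))"
    by (auto simp: fun_eq_iff not_less)
  moreover have "Measurable.pred N (\<lambda>y. \<not> (\<forall>r\<in>{s y..t y}. 0 < x y + X r (g y)))" by measurable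
  ultimately show ?thesis by (simp only:)
qed

lemma excursion_gt_iff:
  assumes "\<omega> \<in> space M" "0 \<le> t" "0 \<le> a"
  shows "returns z t \<omega> \<and> a < excursion z t \<omega> \<longleftrightarrow>
    a \<le> t \<and> returns z (t - a) \<omega> \<and> (\<forall>r\<in>{t - a..t}. 0 < z + X r \<omega>)"
  using lsc_path.excursion_length_gt_iff[OF lsc_path_shift[OF assms(1)] assms(2,3), of z]
  by (auto simp: excursion_def)

lemma excursion_measurable [measurable (raw)]:
  assumes [measurable]: "z \<in> borel_measurable N" "t \<in> borel_measurable N" "g \<in> measurable N M"
  shows "(\<lambda>y. excursion (z y) (t y) (g y)) \<in> borel_measurable N"
proof (rule borel_measurable_iff_greater[THEN iffD2, rule_format])
  fix a :: real
  have g: "g y \<in> space M" if "y \<in> space N" for y using measurable_space[OF assms(3) that] .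
  show "{y \<in> space N. a < excursion (z y) (t y) (g y)} \<in> sets N"
  proof (cases "0 \<le> a")
    case True
    have "a < excursion (z y) (t y) (g y) \<longleftrightarrow> 0 \<le> t y \<and> a \<le> t y \<and> returns (z y) (t y - a) (g y) \<and>
      (\<forall>r\<in>{t y - a..t y}. 0 < z y + X r (g y))" if y: "y \<in> space N" for y
    proof (cases "0 \<le> t y")
      case t: True
      have "a < excursion (z y) (t y) (g y) \<longleftrightarrow> returns (z y) (t y) (g y) \<and> a < excursion (z y) (t y) (g y)"
        using True by (auto simp: excursion_def)
      then show ?thesis using excursion_gt_iff[OF g[OF y] t True, of "z y"] t by blast
    next
      case False
      then show ?thesis using True by (auto simp: excursion_def)
    qed
    then have "{y \<in> space N. a < excursion (z y) (t y) (g y)} = {y \<in> space N. 0 \<le> t y \<and> a \<le> t y \<and>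
      returns (z y) (t y - a) (g y) \<and> (\<forall>r\<in>{t y - a..t y}. 0 < z y + X r (g y))}" by auto
    also have "\<dots> \<in> sets N" by measurable
    finally show ?thesis .
  next
    case False
    have "a < excursion (z y) (t y) (g y)" if y: "y \<in> space N" for y
    proof -
      have "0 \<le> excursion (z y) (t y) (g y)"
        using lsc_path.excursion_length_nonneg[OF lsc_path_shift[OF g[OF y]], of "t y" "z y"] by (auto simp: excursion_def)
      then show ?thesis using False by simp
    qed
    then have "{y \<in> space N. a < excursion (z y) (t y) (g y)} = space N" by auto
    then show ?thesis by simp
  qed
qed

lemma pred_borel_pair:
  assumes B: "B \<in> sets (borel :: (real \<times> real) measure)"
    and [measurable]: "f \<in> borel_measurable N" "g \<in> borel_measurable N"
  shows "Measurable.pred N (\<lambda>y. (f y, g y) \<in> B)"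
proof -
  have "(\<lambda>y. (f y, g y)) \<in> measurable N (borel :: (real \<times> real) measure)" unfolding borel_prod[symmetric] by measurable
  from measurable_sets_Collect[OF this, of "\<lambda>p. p \<in> B"] B show ?thesis by (simp add: pred_def)
qed

lemma excursion_from_event_measurable:
  assumes r: "0 < r" and B: "B \<in> sets borel" and [measurable]: "z \<in> borel_measurable M"
  shows "{\<omega>\<in>space M. (excursion_length_from u (\<lambda>t. z \<omega> + X t \<omega>) r, z \<omega> + X r \<omega>) \<in> B} \<in> sets M"
proof -
  define H where "H \<omega> \<longleftrightarrow> (\<forall>n::nat. \<forall>s\<in>{min r (1 / real (Suc n))..r}. 0 < z \<omega> + X s \<omega>)" for \<omega>
  have [measurable]: "Measurable.pred M H" unfolding H_def by measurable
  note [measurable] = pred_borel_pair[OF B]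
  have "(excursion_length_from u (\<lambda>t. z \<omega> + X t \<omega>) r, z \<omega> + X r \<omega>) \<in> B \<longleftrightarrow>
    (H \<omega> \<and> (u + r, z \<omega> + X r \<omega>) \<in> B) \<or> (\<not> H \<omega> \<and> (excursion (z \<omega>) r \<omega>, z \<omega> + X r \<omega>) \<in> B)" if \<omega>: "\<omega> \<in> space M" for \<omega>
  proof -
    interpret lsc_path "\<lambda>t. z \<omega> + X t \<omega>" by (rule lsc_path_shift[OF \<omega>])
    show ?thesis
      using less_hit_nonpos_iff_pos_on[OF r] not_less_hit_nonpos_imp[OF r]
      by (auto simp: excursion_length_from_def excursion_def H_def)
  qed
  then have "{\<omega>\<in>space M. (excursion_length_from u (\<lambda>t. z \<omega> + X t \<omega>) r, z \<omega> + X r \<omega>) \<in> B} =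
    {\<omega>\<in>space M. (H \<omega> \<and> (u + r, z \<omega> + X r \<omega>) \<in> B) \<or> (\<not> H \<omega> \<and> (excursion (z \<omega>) r \<omega>, z \<omega> + X r \<omega>) \<in> B)}" by auto
  also have "\<dots> \<in> sets M" by measurable
  finally show ?thesis .
qed

lemma excursion_event_measurable:
  assumes r: "0 < r" and B: "B \<in> sets borel" and [measurable]: "z \<in> borel_measurable M"
  shows "{\<omega>\<in>space M. (excursion_length (\<lambda>t. z \<omega> + X t \<omega>) r, z \<omega> + X r \<omega>) \<in> B} \<in> sets M"
proof -
  note [measurable] = pred_borel_pair[OF B]
  have "(excursion_length (\<lambda>t. z \<omega> + X t \<omega>) r, z \<omega> + X r \<omega>) \<in> B \<longleftrightarrow>
    ((\<exists>s\<in>{0..r}. z \<omega> + X s \<omega> \<le> 0) \<and> (excursion (z \<omega>) r \<omega>, z \<omega> + X r \<omega>) \<in> B) \<or>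
    (\<not> (\<exists>s\<in>{0..r}. z \<omega> + X s \<omega> \<le> 0) \<and> (r, z \<omega> + X r \<omega>) \<in> B)" for \<omega>
  proof (cases "\<exists>s\<in>{0..r}. z \<omega> + X s \<omega> \<le> 0")
    case False
    then have "{s. 0 \<le> s \<and> s \<le> r \<and> z \<omega> + X s \<omega> \<le> 0} = {}" by auto
    then have "excursion_length (\<lambda>t. z \<omega> + X t \<omega>) r = r" by (simp add: excursion_length_def last_nonpos_def)
    then show ?thesis using False by simp
  qed (simp add: excursion_def)
  then have "{\<omega>\<in>space M. (excursion_length (\<lambda>t. z \<omega> + X t \<omega>) r, z \<omega> + X r \<omega>) \<in> B} =
    {\<omega>\<in>space M. ((\<exists>s\<in>{0..r}. z \<omega> + X s \<omega> \<le> 0) \<and> (excursion (z \<omega>) r \<omega>, z \<omega> + X r \<omega>) \<in> B) \<or>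
    (\<not> (\<exists>s\<in>{0..r}. z \<omega> + X s \<omega> \<le> 0) \<and> (r, z \<omega> + X r \<omega>) \<in> B)}" by auto
  also have "\<dots> \<in> sets M" by measurable
  finally show ?thesis .
qed

text \<open>Points of B have y > 0, so the path is positive at time r, and the strict inequality for
  the infimum reduces to nonnegativity up to r.\<close>

lemma first_excursion_event:
  assumes r: "0 < r" and B: "B \<subseteq> {0<..} \<times> {0<..}"
  shows "{\<omega>\<in>space M. (v, z \<omega> + X r \<omega>) \<in> B \<and> ereal r < hit_neg (\<lambda>t. z \<omega> + X t \<omega>)} =
    {\<omega>\<in>space M. (v, z \<omega> + X r \<omega>) \<in> B \<and> (\<forall>s\<in>{0..r}. 0 \<le> z \<omega> + X s \<omega>)}"
proof (intro Collect_cong conj_cong refl)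
  fix \<omega> assume \<omega>: "\<omega> \<in> space M" and "(v, z \<omega> + X r \<omega>) \<in> B"
  then have "0 < z \<omega> + X r \<omega>" using B by auto
  then show "ereal r < hit_neg (\<lambda>t. z \<omega> + X t \<omega>) \<longleftrightarrow> (\<forall>s\<in>{0..r}. 0 \<le> z \<omega> + X s \<omega>)"
    by (rule lsc_path.less_hit_neg_iff[OF lsc_path_shift[OF \<omega>] less_imp_le[OF r]])
qed

subsection \<open>Excursions after the first return\<close>

text \<open>The discounted occupation of x + X restricted to the times at which Q holds. When Q s is
  a past event at each s, the Markov property integrates against this measure as the distribution of
  the restarting point.\<close>

definition post_measure :: "real \<Rightarrow> real \<Rightarrow> (real \<Rightarrow> 'a \<Rightarrow> bool) \<Rightarrow> real measure" where
  "post_measure q x Q = distr (density (lborel \<Otimes>\<^sub>M M)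
     (\<lambda>p. discount q (fst p) * indicator {0..} (fst p) * indicator {p. Q (fst p) (snd p)} p)) borel (\<lambda>p. x + X (fst p) (snd p))"

lemma sets_post_measure [simp, measurable_cong]: "sets (post_measure q x Q) = sets borel"
  by (simp add: post_measure_def)

lemma nn_integral_post_measure:
  assumes Q [measurable]: "Measurable.pred (lborel \<Otimes>\<^sub>M M) (\<lambda>p. Q (fst p) (snd p))" and [measurable]: "f \<in> borel_measurable borel"
  shows "(\<integral>\<^sup>+y. f y \<partial>post_measure q x Q) =
    laplace q (\<lambda>s. (\<integral>\<^sup>+\<omega>. indicator {\<omega>. Q s \<omega>} \<omega> * f (x + X s \<omega>) \<partial>M))"
proof -
  have [measurable]: "(\<lambda>p. indicator {p. Q (fst p) (snd p)} p :: ennreal) \<in> borel_measurable (lborel \<Otimes>\<^sub>M M)"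
    by (rule borel_measurable_indicator_pred[OF Q])
  have Qs [measurable]: "Measurable.pred M (\<lambda>\<omega>. Q s \<omega>)" for s
    using measurable_compose[OF measurable_Pair1' Q, of s] by simp
  have [measurable]: "(\<lambda>\<omega>. indicator {\<omega>. Q s \<omega>} \<omega> :: ennreal) \<in> borel_measurable M" for s
    by (rule borel_measurable_indicator_pred[OF Qs])
  have "(\<integral>\<^sup>+y. f y \<partial>post_measure q x Q) =
    (\<integral>\<^sup>+p. discount q (fst p) * indicator {0..} (fst p) * indicator {p. Q (fst p) (snd p)} p * f (x + X (fst p) (snd p)) \<partial>(lborel \<Otimes>\<^sub>M M))"
    unfolding post_measure_def by (subst nn_integral_distr, measurable) (rule nn_integral_density, measurable)
  also have "\<dots> = (\<integral>\<^sup>+s. \<integral>\<^sup>+\<omega>. discount q s * indicator {0..} s * (indicator {\<omega>. Q s \<omega>} \<omega> * f (x + X s \<omega>)) \<partial>M \<partial>lborel)"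
    by (subst nn_integral_fst[symmetric]) (measurable, simp add: indicator_def mult.assoc)
  also have "\<dots> = laplace q (\<lambda>s. (\<integral>\<^sup>+\<omega>. indicator {\<omega>. Q s \<omega>} \<omega> * f (x + X s \<omega>) \<partial>M))"
  proof (rule nn_integral_cong)
    fix s :: real
    have "(\<integral>\<^sup>+\<omega>. discount q s * indicator {0..} s * (indicator {\<omega>. Q s \<omega>} \<omega> * f (x + X s \<omega>)) \<partial>M) =
      discount q s * indicator {0..} s * (\<integral>\<^sup>+\<omega>. indicator {\<omega>. Q s \<omega>} \<omega> * f (x + X s \<omega>) \<partial>M)"
      by (rule nn_integral_cmult) measurable
    then show "(\<integral>\<^sup>+\<omega>. discount q s * indicator {0..} s * (indicator {\<omega>. Q s \<omega>} \<omega> * f (x + X s \<omega>)) \<partial>M) =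
      discount q s * (\<integral>\<^sup>+\<omega>. indicator {\<omega>. Q s \<omega>} \<omega> * f (x + X s \<omega>) \<partial>M) * indicator {0..} s"
      by (simp only: mult.assoc mult.commute mult.left_commute)
  qed
  finally show ?thesis .
qed

lemma emeasure_post_measure:
  assumes Q [measurable]: "Measurable.pred (lborel \<Otimes>\<^sub>M M) (\<lambda>p. Q (fst p) (snd p))" and A [measurable]: "A \<in> sets borel"
  shows "emeasure (post_measure q x Q) A =
    laplace q (\<lambda>s. emeasure M {\<omega>\<in>space M. Q s \<omega> \<and> x + X s \<omega> \<in> A})"
proof -
  have Qs [measurable]: "Measurable.pred M (\<lambda>\<omega>. Q s \<omega>)" for s
    using measurable_compose[OF measurable_Pair1' Q, of s] by simp
  have "emeasure M {\<omega>\<in>space M. Q s \<omega> \<and> x + X s \<omega> \<in> A} = (\<integral>\<^sup>+\<omega>. indicator {\<omega>. Q s \<omega>} \<omega> * indicator A (x + X s \<omega>) \<partial>M)" for s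
  proof -
    have "emeasure M {\<omega>\<in>space M. Q s \<omega> \<and> x + X s \<omega> \<in> A} = (\<integral>\<^sup>+\<omega>. indicator {\<omega>\<in>space M. Q s \<omega> \<and> x + X s \<omega> \<in> A} \<omega> \<partial>M)"
      by (rule nn_integral_indicator[symmetric]) measurable
    also have "\<dots> = (\<integral>\<^sup>+\<omega>. indicator {\<omega>. Q s \<omega>} \<omega> * indicator A (x + X s \<omega>) \<partial>M)"
      by (intro nn_integral_cong) (simp add: indicator_def)
    finally show ?thesis .
  qed
  then show ?thesis using nn_integral_post_measure[OF Q, of "indicator A" q x] by simp
qed

lemma pos_event_dyadic:
  assumes s: "0 \<le> s" and \<omega>: "\<omega> \<in> space M"
  shows "stays_pos x s \<omega> \<longleftrightarrow> (\<exists>m::nat. \<forall>l\<in>dyadics 1. 1 / (real m + 1) \<le> x + (\<lambda>l\<in>dyadics 1. X (l * s) \<omega>) l)"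
  using lsc_path.pos_on_interval_iff[OF lsc_path_shift[OF \<omega>, of x] s, of 0] by simp

lemma nonneg_event_dyadic:
  assumes s: "0 \<le> s" and \<omega>: "\<omega> \<in> space M"
  shows "stays_nonneg x s \<omega> \<longleftrightarrow> (\<forall>l\<in>dyadics 1. 0 \<le> x + (\<lambda>l\<in>dyadics 1. X (l * s) \<omega>) l)"
  using lsc_path.ge_on_interval_iff[OF lsc_path_shift[OF \<omega>, of x] s, of 0 0] by simp

text \<open>The tail hypothesis says that the occupation after the first return has density k exp (-
  \<Phi>(q) z) on (0,\<infinity>). With t = a + s, the age exceeds a if the return happened by time
  s and the path is positive on [s, s + a], so the Markov property at s yields the hypothesis of
  \<open>eq_kendall_measure\<close>.\<close>

lemma return_potential:
  assumes q: "0 < q" and k: "0 \<le> k"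
    and tail: "\<And>c. 0 \<le> c \<Longrightarrow> (laplace q (\<lambda>s. emeasure M {\<omega>\<in>space M. returns x s \<omega> \<and> c < x + X s \<omega>})) = ennreal (k * exp (- passage_rate q * c) / passage_rate q)"
    and B: "B \<in> sets borel" "B \<subseteq> {0<..} \<times> {0<..}"
  shows "laplace q (\<lambda>t. emeasure M {\<omega>\<in>space M. returns x t \<omega> \<and> (excursion x t \<omega>, x + X t \<omega>) \<in> B}) =
    ennreal k * kendall_part M X q B"
proof -
  define Q where "Q t \<omega> \<longleftrightarrow> returns x t \<omega>" for t \<omega>
  have Qm [measurable]: "Measurable.pred (borel \<Otimes>\<^sub>M M) (\<lambda>p. Q (fst p) (snd p))" "Measurable.pred M (\<lambda>\<omega>. Q t \<omega>)" for t
    unfolding Q_def by measurable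
  have pm: "(\<lambda>p. (excursion x (fst p) (snd p), x + X (fst p) (snd p))) \<in> measurable (borel \<Otimes>\<^sub>M M) borel"
    unfolding borel_prod[symmetric] by measurable
  obtain Nu :: "(real \<times> real) measure" where sets_Nu: "sets Nu = sets borel"
    and Nu: "\<And>A. A \<in> sets borel \<Longrightarrow> emeasure Nu A = laplace q (\<lambda>t. emeasure M {\<omega>\<in>space M. Q t \<omega> \<and> (excursion x t \<omega>, x + X t \<omega>) \<in> A})"
    using obtain_occupation_measure[OF Qm(1) pm, of q] by blast
  have "emeasure Nu B = ennreal k * kendall_part M X q B"
  proof (rule eq_kendall_measure[OF q k _ _ B])
    show "sets Nu = sets borel" by (rule sets_Nu)
    fix a c :: real assume a: "0 \<le> a" and c: "0 \<le> c"
    have "emeasure Nu ({a<..} \<times> {c<..}) = laplace q (\<lambda>t. emeasure M {\<omega>\<in>space M. Q t \<omega> \<and> (excursion x t \<omega>, x + X t \<omega>) \<in> {a<..} \<times> {c<..}})"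
      by (rule Nu) (simp add: open_Times borel_open)
    also have "\<dots> = (\<integral>\<^sup>+t. discount q t *
      emeasure M {\<omega>\<in>space M. Q (t - a) \<omega> \<and> (\<forall>r\<in>{t - a..t}. 0 < x + X r \<omega>) \<and> c < x + X t \<omega>} * indicator {0..} (t - a) \<partial>lborel)"
    proof (rule nn_integral_cong)
      fix t :: real
      show "discount q t * emeasure M {\<omega>\<in>space M. Q t \<omega> \<and> (excursion x t \<omega>, x + X t \<omega>) \<in> {a<..} \<times> {c<..}} * indicator {0..} t =
        discount q t * emeasure M {\<omega>\<in>space M. Q (t - a) \<omega> \<and> (\<forall>r\<in>{t - a..t}. 0 < x + X r \<omega>) \<and> c < x + X t \<omega>} * indicator {0..} (t - a)"
      proof (cases "0 \<le> t")
        case True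
        have "{\<omega>\<in>space M. Q t \<omega> \<and> (excursion x t \<omega>, x + X t \<omega>) \<in> {a<..} \<times> {c<..}} =
          (if a \<le> t then {\<omega>\<in>space M. Q (t - a) \<omega> \<and> (\<forall>r\<in>{t - a..t}. 0 < x + X r \<omega>) \<and> c < x + X t \<omega>} else {})"
          using excursion_gt_iff[OF _ True a, of _ x] by (auto simp: Q_def)
        then show ?thesis using True by (simp add: indicator_def)
      qed (use a in simp)
    qed
    also have "\<dots> = (\<integral>\<^sup>+s. discount q (a + s) *
      emeasure M {\<omega>\<in>space M. Q (a + s - a) \<omega> \<and> (\<forall>r\<in>{a + s - a..a + s}. 0 < x + X r \<omega>) \<and> c < x + X (a + s) \<omega>} * indicator {0..} (a + s - a) \<partial>lborel)"
    proof (rule nn_integral_lborel_shift)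
      have "(\<lambda>t. emeasure M {\<omega>\<in>space M. Q (t - a) \<omega> \<and> (\<forall>r\<in>{t - a..t}. 0 < x + X r \<omega>) \<and> c < x + X t \<omega>}) \<in> borel_measurable borel"
        unfolding Q_def by (rule emeasure_event_measurable) measurable
      then show "(\<lambda>t. discount q t * emeasure M {\<omega>\<in>space M. Q (t - a) \<omega> \<and> (\<forall>r\<in>{t - a..t}. 0 < x + X r \<omega>) \<and> c < x + X t \<omega>} *
          indicator {0..} (t - a)) \<in> borel_measurable borel"
        by measurable
    qed
    also have "\<dots> = (\<integral>\<^sup>+s. discount q a * (discount q s *
      (\<integral>\<^sup>+\<omega>. indicator {\<omega>. Q s \<omega>} \<omega> * stay_prob a (x + X s \<omega>) c \<partial>M) * indicator {0..} s) \<partial>lborel)"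
    proof (rule nn_integral_cong)
      fix s :: real
      show "discount q (a + s) *
        emeasure M {\<omega>\<in>space M. Q (a + s - a) \<omega> \<and> (\<forall>r\<in>{a + s - a..a + s}. 0 < x + X r \<omega>) \<and> c < x + X (a + s) \<omega>} * indicator {0..} (a + s - a) =
        discount q a * (discount q s * (\<integral>\<^sup>+\<omega>. indicator {\<omega>. Q s \<omega>} \<omega> * stay_prob a (x + X s \<omega>) c \<partial>M) * indicator {0..} s)"
      proof (cases "0 \<le> s")
        case True
        have "emeasure M {\<omega>\<in>space M. Q s \<omega> \<and> (\<forall>r\<in>{s..s + a}. 0 < x + X r \<omega>) \<and> c < x + X (s + a) \<omega>} =
          (\<integral>\<^sup>+\<omega>. indicator {\<omega>. Q s \<omega>} \<omega> * stay_prob a (x + X s \<omega>) c \<partial>M)"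
        proof (rule markov_stay[OF True a])
          show "Measurable.pred (PiM (dyadics 1) (\<lambda>_. borel)) (\<lambda>u. \<not> (\<exists>m::nat. \<forall>l\<in>dyadics 1. 1 / (real m + 1) \<le> x + u l))"
            by measurable
          show "Q s \<omega> \<longleftrightarrow> \<not> (\<exists>m::nat. \<forall>l\<in>dyadics 1. 1 / (real m + 1) \<le> x + (\<lambda>l\<in>dyadics 1. X (l * s) \<omega>) l)" if "\<omega> \<in> space M" for \<omega>
            unfolding pos_event_dyadic[OF True that, symmetric] Q_def by (auto simp: not_less)
        qed
        moreover have "discount q (a + s) = discount q a * discount q s"
          by (simp add: ennreal_mult[symmetric] exp_add[symmetric] algebra_simps)
        ultimately show ?thesis using True by (simp add: mult.assoc add.commute)
      qed simp
    qed
    also have "\<dots> = discount q a * laplace q (\<lambda>s. (\<integral>\<^sup>+\<omega>. indicator {\<omega>. Q s \<omega>} \<omega> * stay_prob a (x + X s \<omega>) c \<partial>M))"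
    proof (rule nn_integral_cmult)
      have "(\<lambda>p. indicator {\<omega>. Q (fst p) \<omega>} (snd p) :: ennreal) = (\<lambda>p. indicator {p. Q (fst p) (snd p)} p)" by (auto simp: indicator_def)
      then have [measurable]: "(\<lambda>p. indicator {\<omega>. Q (fst p) \<omega>} (snd p) :: ennreal) \<in> borel_measurable (lborel \<Otimes>\<^sub>M M)" by simp
      have "(\<lambda>s. \<integral>\<^sup>+\<omega>. indicator {\<omega>. Q s \<omega>} \<omega> * stay_prob a (x + X s \<omega>) c \<partial>M) \<in> borel_measurable lborel"
        by (rule borel_measurable_nn_integral) (unfold case_prod_beta', measurable)
      then show "(\<lambda>s. discount q s * (\<integral>\<^sup>+\<omega>. indicator {\<omega>. Q s \<omega>} \<omega> * stay_prob a (x + X s \<omega>) c \<partial>M) * indicator {0..} s) \<in> borel_measurable lborel"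
        by measurable
    qed
    also have "laplace q (\<lambda>s. (\<integral>\<^sup>+\<omega>. indicator {\<omega>. Q s \<omega>} \<omega> * stay_prob a (x + X s \<omega>) c \<partial>M)) =
      (\<integral>\<^sup>+z. stay_prob a z c \<partial>post_measure q x Q)"
      by (rule nn_integral_post_measure[symmetric]) measurable
    \<comment> \<open>A path started at z \<le> 0 is not positive at time 0; only positive z remain,
      and there the density is known.\<close>
    also have "\<dots> = (\<integral>\<^sup>+z\<in>{0<..}. stay_prob a z c \<partial>post_measure q x Q)"
    proof (rule nn_integral_cong)
      fix z :: real
      have "stay_prob a z c = 0" if "z \<le> 0"
      proof -
        have "{\<omega>\<in>space M. stays_pos z a \<omega> \<and> c < z + X a \<omega>} = {}"
          using that a zero[of 0] by (auto intro!: bexI[of _ 0])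
        then show ?thesis by (simp only: stay_prob_def emeasure_empty)
      qed
      then show "stay_prob a z c = stay_prob a z c * indicator {0<..} z" by (cases "0 < z") auto
    qed
    also have "\<dots> = (\<integral>\<^sup>+z\<in>{0<..}. ennreal (k * exp (- passage_rate q * z)) * stay_prob a z c \<partial>lborel)"
    proof (rule nn_integral_of_exp_tails[OF sets_post_measure passage_rate_pos[OF q] k])
      fix c' :: real assume "0 \<le> c'"
      then show "emeasure (post_measure q x Q) {c'<..} = ennreal (k * exp (- passage_rate q * c') / passage_rate q)"
        using tail[of c'] by (subst emeasure_post_measure) (measurable, simp add: Q_def)
    qed measurable
    finally show "emeasure Nu ({a<..} \<times> {c<..}) =
      discount q a * (\<integral>\<^sup>+z\<in>{0<..}. ennreal (k * exp (- passage_rate q * z)) * stay_prob a z c \<partial>lborel)" .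
  qed
  then show ?thesis using Nu[OF B(1)] by (simp add: Q_def)
qed

end
lemma ennreal_eq_diffI:
  assumes "e + ennreal a = ennreal b" "0 \<le> a"
  shows "e = ennreal (b - a)" "a \<le> max 0 b"
proof -
  have "ennreal a \<le> ennreal b" using assms(1) by (metis add.commute le_iff_add)
  then show le: "a \<le> max 0 b" by (metis assms(2) ennreal_le_iff2 max.coboundedI1 max.coboundedI2)
  have "e + ennreal a = ennreal (b - a) + ennreal a"
  proof (cases "0 \<le> b")
    case True
    then show ?thesis using assms le by (simp add: ennreal_plus[symmetric] del: ennreal_plus)
  next
    case False
    then show ?thesis using assms le by (simp add: ennreal_neg)
  qed
  then show "e = ennreal (b - a)" by simp
qed

section \<open>The potential split at the first return to the nonpositive half-line\<close>

context normalized_snlp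
begin

text \<open>For a given path there is at most one z from which it touches 0 while staying
  nonnegative; by Fubini the two probabilities agree for almost every z.\<close>

lemma nn_integral_stay_nonneg_prob:
  assumes a: "0 \<le> a" and [measurable]: "f \<in> borel_measurable borel"
  shows "(\<integral>\<^sup>+z\<in>A. f z * stay_nonneg_prob a z c \<partial>lborel) = (\<integral>\<^sup>+z\<in>A. f z * stay_prob a z c \<partial>lborel)"
proof -
  interpret L: pair_sigma_finite lborel M ..
  define P where "P z \<omega> \<longleftrightarrow> stays_nonneg z a \<omega> \<and> \<not> stays_pos z a \<omega>" for z \<omega>
  have Pm: "Measurable.pred (lborel \<Otimes>\<^sub>M M) (\<lambda>p. \<not> P (fst p) (snd p))" unfolding P_def by measurable
  have "AE z in lborel. \<not> P z \<omega>" for \<omega>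
  proof (cases "\<exists>z0. P z0 \<omega>")
    case True
    then obtain z0 where z0: "P z0 \<omega>" ..
    have "z \<le> z'" if "P z \<omega>" "P z' \<omega>" for z z'
    proof -
      obtain r where "r \<in> {0..a}" "\<not> 0 < z + X r \<omega>" using \<open>P z \<omega>\<close> unfolding P_def by blast
      moreover from this have "0 \<le> z' + X r \<omega>" using \<open>P z' \<omega>\<close> unfolding P_def by blast
      ultimately show ?thesis by linarith
    qed
    then have "z = z0" if "P z \<omega>" for z using z0 that by (meson order_antisym)
    then show ?thesis using AE_lborel_singleton[of z0] by (auto elim: eventually_mono)
  qed simp
  then have "AE \<omega> in M. AE z in lborel. \<not> P z \<omega>" by simp
  then have "AE z in lborel. AE \<omega> in M. \<not> P z \<omega>" using L.AE_commute[of "\<lambda>z \<omega>. \<not> P z \<omega>", OF Pm[unfolded pred_def]] by (simp only:)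
  then have "AE z in lborel. stay_nonneg_prob a z c = stay_prob a z c"
  proof eventually_elim
    case (elim z)
    then show ?case unfolding stay_nonneg_prob_def stay_prob_def
    proof (intro emeasure_eq_AE)
      show "AE \<omega> in M. (\<omega> \<in> {\<omega> \<in> space M. stays_nonneg z a \<omega> \<and> c < z + X a \<omega>}) =
        (\<omega> \<in> {\<omega> \<in> space M. stays_pos z a \<omega> \<and> c < z + X a \<omega>})"
        using elim by eventually_elim (auto simp: P_def less_imp_le)
    qed measurable
  qed
  then show ?thesis by (intro nn_integral_cong_AE) (auto elim: eventually_mono)
qed

text \<open>A start x \<le> 0 counts as a return at time 0, so this is the free resolvent beyond c -
  x \<ge> 0, where its tail is exponential.\<close>

lemma return_tail_nonpos:
  assumes q: "0 < q" and x: "x \<le> 0" and c: "0 \<le> c"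
  shows "laplace q (\<lambda>s. emeasure M {\<omega>\<in>space M. returns x s \<omega> \<and> c < x + X s \<omega>}) =
    ennreal (resolvent_const q * exp (passage_rate q * x) * exp (- passage_rate q * c) / passage_rate q)"
proof -
  have "laplace q (\<lambda>s. emeasure M {\<omega>\<in>space M. returns x s \<omega> \<and> c < x + X s \<omega>}) =
    laplace q (\<lambda>s. emeasure M {\<omega>\<in>space M. X s \<omega> \<in> {c - x<..}})"
  proof (rule nn_integral_cong)
    fix s :: real
    have "{\<omega>\<in>space M. returns x s \<omega> \<and> c < x + X s \<omega>} = {\<omega>\<in>space M. X s \<omega> \<in> {c - x<..}}" if "0 \<le> s"
      using that x zero[of 0] by (auto intro!: bexI[of _ 0])
    then show "discount q s * emeasure M {\<omega>\<in>space M. returns x s \<omega> \<and> c < x + X s \<omega>} * indicator {0..} s =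
      discount q s * emeasure M {\<omega>\<in>space M. X s \<omega> \<in> {c - x<..}} * indicator {0..} s"
      by (simp split: split_indicator)
  qed
  also have "\<dots> = emeasure (resolvent q) {c - x<..}" by (rule emeasure_resolvent[symmetric]) simp
  also have "\<dots> = ennreal (resolvent_const q * exp (- passage_rate q * (c - x)) / passage_rate q)"
    using q x c by (intro emeasure_resolvent_tail) auto
  also have "exp (- passage_rate q * (c - x)) = exp (passage_rate q * x) * exp (- passage_rate q * c)"
    by (simp add: exp_add[symmetric] algebra_simps)
  finally show ?thesis by (simp add: mult.assoc)
qed

lemma emeasure_split:
  assumes "Measurable.pred M P" "Measurable.pred M R" "\<And>\<omega>. \<omega> \<in> space M \<Longrightarrow> \<not> (P \<omega> \<and> R \<omega>)"
    and "\<And>\<omega>. \<omega> \<in> space M \<Longrightarrow> S \<omega> \<longleftrightarrow> P \<omega> \<or> R \<omega>"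
  shows "emeasure M {\<omega>\<in>space M. S \<omega>} = emeasure M {\<omega>\<in>space M. P \<omega>} + emeasure M {\<omega>\<in>space M. R \<omega>}"
proof -
  have "{\<omega>\<in>space M. S \<omega>} = {\<omega>\<in>space M. P \<omega>} \<union> {\<omega>\<in>space M. R \<omega>}" using assms(4) by blast
  moreover have "{\<omega>\<in>space M. P \<omega>} \<inter> {\<omega>\<in>space M. R \<omega>} = {}" using assms(3) by blast
  ultimately show ?thesis using assms(1,2) by (simp add: pred_def plus_emeasure)
qed

lemma nn_integral_split:
  assumes P: "Measurable.pred (borel \<Otimes>\<^sub>M M) (\<lambda>p. P (fst p) (snd p))" and R: "Measurable.pred (borel \<Otimes>\<^sub>M M) (\<lambda>p. R (fst p) (snd p))"
    and disj: "\<And>s \<omega>. 0 \<le> s \<Longrightarrow> \<omega> \<in> space M \<Longrightarrow> \<not> (P s \<omega> \<and> R s \<omega>)"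
    and S: "\<And>s \<omega>. 0 \<le> s \<Longrightarrow> \<omega> \<in> space M \<Longrightarrow> S s \<omega> \<longleftrightarrow> P s \<omega> \<or> R s \<omega>"
  shows "laplace q (\<lambda>s. emeasure M {\<omega>\<in>space M. S s \<omega>}) =
    laplace q (\<lambda>s. emeasure M {\<omega>\<in>space M. P s \<omega>}) +
    laplace q (\<lambda>s. emeasure M {\<omega>\<in>space M. R s \<omega>})"
proof -
  note [measurable] = emeasure_event_measurable[OF P] emeasure_event_measurable[OF R]
  have sec: "Measurable.pred M (\<lambda>\<omega>. P s \<omega>)" "Measurable.pred M (\<lambda>\<omega>. R s \<omega>)" for s
    using measurable_compose[OF measurable_Pair1' P, of s] measurable_compose[OF measurable_Pair1' R, of s] by simp_all
  have "laplace q (\<lambda>s. emeasure M {\<omega>\<in>space M. S s \<omega>}) =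
    (\<integral>\<^sup>+s. discount q s * emeasure M {\<omega>\<in>space M. P s \<omega>} * indicator {0..} s +
      discount q s * emeasure M {\<omega>\<in>space M. R s \<omega>} * indicator {0..} s \<partial>lborel)"
  proof (rule nn_integral_cong)
    fix s :: real
    show "discount q s * emeasure M {\<omega>\<in>space M. S s \<omega>} * indicator {0..} s =
      discount q s * emeasure M {\<omega>\<in>space M. P s \<omega>} * indicator {0..} s +
      discount q s * emeasure M {\<omega>\<in>space M. R s \<omega>} * indicator {0..} s"
    proof (cases "0 \<le> s")
      case True
      have "emeasure M {\<omega>\<in>space M. S s \<omega>} = emeasure M {\<omega>\<in>space M. P s \<omega>} + emeasure M {\<omega>\<in>space M. R s \<omega>}"
        by (rule emeasure_split[OF sec disj[OF True] S[OF True]])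
      then show ?thesis using True by (simp add: distrib_left)
    qed simp
  qed
  also have "\<dots> = laplace q (\<lambda>s. emeasure M {\<omega>\<in>space M. P s \<omega>}) +
    laplace q (\<lambda>s. emeasure M {\<omega>\<in>space M. R s \<omega>})"
    by (rule nn_integral_add) measurable
  finally show ?thesis .
qed

definition excursion_potential :: "real \<Rightarrow> real \<Rightarrow> real \<Rightarrow> (real \<times> real) set \<Rightarrow> ennreal" where
  "excursion_potential q u x B = laplace q (\<lambda>s. emeasure M {\<omega>\<in>space M. stays_pos x s \<omega> \<and> (u + s, x + X s \<omega>) \<in> B})"

text \<open>The first part has U = u + s and a path that has stayed positive, the second the age
  after a return. In E a start x \<le> 0 goes with u = 0, and then time 0 is already a
  return.\<close>

lemma potential_decomposition:
  assumes ux: "(u, x) \<in> state_space" and B: "B \<in> sets borel"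
  shows "potential M q (\<lambda>r \<omega>. (excursion_length_from u (\<lambda>t. x + X t \<omega>) r, x + X r \<omega>)) B =
    excursion_potential q u x B + laplace q (\<lambda>t. emeasure M {\<omega>\<in>space M. returns x t \<omega> \<and> (excursion x t \<omega>, x + X t \<omega>) \<in> B})"
  unfolding potential_def excursion_potential_def
proof (rule nn_integral_split)
  note [measurable] = pred_borel_pair[OF B]
  show "Measurable.pred (borel \<Otimes>\<^sub>M M) (\<lambda>p. stays_pos x (fst p) (snd p) \<and> (u + fst p, x + X (fst p) (snd p)) \<in> B)"
    "Measurable.pred (borel \<Otimes>\<^sub>M M) (\<lambda>p. returns x (fst p) (snd p) \<and> (excursion x (fst p) (snd p), x + X (fst p) (snd p)) \<in> B)"
    by measurable
  fix s :: real and \<omega> assume s: "0 \<le> s" and \<omega>: "\<omega> \<in> space M"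
  interpret lsc_path "\<lambda>t. x + X t \<omega>" by (rule lsc_path_shift[OF \<omega>])
  show "\<not> ((stays_pos x s \<omega> \<and> (u + s, x + X s \<omega>) \<in> B) \<and> returns x s \<omega> \<and> (excursion x s \<omega>, x + X s \<omega>) \<in> B)"
    by force
  have neg: "\<not> stays_pos x s \<omega> \<longleftrightarrow> returns x s \<omega>" by (auto simp: not_less)
  show "(excursion_length_from u (\<lambda>t. x + X t \<omega>) s, x + X s \<omega>) \<in> B \<longleftrightarrow>
    stays_pos x s \<omega> \<and> (u + s, x + X s \<omega>) \<in> B \<or>
    returns x s \<omega> \<and> (excursion x s \<omega>, x + X s \<omega>) \<in> B"
  proof (cases "0 < x")
    case True
    then have "0 < x + X 0 \<omega>" using zero[of 0] by simp
    from less_hit_nonpos_iff[OF this s] show ?thesis using neg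
      by (auto simp: excursion_length_from_def excursion_def)
  next
    case False
    then have u: "u = 0" and x: "x + X 0 \<omega> \<le> 0" using ux zero[of 0] by (auto simp: state_space_def)
    then have "returns x s \<omega>" using s by (intro bexI[of _ 0]) auto
    then show ?thesis using excursion_length_from_nonpos_start[OF x s] neg u by (auto simp: excursion_def)
  qed
qed

lemma excursion_potential_nonpos:
  assumes "x \<le> 0" shows "excursion_potential q u x B = 0"
proof -
  have "{\<omega>\<in>space M. stays_pos x s \<omega> \<and> (u + s, x + X s \<omega>) \<in> B} = {}" if "0 \<le> s" for s
    using that assms zero[of 0] by (auto intro!: bexI[of _ 0])
  then have "discount q s * emeasure M {\<omega>\<in>space M. stays_pos x s \<omega> \<and> (u + s, x + X s \<omega>) \<in> B} * indicator {0..} s = 0" for s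
    by (cases "0 \<le> s") (simp_all only: emeasure_empty mult_zero_left mult_zero_right indicator_simps(2) atLeast_iff not_False_eq_True)
  then show ?thesis unfolding excursion_potential_def by (simp only:) simp
qed

lemma potential_nonpos:
  assumes q: "0 < q" and x: "x \<le> 0" and B: "B \<in> sets borel" "B \<subseteq> {0<..} \<times> {0<..}"
  shows "potential M q (\<lambda>r \<omega>. (excursion_length_from 0 (\<lambda>t. x + X t \<omega>) r, x + X r \<omega>)) B =
      ennreal (resolvent_const q * exp (passage_rate q * x)) * kendall_part M X q B"
    and "x = 0 \<Longrightarrow> potential M q (\<lambda>r \<omega>. (excursion_length (\<lambda>t. X t \<omega>) r, X r \<omega>)) B = ennreal (resolvent_const q) * kendall_part M X q B"
proof -
  have k: "0 \<le> resolvent_const q * exp (passage_rate q * x)" using resolvent_const_pos[OF q] by simp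
  show 1: "potential M q (\<lambda>r \<omega>. (excursion_length_from 0 (\<lambda>t. x + X t \<omega>) r, x + X r \<omega>)) B =
      ennreal (resolvent_const q * exp (passage_rate q * x)) * kendall_part M X q B"
    using x return_potential[OF q k return_tail_nonpos[OF q x] B]
    by (subst potential_decomposition[OF _ B(1)]) (simp_all add: state_space_def excursion_potential_nonpos)
  assume x0: "x = 0"
  have "potential M q (\<lambda>r \<omega>. (excursion_length (\<lambda>t. X t \<omega>) r, X r \<omega>)) B =
    potential M q (\<lambda>r \<omega>. (excursion_length_from 0 (\<lambda>t. x + X t \<omega>) r, x + X r \<omega>)) B"
    unfolding potential_def
  proof (rule nn_integral_cong)
    fix r :: real
    have "excursion_length_from 0 (\<lambda>t. 0 + X t \<omega>) r = excursion_length (\<lambda>t. X t \<omega>) r" if "0 \<le> r" "\<omega> \<in> space M" for \<omega>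
      using lsc_path.excursion_length_from_nonpos_start[OF lsc_path_shift[OF that(2)], of 0 r] that zero[of 0] by simp
    then have "{\<omega>\<in>space M. (excursion_length (\<lambda>t. X t \<omega>) r, X r \<omega>) \<in> B} =
      {\<omega>\<in>space M. (excursion_length_from 0 (\<lambda>t. x + X t \<omega>) r, x + X r \<omega>) \<in> B}" if "0 \<le> r" using that x0 by auto
    then show "discount q r * emeasure M {\<omega>\<in>space M. (excursion_length (\<lambda>t. X t \<omega>) r, X r \<omega>) \<in> B} * indicator {0..} r =
      discount q r * emeasure M {\<omega>\<in>space M. (excursion_length_from 0 (\<lambda>t. x + X t \<omega>) r, x + X r \<omega>) \<in> B} * indicator {0..} r"
      by (cases "0 \<le> r") simp_all
  qed
  then show "potential M q (\<lambda>r \<omega>. (excursion_length (\<lambda>t. X t \<omega>) r, X r \<omega>)) B = ennreal (resolvent_const q) * kendall_part M X q B"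
    using 1 x0 by simp
qed

text \<open>The substitution is v = u + r. The condition r < \<tau> becomes nonnegativity up to r,
  whereas \<open>excursion_potential\<close> asks for positivity, that is r < \<sigma> when x > 0.
  The two are reconciled differently for x > 0 and for x = 0.\<close>

lemma first_excursion_part_eq:
  assumes B: "B \<in> sets borel" "B \<subseteq> {0<..} \<times> {0<..}"
  shows "first_excursion_part M X q u x B = laplace q (\<lambda>r. emeasure M {\<omega>\<in>space M. stays_nonneg x r \<omega> \<and> (u + r, x + X r \<omega>) \<in> B})"
proof -
  note [measurable] = pred_borel_pair[OF B(1)]
  have "first_excursion_part M X q u x B = (\<integral>\<^sup>+v\<in>{u<..}. discount q (v - u) *
    emeasure M {\<omega>\<in>space M. (v, x + X (v - u) \<omega>) \<in> B \<and> stays_nonneg x (v - u) \<omega>} \<partial>lborel)"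
    unfolding first_excursion_part_def
  proof (rule nn_integral_cong)
    fix v :: real
    show "discount q (v - u) * emeasure M {\<omega>\<in>space M. (v, x + X (v - u) \<omega>) \<in> B \<and> ereal (v - u) < hit_neg (\<lambda>t. x + X t \<omega>)} * indicator {u<..} v =
      discount q (v - u) * emeasure M {\<omega>\<in>space M. (v, x + X (v - u) \<omega>) \<in> B \<and> stays_nonneg x (v - u) \<omega>} * indicator {u<..} v"
      using first_excursion_event[OF _ B(2), of "v - u" v "\<lambda>_. x"] by (cases "u < v") simp_all
  qed
  also have "\<dots> = (\<integral>\<^sup>+r. ennreal (exp (- q * (u + r - u))) *
    emeasure M {\<omega>\<in>space M. (u + r, x + X (u + r - u) \<omega>) \<in> B \<and> stays_nonneg x (u + r - u) \<omega>} * indicator {u<..} (u + r) \<partial>lborel)"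
  proof (rule nn_integral_lborel_shift)
    have [measurable]: "(\<lambda>v. emeasure M {\<omega>\<in>space M. (v, x + X (v - u) \<omega>) \<in> B \<and> stays_nonneg x (v - u) \<omega>}) \<in> borel_measurable borel"
      by (rule emeasure_event_measurable) measurable
    show "(\<lambda>v. discount q (v - u) * emeasure M {\<omega>\<in>space M. (v, x + X (v - u) \<omega>) \<in> B \<and> stays_nonneg x (v - u) \<omega>} *
        indicator {u<..} v) \<in> borel_measurable borel"
      by measurable
  qed
  also have "\<dots> = laplace q (\<lambda>r. emeasure M {\<omega>\<in>space M. stays_nonneg x r \<omega> \<and> (u + r, x + X r \<omega>) \<in> B})"
  proof (rule nn_integral_cong_AE)
    have "AE r in lborel. r \<noteq> (0::real)" by (rule AE_lborel_singleton)
    then show "AE r in lborel. ennreal (exp (- q * (u + r - u))) *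
      emeasure M {\<omega>\<in>space M. (u + r, x + X (u + r - u) \<omega>) \<in> B \<and> stays_nonneg x (u + r - u) \<omega>} * indicator {u<..} (u + r) =
      discount q r * emeasure M {\<omega>\<in>space M. stays_nonneg x r \<omega> \<and> (u + r, x + X r \<omega>) \<in> B} * indicator {0..} r"
    proof eventually_elim
      case (elim r)
      then show ?case by (cases "0 < r") (simp_all add: conj_commute)
    qed
  qed
  finally show ?thesis .
qed

lemma first_excursion_part_neg:
  assumes x: "x < 0" and B: "B \<in> sets borel" "B \<subseteq> {0<..} \<times> {0<..}"
  shows "first_excursion_part M X q u x B = 0"
proof -
  have "{\<omega>\<in>space M. stays_nonneg x r \<omega> \<and> (u + r, x + X r \<omega>) \<in> B} = {}" if "0 \<le> r" for r
    using that x zero[of 0] by (auto intro!: bexI[of _ 0])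
  then have "discount q r * emeasure M {\<omega>\<in>space M. stays_nonneg x r \<omega> \<and> (u + r, x + X r \<omega>) \<in> B} * indicator {0..} r = 0" for r
    by (cases "0 \<le> r") (simp_all only: emeasure_empty mult_zero_left mult_zero_right indicator_simps(2) atLeast_iff not_False_eq_True)
  then show ?thesis unfolding first_excursion_part_eq[OF B] by (simp only:) simp
qed

end

section \<open>Starting points at and above zero, with the scale function\<close>

context snlp_scale
begin

lemma killed_formula_zero: "0 \<le> c \<Longrightarrow> killed_formula 0 c = W 0 * exp (- \<Phi> * c) / \<Phi>"
  by (simp add: killed_formula_def W_int_def)

text \<open>W 0 / \<Phi> is the value of the weak killed tail at x = c = 0, a limit of nonnegative
  quantities.\<close>

lemma W_zero_nonneg: "0 \<le> W 0"
proof -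
  have "0 \<le> W 0 / \<Phi>" using killed_nonneg_tail_eq(2)[of 0 0] killed_formula_zero[of 0] by simp
  then show ?thesis using Phi_pos by (simp add: zero_le_divide_iff)
qed

text \<open>The strict and the weak killed tail at c = 0 are given by the same finite formula, so
  the event of touching 0 while staying nonnegative has discounted probability zero.\<close>

lemma AE_nonneg_imp_pos:
  assumes x: "0 < x"
  shows "AE s in lborel. 0 \<le> s \<longrightarrow> emeasure M {\<omega>\<in>space M. stays_nonneg x s \<omega> \<and> \<not> stays_pos x s \<omega>} = 0"
proof -
  define N where "N s \<omega> \<longleftrightarrow> stays_nonneg x s \<omega> \<and> \<not> stays_pos x s \<omega>" for s \<omega>
  define I where "I = laplace q (\<lambda>s. emeasure M {\<omega>\<in>space M. N s \<omega>})"
  have m: "Measurable.pred (borel \<Otimes>\<^sub>M M) (\<lambda>p. N (fst p) (snd p))"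
    "Measurable.pred (borel \<Otimes>\<^sub>M M) (\<lambda>p. stays_pos x (fst p) (snd p) \<and> 0 < x + X (fst p) (snd p))"
    unfolding N_def by measurable
  have "killed_nonneg_tail q x 0 = killed_tail q x 0 + I"
    unfolding killed_nonneg_tail_def killed_tail_def stay_prob_def I_def
    by (rule nn_integral_split[OF m(2,1)]) (auto simp: less_imp_le N_def)
  then have "I + ennreal (killed_formula x 0) = ennreal (killed_formula x 0)"
    unfolding killed_tail_eq(1)[OF order_refl x] killed_nonneg_tail_eq(1)[OF order_refl less_imp_le[OF x]] by (simp only: add.commute)
  from ennreal_eq_diffI(1)[OF this killed_tail_eq(2)[OF order_refl x]] have I: "I = 0" by simp
  note [measurable] = emeasure_event_measurable[OF m(1)]
  have "(\<lambda>s. discount q s * emeasure M {\<omega>\<in>space M. N s \<omega>} * indicator {0..} s) \<in> borel_measurable lborel"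
    by measurable
  from nn_integral_0_iff_AE[OF this]
  have "AE s in lborel. discount q s * emeasure M {\<omega>\<in>space M. N s \<omega>} * indicator {0..} s = 0"
    using I unfolding I_def by blast
  then show ?thesis unfolding N_def[symmetric] by eventually_elim (auto simp: indicator_def)
qed

lemma first_excursion_part_pos:
  assumes x: "0 < x" and B: "B \<in> sets borel" "B \<subseteq> {0<..} \<times> {0<..}"
  shows "first_excursion_part M X q u x B = excursion_potential q u x B"
  unfolding first_excursion_part_eq[OF B] excursion_potential_def
proof (rule nn_integral_cong_AE)
  note [measurable] = pred_borel_pair[OF B(1)]
  show "AE r in lborel. discount q r * emeasure M {\<omega>\<in>space M. stays_nonneg x r \<omega> \<and> (u + r, x + X r \<omega>) \<in> B} * indicator {0..} r =
    discount q r * emeasure M {\<omega>\<in>space M. stays_pos x r \<omega> \<and> (u + r, x + X r \<omega>) \<in> B} * indicator {0..} r"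
    using AE_nonneg_imp_pos[OF x]
  proof eventually_elim
    case (elim r)
    show ?case
    proof (cases "0 \<le> r")
      case True
      have "AE \<omega> in M. \<not> (stays_nonneg x r \<omega> \<and> \<not> stays_pos x r \<omega>)"
      proof (rule AE_I[OF _ elim[rule_format, OF True]])
        show "{\<omega>\<in>space M. stays_nonneg x r \<omega> \<and> \<not> stays_pos x r \<omega>} \<in> sets M" by measurable
      qed blast
      then have "emeasure M {\<omega>\<in>space M. stays_nonneg x r \<omega> \<and> (u + r, x + X r \<omega>) \<in> B} =
        emeasure M {\<omega>\<in>space M. stays_pos x r \<omega> \<and> (u + r, x + X r \<omega>) \<in> B}"
      proof (intro emeasure_eq_AE)
        show "{\<omega>\<in>space M. stays_nonneg x r \<omega> \<and> (u + r, x + X r \<omega>) \<in> B} \<in> sets M"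
          "{\<omega>\<in>space M. stays_pos x r \<omega> \<and> (u + r, x + X r \<omega>) \<in> B} \<in> sets M"
          by measurable
      qed (auto elim!: eventually_mono simp: less_imp_le)
      then show ?thesis by simp
    qed simp
  qed
qed

text \<open>The occupation after the return is the free resolvent minus the killed one. The
  integrals of W in the two formulas cancel and leave a pure exponential in c; its factor is
  nonnegative because the killed resolvent is dominated by the free one.\<close>

lemma return_tail_pos:
  assumes x: "0 < x"
  shows "0 \<le> resolvent_const q * exp (\<Phi> * x) - W x"
    and "0 \<le> c \<Longrightarrow> (laplace q (\<lambda>s. emeasure M {\<omega>\<in>space M. returns x s \<omega> \<and> c < x + X s \<omega>})) =
    ennreal ((resolvent_const q * exp (\<Phi> * x) - W x) * exp (- \<Phi> * c) / \<Phi>)"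
proof -
  let ?E = "\<lambda>c. laplace q (\<lambda>s. emeasure M {\<omega>\<in>space M. returns x s \<omega> \<and> c < x + X s \<omega>})"
  have *: "?E c = ennreal ((resolvent_const q * exp (\<Phi> * x) - W x) * exp (- \<Phi> * c) / \<Phi>) \<and> 0 \<le> (resolvent_const q * exp (\<Phi> * x) - W x) * exp (- \<Phi> * c) / \<Phi>" if c: "0 \<le> c" for c
  proof -
    have "emeasure (resolvent q) {c - x<..} = ?E c + killed_tail q x c"
      unfolding killed_tail_def stay_prob_def emeasure_resolvent[OF borel_open[OF open_greaterThan]]
    proof (rule nn_integral_split)
      show "Measurable.pred (borel \<Otimes>\<^sub>M M) (\<lambda>p. returns x (fst p) (snd p) \<and> c < x + X (fst p) (snd p))"
        "Measurable.pred (borel \<Otimes>\<^sub>M M) (\<lambda>p. stays_pos x (fst p) (snd p) \<and> c < x + X (fst p) (snd p))"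
        by measurable
    qed (auto simp: not_less)
    then have "?E c + ennreal (killed_formula x c) = ennreal (measure (resolvent q) {c - x<..})"
      using killed_tail_eq(1)[OF c x] finite_measure.emeasure_eq_measure[OF finite_measure_resolvent[OF q]] by simp
    note e = ennreal_eq_diffI[OF this killed_tail_eq(2)[OF c x]]
    have d: "measure (resolvent q) {c - x<..} - killed_formula x c = (resolvent_const q * exp (\<Phi> * x) - W x) * exp (- \<Phi> * c) / \<Phi>"
    proof -
      have "exp (\<Phi> * (x - c)) = exp (\<Phi> * x) * exp (- \<Phi> * c)" by (simp add: exp_add[symmetric] algebra_simps)
      then show ?thesis unfolding measure_resolvent_tail_eq killed_formula_def by (simp add: diff_divide_distrib algebra_simps)
    qed
    have "0 \<le> measure (resolvent q) {c - x<..} - killed_formula x c" using e(2) by simp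
    then show ?thesis using e(1) unfolding d by blast
  qed
  show "0 \<le> (resolvent_const q * exp (\<Phi> * x) - W x)" using *[of 0] Phi_pos by (auto simp: zero_le_divide_iff)
  show "?E c = ennreal ((resolvent_const q * exp (\<Phi> * x) - W x) * exp (- \<Phi> * c) / \<Phi>)" if "0 \<le> c" using *[OF that] by blast
qed

lemma potential_pos:
  assumes x: "0 < x" and u: "0 < u" and B: "B \<in> sets borel" "B \<subseteq> {0<..} \<times> {0<..}"
  shows "potential M q (\<lambda>r \<omega>. (excursion_length_from u (\<lambda>t. x + X t \<omega>) r, x + X r \<omega>)) B =
    first_excursion_part M X q u x B + ennreal (resolvent_const q * exp (\<Phi> * x) - W x) * kendall_part M X q B"
    and "0 \<le> resolvent_const q * exp (\<Phi> * x) - W x"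
proof -
  show k: "0 \<le> resolvent_const q * exp (\<Phi> * x) - W x" by (rule return_tail_pos[OF x])
  show "potential M q (\<lambda>r \<omega>. (excursion_length_from u (\<lambda>t. x + X t \<omega>) r, x + X r \<omega>)) B =
    first_excursion_part M X q u x B + ennreal (resolvent_const q * exp (\<Phi> * x) - W x) * kendall_part M X q B"
    using return_potential[OF q, folded \<Phi>_def, OF k return_tail_pos(2)[OF x] B] x u
    by (subst potential_decomposition[OF _ B(1)]) (simp_all add: state_space_def first_excursion_part_pos[OF x B] \<Phi>_def)
qed

text \<open>As long as the path has not gone below 0 the age equals the time, so the Markov property
  at s = t - a applies as it does after a return. The weak killed tail at x = 0 supplies the density
  W 0 exp (- \<Phi> z) of the restarting point, and the first excursion term thus becomes itself a
  multiple of the Kendall measure.\<close>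

lemma first_excursion_part_zero:
  assumes B: "B \<in> sets borel" "B \<subseteq> {0<..} \<times> {0<..}"
  shows "first_excursion_part M X q 0 0 B = ennreal (W 0) * kendall_part M X q B"
proof -
  define Q where "Q t \<omega> \<longleftrightarrow> stays_nonneg 0 t \<omega>" for t \<omega>
  have Qm [measurable]: "Measurable.pred (borel \<Otimes>\<^sub>M M) (\<lambda>p. Q (fst p) (snd p))" "Measurable.pred M (\<lambda>\<omega>. Q t \<omega>)" for t
    unfolding Q_def by measurable
  have QmL [measurable]: "Measurable.pred (lborel \<Otimes>\<^sub>M M) (\<lambda>p. Q (fst p) (snd p))"
    unfolding Q_def by measurable
  have pm: "(\<lambda>p. (0 + fst p, 0 + X (fst p) (snd p))) \<in> measurable (borel \<Otimes>\<^sub>M M) borel"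
    unfolding borel_prod[symmetric] by measurable
  obtain Nu :: "(real \<times> real) measure" where sets_Nu: "sets Nu = sets borel"
    and Nu: "\<And>A. A \<in> sets borel \<Longrightarrow> emeasure Nu A = laplace q (\<lambda>t. emeasure M {\<omega>\<in>space M. Q t \<omega> \<and> (0 + t, 0 + X t \<omega>) \<in> A})"
    using obtain_occupation_measure[OF Qm(1) pm, of q] by blast
  define P where "P = post_measure q 0 Q"
  have P_sets [measurable_cong]: "sets P = sets borel" by (simp add: P_def)
  have P_ge: "emeasure P {c..} = ennreal (W 0 * exp (- \<Phi> * c) / \<Phi>)" if "0 \<le> c" for c
    using killed_nonneg_tail_eq(1)[OF that order_refl] killed_formula_zero[OF that]
    unfolding P_def by (subst emeasure_post_measure[OF QmL]) (simp_all add: killed_nonneg_tail_def Q_def)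
  \<comment> \<open>The open half-line is exhausted by closed ones. Agreement with
    \<open>P_ge\<close> at c = 0 then excludes an atom at 0.\<close>
  have P_gt: "emeasure P {c<..} = ennreal (W 0 * exp (- \<Phi> * c) / \<Phi>)" if c: "0 \<le> c" for c
  proof -
    have "(\<lambda>n. emeasure P {c + 1 / real (Suc n)..}) \<longlonglongrightarrow> emeasure P (\<Union>n. {c + 1 / real (Suc n)..})"
      by (rule Lim_emeasure_incseq) (auto simp: P_sets incseq_def frac_le intro: order_trans[rotated])
    also have "(\<Union>n. {c + 1 / real (Suc n)..}) = {c<..}"
    proof (intro equalityI subsetI)
      fix y assume "y \<in> {c<..}"
      then obtain n where "1 / real (Suc n) < y - c" using reals_Archimedean[of "y - c"] by (auto simp: inverse_eq_divide)
      then have "y \<in> {c + 1 / real (Suc n)..}" by simp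
      then show "y \<in> (\<Union>n. {c + 1 / real (Suc n)..})" by blast
    next
      fix y assume "y \<in> (\<Union>n. {c + 1 / real (Suc n)..})"
      then obtain n where "c + 1 / real (Suc n) \<le> y" by blast
      moreover have "0 < 1 / real (Suc n)" by simp
      ultimately show "y \<in> {c<..}" unfolding greaterThan_iff by linarith
    qed
    finally have 1: "(\<lambda>n. emeasure P {c + 1 / real (Suc n)..}) \<longlonglongrightarrow> emeasure P {c<..}" .
    have lim: "(\<lambda>n. c + 1 / real (Suc n)) \<longlonglongrightarrow> c"
      using tendsto_add[OF tendsto_const LIMSEQ_inverse_real_of_nat, of c] by (simp add: inverse_eq_divide)
    have "(\<lambda>n. ennreal (W 0 * exp (- \<Phi> * (c + 1 / real (Suc n))) / \<Phi>)) \<longlonglongrightarrow> ennreal (W 0 * exp (- \<Phi> * c) / \<Phi>)"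
      using Phi_pos by (intro tendsto_ennrealI tendsto_intros lim) auto
    moreover have "0 \<le> c + 1 / real (Suc n)" for n using c by (intro add_nonneg_nonneg) auto
    ultimately have "(\<lambda>n. emeasure P {c + 1 / real (Suc n)..}) \<longlonglongrightarrow> ennreal (W 0 * exp (- \<Phi> * c) / \<Phi>)"
      by (simp only: P_ge)
    from LIMSEQ_unique[OF 1 this] show ?thesis .
  qed
  have "emeasure P {0<..} + emeasure P {0} = emeasure P ({0<..} \<union> {0})"
    by (rule plus_emeasure) (auto simp: P_sets)
  also have "{0<..} \<union> {0} = {0 :: real..}" by auto
  finally have "emeasure P {0<..} + emeasure P {0} = emeasure P {0..}" .
  then have "emeasure P {0} + ennreal (W 0 * exp (- \<Phi> * 0) / \<Phi>) = ennreal (W 0 * exp (- \<Phi> * 0) / \<Phi>)"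
    unfolding P_ge[OF order_refl] P_gt[OF order_refl] by (simp only: add.commute)
  from ennreal_eq_diffI(1)[OF this] have P0: "emeasure P {0} = 0" using W_zero_nonneg Phi_pos by simp
  have "emeasure Nu B = ennreal (W 0) * kendall_part M X q B"
  proof (rule eq_kendall_measure[OF q W_zero_nonneg sets_Nu _ B])
    fix a c :: real assume a: "0 \<le> a" and c: "0 \<le> c"
    have "emeasure Nu ({a<..} \<times> {c<..}) = laplace q (\<lambda>t. emeasure M {\<omega>\<in>space M. Q t \<omega> \<and> (0 + t, 0 + X t \<omega>) \<in> {a<..} \<times> {c<..}})"
      by (rule Nu) (simp add: open_Times borel_open)
    also have "\<dots> = (\<integral>\<^sup>+t. discount q t * emeasure M {\<omega>\<in>space M. Q t \<omega> \<and> c < 0 + X t \<omega>} * indicator {a..} t \<partial>lborel)"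
    proof (rule nn_integral_cong_AE)
      have "AE t in lborel. t \<noteq> a" by (rule AE_lborel_singleton)
      then show "AE t in lborel. discount q t *
          emeasure M {\<omega>\<in>space M. Q t \<omega> \<and> (0 + t, 0 + X t \<omega>) \<in> {a<..} \<times> {c<..}} * indicator {0..} t =
        discount q t * emeasure M {\<omega>\<in>space M. Q t \<omega> \<and> c < 0 + X t \<omega>} * indicator {a..} t"
      proof eventually_elim
        case (elim t)
        then show ?case using a by (cases "a < t") simp_all
      qed
    qed
    also have "\<dots> = (\<integral>\<^sup>+s. discount q (a + s) *
      emeasure M {\<omega>\<in>space M. Q (a + s) \<omega> \<and> c < 0 + X (a + s) \<omega>} * indicator {a..} (a + s) \<partial>lborel)"
    proof (rule nn_integral_lborel_shift)
      have "(\<lambda>t. emeasure M {\<omega>\<in>space M. Q t \<omega> \<and> c < 0 + X t \<omega>}) \<in> borel_measurable borel"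
        by (rule emeasure_event_measurable) measurable
      then show "(\<lambda>t. discount q t * emeasure M {\<omega>\<in>space M. Q t \<omega> \<and> c < 0 + X t \<omega>} * indicator {a..} t) \<in> borel_measurable borel"
        by measurable
    qed
    also have "\<dots> = (\<integral>\<^sup>+s. discount q a * (discount q s *
      (\<integral>\<^sup>+\<omega>. indicator {\<omega>. Q s \<omega>} \<omega> * stay_nonneg_prob a (0 + X s \<omega>) c \<partial>M) * indicator {0..} s) \<partial>lborel)"
    proof (rule nn_integral_cong)
      fix s :: real
      show "discount q (a + s) * emeasure M {\<omega>\<in>space M. Q (a + s) \<omega> \<and> c < 0 + X (a + s) \<omega>} * indicator {a..} (a + s) =
        discount q a * (discount q s *
          (\<integral>\<^sup>+\<omega>. indicator {\<omega>. Q s \<omega>} \<omega> * stay_nonneg_prob a (0 + X s \<omega>) c \<partial>M) * indicator {0..} s)"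
      proof (cases "0 \<le> s")
        case True
        have "{\<omega>\<in>space M. Q (a + s) \<omega> \<and> c < 0 + X (a + s) \<omega>} =
          {\<omega>\<in>space M. Q s \<omega> \<and> (\<forall>r\<in>{s..s + a}. 0 \<le> 0 + X r \<omega>) \<and> c < 0 + X (s + a) \<omega>}"
        proof -
          have "{0..a + s} = {0..s} \<union> {s..s + a}" using a True by auto
          then show ?thesis unfolding Q_def by (auto simp: add.commute)
        qed
        also have "emeasure M \<dots> = (\<integral>\<^sup>+\<omega>. indicator {\<omega>. Q s \<omega>} \<omega> * stay_nonneg_prob a (0 + X s \<omega>) c \<partial>M)"
        proof (rule markov_stay_nonneg[OF True a])
          show "Measurable.pred (PiM (dyadics 1) (\<lambda>_. borel)) (\<lambda>u. \<forall>l\<in>dyadics 1. (0::real) \<le> 0 + u l)"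
            by measurable
          show "Q s \<omega> \<longleftrightarrow> (\<forall>l\<in>dyadics 1. 0 \<le> 0 + (\<lambda>l\<in>dyadics 1. X (l * s) \<omega>) l)" if "\<omega> \<in> space M" for \<omega>
            unfolding nonneg_event_dyadic[OF True that, symmetric] Q_def ..
        qed
        finally have "emeasure M {\<omega>\<in>space M. Q (a + s) \<omega> \<and> c < 0 + X (a + s) \<omega>} =
          (\<integral>\<^sup>+\<omega>. indicator {\<omega>. Q s \<omega>} \<omega> * stay_nonneg_prob a (0 + X s \<omega>) c \<partial>M)" .
        moreover have "discount q (a + s) = discount q a * discount q s"
          by (simp add: ennreal_mult[symmetric] exp_add[symmetric] algebra_simps)
        ultimately show ?thesis using True by (simp add: mult.assoc)
      qed simp
    qed
    also have "\<dots> = discount q a * laplace q (\<lambda>s. (\<integral>\<^sup>+\<omega>. indicator {\<omega>. Q s \<omega>} \<omega> * stay_nonneg_prob a (0 + X s \<omega>) c \<partial>M))"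
    proof (rule nn_integral_cmult)
      have "(\<lambda>p. indicator {\<omega>. Q (fst p) \<omega>} (snd p) :: ennreal) = (\<lambda>p. indicator {p. Q (fst p) (snd p)} p)" by (auto simp: indicator_def)
      then have [measurable]: "(\<lambda>p. indicator {\<omega>. Q (fst p) \<omega>} (snd p) :: ennreal) \<in> borel_measurable (borel \<Otimes>\<^sub>M M)"
        using borel_measurable_indicator_pred[OF Qm(1)] by simp
      have "(\<lambda>s. \<integral>\<^sup>+\<omega>. indicator {\<omega>. Q s \<omega>} \<omega> * stay_nonneg_prob a (0 + X s \<omega>) c \<partial>M) \<in> borel_measurable borel"
        by (rule borel_measurable_nn_integral) (unfold case_prod_beta', measurable)
      then show "(\<lambda>s. discount q s * (\<integral>\<^sup>+\<omega>. indicator {\<omega>. Q s \<omega>} \<omega> * stay_nonneg_prob a (0 + X s \<omega>) c \<partial>M) * indicator {0..} s) \<in> borel_measurable lborel"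
        by measurable
    qed
    also have "laplace q (\<lambda>s. (\<integral>\<^sup>+\<omega>. indicator {\<omega>. Q s \<omega>} \<omega> * stay_nonneg_prob a (0 + X s \<omega>) c \<partial>M)) =
      (\<integral>\<^sup>+z. stay_nonneg_prob a z c \<partial>P)"
      unfolding P_def by (rule nn_integral_post_measure[OF QmL, symmetric]) measurable
    also have "\<dots> = (\<integral>\<^sup>+z\<in>{0<..}. stay_nonneg_prob a z c \<partial>P)"
    proof (rule nn_integral_cong_AE)
      have "AE z in P. z \<noteq> 0" using P0 by (intro AE_I[where N = "{0}"]) (auto simp: P_sets)
      then show "AE z in P. stay_nonneg_prob a z c = stay_nonneg_prob a z c * indicator {0<..} z"
      proof eventually_elim
        case (elim z)
        have "stay_nonneg_prob a z c = 0" if "z < 0"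
        proof -
          have "{\<omega>\<in>space M. stays_nonneg z a \<omega> \<and> c < z + X a \<omega>} = {}"
            using that a zero[of 0] by (auto intro!: bexI[of _ 0])
          then show ?thesis by (simp only: stay_nonneg_prob_def emeasure_empty)
        qed
        then show ?case using elim by (cases "0 < z") auto
      qed
    qed
    also have "\<dots> = (\<integral>\<^sup>+z\<in>{0<..}. ennreal (W 0 * exp (- passage_rate q * z)) * stay_nonneg_prob a z c \<partial>lborel)"
      by (rule nn_integral_of_exp_tails[OF P_sets passage_rate_pos[OF q] W_zero_nonneg]) (simp_all add: P_gt \<Phi>_def)
    \<comment> \<open>The two probabilities agree for almost every z only, which suffices now that
      the restarting point has a density.\<close>
    also have "\<dots> = (\<integral>\<^sup>+z\<in>{0<..}. ennreal (W 0 * exp (- passage_rate q * z)) * stay_prob a z c \<partial>lborel)"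
      by (rule nn_integral_stay_nonneg_prob[OF a]) measurable
    finally show "emeasure Nu ({a<..} \<times> {c<..}) =
      discount q a * (\<integral>\<^sup>+z\<in>{0<..}. ennreal (W 0 * exp (- passage_rate q * z)) * stay_prob a z c \<partial>lborel)" .
  qed
  then show ?thesis using Nu[OF B(1)] by (simp add: first_excursion_part_eq[OF B] Q_def)
qed

end

subsection \<open>Removal of the initial value\<close>

context spectrally_negative_levy
begin

text \<open>X 0 = 0 holds only almost surely, and negative times are unconstrained. Subtracting X 0
  and freezing negative times yields a process as in \<open>normalized_snlp\<close> with the same
  laws at times t \<ge> 0.\<close>

definition normalized :: "real \<Rightarrow> 'a \<Rightarrow> real" where
  "normalized t \<omega> = X (max 0 t) \<omega> - X 0 \<omega>"

lemma normalized_snlp: "normalized_snlp M normalized"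
proof
  note [measurable] = random_variable
  show "random_variable borel (normalized t)" if "t \<ge> 0" for t
    unfolding normalized_def[abs_def] using random_variable[of "max 0 t"] random_variable[of 0] by simp
  show "AE \<omega> in M. normalized 0 \<omega> = 0" by (simp add: normalized_def)
  show "continuous (at_right t) (\<lambda>s. normalized s \<omega>)" if "\<omega> \<in> space M" "0 \<le> t" for \<omega> t
  proof -
    have "((\<lambda>s. X s \<omega> - X 0 \<omega>) \<longlongrightarrow> X t \<omega> - X 0 \<omega>) (at_right t)"
      using right_continuous[OF that] by (intro tendsto_intros) (simp add: continuous_within)
    moreover have "eventually (\<lambda>s. X s \<omega> - X 0 \<omega> = normalized s \<omega>) (at_right t)"
      using eventually_at_right_less[of t] by eventually_elim (use that in \<open>simp add: normalized_def\<close>)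
    ultimately have "((\<lambda>s. normalized s \<omega>) \<longlongrightarrow> X t \<omega> - X 0 \<omega>) (at_right t)" using tendsto_cong by fast
    then show ?thesis using that by (simp add: continuous_within normalized_def)
  qed
  have left: "((\<lambda>s. normalized s \<omega>) \<longlongrightarrow> l) (at_left t) \<longleftrightarrow> ((\<lambda>s. X s \<omega>) \<longlongrightarrow> l + X 0 \<omega>) (at_left t)" if "0 < t" for \<omega> t l
  proof -
    have "eventually (\<lambda>s. 0 < s) (at_left t)" using that by (rule eventually_at_left_real[THEN eventually_mono]) auto
    then have "eventually (\<lambda>s. normalized s \<omega> + X 0 \<omega> = X s \<omega>) (at_left t)"
      by eventually_elim (simp add: normalized_def)
    then have "((\<lambda>s. X s \<omega>) \<longlongrightarrow> l + X 0 \<omega>) (at_left t) \<longleftrightarrow> ((\<lambda>s. normalized s \<omega> + X 0 \<omega>) \<longlongrightarrow> l + X 0 \<omega>) (at_left t)"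
      by (intro tendsto_cong) (auto elim: eventually_mono)
    then show ?thesis
      using tendsto_add_const_iff[of "X 0 \<omega>" "\<lambda>s. normalized s \<omega>" l "at_left t"] by (simp only: add.commute)
  qed
  show "\<exists>l. ((\<lambda>s. normalized s \<omega>) \<longlongrightarrow> l) (at_left t)" if t: "\<omega> \<in> space M" "0 < t" for \<omega> t
  proof -
    obtain l where "((\<lambda>s. X s \<omega>) \<longlongrightarrow> l) (at_left t)" using left_limits[OF t] by blast
    then have "((\<lambda>s. normalized s \<omega>) \<longlongrightarrow> l - X 0 \<omega>) (at_left t)" by (simp add: left[OF t(2)])
    then show ?thesis by blast
  qed
  show "normalized t \<omega> \<le> l" if "\<omega> \<in> space M" "0 < t" "((\<lambda>s. normalized s \<omega>) \<longlongrightarrow> l) (at_left t)" for \<omega> t l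
    using no_positive_jumps[OF that(1,2) left[OF that(2), THEN iffD1, OF that(3)]] that(2) by (simp add: normalized_def)
  show "indep_vars (\<lambda>_. borel) (\<lambda>i \<omega>. normalized (t (Suc i)) \<omega> - normalized (t i) \<omega>) {..<n}"
    if t: "t 0 \<ge> 0" "\<And>i. i < n \<Longrightarrow> t i \<le> t (Suc i)" for t :: "nat \<Rightarrow> real" and n
  proof -
    have "0 \<le> t i" if "i \<le> n" for i using that
    proof (induction i)
      case (Suc i)
      then show ?case using t(2)[of i] by simp
    qed (use t(1) in simp)
    then have "(\<lambda>\<omega>. normalized (t (Suc i)) \<omega> - normalized (t i) \<omega>) = (\<lambda>\<omega>. X (t (Suc i)) \<omega> - X (t i) \<omega>)" if "i < n" for i
      using that by (simp add: normalized_def fun_eq_iff)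
    then have "indep_vars (\<lambda>_. borel) (\<lambda>i \<omega>. normalized (t (Suc i)) \<omega> - normalized (t i) \<omega>) {..<n} \<longleftrightarrow>
      indep_vars (\<lambda>_. borel) (\<lambda>i \<omega>. X (t (Suc i)) \<omega> - X (t i) \<omega>) {..<n}"
      by (intro indep_vars_cong) auto
    then show ?thesis using independent_increments[of t n] t by blast
  qed
  show "distr M borel (\<lambda>\<omega>. normalized (s + h) \<omega> - normalized s \<omega>) = distr M borel (normalized h)" if "0 \<le> s" "0 \<le> h" for s h
    using stationary_increments[OF that] stationary_increments[OF order_refl that(2)] that by (simp add: normalized_def[abs_def])
  have "monotone_on {0..} (\<le>) (\<le>) (\<lambda>t. normalized t \<omega>) \<longleftrightarrow> monotone_on {0..} (\<le>) (\<le>) (\<lambda>t. X t \<omega>)"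
    "monotone_on {0..} (\<le>) (\<ge>) (\<lambda>t. normalized t \<omega>) \<longleftrightarrow> monotone_on {0..} (\<le>) (\<ge>) (\<lambda>t. X t \<omega>)" for \<omega>
    by (auto simp: monotone_on_def normalized_def)
  then show "\<not> (AE \<omega> in M. monotone_on {0..} (\<le>) (\<le>) (\<lambda>t. normalized t \<omega>))"
    "\<not> (AE \<omega> in M. monotone_on {0..} (\<le>) (\<ge>) (\<lambda>t. normalized t \<omega>))"
    using not_increasing not_decreasing by simp_all
  show "normalized t \<omega> = 0" if "t \<le> 0" for t \<omega> using that by (simp add: normalized_def)
qed

lemma distr_normalized: "0 \<le> t \<Longrightarrow> distr M borel (normalized t) = distr M borel (X t)"
  using stationary_increments[of 0 t] by (simp add: normalized_def[abs_def])

lemma laplace_exponent_normalized: "laplace_exponent M normalized = laplace_exponent M X"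
proof
  fix \<beta>
  interpret N: normalized_snlp M normalized by (rule normalized_snlp)
  have "(\<integral>\<omega>. exp (\<beta> * normalized 1 \<omega>) \<partial>M) = (\<integral>y. exp (\<beta> * y) \<partial>distr M borel (normalized 1))"
    using N.random_variable[of 1] by (subst integral_distr) auto
  also have "\<dots> = (\<integral>\<omega>. exp (\<beta> * X 1 \<omega>) \<partial>M)"
    using random_variable[of 1] by (subst distr_normalized, simp, subst integral_distr) auto
  finally show "laplace_exponent M normalized \<beta> = laplace_exponent M X \<beta>" by (simp add: laplace_exponent_def)
qed

lemma right_inverse_normalized: "right_inverse M normalized = right_inverse M X"
  by (simp add: right_inverse_def[abs_def] laplace_exponent_normalized)

lemma is_scale_function_normalized: "is_scale_function M normalized q W \<longleftrightarrow> is_scale_function M X q W"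
  by (simp add: is_scale_function_def laplace_exponent_normalized right_inverse_normalized)

lemma kendall_part_normalized: "kendall_part M normalized q B = kendall_part M X q B"
  unfolding kendall_part_def by (intro nn_integral_cong) (simp add: distr_normalized split: split_indicator)

text \<open>The event for X is the event for \<open>normalized\<close> with the random start x + X
  0; this gives its measurability and is why the measurability lemmas admit a random z. The
  probabilities agree because X 0 = 0 almost surely.\<close>

lemma emeasure_path_event_normalized:
  assumes cong: "\<And>w w'. (\<And>t. 0 \<le> t \<Longrightarrow> w t = w' t) \<Longrightarrow> F w \<longleftrightarrow> F w'"
    and meas: "\<And>z. z \<in> borel_measurable M \<Longrightarrow> {\<omega>\<in>space M. F (\<lambda>t. z \<omega> + normalized t \<omega>)} \<in> sets M"
  shows "emeasure M {\<omega>\<in>space M. F (\<lambda>t. x + normalized t \<omega>)} = emeasure M {\<omega>\<in>space M. F (\<lambda>t. x + X t \<omega>)}"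
proof (rule emeasure_eq_AE)
  have [measurable]: "X 0 \<in> borel_measurable M" by (rule random_variable) simp
  show "{\<omega>\<in>space M. F (\<lambda>t. x + normalized t \<omega>)} \<in> sets M" by (rule meas) simp
  have "F (\<lambda>t. x + X 0 \<omega> + normalized t \<omega>) \<longleftrightarrow> F (\<lambda>t. x + X t \<omega>)" for \<omega>
    by (rule cong) (simp add: normalized_def)
  then show "{\<omega>\<in>space M. F (\<lambda>t. x + X t \<omega>)} \<in> sets M" using meas[of "\<lambda>\<omega>. x + X 0 \<omega>"] by simp
  show "AE \<omega> in M. (\<omega> \<in> {\<omega>\<in>space M. F (\<lambda>t. x + normalized t \<omega>)}) = (\<omega> \<in> {\<omega>\<in>space M. F (\<lambda>t. x + X t \<omega>)})"
    using start_zero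
  proof eventually_elim
    case (elim \<omega>)
    have "F (\<lambda>t. x + normalized t \<omega>) \<longleftrightarrow> F (\<lambda>t. x + X t \<omega>)" by (rule cong) (simp add: normalized_def elim)
    then show ?case by simp
  qed
qed

lemma potential_normalized:
  assumes B: "B \<in> sets borel"
  shows "potential M q (\<lambda>r \<omega>. (excursion_length_from u (\<lambda>t. x + normalized t \<omega>) r, x + normalized r \<omega>)) B =
      potential M q (\<lambda>r \<omega>. (excursion_length_from u (\<lambda>t. x + X t \<omega>) r, x + X r \<omega>)) B"
    and "potential M q (\<lambda>r \<omega>. (excursion_length (\<lambda>t. normalized t \<omega>) r, normalized r \<omega>)) B =
      potential M q (\<lambda>r \<omega>. (excursion_length (\<lambda>t. X t \<omega>) r, X r \<omega>)) B"
proof -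
  interpret N: normalized_snlp M normalized by (rule normalized_snlp)
  have AE: "AE r in lborel. r \<noteq> (0::real)" by (rule AE_lborel_singleton)
  have 1: "emeasure M {\<omega>\<in>space M. (excursion_length_from u (\<lambda>t. x + normalized t \<omega>) r, x + normalized r \<omega>) \<in> B} =
    emeasure M {\<omega>\<in>space M. (excursion_length_from u (\<lambda>t. x + X t \<omega>) r, x + X r \<omega>) \<in> B}" if r: "0 < r" for r
  proof (rule emeasure_path_event_normalized[where F = "\<lambda>w. (excursion_length_from u w r, w r) \<in> B"])
    fix w w' :: "real \<Rightarrow> real" assume w: "\<And>t. 0 \<le> t \<Longrightarrow> w t = w' t"
    show "((excursion_length_from u w r, w r) \<in> B) = ((excursion_length_from u w' r, w' r) \<in> B)"
      using path_functionals_cong(5)[where w = w and w' = w' and u = u and t = r, OF w] w[of r] r by simp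
  qed (rule N.excursion_from_event_measurable[OF r B])
  have 2: "emeasure M {\<omega>\<in>space M. (excursion_length (\<lambda>t. 0 + normalized t \<omega>) r, 0 + normalized r \<omega>) \<in> B} =
    emeasure M {\<omega>\<in>space M. (excursion_length (\<lambda>t. 0 + X t \<omega>) r, 0 + X r \<omega>) \<in> B}" if r: "0 < r" for r
  proof (rule emeasure_path_event_normalized[where F = "\<lambda>w. (excursion_length w r, w r) \<in> B"])
    fix w w' :: "real \<Rightarrow> real" assume w: "\<And>t. 0 \<le> t \<Longrightarrow> w t = w' t"
    show "((excursion_length w r, w r) \<in> B) = ((excursion_length w' r, w' r) \<in> B)"
      using path_functionals_cong(2)[where w = w and w' = w' and t = r, OF w] w[of r] r by simp
  qed (rule N.excursion_event_measurable[OF r B])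
  show "potential M q (\<lambda>r \<omega>. (excursion_length_from u (\<lambda>t. x + normalized t \<omega>) r, x + normalized r \<omega>)) B =
      potential M q (\<lambda>r \<omega>. (excursion_length_from u (\<lambda>t. x + X t \<omega>) r, x + X r \<omega>)) B"
    unfolding potential_def using AE by (intro nn_integral_cong_AE) (auto elim!: eventually_mono simp: 1 indicator_def)
  show "potential M q (\<lambda>r \<omega>. (excursion_length (\<lambda>t. normalized t \<omega>) r, normalized r \<omega>)) B =
      potential M q (\<lambda>r \<omega>. (excursion_length (\<lambda>t. X t \<omega>) r, X r \<omega>)) B"
    unfolding potential_def using AE 2 by (intro nn_integral_cong_AE) (auto elim!: eventually_mono simp: indicator_def)
qed

lemma first_excursion_part_normalized:
  assumes B: "B \<in> sets borel" "B \<subseteq> {0<..} \<times> {0<..}"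
  shows "first_excursion_part M normalized q u x B = first_excursion_part M X q u x B"
proof -
  interpret N: normalized_snlp M normalized by (rule normalized_snlp)
  have "emeasure M {\<omega>\<in>space M. (v, x + normalized (v - u) \<omega>) \<in> B \<and> ereal (v - u) < hit_neg (\<lambda>t. x + normalized t \<omega>)} =
    emeasure M {\<omega>\<in>space M. (v, x + X (v - u) \<omega>) \<in> B \<and> ereal (v - u) < hit_neg (\<lambda>t. x + X t \<omega>)}" if v: "u < v" for v
  proof (rule emeasure_path_event_normalized[where F = "\<lambda>w. (v, w (v - u)) \<in> B \<and> ereal (v - u) < hit_neg w"])
    fix w w' :: "real \<Rightarrow> real" assume w: "\<And>t. 0 \<le> t \<Longrightarrow> w t = w' t"
    show "((v, w (v - u)) \<in> B \<and> ereal (v - u) < hit_neg w) = ((v, w' (v - u)) \<in> B \<and> ereal (v - u) < hit_neg w')"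
      using path_functionals_cong(4)[where w = w and w' = w', OF w] w[of "v - u"] v by simp
  next
    fix z :: "'a \<Rightarrow> real" assume [measurable]: "z \<in> borel_measurable M"
    note [measurable] = N.pred_borel_pair[OF B(1)]
    have "{\<omega>\<in>space M. (v, z \<omega> + normalized (v - u) \<omega>) \<in> B \<and> ereal (v - u) < hit_neg (\<lambda>t. z \<omega> + normalized t \<omega>)} =
      {\<omega>\<in>space M. (v, z \<omega> + normalized (v - u) \<omega>) \<in> B \<and> (\<forall>s\<in>{0..v - u}. 0 \<le> z \<omega> + normalized s \<omega>)}"
      using v by (intro N.first_excursion_event[OF _ B(2)]) simp
    also have "\<dots> \<in> sets M" by measurable
    finally show "{\<omega>\<in>space M. (v, z \<omega> + normalized (v - u) \<omega>) \<in> B \<and> ereal (v - u) < hit_neg (\<lambda>t. z \<omega> + normalized t \<omega>)} \<in> sets M" .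
  qed
  then show ?thesis unfolding first_excursion_part_def by (intro nn_integral_cong) (simp split: split_indicator)
qed

end

section \<open>Transfer to extended reals and the three cases for the sign of x\<close>

lemma enn2ereal_add_mult:
  "0 \<le> k \<Longrightarrow> enn2ereal (a + ennreal k * b) = enn2ereal a + ereal k * enn2ereal b"
  by (simp add: plus_ennreal.rep_eq times_ennreal.rep_eq enn2ereal_ennreal)

theorem corollary3p10:
  fixes M :: "'a measure" and X :: "real \<Rightarrow> 'a \<Rightarrow> real" and q :: real
  assumes "spectrally_negative_levy M X" and "q > 0"
  shows
    "(\<forall>W u x B. is_scale_function M X q W \<longrightarrow> (u, x) \<in> state_space \<longrightarrow>
        B \<in> sets borel \<longrightarrow> B \<subseteq> {0<..} \<times> {0<..} \<longrightarrow>
        enn2ereal (potential M q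
          (\<lambda>r \<omega>. (excursion_length_from u (\<lambda>t. x + X t \<omega>) r, x + X r \<omega>)) B) =
        enn2ereal (first_excursion_part M X q u x B) +
        ereal (exp (right_inverse M X q * x) * deriv (right_inverse M X) q - W x) *
          enn2ereal (kendall_part M X q B)) \<and>
     (\<forall>B. B \<in> sets borel \<longrightarrow> B \<subseteq> {0<..} \<times> {0<..} \<longrightarrow>
        enn2ereal (potential M q (\<lambda>r \<omega>. (excursion_length (\<lambda>t. X t \<omega>) r, X r \<omega>)) B) =
        ereal (deriv (right_inverse M X) q) * enn2ereal (kendall_part M X q B))"
proof (intro conjI allI impI)
  interpret spectrally_negative_levy M X by (rule assms(1))
  interpret N: normalized_snlp M normalized by (rule normalized_snlp)
  note q = assms(2)
  let ?C = "N.resolvent_const q" and ?P = "N.passage_rate q"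
  have right_inverse: "right_inverse M X q = ?P" and deriv: "deriv (right_inverse M X) q = ?C"
    using N.right_inverse_eq[OF q] N.deriv_right_inverse[OF q] by (simp_all add: right_inverse_normalized)
  {
    fix B :: "(real \<times> real) set" assume B: "B \<in> sets borel" "B \<subseteq> {0<..} \<times> {0<..}"
    show "enn2ereal (potential M q (\<lambda>r \<omega>. (excursion_length (\<lambda>t. X t \<omega>) r, X r \<omega>)) B) =
        ereal (deriv (right_inverse M X) q) * enn2ereal (kendall_part M X q B)"
      using N.potential_nonpos(2)[OF q order_refl B refl] N.resolvent_const_pos[OF q]
      by (simp add: deriv potential_normalized[OF B(1)] kendall_part_normalized times_ennreal.rep_eq enn2ereal_ennreal)
  }
  fix W u x and B :: "(real \<times> real) set"
  assume W: "is_scale_function M X q W" and ux: "(u, x) \<in> state_space" and B: "B \<in> sets borel" "B \<subseteq> {0<..} \<times> {0<..}"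
  interpret S: snlp_scale M normalized q W
    by unfold_locales (use q W in \<open>simp_all add: is_scale_function_normalized\<close>)
  note norm = potential_normalized[OF B(1)] first_excursion_part_normalized[OF B] kendall_part_normalized
  let ?K = "kendall_part M X q B"
  show "enn2ereal (potential M q (\<lambda>r \<omega>. (excursion_length_from u (\<lambda>t. x + X t \<omega>) r, x + X r \<omega>)) B) =
        enn2ereal (first_excursion_part M X q u x B) +
        ereal (exp (right_inverse M X q * x) * deriv (right_inverse M X) q - W x) * enn2ereal ?K"
    unfolding right_inverse deriv mult.commute[of "exp (?P * x)"]
  proof (cases x "0 :: real" rule: linorder_cases)
    \<comment> \<open>For x < 0 both the scale function and the first excursion term vanish, and u =
      0.\<close>
    case less
    then have "u = 0" using ux by (auto simp: state_space_def)
    moreover have "0 \<le> ?C * exp (?P * x) - W x" using less S.W_neg N.resolvent_const_pos[OF q] by simp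
    ultimately show "enn2ereal (potential M q (\<lambda>r \<omega>. (excursion_length_from u (\<lambda>t. x + X t \<omega>) r, x + X r \<omega>)) B) =
        enn2ereal (first_excursion_part M X q u x B) + ereal (?C * exp (?P * x) - W x) * enn2ereal ?K"
      using N.potential_nonpos(1)[OF q less_imp_le[OF less] B] N.first_excursion_part_neg[OF less B, of q 0] S.W_neg[OF less]
      unfolding norm by (simp add: enn2ereal_add_mult[symmetric])
  next
    case equal
    then have u: "u = 0" using ux by (auto simp: state_space_def)
    \<comment> \<open>The summand W 0 k from the first excursion has to cancel against - W 0 k from
      the bracket, which in extended reals calls for a finite k.\<close>
    have "?K < \<infinity>" using N.kendall_part_finite[OF q B] by (simp add: kendall_part_normalized)
    then obtain k where k: "0 \<le> k" "?K = ennreal k" by (cases ?K) auto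
    have "potential M q (\<lambda>r \<omega>. (excursion_length_from u (\<lambda>t. x + X t \<omega>) r, x + X r \<omega>)) B = ennreal (?C * k)"
      using N.potential_nonpos(1)[OF q order_refl B] equal u k N.resolvent_const_pos[OF q]
      unfolding norm by (simp add: ennreal_mult less_imp_le)
    moreover have "first_excursion_part M X q u x B = ennreal (W 0 * k)"
      using S.first_excursion_part_zero[OF B] equal u k S.W_zero_nonneg unfolding norm by (simp add: ennreal_mult)
    ultimately show "enn2ereal (potential M q (\<lambda>r \<omega>. (excursion_length_from u (\<lambda>t. x + X t \<omega>) r, x + X r \<omega>)) B) =
        enn2ereal (first_excursion_part M X q u x B) + ereal (?C * exp (?P * x) - W x) * enn2ereal ?K"
      using equal k S.W_zero_nonneg N.resolvent_const_pos[OF q] by (simp add: enn2ereal_ennreal algebra_simps)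
  next
    case greater
    then have u: "0 < u" using ux by (auto simp: state_space_def)
    show "enn2ereal (potential M q (\<lambda>r \<omega>. (excursion_length_from u (\<lambda>t. x + X t \<omega>) r, x + X r \<omega>)) B) =
        enn2ereal (first_excursion_part M X q u x B) + ereal (?C * exp (?P * x) - W x) * enn2ereal ?K"
      using S.potential_pos[OF greater u B] unfolding norm by (simp add: enn2ereal_add_mult S.\<Phi>_def)
  qed
qed
end
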